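(* Let $u_1,u_2,\dots\in\overline{k}[t]$ be a sequence of polynomials such that $\|u_i\|_\infty<|\theta|_\infty^{\frac{iq}{q-1}}$ for all $i\ge 1$, and let $\mathscr{L}_{\mathbf{s}}$ be the associated series for each index $\mathbf{s}$. Let $n\ge 0$ and $l\ge 1$ be integers and let $I$ be a finite set of indices such that $I=\bigcup_{\mathbf{s}\in I}\operatorname{Sub}(\mathbf{s})$. Then $$\begin{aligned} &\operatorname{tr.deg}_{\overline{k}}\,\overline{k}\left(\partial_t^{(n')}\Omega|_{t=\theta},\ \partial_t^{(n')}\Omega_l^{(-l')}|_{t=\theta},\ \partial_t^{(n')}\mathscr{L}_{\mathbf{s}}|_{t=\theta}\ \middle|\ 0\le n'\le n,\ 0\le l'<l,\ \mathbf{s}\in I\right)\\ =\;&\operatorname{tr.deg}_{\overline{k}}\,\overline{k}\left(\partial_t^{(n')}\Omega|_{t=\theta},\ \partial_t^{(n')}\Omega_l^{(-l')}|_{t=\theta}\ \middle|\ 0\le n'\le n,\ 0\le l'<l\right)\\ &+\operatorname{tr.deg}_{\overline{k}}\,\overline{k}\left(\partial_t^{(n')}\Omega|_{t=\theta},\ \partial_t^{(n')}\mathscr{L}_{\mathbf{s}}|_{t=\theta}\ \middle|\ 0\le n'\le n,\ \mathbf{s}\in I\right)\\ &-\operatorname{tr.deg}_{\overline{k}}\,\overline{k}\left(\partial_t^{(n')}\Omega|_{t=\theta}\ \middle|\ 0\le n'\le n\right). \end{aligned}$$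
   Context: Let $q$ be a power of a prime $p$, $k=\mathbb{F}_q(\theta)$, $k_\infty=\mathbb{F}_q((1/\theta))$, and $\mathbb{C}_\infty$ the completion of an algebraic closure of $k_\infty$, with absolute value $|\cdot|_\infty$ normalized by $|\theta|_\infty=q$. Let $\overline{k}$ be the algebraic closure of $k$ in $\mathbb{C}_\infty$, and $t$ a variable independent of $\theta$. For $u=\sum_i a_it^i\in\overline{k}[t]$ put $\|u\|_\infty:=\max_i|a_i|_\infty$. For $m\in\mathbb{Z}$, the $m$-fold Frobenius twist of $f=\sum_i a_it^i\in\mathbb{C}_\infty((t))$ is $f^{(m)}:=\sum_i a_i^{q^m}t^i$. For $m\ge 0$, the $m$-th hyperderivative is the $\mathbb{C}_\infty$-linear operator $\partial_t^{(m)}\left(\sum_i a_it^i\right)=\sum_i\binom{i}{m}a_it^{i-m}$ on $\mathbb{C}_\infty((t))$ (binomial coefficients reduced to $\mathbb{F}_p$). All series below and their hyperderivatives converge at $t=\theta$. For $l\ge 1$, fix a $(q^l-1)$-th root of $-\theta$ and put $\Omega_l:=(-\theta)^{\frac{-q^l}{q^l-1}}\prod_{i=1}^\infty\left(1-\frac{t}{\theta^{q^{il}}}\right)$ and $\Omega:=\Omega_1$; $\Omega_l^{(-l')}$ denotes the $(-l')$-fold Frobenius twist of $\Omega_l$. An index is a tuple $\mathbf{s}=(s_1,\dots,s_d)$ of positive integers with $d\ge 1$; $\operatorname{Sub}(\mathbf{s}):=\{(s_i,s_{i+1},\dots,s_j)\mid 1\le i\le j\le d\}$. For an index $\mathbf{s}=(s_1,\dots,s_d)$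 put $$\mathscr{L}_{\mathbf{s}}:=\sum_{i_1>\cdots>i_d\ge 0}(\Omega^{s_d}u_{s_d})^{(i_d)}\cdots(\Omega^{s_1}u_{s_1})^{(i_1)}.$$ *)

theory Defs
  imports
    "HOL-Analysis.Analysis"
    "HOL-Computational_Algebra.Formal_Laurent_Series"
    "HOL-Computational_Algebra.Polynomial_FPS"
    "HOL-Library.Poly_Mapping"
    "HOL-Algebra.Algebraic_Closure_Type"
    "HOL-Algebra.Generated_Fields"
begin

section \<open>Transcendence degree\<close>

text \<open>Subfields of a field type \<open>'a\<close> are subsets of \<open>'a\<close>; generated subfields and algebraic
  elements are those of \<open>HOL-Algebra\<close>, applied to the ring structure of the type.\<close>

definition adjoin :: "'a::field set \<Rightarrow> 'a set \<Rightarrow> 'a set" where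
  "adjoin K S = generate_field ring_of_type_algebra (K \<union> S)"

definition algebraic_over :: "'a::field set \<Rightarrow> 'a \<Rightarrow> bool" where
  "algebraic_over K x \<longleftrightarrow> (ring.algebraic ring_of_type_algebra over K) x"

text \<open>A polynomial in variables indexed by the field elements themselves is a finitely supported
  family of coefficients indexed by monomials \<open>'a \<Rightarrow>\<^sub>0 nat\<close>; it is evaluated by substituting
  for every variable the element that indexes it.\<close>

definition eval_mpoly :: "(('a::field \<Rightarrow>\<^sub>0 nat) \<Rightarrow>\<^sub>0 'a) \<Rightarrow> 'a" where
  "eval_mpoly P =
     (\<Sum>m\<in>Poly_Mapping.keys P. Poly_Mapping.lookup P m *
        (\<Prod>x\<in>Poly_Mapping.keys m. x ^ Poly_Mapping.lookup m x))"

definition alg_independent :: "'a::field set \<Rightarrow> 'a set \<Rightarrow> bool" where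
  "alg_independent K B \<longleftrightarrow>
     (\<forall>P. range (Poly_Mapping.lookup P) \<subseteq> K \<and>
          (\<forall>m\<in>Poly_Mapping.keys P. Poly_Mapping.keys m \<subseteq> B) \<and>
          eval_mpoly P = 0 \<longrightarrow> P = 0)"

definition transcendence_basis :: "'a::field set \<Rightarrow> 'a set \<Rightarrow> 'a set \<Rightarrow> bool" where
  "transcendence_basis K L B \<longleftrightarrow>
     B \<subseteq> L \<and> alg_independent K B \<and> (\<forall>x\<in>L. algebraic_over (adjoin K B) x)"

text \<open>All transcendence bases of \<open>L\<close> over \<open>K\<close> have the same cardinality. An infinite
  transcendence degree would be mapped to \<open>0\<close>; below, \<open>L\<close> is finitely generated over \<open>K\<close>.\<close>

definition trdeg :: "'a::field set \<Rightarrow> 'a set \<Rightarrow> nat" where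
  "trdeg K L = card (SOME B. transcendence_basis K L B)"


section \<open>The field of Tate-Drinfeld complex numbers\<close>

text \<open>With \<open>'f\<close> the finite field with \<open>q\<close> elements, \<open>'f fls\<close> with uniformizer \<open>fls_X\<close>
  corresponding to \<open>1/\<theta>\<close> is the field of Laurent series in \<open>1/\<theta>\<close>.\<close>

definition cabs :: "'c::{field,metric_space} \<Rightarrow> real" where
  "cabs x = dist x 0"

text \<open>\<open>is_C_infinity \<iota>\<close>: with respect to the embedding \<open>\<iota>\<close>, the type \<open>'c\<close> is a completion of an
  algebraic closure of \<open>'f fls\<close>, where \<open>'f fls\<close> carries the absolute value with
  \<open>\<bar>\<theta>\<bar> = q\<close>, and the metric of \<open>'c\<close> is induced by a multiplicative ultrametric absolute value.\<close>

definition is_C_infinity :: "('f::{finite,field} fls \<Rightarrow> 'c::{field,metric_space}) \<Rightarrow> bool" where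
  "is_C_infinity \<iota> \<longleftrightarrow>
     \<iota> \<in> ring_hom ring_of_type_algebra ring_of_type_algebra \<and>
     (\<forall>x y::'c. dist x y = cabs (x - y)) \<and>
     (\<forall>x y::'c. cabs (x * y) = cabs x * cabs y) \<and>
     (\<forall>x y::'c. cabs (x + y) \<le> max (cabs x) (cabs y)) \<and>
     (\<forall>f. f \<noteq> 0 \<longrightarrow> cabs (\<iota> f) = real CARD('f) powi (- fls_subdegree f)) \<and>
     (\<exists>A. algebraic_closure (ring_of_type_algebra\<lparr>carrier := A\<rparr>) (range \<iota>) \<and>
          closure A = UNIV) \<and>
     complete (UNIV :: 'c set)"

definition theta :: "('f::{finite,field} fls \<Rightarrow> 'c::{field,metric_space}) \<Rightarrow> 'c" where
  "theta \<iota> = \<iota> fls_X_inv"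

definition kfield :: "('f::{finite,field} fls \<Rightarrow> 'c::{field,metric_space}) \<Rightarrow> 'c set" where
  "kfield \<iota> = adjoin (range (\<lambda>c. \<iota> (fls_const c))) {theta \<iota>}"

definition kbar :: "('f::{finite,field} fls \<Rightarrow> 'c::{field,metric_space}) \<Rightarrow> 'c set" where
  "kbar \<iota> = {x. algebraic_over (kfield \<iota>) x}"

definition poly_norm :: "'c::{field,metric_space} poly \<Rightarrow> real" where
  "poly_norm u = Max (range (\<lambda>i. cabs (Polynomial.coeff u i)))"


section \<open>Frobenius twists, hyperderivatives and evaluation\<close>

text \<open>All series of interest are power series in \<open>t\<close>, so the operators are defined on
  \<open>'c fps\<close>, where the variable \<open>fps_X\<close> plays the role of \<open>t\<close>.\<close>

definition frob_power :: "nat \<Rightarrow> int \<Rightarrow> 'c::field \<Rightarrow> 'c" where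
  "frob_power q m a =
     (if m \<ge> 0 then a ^ (q ^ nat m) else (THE b. b ^ (q ^ nat (- m)) = a))"

definition twist :: "nat \<Rightarrow> int \<Rightarrow> 'c::field fps \<Rightarrow> 'c fps" where
  "twist q m f = Abs_fps (\<lambda>i. frob_power q m (fps_nth f i))"

text \<open>The coefficient of \<open>t^j\<close> comes from the term with exponent \<open>i = j + m\<close>; terms with
  \<open>i < m\<close> vanish.\<close>

definition hyperderiv :: "nat \<Rightarrow> 'c::field fps \<Rightarrow> 'c fps" where
  "hyperderiv m f = Abs_fps (\<lambda>j. of_nat ((j + m) choose m) * fps_nth f (j + m))"

definition eval_at :: "'c::{field,metric_space} \<Rightarrow> 'c fps \<Rightarrow> 'c" where
  "eval_at x f = suminf (\<lambda>i. fps_nth f i * x ^ i)"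

definition hyperderiv_values :: "nat \<Rightarrow> 'c::{field,metric_space} \<Rightarrow> 'c fps set \<Rightarrow> 'c set" where
  "hyperderiv_values n x F = {eval_at x (hyperderiv n' f) | n' f. n' \<le> n \<and> f \<in> F}"


section \<open>The series\<close>

text \<open>Infinite products and sums of power series are taken coefficientwise, with respect to the
  topology of \<open>'c\<close> (not the \<open>t\<close>-adic topology of the type \<open>fps\<close>).
  The argument \<open>r\<close> of \<open>Omega q \<theta> r l\<close> is the chosen \<open>(q^l - 1)\<close>-th root of \<open>-\<theta>\<close>.\<close>

definition Omega :: "nat \<Rightarrow> 'c::{field,metric_space} \<Rightarrow> 'c \<Rightarrow> nat \<Rightarrow> 'c fps" where
  "Omega q \<theta> r l =
     fps_const (inverse (r ^ (q ^ l))) *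
     Abs_fps (\<lambda>j. lim (\<lambda>N.
       fps_nth (\<Prod>i=1..N. 1 - fps_const (inverse (\<theta> ^ (q ^ (i * l)))) * fps_X) j))"

definition is_index :: "nat list \<Rightarrow> bool" where
  "is_index s \<longleftrightarrow> s \<noteq> [] \<and> (\<forall>a\<in>set s. a > 0)"

definition Sub :: "nat list \<Rightarrow> nat list set" where
  "Sub s = {map (\<lambda>r. s ! r) [i..<Suc j] | i j. i \<le> j \<and> j < length s}"

text \<open>Lists are numbered from \<open>0\<close>, so \<open>s ! r\<close> is the entry with number \<open>r + 1\<close>.
  The argument \<open>W\<close> of \<open>Lseries\<close> is the series \<open>Omega\<close> with \<open>l = 1\<close>.\<close>

definition Lseries ::
    "nat \<Rightarrow> 'c::{field,metric_space} fps \<Rightarrow> (nat \<Rightarrow> 'c poly) \<Rightarrow> nat list \<Rightarrow> 'c fps" where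
  "Lseries q W u s =
     Abs_fps (\<lambda>j. \<Sum>\<^sub>\<infinity>k\<in>{k. length k = length s \<and> sorted_wrt (>) k}.
       fps_nth (\<Prod>r<length s. twist q (int (k ! r)) (W ^ (s ! r) * fps_of_poly (u (s ! r)))) j)"

end

theory Submission
 imports Defs
begin

text \<open>
 Write Kb for the algebraic closure of \<open>F_q(\<theta>)\<close> in \<open>C_\<infinity>\<close> and k0 = Kb(t); from
  \<open>carlitz_field\<close> on, \<theta> is the locale parameter th. The identity is proved for the functions
  themselves, over k0, and then carried over to their values at t = \<theta>, over Kb.

  From functions to values. Let X be a finite family of entire functions with weights such that,
  for every f in X, the twist of f times a power of \<open>t - \<theta>^q\<close> is a polynomial in X over
  \<open>Kb[t]\<close> of weight at most that of f. Then the transcendence degree of the values equals that of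
  the functions (\<open>trdeg_values_eq_functions\<close>). A relation between the functions yields one between
  the values once the common factors t - \<theta> of its coefficients are removed. Conversely, if the
  values have transcendence degree r, the values of all monomials of weight at most n span a
  space of dimension \<open>O(n^r)\<close> (\<open>growth_bound\<close>), while there are more monomials in r + 1
  algebraically independent functions. So it suffices to show that functions solving a linear system
  of twisted equations are linearly dependent over \<open>Kb[t]\<close> if they outnumber the dimension of a
  space containing the values of all solutions (\<open>relation_from_values\<close>). This is a transcendence
  argument: Siegel's lemma gives a combination of the N-fold twists with small coefficients that
  vanishes at \<open>\<theta>^(q^j)\<close> for j = 1, ..., N; its coefficients are bounded from above by a Schwarz
  lemma (\<open>many_zeros_bound\<close>), and from below, if it is not zero, by Liouville's inequality
  (\<open>combination_lower_bound\<close>). For large N it is therefore zero, and untwisting gives the relation.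

  The identity for functions. Let \<tau> be the l-fold twist and \<open>\<omega>_i\<close> the (-i)-fold twist of
  \<open>\<Omega>_l\<close>. The hyperderivatives of the \<open>\<omega>_i\<close> are adjoined to two fields, k0 with those of \<Omega>, and
  k0 with those of \<Omega> and of all \<open>L_s\<close>; the identity says that the transcendence degree grows by
  the same amount. Adjoining one element at a time, it is enough that an element which is algebraic
  over the larger field is algebraic over the smaller one. The elements are, first, the logarithmic
  hyperderivatives h of the \<open>\<omega>_i\<close>, for which \<tau> h - h lies in the field generated by those of
  lower order; here an analogue of Artin-Schreier theory (\<open>additive_algebraic\<close>) turns algebraicity
  into an equation Q(\<tau> h - h) = \<tau> f - f with an additive polynomial Q, and a weight argument
  (\<open>descent\<close>) replaces f by an element free of \<Omega> and the \<open>L_s\<close>. Next come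
  \<open>\<omega>_1, ..., \<omega>_(l-1)\<close>, which are transcendental at each step even over the larger field
  (\<open>om_transcendental\<close>): otherwise a nontrivial product of powers of the multipliers of \<Omega> and the
  \<open>\<omega>_i\<close> would have the form \<tau> b / b with b in k0, and orders of zeros along the points
  \<open>\<theta>^(q^k)\<close> exclude this (\<open>k0_no_character\<close>). Finally \<Omega> is a rational function times the product of
  all \<open>\<omega>_i\<close> (\<open>om_product\<close>), so \<open>\<omega>_0\<close> adds nothing. Both parts need that quotients of entire functions
  fixed by a twist are rational (\<open>constants_rational\<close>).
\<close>

section \<open>Subfields and algebraic elements\<close>

hide_const (open) up_ring.coeff up_ring.monom Polynomials.degree Polynomials.lead_coeff Coset.order

abbreviation tends :: "(nat => 'a::topological_space) => 'a => bool" (infix "---->" 60)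
 where "f ----> a == f \<longlonglongrightarrow> a"

abbreviation "pser == fps_of_poly"

abbreviation "cf == fps_nth"

abbreviation "vars == Poly_Mapping.keys"

abbreviation "lkp == Poly_Mapping.lookup"

abbreviation "rta == ring_of_type_algebra"

text \<open>No exception for 0 is needed in the last clause, since inverse 0 = 0.\<close>

definition subfld :: "'a::field set => bool" where
 "subfld F \<longleftrightarrow> 0 \<in> F & 1 \<in> F & (\<forall>x\<in>F. \<forall>y\<in>F. x + y \<in> F & x * y \<in> F) &
   (\<forall>x\<in>F. - x \<in> F & inverse x \<in> F)"

lemma subfldI:
 assumes "0 \<in> F" "1 \<in> F" "!!x y. x \<in> F ==> y \<in> F ==> x + y \<in> F"
  "!!x y. x \<in> F ==> y \<in> F ==> x * y \<in> F" "!!x. x \<in> F ==> - x \<in> F"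
  "!!x. x \<in> F ==> x ~= 0 ==> inverse x \<in> F"
 shows "subfld F" unfolding subfld_def using assms by (metis inverse_zero)

lemma subfld_0: "subfld F ==> 0 \<in> F"
 and subfld_1: "subfld F ==> 1 \<in> F"
 and subfld_add: "subfld F ==> x \<in> F ==> y \<in> F ==> x + y \<in> F"
 and subfld_mult: "subfld F ==> x \<in> F ==> y \<in> F ==> x * y \<in> F"
 and subfld_uminus: "subfld F ==> x \<in> F ==> - x \<in> F"
 and subfld_inverse: "subfld F ==> x \<in> F ==> inverse x \<in> F" by (auto simp: subfld_def)

lemma subfld_diff: "subfld F ==> x \<in> F ==> y \<in> F ==> x - y \<in> F"
 using subfld_add[of F x "- y"] subfld_uminus[of F y] by simp

lemma subfld_divide: "subfld F ==> x \<in> F ==> y \<in> F ==> x / y \<in> F"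
 by (simp add: divide_inverse subfld_mult subfld_inverse)

lemma subfld_sum: "subfld F ==> (!!i. i \<in> A ==> f i \<in> F) ==> sum f A \<in> F"
 by (induction A rule: infinite_finite_induct) (auto simp: subfld_0 subfld_add)

lemma subfld_prod: "subfld F ==> (!!i. i \<in> A ==> f i \<in> F) ==> prod f A \<in> F"
 by (induction A rule: infinite_finite_induct) (auto simp: subfld_1 subfld_mult)

lemma subfld_power: "subfld F ==> x \<in> F ==> x ^ n \<in> F" by (induction n) (auto simp: subfld_1 subfld_mult)

lemma subfld_powi: "subfld F ==> x \<in> F ==> x powi n \<in> F"
 by (simp add: power_int_def subfld_power subfld_inverse)

lemma subfld_of_nat: "subfld F ==> of_nat n \<in> F" by (induction n) (auto simp: subfld_0 subfld_1 subfld_add)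

lemmas subfld_intros = subfld_0 subfld_1 subfld_add subfld_mult subfld_uminus subfld_inverse
 subfld_diff subfld_divide subfld_sum subfld_prod subfld_power subfld_powi subfld_of_nat

lemma type_ring_simps [simp]:
 "carrier (rta :: 'a::field ring) = UNIV"
 "x \<otimes>\<^bsub>rta\<^esub> y = x * (y::'a)"
 "x \<oplus>\<^bsub>rta\<^esub> y = x + (y::'a)"
 "\<one>\<^bsub>rta\<^esub> = (1::'a)"
 "\<zero>\<^bsub>rta\<^esub> = (0::'a)" by (auto simp: ring_of_type_algebra_def)

lemma type_ring_uminus [simp]: "\<ominus>\<^bsub>rta\<^esub> x = - (x::'a::field)"
proof -
 interpret field "rta :: 'a ring" by (rule field_from_type_algebra)
 show ?thesis using minus_equality[of "- x" x] by simp
qed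

lemma type_ring_inv: "x ~= 0 ==> inv\<^bsub>rta\<^esub> x = inverse (x::'a::field)"
proof -
 assume "x ~= 0"
 interpret field "rta :: 'a ring" by (rule field_from_type_algebra)
 show ?thesis using comm_inv_char[of x "inverse x"] \<open>x ~= 0\<close> by simp
qed

lemma type_ring_pow [simp]: "x [^]\<^bsub>rta\<^esub> (n::nat) = (x::'a::field) ^ n"
proof -
 interpret field "rta :: 'a ring" by (rule field_from_type_algebra)
 show ?thesis by (induction n) (auto simp: nat_pow_Suc2 mult.commute)
qed

lemma subfield_iff_subfld: "subfield F (rta :: 'a::field ring) \<longleftrightarrow> subfld F"
proof -
 interpret field "rta :: 'a ring" by (rule field_from_type_algebra)
 show ?thesis
 proof
  assume s: "subfield F rta"
  note r = subringE[OF subfieldE(1)[OF s]]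
  show "subfld F"
  proof (rule subfldI)
   show "0 \<in> F" "1 \<in> F" using r(2,3) by simp_all
   show "!!x y. x \<in> F ==> y \<in> F ==> x + y \<in> F" using r(7) by simp
   show "!!x y. x \<in> F ==> y \<in> F ==> x * y \<in> F" using r(6) by simp
   show "!!x. x \<in> F ==> - x \<in> F" using r(5) by simp
   show "!!x. x \<in> F ==> x ~= 0 ==> inverse x \<in> F" using subfield_m_inv(1)[OF s] type_ring_inv by force
  qed
 next
  assume s: "subfld F"
  show "subfield F rta" by (intro subfieldI' subringI) (use s in "auto simp: subfld_def type_ring_inv")
 qed
qed

lemma subfld_adjoin: "subfld (adjoin K S)"
proof -
 interpret field "rta :: 'a ring" by (rule field_from_type_algebra)
 show ?thesis unfolding adjoin_def subfield_iff_subfld[symmetric] by (rule generate_field_is_subfield) simp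
qed

lemma adjoin_base: "x \<in> K ==> x \<in> adjoin K S"
 and adjoin_gen: "x \<in> S ==> x \<in> adjoin K S" by (auto simp: adjoin_def intro: generate_field.incl)

lemma adjoin_least: "subfld F ==> K \<subseteq> F ==> S \<subseteq> F ==> adjoin K S \<subseteq> F"
proof -
 interpret field "rta :: 'a ring" by (rule field_from_type_algebra)
 assume "subfld F" "K \<subseteq> F" "S \<subseteq> F"
 thus ?thesis unfolding adjoin_def subfield_iff_subfld[symmetric] by (intro generate_field_min_subfield1) auto
qed

lemma adjoin_mono: "K \<subseteq> K' ==> S \<subseteq> S' ==> adjoin K S \<subseteq> adjoin K' S'"
 by (rule adjoin_least[OF subfld_adjoin]) (auto intro: adjoin_base adjoin_gen)

lemma adjoin_empty: "subfld K ==> adjoin K {} = K" by (intro equalityI adjoin_least subsetI) (auto intro: adjoin_base)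

lemma adjoin_Un: "adjoin K (S Un T) = adjoin (adjoin K S) T"
proof
 show "adjoin K (S Un T) \<subseteq> adjoin (adjoin K S) T"
  by (rule adjoin_least[OF subfld_adjoin]) (auto intro: adjoin_base adjoin_gen)
 show "adjoin (adjoin K S) T \<subseteq> adjoin K (S Un T)"
  by (rule adjoin_least[OF subfld_adjoin]) (auto intro: adjoin_gen adjoin_mono[THEN subsetD, of K K S])
qed

lemma adjoin_insert: "adjoin K (insert y S) = adjoin (adjoin K S) {y}" using adjoin_Un[of K S "{y}"] by simp

definition polys :: "'a::comm_ring_1 set => 'a poly set" where
 "polys F = {p. \<forall>i. coeff p i \<in> F}"

lemma polysI: "(!!i. coeff p i \<in> F) ==> p \<in> polys F" by (simp add: polys_def)

lemma polysD: "p \<in> polys F ==> coeff p i \<in> F" by (simp add: polys_def)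

lemma polys_mono: "F \<subseteq> G ==> polys F \<subseteq> polys G" by (auto simp: polys_def)

context fixes F :: "'a::field set" assumes F: "subfld F" begin

lemma polys_0: "0 \<in> polys F" by (auto intro!: polysI simp: F subfld_0)

lemma polys_const: "c \<in> F ==> [:c:] \<in> polys F"
 by (auto intro!: polysI simp: coeff_pCons subfld_0[OF F] split: nat.split)

lemma polys_1: "1 \<in> polys F" using polys_const[of 1] subfld_1[OF F] by (simp add: one_pCons)

lemma polys_add: "p \<in> polys F ==> r \<in> polys F ==> p + r \<in> polys F"
 by (auto simp: polys_def subfld_add[OF F])

lemma polys_uminus: "p \<in> polys F ==> - p \<in> polys F" by (auto simp: polys_def subfld_uminus[OF F])

lemma polys_diff: "p \<in> polys F ==> r \<in> polys F ==> p - r \<in> polys F"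
 by (auto simp: polys_def subfld_diff[OF F])

lemma polys_mult: "p \<in> polys F ==> r \<in> polys F ==> p * r \<in> polys F"
 by (auto simp: polys_def coeff_mult intro!: subfld_sum[OF F] subfld_mult[OF F])

lemma polys_smult: "c \<in> F ==> p \<in> polys F ==> Polynomial.smult c p \<in> polys F"
 by (auto simp: polys_def intro!: subfld_mult[OF F])

lemma polys_pCons: "c \<in> F ==> p \<in> polys F ==> pCons c p \<in> polys F"
 by (auto simp: polys_def coeff_pCons split: nat.split)

lemma polys_power: "p \<in> polys F ==> p ^ n \<in> polys F" by (induction n) (auto simp: polys_1 polys_mult)

lemma polys_sum: "(!!i. i \<in> A ==> p i \<in> polys F) ==> sum p A \<in> polys F"
 by (induction A rule: infinite_finite_induct) (auto simp: polys_0 polys_add)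

lemma polys_prod: "(!!i. i \<in> A ==> p i \<in> polys F) ==> prod p A \<in> polys F"
 by (induction A rule: infinite_finite_induct) (auto simp: polys_1 polys_mult)

lemma polys_monom: "c \<in> F ==> monom c n \<in> polys F" by (auto simp: polys_def subfld_0[OF F])

lemma poly_in_subfld: "p \<in> polys F ==> x \<in> F ==> poly p x \<in> F"
 by (auto simp: poly_altdef polys_def intro!: subfld_sum[OF F] subfld_mult[OF F] subfld_power[OF F])

lemma polys_pcompose: "p \<in> polys F ==> r \<in> polys F ==> pcompose p r \<in> polys F"
proof (induction p)
 case (pCons a p)
 have "a \<in> F" using polysD[OF pCons.prems(1), of 0] by simp
 moreover have "p \<in> polys F" using polysD[OF pCons.prems(1), of "Suc i" for i] by (auto intro!: polysI)
 ultimately show ?case using pCons by (simp add: pcompose_pCons polys_add polys_const polys_mult)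
qed (simp add: polys_0)

lemma algebraic_over_iff:
 "algebraic_over F x \<longleftrightarrow> (\<exists>p\<in>polys F. p ~= 0 & poly p x = 0)"
proof -
 interpret R: field "rta :: 'a ring" by (rule field_from_type_algebra)
 note ev = R.eval.simps
 have eval: "R.eval p x = poly (Poly (rev p)) x" for p
  by (induction p) (auto simp: Poly_append poly_monom algebra_simps)
 have sr: "subring F rta" using F unfolding subfield_iff_subfld[symmetric] by (rule subfieldE)
 show ?thesis
 proof
  assume "algebraic_over F x"
  then obtain p where p: "p \<in> carrier (univ_poly rta F)" "p ~= []" "R.eval p x = 0"
   unfolding algebraic_over_def using R.algebraicE[OF sr, of x] by auto
  from p(1,2) have p': "set p \<subseteq> F" "hd p ~= 0" by (auto simp: univ_poly_def polynomial_def)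
  have "Poly (rev p) ~= 0"
  proof
   assume "Poly (rev p) = 0"
   hence "coeff (Poly (rev p)) (length p - 1) = 0" by simp
   thus False using p(2) p'(2) by (simp add: coeff_Poly_eq nth_default_def rev_nth hd_conv_nth)
  qed
  moreover have "Poly (rev p) \<in> polys F"
   using p' subfld_0[OF F] by (intro polysI) (auto intro: subsetD[OF p'(1)] simp: coeff_Poly_eq nth_default_def rev_nth)
  ultimately show "\<exists>p\<in>polys F. p ~= 0 & poly p x = 0" using p(3) eval by auto
 next
  assume "\<exists>p\<in>polys F. p ~= 0 & poly p x = 0"
  then obtain p where p: "p \<in> polys F" "p ~= 0" "poly p x = 0" by auto
  let ?p = "rev (coeffs p)"
  have "set ?p \<subseteq> F" using p(1) by (auto simp: polys_def coeffs_def split: if_splits)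
  moreover have "Polynomials.lead_coeff ?p ~= 0" using p(2) by (simp add: hd_rev last_coeffs_eq_coeff_degree)
  ultimately have "?p \<in> carrier (univ_poly rta F)" by (simp add: univ_poly_def polynomial_def)
  moreover have "?p ~= []" using p(2) by simp
  moreover have "R.eval ?p x = \<zero>\<^bsub>rta\<^esub>" using p(3) by (simp add: eval)
  ultimately show "algebraic_over F x" unfolding algebraic_over_def by (rule R.algebraicI)
 qed
qed

lemma algebraic_over_self: "x \<in> F ==> algebraic_over F x" unfolding algebraic_over_iff
 by (rule bexI[of _ "[:- x, 1:]"]) (auto simp: subfld_1[OF F] subfld_uminus[OF F] intro!: polys_pCons polys_const)

lemma subfld_algebraics: "subfld {x. algebraic_over F x}"
proof -
 interpret R: field "rta :: 'a ring" by (rule field_from_type_algebra)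
 have "subfield F rta" using F by (simp add: subfield_iff_subfld)
 from R.subfield_of_algebraics[OF this] show ?thesis by (simp add: subfield_iff_subfld algebraic_over_def)
qed

end

lemma algebraic_over_mono: "subfld F ==> subfld G ==> F \<subseteq> G ==> algebraic_over F x ==> algebraic_over G x"
 using polys_mono[of F G] by (auto simp: algebraic_over_iff)

lemma algebraic_over_trans:
 assumes F: "subfld F" and G: "subfld G" and GF: "!!y. y \<in> G ==> algebraic_over F y"
  and x: "algebraic_over G x"
 shows "algebraic_over F x"
proof -
 interpret R: field "rta :: 'a ring" by (rule field_from_type_algebra)
 obtain p where p: "p \<in> polys G" "p ~= 0" "poly p x = 0" using x algebraic_over_iff[OF G] by auto
 have SF: "subfield F rta" using F by (simp add: subfield_iff_subfld)
 define A where "A = R.finite_extension F (coeffs p)"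
 have alg: "(R.algebraic over F) y" if "y \<in> set (coeffs p)" for y
  using GF[of y] that p(1) by (auto simp: algebraic_over_def coeffs_def polys_def split: if_splits)
 have A: "subfield A rta" unfolding A_def using R.finite_extension_is_subfield[OF SF] alg by simp
 have fdA: "R.finite_dimension F A" unfolding A_def using R.finite_extension_finite_dimension(1)[OF SF] alg by simp
 have cA: "set (coeffs p) \<subseteq> A" unfolding A_def using R.finite_extension_mem[OF subfieldE(1)[OF SF]] by simp
 have A': "subfld A" using A by (simp add: subfield_iff_subfld)
 have "p \<in> polys A"
 proof (rule polysI)
  fix i show "coeff p i \<in> A"
   by (cases "i <= degree p") (use cA coeff_in_coeffs[OF p(2)] subfld_0[OF A'] in "auto simp: coeff_eq_0")
 qed
 hence "algebraic_over A x" using p algebraic_over_iff[OF A'] by auto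
 hence xA: "(R.algebraic over A) x" by (simp add: algebraic_over_def)
 have "R.finite_dimension A (R.simple_extension A x)" using R.finite_dimension_simple_extension[OF A, of x] xA by simp
 hence fd: "R.finite_dimension F (R.simple_extension A x)" using R.telescopic_base_dim(1)[OF SF A fdA] by simp
 have "(R.algebraic over F) x" by (rule R.finite_dimension_imp_algebraic[OF SF _ fd])
   (use R.simple_extension_is_subring[OF subfieldE(1)[OF A]] R.simple_extension_mem[OF subfieldE(1)[OF A]] in auto)
 thus ?thesis by (simp add: algebraic_over_def)
qed

lemma adjoin_single_iff:
 assumes F: "subfld F"
 shows "z \<in> adjoin F {y} \<longleftrightarrow> (\<exists>P\<in>polys F. \<exists>Q\<in>polys F. poly Q y ~= 0 & z = poly P y / poly Q y)"
proof
 let ?R = "{z. \<exists>P\<in>polys F. \<exists>Q\<in>polys F. poly Q y ~= 0 & z = poly P y / poly Q y}"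
 have R: "subfld ?R"
 proof (rule subfldI; (elim CollectE bexE conjE)?)
  show "0 \<in> ?R" by (rule CollectI, rule bexI[of _ 0], rule bexI[of _ 1]) (auto simp: F polys_0 polys_1)
  show "1 \<in> ?R" by (rule CollectI, rule bexI[of _ 1], rule bexI[of _ 1]) (auto simp: F polys_0 polys_1)
 next
  fix x z P Q P' Q' assume *: "P \<in> polys F" "Q \<in> polys F" "poly Q y ~= 0" "x = poly P y / poly Q y"
   "P' \<in> polys F" "Q' \<in> polys F" "poly Q' y ~= 0" "z = poly P' y / poly Q' y"
  have eq: "x + z = poly (P * Q' + P' * Q) y / poly (Q * Q') y"
   unfolding *(4,8) using *(3,7) by (simp add: add_divide_eq_iff divide_add_eq_iff mult.commute)
  have mem: "P * Q' + P' * Q \<in> polys F" "Q * Q' \<in> polys F" using * F by (simp_all add: polys_add polys_mult)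
  show "x + z \<in> ?R" using eq mem * by (intro CollectI bexI[OF _ mem(1)] bexI[OF _ mem(2)]) auto
  have mem': "P * P' \<in> polys F" using * F by (simp_all add: polys_mult)
  show "x * z \<in> ?R" using * by (intro CollectI bexI[OF _ mem'] bexI[OF _ mem(2)]) auto
 next
  fix x P Q assume *: "P \<in> polys F" "Q \<in> polys F" "poly Q y ~= 0" "x = poly P y / poly Q y"
  show "- x \<in> ?R" using * polys_uminus[OF F *(1)] by (intro CollectI bexI[of _ "-P"] bexI[OF _ *(2)]) auto
  assume "x ~= 0"
  thus "inverse x \<in> ?R" using * by (intro CollectI bexI[OF _ *(2)] bexI[OF _ *(1)]) auto
 qed
 have "F \<subseteq> ?R"
 proof
  fix c assume "c \<in> F"
  thus "c \<in> ?R" by (intro CollectI bexI[of _ "[:c:]"] bexI[of _ 1]) (auto simp: F polys_1 polys_const)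
 qed
 moreover have "{y} \<subseteq> ?R" by (intro subsetI CollectI bexI[of _ "[:0,1:]"] bexI[of _ 1])
   (auto simp: F polys_1 polys_const polys_pCons subfld_0 subfld_1)
 ultimately have "adjoin F {y} \<subseteq> ?R" using R by (intro adjoin_least) auto
 moreover assume "z \<in> adjoin F {y}"
 ultimately show "\<exists>P\<in>polys F. \<exists>Q\<in>polys F. poly Q y ~= 0 & z = poly P y / poly Q y" by auto
next
 assume "\<exists>P\<in>polys F. \<exists>Q\<in>polys F. poly Q y ~= 0 & z = poly P y / poly Q y"
 then obtain P Q where *: "P \<in> polys F" "Q \<in> polys F" "z = poly P y / poly Q y" by auto
 have s: "subfld (adjoin F {y})" by (rule subfld_adjoin)
 have "polys F \<subseteq> polys (adjoin F {y})" by (intro polys_mono) (auto intro: adjoin_base)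
 hence "poly P y \<in> adjoin F {y}" "poly Q y \<in> adjoin F {y}"
  using * poly_in_subfld[OF s _ adjoin_gen[of y "{y}"]] by auto
 thus "z \<in> adjoin F {y}" using * subfld_divide[OF s] by simp
qed

lemma adjoin_single_common_denominator:
 assumes F: "subfld F" and "finite I" and "!!i. i \<in> I ==> z i \<in> adjoin F {y}"
 shows "\<exists>Q\<in>polys F. poly Q y ~= 0 & (\<forall>i\<in>I. \<exists>P\<in>polys F. poly Q y * z i = poly P y)"
 using assms(2,3)
proof (induction I)
 case empty thus ?case by (intro bexI[of _ 1]) (auto simp: F polys_1)
next
 case (insert i I)
 then obtain Q where Q: "Q \<in> polys F" "poly Q y ~= 0" "\<forall>i\<in>I. \<exists>P\<in>polys F. poly Q y * z i = poly P y"
  by auto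
 from insert.prems[of i] obtain P' Q' where i: "P' \<in> polys F" "Q' \<in> polys F" "poly Q' y ~= 0" "z i = poly P' y / poly Q' y"
  by (auto simp: adjoin_single_iff[OF F])
 show ?case
 proof (rule bexI[of _ "Q * Q'"], intro conjI ballI)
  show "Q * Q' \<in> polys F" using Q i F by (simp add: polys_mult)
  show "poly (Q * Q') y ~= 0" using Q i by simp
  fix j assume "j \<in> insert i I"
  then consider "j = i" | "j \<in> I" by auto
  thus "\<exists>P\<in>polys F. poly (Q * Q') y * z j = poly P y"
  proof cases
   case 1 thus ?thesis using i Q F by (intro bexI[of _ "Q * P'"]) (auto simp: polys_mult)
  next
   case 2
   then obtain P where "P \<in> polys F" "poly Q y * z j = poly P y" using Q by auto
   thus ?thesis using i F by (intro bexI[of _ "P * Q'"]) (auto simp: polys_mult algebra_simps)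
  qed
 qed
qed

lemma algebraic_over_adjoin_single:
 assumes F: "subfld F" and alg: "algebraic_over (adjoin F {x}) y"
 shows "\<exists>n G. (\<forall>j. G j \<in> polys F) & (\<exists>j\<le>n. poly (G j) x ~= 0) & (\<Sum>j\<le>n. poly (G j) x * y ^ j) = 0"
proof -
 obtain p where p: "p \<in> polys (adjoin F {x})" "p ~= 0" "poly p y = 0"
  using alg unfolding algebraic_over_iff[OF subfld_adjoin] by auto
 let ?n = "degree p"
 obtain Q where Q: "Q \<in> polys F" "poly Q x ~= 0"
  "\<forall>i\<in>{..?n}. \<exists>P\<in>polys F. poly Q x * coeff p i = poly P x"
  using adjoin_single_common_denominator[OF F, of "{..?n}" "coeff p" x] p(1) by (auto simp: polys_def)
 then obtain G where G: "!!i. i <= ?n ==> G i \<in> polys F & poly Q x * coeff p i = poly (G i) x" by (metis atMost_iff)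
 define G' where "G' = (%i. if i <= ?n then G i else 0)"
 show ?thesis
 proof (rule exI[of _ ?n], rule exI[of _ G'], intro conjI allI)
  show "G' j \<in> polys F" for j using G F by (auto simp: G'_def polys_0)
  have "poly (G' ?n) x = poly Q x * coeff p ?n" using G by (auto simp: G'_def)
  also have "... ~= 0" using Q p by simp
  finally show "\<exists>j\<le>?n. poly (G' j) x ~= 0" by auto
  have "(\<Sum>j\<le>?n. poly (G' j) x * y ^ j) = (\<Sum>j\<le>?n. poly Q x * (coeff p j * y ^ j))"
   by (rule sum.cong) (use G in "auto simp: G'_def")
  also have "... = poly Q x * poly p y" by (simp add: poly_altdef sum_distrib_left)
  finally show "(\<Sum>j\<le>?n. poly (G' j) x * y ^ j) = 0" using p by simp
 qed
qed

text \<open>A relation G(x, y) = 0 over F can be read as an equation for x over F(y). It is not the zero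
 equation: y is transcendental over F, so a nonzero polynomial over F cannot vanish at y.\<close>

lemma algebraic_over_exchange_single:
 assumes F: "subfld F" and alg: "algebraic_over (adjoin F {x}) y" and tr: "\<not> algebraic_over F y"
 shows "algebraic_over (adjoin F {y}) x"
proof -
 obtain n G where G: "!!j. G j \<in> polys F" "\<exists>j\<le>n. poly (G j) x ~= 0" "(\<Sum>j\<le>n. poly (G j) x * y ^ j) = 0"
  using algebraic_over_adjoin_single[OF F alg] by blast
 define H where "H = (\<Sum>j\<le>n. Polynomial.smult (y ^ j) (G j))"
 have s: "subfld (adjoin F {y})" by (rule subfld_adjoin)
 have "G j \<in> polys (adjoin F {y})" for j
  using G(1)[of j] polys_mono[of F "adjoin F {y}"] by (auto intro: adjoin_base)
 hence "H \<in> polys (adjoin F {y})" unfolding H_def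
  by (intro polys_sum polys_smult s subfld_power) (auto intro: adjoin_gen)
 moreover have "poly H x = 0" using G(3) by (simp add: H_def poly_sum mult.commute)
 moreover have "H ~= 0"
 proof
  assume H0: "H = 0"
  obtain j where j: "j <= n" "poly (G j) x ~= 0" using G(2) by auto
  then obtain i where i: "coeff (G j) i ~= 0" by (metis poly_0 poly_eqI coeff_0)
  define P where "P = (\<Sum>j\<le>n. monom (coeff (G j) i) j)"
  have "P \<in> polys F" unfolding P_def by (intro polys_sum polys_monom F) (use G(1) in "auto simp: polys_def")
  moreover have "coeff P j = coeff (G j) i" using j by (simp add: P_def coeff_sum)
  hence "P ~= 0" using i by auto
  moreover have "poly P y = coeff H i" by (simp add: P_def H_def poly_sum poly_monom coeff_sum mult.commute)
  hence "poly P y = 0" using H0 by simp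
  ultimately show False using tr algebraic_over_iff[OF F] by auto
 qed
 ultimately show ?thesis using algebraic_over_iff[OF s] by auto
qed

section \<open>Algebraic closure and transcendence degree\<close>

text \<open>A closure operator with the exchange property (\<open>acl_idem\<close>,
 \<open>acl_exchange\<close>): transcendence degrees are dimensions with respect to it.\<close>

definition acl :: "'a::field set => 'a set => 'a set" where
 "acl K S = {x. algebraic_over (adjoin K S) x}"

lemma subfld_acl: "subfld (acl K S)" unfolding acl_def by (rule subfld_algebraics[OF subfld_adjoin])

lemma adjoin_subset_acl: "adjoin K S \<subseteq> acl K S"
 unfolding acl_def using algebraic_over_self[OF subfld_adjoin] by auto

lemma acl_gen: "x \<in> S ==> x \<in> acl K S" and acl_base: "x \<in> K ==> x \<in> acl K S"
 using adjoin_subset_acl[of K S] by (auto intro: adjoin_gen adjoin_base)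

lemma acl_idem:
 assumes "T \<subseteq> acl K S" shows "acl K T \<subseteq> acl K S"
proof
 fix x assume "x \<in> acl K T"
 hence x: "algebraic_over (adjoin K T) x" by (simp add: acl_def)
 have "adjoin K T \<subseteq> acl K S" by (rule adjoin_least[OF subfld_acl]) (use assms acl_base in auto)
 hence "algebraic_over (adjoin K S) x"
  by (intro algebraic_over_trans[OF subfld_adjoin subfld_adjoin _ x]) (auto simp: acl_def)
 thus "x \<in> acl K S" by (simp add: acl_def)
qed

lemma acl_mono: "S \<subseteq> T ==> acl K S \<subseteq> acl K T" by (rule acl_idem) (auto intro: acl_gen)

lemma acl_exchange:
 assumes "y \<in> acl K (insert x S)" "y \<notin> acl K S" shows "x \<in> acl K (insert y S)"
 using algebraic_over_exchange_single[OF subfld_adjoin, of K S x y] assms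
 by (simp add: acl_def adjoin_insert[of K x S] adjoin_insert[of K y S])

definition mono_val :: "('a::field \<Rightarrow>\<^sub>0 nat) => 'a" where
 "mono_val m = (\<Prod>x\<in>vars m. x ^ lkp m x)"

lemma mono_val_superset:
 "finite A ==> vars m \<subseteq> A ==> mono_val m = (\<Prod>x\<in>A. x ^ lkp m x)"
 unfolding mono_val_def by (rule prod.mono_neutral_left) (auto simp: in_keys_iff)

lemma mono_val_add: "mono_val (m + m') = mono_val m * mono_val m'"
proof -
 let ?A = "vars m Un vars m'"
 have "mono_val (m + m') = (\<Prod>x\<in>?A. x ^ lkp (m + m') x)"
  by (rule mono_val_superset) (use Poly_Mapping.keys_add[of m m'] in auto)
 also have "... = mono_val m * mono_val m'"
  by (simp add: mono_val_superset[of ?A m] mono_val_superset[of ?A m'] lookup_add power_add prod.distrib)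
 finally show ?thesis .
qed

lemma mono_val_single [simp]: "mono_val (Poly_Mapping.single x n) = x ^ n" by (cases "n = 0") (auto simp: mono_val_def)

text \<open>In this form independence speaks of finite families of coefficients and monomials, so no
 arithmetic of multivariate polynomials is needed.\<close>

lemma alg_independent_iff:
 "alg_independent K B \<longleftrightarrow>
  (\<forall>M c. finite M --> (\<forall>m\<in>M. vars m \<subseteq> B & c m \<in> K) -->
    (\<Sum>m\<in>M. c m * mono_val m) = 0 --> (\<forall>m\<in>M. c m = 0))" if "0 \<in> K"
proof (intro iffI allI impI)
 fix M c assume ai: "alg_independent K B" and M: "finite M" "\<forall>m\<in>M. vars m \<subseteq> B & c m \<in> K"
  and 0: "(\<Sum>m\<in>M. c m * mono_val m) = 0"
 define P where "P = Poly_Mapping.Abs_poly_mapping (%m. if m \<in> M then c m else 0)"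
 have fin: "finite {m. (if m \<in> M then c m else 0) ~= 0}" by (rule finite_subset[OF _ M(1)]) (auto split: if_splits)
 have lk: "lkp P m = (if m \<in> M then c m else 0)" for m
  unfolding P_def by (subst Abs_poly_mapping_inverse) (use fin in auto)
 have ks: "vars P = {m\<in>M. c m ~= 0}" by (auto simp: in_keys_iff lk split: if_splits)
 have "eval_mpoly P = (\<Sum>m\<in>M. c m * mono_val m)" unfolding eval_mpoly_def mono_val_def[symmetric] ks lk
  by (rule sum.mono_neutral_cong_left) (use M in auto)
 hence "eval_mpoly P = 0" using 0 by simp
 moreover have "range (lkp P) \<subseteq> K" "\<forall>m\<in>vars P. vars m \<subseteq> B"
  using M that by (auto simp: lk ks)
 ultimately have "P = 0" using ai unfolding alg_independent_def by blast
 thus "\<forall>m\<in>M. c m = 0" using lk by (metis lookup_zero)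
next
 assume R: "\<forall>M c. finite M --> (\<forall>m\<in>M. vars m \<subseteq> B & c m \<in> K) -->
    (\<Sum>m\<in>M. c m * mono_val m) = 0 --> (\<forall>m\<in>M. c m = 0)"
 show "alg_independent K B" unfolding alg_independent_def
 proof (intro allI impI, elim conjE)
  fix P :: "('a \<Rightarrow>\<^sub>0 nat) \<Rightarrow>\<^sub>0 'a"
  assume P: "range (lkp P) \<subseteq> K" "\<forall>m\<in>vars P. vars m \<subseteq> B" "eval_mpoly P = 0"
  have "\<forall>m\<in>vars P. lkp P m = 0"
   using R[rule_format, of "vars P" "lkp P"] P by (auto simp: eval_mpoly_def mono_val_def)
  thus "P = 0" by (metis in_keys_iff lookup_zero poly_mapping_eqI)
 qed
qed

definition gen_ring :: "'a::field set => 'a set => 'a set" where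
 "gen_ring K B = {z. \<exists>M c. finite M & (\<forall>m\<in>M. vars m \<subseteq> B & c m \<in> K) &
   z = (\<Sum>m\<in>M. c m * mono_val m)}"

context fixes K B :: "'a::field set" assumes K: "subfld K" begin

lemma gen_ring_monom: "c \<in> K ==> vars m \<subseteq> B ==> c * mono_val m \<in> gen_ring K B"
 unfolding gen_ring_def by (intro CollectI exI[of _ "{m}"] exI[of _ "%_. c"]) auto

lemma gen_ring_add:
 assumes "x \<in> gen_ring K B" "y \<in> gen_ring K B" shows "x + y \<in> gen_ring K B"
proof -
 obtain M c where 1: "finite M" "\<forall>m\<in>M. vars m \<subseteq> B & c m \<in> K" "x = (\<Sum>m\<in>M. c m * mono_val m)"
  using assms(1) by (auto simp: gen_ring_def)
 obtain M' c' where 2: "finite M'" "\<forall>m\<in>M'. vars m \<subseteq> B & c' m \<in> K" "y = (\<Sum>m\<in>M'. c' m * mono_val m)"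
  using assms(2) by (auto simp: gen_ring_def)
 define d d' where "d = (%m. if m \<in> M then c m else 0)" and "d' = (%m. if m \<in> M' then c' m else 0)"
 have "x = (\<Sum>m\<in>M Un M'. d m * mono_val m)"
  unfolding 1(3) by (rule sum.mono_neutral_cong_left) (use 1 2 in "auto simp: d_def")
 moreover have "y = (\<Sum>m\<in>M Un M'. d' m * mono_val m)"
  unfolding 2(3) by (rule sum.mono_neutral_cong_left) (use 1 2 in "auto simp: d'_def")
 ultimately have "x + y = (\<Sum>m\<in>M Un M'. (d m + d' m) * mono_val m)" by (simp add: sum.distrib algebra_simps)
 moreover have "\<forall>m\<in>M Un M'. vars m \<subseteq> B & d m + d' m \<in> K"
  using 1(2) 2(2) by (auto simp: d_def d'_def subfld_add[OF K] subfld_0[OF K])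
 ultimately show ?thesis using 1(1) 2(1) unfolding gen_ring_def
  by (intro CollectI exI[of _ "M Un M'"] exI[of _ "%m. d m + d' m"]) simp
qed

lemma gen_ring_0: "0 \<in> gen_ring K B" using gen_ring_monom[of 0 0] subfld_0[OF K] by simp

lemma gen_ring_sum: "(!!i. i \<in> A ==> f i \<in> gen_ring K B) ==> sum f A \<in> gen_ring K B"
 by (induction A rule: infinite_finite_induct) (auto simp: gen_ring_0 gen_ring_add)

lemma gen_ring_mult:
 assumes "x \<in> gen_ring K B" "y \<in> gen_ring K B" shows "x * y \<in> gen_ring K B"
proof -
 obtain M c where 1: "finite M" "\<forall>m\<in>M. vars m \<subseteq> B & c m \<in> K" "x = (\<Sum>m\<in>M. c m * mono_val m)"
  using assms(1) by (auto simp: gen_ring_def)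
 obtain M' c' where 2: "finite M'" "\<forall>m\<in>M'. vars m \<subseteq> B & c' m \<in> K" "y = (\<Sum>m\<in>M'. c' m * mono_val m)"
  using assms(2) by (auto simp: gen_ring_def)
 have "x * y = (\<Sum>m\<in>M. \<Sum>m'\<in>M'. (c m * c' m') * mono_val (m + m'))"
  unfolding 1(3) 2(3) sum_product by (intro sum.cong refl) (simp add: mono_val_add mult_ac)
 also have "... \<in> gen_ring K B"
 proof (intro gen_ring_sum gen_ring_monom)
  fix m m' assume "m \<in> M" "m' \<in> M'"
  thus "c m * c' m' \<in> K" "vars (m + m') \<subseteq> B"
   using 1(2) 2(2) Poly_Mapping.keys_add[of m m'] by (fastforce simp: subfld_mult[OF K])+
 qed
 finally show ?thesis .
qed

lemma gen_ring_const: "c \<in> K ==> c \<in> gen_ring K B" using gen_ring_monom[of c 0] by (simp add: mono_val_def)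

lemma gen_ring_gen: "b \<in> B ==> b \<in> gen_ring K B"
 using gen_ring_monom[of 1 "Poly_Mapping.single b 1"] by (simp add: subfld_1[OF K])

lemma gen_ring_uminus: "x \<in> gen_ring K B ==> - x \<in> gen_ring K B"
 using gen_ring_mult[OF gen_ring_const[of "-1"], of x] subfld_1[OF K] subfld_uminus[OF K] by simp

lemma adjoin_iff_gen_ring: "z \<in> adjoin K B \<longleftrightarrow> (\<exists>x\<in>gen_ring K B. \<exists>y\<in>gen_ring K B. y ~= 0 & z = x / y)"
proof
 let ?R = "{z. \<exists>x\<in>gen_ring K B. \<exists>y\<in>gen_ring K B. y ~= 0 & z = x / y}"
 have in_R: "x / y \<in> ?R" if "x \<in> gen_ring K B" "y \<in> gen_ring K B" "y ~= 0" for x y using that by auto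
 have one: "1 \<in> gen_ring K B" using gen_ring_const[OF subfld_1[OF K]] .
 have "subfld ?R"
 proof (rule subfldI; (elim CollectE bexE conjE)?)
  show "0 \<in> ?R" using in_R[OF gen_ring_0 one] by simp
  show "1 \<in> ?R" using in_R[OF one one] by simp
 next
  fix x z a b a' b' assume *: "a \<in> gen_ring K B" "b \<in> gen_ring K B" "b ~= 0" "x = a / b"
   "a' \<in> gen_ring K B" "b' \<in> gen_ring K B" "b' ~= 0" "z = a' / b'"
  have "x + z = (a * b' + a' * b) / (b * b')"
   unfolding *(4,8) using *(3,7) by (simp add: add_divide_eq_iff divide_add_eq_iff mult.commute)
  thus "x + z \<in> ?R" using in_R[of "a * b' + a' * b" "b * b'"] * by (simp add: gen_ring_add gen_ring_mult)
  show "x * z \<in> ?R" using in_R[of "a * a'" "b * b'"] * by (simp add: gen_ring_mult)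
 next
  fix x a b assume *: "a \<in> gen_ring K B" "b \<in> gen_ring K B" "b ~= 0" "x = a / b"
  show "- x \<in> ?R" using in_R[of "- a" b] * by (simp add: gen_ring_uminus)
  assume "x ~= 0" thus "inverse x \<in> ?R" using in_R[of b a] * by simp
 qed
 moreover have "K \<subseteq> ?R" using in_R[OF _ one] gen_ring_const by fastforce
 moreover have "B \<subseteq> ?R" using in_R[OF _ one] gen_ring_gen by fastforce
 ultimately have "adjoin K B \<subseteq> ?R" by (intro adjoin_least) auto
 moreover assume "z \<in> adjoin K B"
 ultimately show "\<exists>x\<in>gen_ring K B. \<exists>y\<in>gen_ring K B. y ~= 0 & z = x / y" by auto
next
 have *: "x \<in> adjoin K B" if x: "x \<in> gen_ring K B" for x
 proof -
  obtain M c where 1: "finite M" "\<forall>m\<in>M. vars m \<subseteq> B & c m \<in> K" "x = (\<Sum>m\<in>M. c m * mono_val m)"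
   using x by (auto simp: gen_ring_def)
  show ?thesis unfolding 1(3) mono_val_def using 1(2)
   by (intro subfld_sum subfld_mult subfld_prod subfld_power subfld_adjoin) (auto intro: adjoin_base adjoin_gen)
 qed
 assume "\<exists>x\<in>gen_ring K B. \<exists>y\<in>gen_ring K B. y ~= 0 & z = x / y"
 thus "z \<in> adjoin K B" using * by (auto intro!: subfld_divide subfld_adjoin)
qed

text \<open>By \<open>adjoin_iff_gen_ring\<close> the coefficients have a common denominator in the generated
 ring.\<close>

lemma algebraic_over_adjoin_iff:
 "algebraic_over (adjoin K B) y \<longleftrightarrow>
  (\<exists>p\<in>polys (gen_ring K B). p ~= 0 & poly p y = 0)"
proof
 have s: "subfld (adjoin K B)" by (rule subfld_adjoin)
 {
  assume "algebraic_over (adjoin K B) y"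
  then obtain p where p: "p \<in> polys (adjoin K B)" "p ~= 0" "poly p y = 0" unfolding algebraic_over_iff[OF s] by auto
  have "\<exists>d\<in>gen_ring K B. d ~= 0 & (\<forall>i\<in>A. d * coeff p i \<in> gen_ring K B)" if "finite A" for A
   using that
  proof induction
   case empty
   show ?case using gen_ring_const[OF subfld_1[OF K]] by (intro bexI[of _ 1]) auto
  next
   case (insert i A)
   then obtain d where d: "d \<in> gen_ring K B" "d ~= 0" "\<forall>i\<in>A. d * coeff p i \<in> gen_ring K B" by auto
   obtain x z where xz: "x \<in> gen_ring K B" "z \<in> gen_ring K B" "z ~= 0" "coeff p i = x / z"
    using polysD[OF p(1), of i] unfolding adjoin_iff_gen_ring by auto
   have "d * z * coeff p j \<in> gen_ring K B" if "j \<in> insert i A" for j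
   proof (cases "j = i")
    case True thus ?thesis using xz d by (simp add: gen_ring_mult)
   next
    case False
    hence "z * (d * coeff p j) \<in> gen_ring K B" using that d xz by (simp add: gen_ring_mult)
    thus ?thesis by (simp add: mult_ac)
   qed
   thus ?case using d xz by (intro bexI[of _ "d * z"]) (auto simp: gen_ring_mult)
  qed
  from this[of "{..degree p}"] obtain d where d: "d \<in> gen_ring K B" "d ~= 0" "\<forall>i\<le>degree p. d * coeff p i \<in> gen_ring K B"
   by auto
  have "Polynomial.smult d p \<in> polys (gen_ring K B)"
  proof (rule polysI)
   fix i show "coeff (Polynomial.smult d p) i \<in> gen_ring K B"
    by (cases "i <= degree p") (use d in "auto simp: coeff_eq_0 gen_ring_0")
  qed
  thus "\<exists>p\<in>polys (gen_ring K B). p ~= 0 & poly p y = 0"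
   using p d by (intro bexI[of _ "Polynomial.smult d p"]) auto
 }
 assume "\<exists>p\<in>polys (gen_ring K B). p ~= 0 & poly p y = 0"
 moreover have "gen_ring K B \<subseteq> adjoin K B"
 proof
  fix x assume "x \<in> gen_ring K B"
  thus "x \<in> adjoin K B" unfolding adjoin_iff_gen_ring
   using gen_ring_const[OF subfld_1[OF K]] by (intro bexI[of _ x] bexI[of _ 1]) auto
 qed
 ultimately show "algebraic_over (adjoin K B) y"
  unfolding algebraic_over_iff[OF s] using polys_mono[of "gen_ring K B" "adjoin K B"] by blast
qed

end

lemma mono_val_split:
 "mono_val m = x ^ lkp m x * mono_val (Poly_Mapping.update x 0 m)"
proof -
 let ?A = "insert x (vars m)"
 have k: "vars (Poly_Mapping.update x 0 m) \<subseteq> ?A" by (auto simp: in_keys_iff lookup_update split: if_splits)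
 have "mono_val m = (\<Prod>y\<in>?A. y ^ lkp m y)" by (rule mono_val_superset) auto
 also have "... = x ^ lkp m x * (\<Prod>y\<in>?A - {x}. y ^ lkp m y)" by (subst prod.remove[of _ x]) auto
 also have "(\<Prod>y\<in>?A - {x}. y ^ lkp m y) = (\<Prod>y\<in>?A - {x}. y ^ lkp (Poly_Mapping.update x 0 m) y)"
  by (rule prod.cong) (auto simp: lookup_update)
 also have "... = mono_val (Poly_Mapping.update x 0 m)"
  by (rule mono_val_superset[symmetric]) (auto simp: in_keys_iff lookup_update split: if_splits)
 finally show ?thesis .
qed

lemma alg_independent_mono:
 assumes K: "subfld K" and "alg_independent K B" "A \<subseteq> B" shows "alg_independent K A"
 using assms unfolding alg_independent_iff[OF subfld_0[OF K]] by blast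

text \<open>Sorted by powers of b, a relation becomes an equation for b over \<open>gen_ring K B\<close>. As
 b is transcendental, its coefficients vanish, and these are relations in B.\<close>

lemma alg_independent_insertI:
 assumes K: "subfld K" and B: "alg_independent K B" and b: "b \<notin> acl K B"
 shows "alg_independent K (insert b B)" unfolding alg_independent_iff[OF subfld_0[OF K]]
proof (intro allI impI ballI)
 fix M c m0
 assume M: "finite M" "\<forall>m\<in>M. vars m \<subseteq> insert b B & c m \<in> K"
  and 0: "(\<Sum>m\<in>M. c m * mono_val m) = 0" and m0: "m0 \<in> M"
 define e where "e = (%m::'a \<Rightarrow>\<^sub>0 nat. lkp m b)"
 define r where "r = (%m::'a \<Rightarrow>\<^sub>0 nat. Poly_Mapping.update b 0 m)"
 have kr: "vars (r m) \<subseteq> B" if "m \<in> M" for m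
 proof
  fix x assume "x \<in> vars (r m)"
  hence "x ~= b" "x \<in> vars m" by (auto simp: r_def in_keys_iff lookup_update split: if_splits)
  thus "x \<in> B" using M(2) that by blast
 qed
 have restore: "Poly_Mapping.update b (e m) (r m) = m" for m
  by (rule poly_mapping_eqI) (auto simp: r_def e_def lookup_update)
 define p where "p = (\<Sum>m\<in>M. monom (c m * mono_val (r m)) (e m))"
 have cp: "coeff p i = (\<Sum>m | m \<in> M & e m = i. c m * mono_val (r m))" for i
  using M(1) by (simp add: p_def coeff_sum sum.inter_filter)
 have "p \<in> polys (gen_ring K B)"
  by (rule polysI, unfold cp, intro gen_ring_sum[OF K] gen_ring_monom[OF K]) (use M(2) kr in auto)
 moreover have "poly p b = 0"
 proof -
  have "poly p b = (\<Sum>m\<in>M. c m * mono_val m)" unfolding p_def poly_sum poly_monom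
   by (intro sum.cong refl) (subst mono_val_split[of _ b], simp add: e_def r_def mult_ac)
  thus ?thesis using 0 by simp
 qed
 ultimately have "p = 0" using b algebraic_over_adjoin_iff[OF K, of B b] by (auto simp: acl_def)
 hence z: "(\<Sum>m | m \<in> M & e m = e m0. c m * mono_val (r m)) = 0" using cp[of "e m0"] by simp
 let ?M = "{m\<in>M. e m = e m0}"
 have inj: "inj_on r ?M"
 proof (rule inj_onI)
  fix m m' assume "m \<in> ?M" "m' \<in> ?M" "r m = r m'"
  thus "m = m'" using restore[of m] restore[of m'] by simp
 qed
 define c' where "c' = (%m. c (Poly_Mapping.update b (e m0) m))"
 have c': "c' (r m) = c m" if "m \<in> ?M" for m using restore[of m] that by (simp add: c'_def)
 have "(\<Sum>m\<in>r ` ?M. c' m * mono_val m) = (\<Sum>m\<in>?M. c m * mono_val (r m))"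
  by (subst sum.reindex[OF inj]) (auto intro!: sum.cong simp: c')
 hence "(\<Sum>m\<in>r ` ?M. c' m * mono_val m) = 0" using z by simp
 moreover have "finite (r ` ?M)" using M(1) by simp
 moreover have "\<forall>m\<in>r ` ?M. vars m \<subseteq> B & c' m \<in> K" using M(2) kr c' by auto
 ultimately have "\<forall>m\<in>r ` ?M. c' m = 0" using B unfolding alg_independent_iff[OF subfld_0[OF K]] by blast
 thus "c m0 = 0" using m0 c'[of m0] by auto
qed

text \<open>Conversely, an equation for b over \<open>gen_ring K B\<close> is a relation in insert b B.\<close>

lemma alg_independent_not_acl:
 assumes K: "subfld K" and ai: "alg_independent K (insert b B)" and b: "b \<notin> B"
 shows "b \<notin> acl K B"
proof
 assume "b \<in> acl K B"
 then obtain p where p: "p \<in> polys (gen_ring K B)" "p ~= 0" "poly p b = 0"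
  using algebraic_over_adjoin_iff[OF K] by (auto simp: acl_def)
 have "\<exists>M c. finite M & (\<forall>m\<in>M. vars m \<subseteq> B & c m \<in> K) &
   coeff p i = (\<Sum>m\<in>M. c m * mono_val m)" for i using polysD[OF p(1), of i] by (auto simp: gen_ring_def)
 then obtain M c where M: "!!i. finite (M i)" "!!i m. m \<in> M i ==> vars m \<subseteq> B & c i m \<in> K"
  "!!i. coeff p i = (\<Sum>m\<in>M i. c i m * mono_val m)" by metis
 define S where "S = (SIGMA i:{..degree p}. M i)"
 have finS: "finite S" using M(1) by (auto simp: S_def)
 define g where "g = (%(i::nat, m). Poly_Mapping.single b i + m)"
 have lkb: "lkp m b = 0" if "m \<in> M i" for i m using M(2)[OF that] b by (metis in_keys_iff subsetD)
 have g1: "lkp (g (i, m)) b = i" if "m \<in> M i" for i m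
  using lkb[OF that] by (simp add: g_def lookup_add lookup_single)
 have g2: "Poly_Mapping.update b 0 (g (i, m)) = m" if "m \<in> M i" for i m
  using lkb[OF that] by (intro poly_mapping_eqI) (auto simp: g_def lookup_add lookup_single lookup_update when_def)
 have inj: "inj_on g S"
 proof (rule inj_onI)
  fix x y assume "x \<in> S" "y \<in> S" "g x = g y"
  then obtain i m i' m' where xy: "x = (i, m)" "y = (i', m')" "m \<in> M i" "m' \<in> M i'" "g (i, m) = g (i', m')"
   by (auto simp: S_def)
  thus "x = y" using g1[of m i] g1[of m' i'] g2[of m i] g2[of m' i'] by simp
 qed
 define c' where "c' = (%m. c (lkp m b) (Poly_Mapping.update b 0 m))"
 have "(\<Sum>m\<in>g ` S. c' m * mono_val m) = (\<Sum>x\<in>S. c' (g x) * mono_val (g x))"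
  by (subst sum.reindex[OF inj]) simp
 also have "... = (\<Sum>(i, m)\<in>S. b ^ i * (c i m * mono_val m))"
  by (rule sum.cong) (auto simp: S_def c'_def g1 g2, simp add: g_def mono_val_add)
 also have "... = (\<Sum>i\<le>degree p. \<Sum>m\<in>M i. b ^ i * (c i m * mono_val m))"
  unfolding S_def by (rule sum.Sigma[symmetric]) (use M(1) in auto)
 also have "... = poly p b" by (simp add: poly_altdef M(3) sum_distrib_left mult.commute)
 finally have "(\<Sum>m\<in>g ` S. c' m * mono_val m) = 0" using p by simp
 moreover have "finite (g ` S)" using finS by simp
 moreover have "\<forall>m\<in>g ` S. vars m \<subseteq> insert b B & c' m \<in> K"
 proof (intro ballI conjI)
  fix x assume "x \<in> g ` S"
  then obtain i m where x: "x = g (i, m)" "m \<in> M i" by (auto simp: S_def)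
  show "c' x \<in> K" using M(2)[OF x(2)] g1[OF x(2)] g2[OF x(2)] by (simp add: x(1) c'_def)
  show "vars x \<subseteq> insert b B"
   using M(2)[OF x(2)] Poly_Mapping.keys_add[of "Poly_Mapping.single b i" m] by (auto simp: x(1) g_def split: if_splits)
 qed
 ultimately have z: "\<forall>m\<in>g ` S. c' m = 0" using ai unfolding alg_independent_iff[OF subfld_0[OF K]] by blast
 have "coeff p i = 0" if "i <= degree p" for i
 proof -
  have "c i m = 0" if m: "m \<in> M i" for m
  proof -
   have "g (i, m) \<in> g ` S" using m \<open>i <= degree p\<close> by (auto simp: S_def)
   hence "c' (g (i, m)) = 0" using z by blast
   thus ?thesis using g1[OF m] g2[OF m] by (simp add: c'_def)
  qed
  thus ?thesis by (simp add: M(3))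
 qed
 thus False using p(2) by (metis leading_coeff_0_iff order_refl)
qed

lemma alg_independent_empty: "subfld K ==> alg_independent K {}" unfolding alg_independent_iff[OF subfld_0]
proof (intro allI impI ballI)
 fix M c and m :: "'a \<Rightarrow>\<^sub>0 nat" assume *: "\<forall>m\<in>M. vars m \<subseteq> {} & c m \<in> K"
  "(\<Sum>m\<in>M. c m * mono_val m) = 0" "m \<in> M"
 hence z: "m = 0" if "m \<in> M" for m using that by auto
 hence "M = {0}" "m = 0" using *(3) by auto
 thus "c m = 0" using * by (simp add: mono_val_def)
qed

text \<open>Steinitz exchange. Some b \<in> B - S depends on a minimal subset T of S that contains B \<inter>
 S; by independence of B there is an s \<in> T - B, and replacing s by b brings S closer to B.\<close>

lemma alg_independent_card_le:
 assumes K: "subfld K" and "alg_independent K B" "finite B" "finite S" "B \<subseteq> acl K S"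
 shows "card B <= card S" using assms(4,5)
proof (induction "card (B - S)" arbitrary: S rule: less_induct)
 case (less S)
 show ?case
 proof (cases "B \<subseteq> S")
  case True thus ?thesis using less.prems card_mono by blast
 next
  case False
  then obtain b where b: "b \<in> B" "b \<notin> S" by auto
  let ?P = "%T. T \<subseteq> S & B \<inter> S \<subseteq> T & b \<in> acl K T"
  have "?P S" using less.prems b by auto
  then obtain T where T: "?P T" "!!T'. ?P T' ==> card T <= card T'" using ex_has_least_nat[of ?P S card] by auto
  have nb: "b \<notin> acl K (B - {b})"
   using alg_independent_not_acl[OF K, of b "B - {b}"] assms(2) b by (simp add: insert_absorb)
  have "T ~= B \<inter> S" using nb T(1) acl_mono[of "B \<inter> S" "B - {b}" K] b by auto
  then obtain s where s: "s \<in> T" "s \<notin> B" "s \<in> S" using T(1) by auto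
  have finT: "finite T" using T(1) less.prems(1) finite_subset by auto
  have "b \<notin> acl K (T - {s})"
  proof
   assume "b \<in> acl K (T - {s})"
   hence "card T <= card (T - {s})" using T(1) s by (intro T(2)) auto
   thus False using finT s(1) card_Diff1_less by fastforce
  qed
  hence "s \<in> acl K (insert b (T - {s}))"
   using acl_exchange[of b K s "T - {s}"] T(1) s(1) by (simp add: insert_absorb)
  moreover define S' where "S' = insert b (S - {s})"
  ultimately have sS: "s \<in> acl K S'" using acl_mono[of "insert b (T - {s})" S' K] T(1) by auto
  hence "S \<subseteq> acl K S'" using acl_gen[of _ S' K] by (auto simp: S'_def)
  hence "B \<subseteq> acl K S'" using acl_idem less.prems(2) by blast
  moreover have "card (B - S') < card (B - S)" by (rule psubset_card_mono) (use b s assms(3) in "auto simp: S'_def")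
  moreover have "finite S'" using less.prems by (simp add: S'_def)
  ultimately have "card B <= card S'" using less.hyps by blast
  also have "card S' = Suc (card (S - {s}))" using b less.prems(1) by (simp add: S'_def)
  also have "... = card S" using card.remove[OF less.prems(1) s(3)] by simp
  finally show ?thesis .
 qed
qed

lemma exists_alg_basis:
 assumes K: "subfld K" and "finite S"
 shows "\<exists>B\<subseteq>S. alg_independent K B & S \<subseteq> acl K B" using assms(2)
proof induction
 case empty thus ?case using alg_independent_empty[OF K] by auto
next
 case (insert x S)
 then obtain B where B: "B \<subseteq> S" "alg_independent K B" "S \<subseteq> acl K B" by auto
 show ?case
 proof (cases "x \<in> acl K B")
  case True thus ?thesis using B by (intro exI[of _ B]) auto
 next
  case False
  thus ?thesis using B alg_independent_insertI[OF K B(2) False] acl_mono[of B "insert x B" K] acl_gen[of x "insert x B" K]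
   by (intro exI[of _ "insert x B"]) auto
 qed
qed

text \<open>\<open>trdeg\<close> is the size of an arbitrarily chosen transcendence basis; any finite one may
 be used instead.\<close>

lemma trdeg_eq_card:
 assumes K: "subfld K" and B: "alg_independent K B" "finite B" "B \<subseteq> adjoin K S" "S \<subseteq> acl K B"
 shows "trdeg K (adjoin K S) = card B"
proof -
 let ?tb = "transcendence_basis K (adjoin K S)"
 have sub: "adjoin K S \<subseteq> acl K B" by (rule adjoin_least[OF subfld_acl]) (use B acl_base in auto)
 hence tb: "?tb B" using B by (auto simp: transcendence_basis_def acl_def)
 define B' where "B' = (SOME B. ?tb B)"
 have B': "?tb B'" unfolding B'_def using tb by (rule someI)
 have sub': "B' \<subseteq> acl K B" using B' sub by (auto simp: transcendence_basis_def)
 have le: "finite A ==> A \<subseteq> B' ==> card A <= card B" for A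
  using alg_independent_card_le[OF K _ _ B(2), of A] alg_independent_mono[OF K, of B' A] B' sub'
  by (auto simp: transcendence_basis_def)
 have fin: "finite B'"
 proof (rule ccontr)
  assume "infinite B'"
  then obtain A where "A \<subseteq> B'" "finite A" "card A = Suc (card B)" using infinite_arbitrarily_large by metis
  thus False using le[of A] by auto
 qed
 have "B \<subseteq> acl K B'" using B' B(3) by (auto simp: transcendence_basis_def acl_def)
 hence "card B <= card B'" using alg_independent_card_le[OF K B(1,2) fin] by auto
 thus ?thesis using le[OF fin] by (simp add: trdeg_def B'_def)
qed

lemma trdeg_insert:
 assumes K: "subfld K" and S: "finite S"
 shows "trdeg K (adjoin K (insert y S)) = trdeg K (adjoin K S) + (if y \<in> acl K S then 0 else 1)"
proof -
 obtain B where B: "B \<subseteq> S" "alg_independent K B" "S \<subseteq> acl K B" using exists_alg_basis[OF K S] by auto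
 have finB: "finite B" using B(1) S finite_subset by auto
 have eq: "acl K B = acl K S" using acl_mono[OF B(1)] acl_idem[OF B(3)] by auto
 have Bs: "B \<subseteq> adjoin K S" "B \<subseteq> adjoin K (insert y S)" using B(1) by (auto intro: adjoin_gen)
 have 1: "trdeg K (adjoin K S) = card B" by (rule trdeg_eq_card[OF K B(2) finB Bs(1) B(3)])
 show ?thesis
 proof (cases "y \<in> acl K S")
  case True
  have "trdeg K (adjoin K (insert y S)) = card B"
   by (rule trdeg_eq_card[OF K B(2) finB Bs(2)]) (use True B(3) eq in auto)
  thus ?thesis using 1 True by simp
 next
  case False
  hence "y \<notin> acl K B" using eq by simp
  moreover from this have "y \<notin> B" using acl_gen by blast
  moreover have "trdeg K (adjoin K (insert y S)) = card (insert y B)"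
   by (rule trdeg_eq_card[OF K alg_independent_insertI[OF K B(2) \<open>y \<notin> acl K B\<close>]])
    (use finB Bs(2) B(3) acl_mono[of B "insert y B" K] in "auto intro: adjoin_gen acl_gen")
  ultimately show ?thesis using 1 False finB by simp
 qed
qed

lemma trdeg_cong_acl:
 assumes K: "subfld K" and S: "finite S" "finite T" and "S \<subseteq> acl K T" "T \<subseteq> acl K S"
 shows "trdeg K (adjoin K S) = trdeg K (adjoin K T)"
proof -
 have *: "trdeg K (adjoin K (S Un T)) = trdeg K (adjoin K S)" if "finite T" "finite S" "T \<subseteq> acl K S" for S T
  using that(1,3)
 proof induction
  case (insert y T)
  have "y \<in> acl K (S Un T)" using acl_mono[of S "S Un T" K] insert.prems by auto
  thus ?case using insert that(2) trdeg_insert[OF K, of "S Un T" y] by simp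
 qed simp
 show ?thesis using *[OF S(2,1)] *[OF S] assms by (metis sup_commute)
qed

section \<open>Linear systems and finite extensions\<close>

text \<open>Elimination without division: equation e and the unknown v are removed by cross multiplication
 with a e v, so that the solution stays in the ring R.\<close>

lemma underdetermined_system:
 fixes a :: "'e => 'u => 'a::idom"
 assumes R: "0 \<in> R" "1 \<in> R" "!!x y. x \<in> R ==> y \<in> R ==> x + y \<in> R" "!!x y. x \<in> R ==> y \<in> R ==> x * y \<in> R"
   "!!x. x \<in> R ==> - x \<in> R"
  and "finite E" "finite U" "card E < card U" "!!e u. e \<in> E ==> u \<in> U ==> a e u \<in> R"
 shows "\<exists>x. (\<forall>u\<in>U. x u \<in> R) & (\<exists>u\<in>U. x u ~= 0) & (\<forall>e\<in>E. (\<Sum>u\<in>U. a e u * x u) = 0)"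
 using assms(6-9)
proof (induction E arbitrary: a U rule: finite_induct)
 case empty
 hence "U ~= {}" by auto
 thus ?case by (intro exI[of _ "%_. 1"]) (use R in auto)
next
 case (insert e E)
 have sumR: "sum f A \<in> R" if "!!i. i \<in> A ==> f i \<in> R" for f :: "'u => 'a" and A
  using that by (induction A rule: infinite_finite_induct) (auto simp: R)
 show ?case
 proof (cases "\<forall>u\<in>U. a e u = 0")
  case True
  have "\<exists>x. (\<forall>u\<in>U. x u \<in> R) & (\<exists>u\<in>U. x u ~= 0) & (\<forall>e\<in>E. (\<Sum>u\<in>U. a e u * x u) = 0)"
   by (rule insert.IH) (use insert in auto)
  then obtain x where x: "(\<forall>u\<in>U. x u \<in> R) & (\<exists>u\<in>U. x u ~= 0) & (\<forall>e\<in>E. (\<Sum>u\<in>U. a e u * x u) = 0)" by auto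
  moreover have "(\<Sum>u\<in>U. a e u * x u) = 0" by (rule sum.neutral) (use True in auto)
  ultimately show ?thesis by (intro exI[of _ x]) auto
 next
  case False
  then obtain v where v: "v \<in> U" "a e v ~= 0" by auto
  let ?U = "U - {v}"
  define a' where "a' = (%e' u. a e v * a e' u - a e' v * a e u)"
  have a'R: "a' e' u \<in> R" if "e' \<in> E" "u \<in> ?U" for e' u
  proof -
   have "a e v * a e' u \<in> R" "a e' v * a e u \<in> R" using that v insert.prems(3) by (auto intro!: R(4))
   thus ?thesis unfolding a'_def using R(3)[of _ "- (a e' v * a e u)"] R(5) by auto
  qed
  have "card E < card ?U" using insert v by (simp add: card_Diff_singleton)
  then obtain x where x: "\<forall>u\<in>?U. x u \<in> R" "\<exists>u\<in>?U. x u ~= 0" "\<forall>e'\<in>E. (\<Sum>u\<in>?U. a' e' u * x u) = 0"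
   using insert.IH[of ?U a'] a'R insert.prems(1) by auto
  define y where "y = (%u. if u = v then - (\<Sum>u\<in>?U. a e u * x u) else a e v * x u)"
  have yR: "\<forall>u\<in>U. y u \<in> R" using x(1) v insert.prems(3) unfolding y_def by (auto intro!: R(4,5) sumR)
  have yn: "\<exists>u\<in>U. y u ~= 0" using x(2) v by (auto simp: y_def)
  have split: "(\<Sum>u\<in>U. a e' u * y u) = a e' v * y v + (\<Sum>u\<in>?U. a e' u * (a e v * x u))" for e'
   unfolding sum.remove[OF insert.prems(1) v(1)] by (rule arg_cong2[where f = "(+)"]) (auto intro!: sum.cong simp: y_def)
  have "(\<Sum>u\<in>U. a e' u * y u) = 0" if "e' \<in> insert e E" for e'
  proof (cases "e' = e")
   case True
   show ?thesis unfolding split True by (simp add: y_def sum_distrib_left algebra_simps)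
  next
   case False
   hence "e' \<in> E" using that by auto
   have "(\<Sum>u\<in>U. a e' u * y u) = (\<Sum>u\<in>?U. a' e' u * x u)"
    unfolding split by (simp add: y_def a'_def sum_distrib_left sum_subtractf[symmetric] algebra_simps)
   thus ?thesis using x(3) \<open>e' \<in> E\<close> by simp
  qed
  thus ?thesis using yR yn by blast
 qed
qed

text \<open>The field k(Z) has a finite basis over k that contains 1. Coordinates are used since the basis
 will be rescaled to one of an order over \<open>F_q[\<theta>]\<close>.\<close>

lemma finite_algebraic_basis:
 fixes k Z :: "'a::field set"
 assumes k: "subfld k" and Z: "finite Z" "!!z. z \<in> Z ==> algebraic_over k z"
 shows "\<exists>h (w::nat => 'a) j. j < h & w j = 1 & (\<forall>b<h. algebraic_over k (w b)) &
   (\<forall>c. (\<forall>b<h. c b \<in> k) --> (\<Sum>b<h. c b * w b) = 0 --> (\<forall>b<h. c b = 0)) &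
   (\<forall>a<h. \<forall>b<h. \<exists>c. (\<forall>i<h. c i \<in> k) & w a * w b = (\<Sum>i<h. c i * w i)) &
   (\<forall>z\<in>Z. \<exists>c. (\<forall>i<h. c i \<in> k) & z = (\<Sum>i<h. c i * w i))"
proof -
 interpret R: field "rta :: 'a ring" by (rule field_from_type_algebra)
 have K: "subfield k rta" using k by (simp add: subfield_iff_subfld)
 obtain zs where zs: "set zs = Z" using Z(1) finite_list by auto
 define E where "E = R.finite_extension k zs"
 have alg: "(R.algebraic over k) z" if "z \<in> set zs" for z using Z(2)[of z] that zs by (simp add: algebraic_over_def)
 have subr: "subring E rta" unfolding E_def using R.finite_extension_is_subring[OF subfieldE(1)[OF K]] by simp
 obtain n where n: "R.dimension n k E"
  using R.finite_extension_finite_dimension(1)[OF K _ alg] unfolding E_def R.finite_dimension_def by auto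
 have ZE: "Z \<subseteq> E" unfolding E_def using R.finite_extension_mem[OF subfieldE(1)[OF K], of zs] zs by simp
 have ind1: "R.independent k [1]" by (rule R.independent.li_Cons) auto
 have "1 \<in> E" using subringE(3)[OF subr] by simp
 then obtain Vs where Vs: "length (Vs @ [1]) = n" "R.independent k (Vs @ [1])" "R.Span k (Vs @ [1]) = E"
  using R.complete_base[OF K n ind1] by auto
 define U where "U = Vs @ [1]"
 define w where "w = (%i. U ! i)"
 have lU: "length U = n" using Vs by (simp add: U_def)
 have comb: "R.combine Ks Us = (\<Sum>i<length Us. Ks ! i * Us ! i)" if "length Ks = length Us" for Ks Us
  using that by (induction Ks Us rule: list_induct2) (auto simp: sum.lessThan_Suc_shift simp del: sum.lessThan_Suc)
 have inE: "x \<in> E \<longleftrightarrow> (\<exists>c. (\<forall>i<n. c i \<in> k) & x = (\<Sum>i<n. c i * w i))" for x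
 proof -
  have "x \<in> E \<longleftrightarrow> (\<exists>Ks. set Ks \<subseteq> k & length Ks = length U & x = R.combine Ks U)"
   using R.Span_mem_iff_length_version[OF K, of U x] Vs(3) by (simp add: U_def)
  also have "... \<longleftrightarrow> (\<exists>c. (\<forall>i<n. c i \<in> k) & x = (\<Sum>i<n. c i * w i))"
  proof (intro iffI; elim exE conjE)
   fix Ks assume "set Ks \<subseteq> k" "length Ks = length U" "x = R.combine Ks U"
   thus "\<exists>c. (\<forall>i<n. c i \<in> k) & x = (\<Sum>i<n. c i * w i)"
    by (intro exI[of _ "%i. Ks ! i"]) (auto simp: comb lU w_def)
  next
   fix c assume "\<forall>i<n. c i \<in> k" "x = (\<Sum>i<n. c i * w i)"
   thus "\<exists>Ks. set Ks \<subseteq> k & length Ks = length U & x = R.combine Ks U"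
    by (intro exI[of _ "map c [0..<n]"]) (auto simp: comb lU w_def)
  qed
  finally show ?thesis .
 qed
 have wE: "w a \<in> E" if "a < n" for a
 proof -
  have "(\<Sum>i<n. (if i = a then 1 else 0) * w i) = (\<Sum>i<n. if i = a then w i else 0)" by (rule sum.cong) auto
  also have "... = w a" using that by simp
  finally have "(\<Sum>i<n. (if i = a then 1 else 0) * w i) = w a" .
  thus ?thesis unfolding inE
   by (intro exI[of _ "%i. if i = a then 1 else 0"]) (use subfld_0[OF k] subfld_1[OF k] in auto)
 qed
 show ?thesis
 proof (rule exI[of _ n], rule exI[of _ w], rule exI[of _ "n - 1"], intro conjI allI impI ballI)
  show "n - 1 < n" using Vs(1) by auto
  show "w (n - 1) = 1" using Vs(1) by (auto simp: w_def U_def nth_append)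
  show "algebraic_over k (w b)" if "b < n" for b unfolding algebraic_over_def
   using R.finite_extesion_mem_imp_algebraic[OF K _ alg] wE[OF that] by (auto simp: E_def)
 next
  fix c b assume c: "\<forall>b<n. c b \<in> k" "(\<Sum>b<n. c b * w b) = 0" "b < n"
  have "set (take (length U) (map c [0..<n])) \<subseteq> {\<zero>\<^bsub>rta\<^esub>}"
   by (rule R.independent_imp_trivial_combine[OF K])
    (use Vs(2) c in "auto simp: comb lU w_def U_def[symmetric]")
  hence "c ` {..<n} \<subseteq> {0}" by (simp add: lU lessThan_atLeast0)
  thus "c b = 0" using c(3) by blast
 next
  fix a b assume "a < n" "b < n"
  thus "\<exists>c. (\<forall>i<n. c i \<in> k) & w a * w b = (\<Sum>i<n. c i * w i)"
   using subringE(6)[OF subr wE wE] inE by simp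
 next
  fix z assume "z \<in> Z"
  thus "\<exists>c. (\<forall>i<n. c i \<in> k) & z = (\<Sum>i<n. c i * w i)" using ZE inE by blast
 qed
qed

section \<open>The ultrametric field and its Frobenius map\<close>

text \<open>The properties of \<open>C_\<infinity>\<close> on which the proof rests. FF is the field of
 constants \<open>F_q\<close> and th is \<theta>; algebraic closedness enters through q-th roots
 of algebraic elements.\<close>

locale carlitz_field =
 fixes q :: nat and FF :: "'c::{field,metric_space} set" and th :: 'c
 assumes dist_cabs: "dist x y = cabs (x - (y::'c))"
  and cabs_mult: "cabs (x * y) = cabs x * cabs (y::'c)"
  and cabs_ultra: "cabs (x + y) <= max (cabs x) (cabs (y::'c))"
  and complete_C: "complete (UNIV :: 'c set)"
  and q_ge_2: "2 <= q"
  and frob_add: "(x + y) ^ q = x ^ q + (y::'c) ^ q"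
  and FF: "subfld FF" "!!c. c \<in> FF ==> c ^ q = c"
  and cabs_theta: "cabs th = real q"
  and root_ex: "!!a. algebraic_over (adjoin FF {th}) a ==> \<exists>b. b ^ q = a"
begin

definition Kb :: "'c set" where "Kb = {x. algebraic_over (adjoin FF {th}) x}"

lemma subfld_Kb: "subfld Kb" unfolding Kb_def by (rule subfld_algebraics[OF subfld_adjoin])

lemma FF_Kb: "FF \<subseteq> Kb" and theta_Kb: "th \<in> Kb"
 unfolding Kb_def by (auto intro!: algebraic_over_self[OF subfld_adjoin] intro: adjoin_base adjoin_gen)

lemma cabs_nonneg [simp]: "cabs (x::'c) >= 0" by (simp add: cabs_def)
lemma cabs_0 [simp]: "cabs (0::'c) = 0" by (simp add: cabs_def)
lemma cabs_eq_0 [simp]: "cabs (x::'c) = 0 \<longleftrightarrow> x = 0" by (simp add: cabs_def)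
lemma cabs_pos [simp]: "cabs (x::'c) > 0 \<longleftrightarrow> x ~= 0" by (simp add: cabs_def)

lemma cabs_1 [simp]: "cabs (1::'c) = 1"
proof -
 have "cabs (1::'c) * cabs (1::'c) = cabs (1::'c) * 1" using cabs_mult[of 1 1] by simp
 moreover have "cabs (1::'c) ~= 0" by simp
 ultimately show ?thesis using mult_left_cancel by blast
qed

lemma cabs_minus [simp]: "cabs (- x) = cabs (x::'c)"
 using dist_cabs[of 0 x] dist_cabs[of x 0] by (simp add: dist_commute)

lemma cabs_minus_commute: "cabs (x - y) = cabs (y - (x::'c))" using cabs_minus[of "x - y"] by simp

lemma cabs_power: "cabs ((x::'c) ^ n) = cabs x ^ n" by (induction n) (auto simp: cabs_mult)

lemma cabs_inverse: "cabs (inverse (x::'c)) = inverse (cabs x)"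
proof (cases "x = 0")
 case False
 have "cabs x * cabs (inverse x) = 1" using cabs_mult[of x "inverse x"] False by simp
 thus ?thesis using inverse_unique by metis
qed simp

lemma cabs_divide: "cabs (x / (y::'c)) = cabs x / cabs y" by (simp add: divide_inverse cabs_mult cabs_inverse)

lemma cabs_add_le: "cabs x <= B ==> cabs y <= B ==> cabs (x + y :: 'c) <= B" using cabs_ultra[of x y] by linarith

lemma cabs_diff_le: "cabs x <= B ==> cabs y <= B ==> cabs (x - y :: 'c) <= B" using cabs_add_le[of x B "- y"] by simp

lemma cabs_add_less: "cabs x < B ==> cabs y < B ==> cabs (x + y :: 'c) < B" using cabs_ultra[of x y] by linarith

lemma cabs_diff_less: "cabs x < B ==> cabs y < B ==> cabs (x - y :: 'c) < B" using cabs_add_less[of x B "- y"] by simp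

lemma cabs_sum_le: "B >= 0 ==> (!!i. i \<in> A ==> cabs (f i :: 'c) <= B) ==> cabs (sum f A) <= B"
 by (induction A rule: infinite_finite_induct) (auto intro: cabs_add_le)

lemma cabs_sum_less: "B > 0 ==> (!!i. i \<in> A ==> cabs (f i :: 'c) < B) ==> cabs (sum f A) < B"
 by (induction A rule: infinite_finite_induct) (auto intro: cabs_add_less)

lemma cabs_add_eq: "cabs x < cabs y ==> cabs (x + y :: 'c) = cabs y"
proof -
 assume a: "cabs x < cabs y"
 have "cabs (x + y) <= cabs y" using cabs_ultra[of x y] a by simp
 moreover have "cabs y <= max (cabs (x + y)) (cabs x)" using cabs_ultra[of "x + y" "- x"] by simp
 ultimately show ?thesis using a by linarith
qed

lemma q_pos: "q > 0" and q_gt1: "q > 1" using q_ge_2 by auto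

lemma frob_add_pow: "(x + y) ^ q ^ n = x ^ q ^ n + (y::'c) ^ q ^ n"
proof (induction n)
 case (Suc n)
 have "(x + y) ^ q ^ Suc n = ((x + y) ^ q ^ n) ^ q" by (simp add: power_mult[symmetric] mult.commute)
 also have "... = (x ^ q ^ n) ^ q + (y ^ q ^ n) ^ q" by (simp add: Suc frob_add)
 finally show ?case by (simp add: power_mult[symmetric] mult.commute)
qed simp

lemma frob_0 [simp]: "(0::'c) ^ q ^ n = 0" using q_pos by simp

lemma frob_minus: "(- x) ^ q ^ n = - ((x::'c) ^ q ^ n)"
 using frob_add_pow[of x "- x" n] by (simp add: eq_neg_iff_add_eq_0 add.commute)

lemma frob_diff: "(x - y) ^ q ^ n = x ^ q ^ n - (y::'c) ^ q ^ n"
 using frob_add_pow[of x "- y" n] by (simp add: frob_minus)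

lemma frob_sum: "(sum f A) ^ q ^ n = (\<Sum>i\<in>A. (f i :: 'c) ^ q ^ n)"
 by (induction A rule: infinite_finite_induct) (auto simp: frob_add_pow)

lemma frob_inj: "x ^ q ^ n = (y::'c) ^ q ^ n \<longleftrightarrow> x = y"
 using frob_diff[of x y n] q_pos by (metis eq_iff_diff_eq_0 power_eq_0_iff)

lemma cabs_fixed: "c ^ q ^ n = c ==> n > 0 ==> (c::'c) ~= 0 ==> cabs c = 1"
proof -
 assume c: "c ^ q ^ n = c" "n > 0" "c ~= 0"
 have "q ^ n > 1" using one_less_power[OF q_gt1 c(2)] .
 then obtain m where m: "q ^ n = Suc m" "m > 0" by (metis One_nat_def Suc_lessE)
 have "c * c ^ m = c * 1" using c(1) m by simp
 hence "c ^ m = 1" using c(3) by simp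
 hence "cabs c ^ m = 1" by (metis cabs_power cabs_1)
 hence "cabs c ^ m = 1 ^ m" by simp
 thus ?thesis using m(2) by (metis cabs_nonneg power_eq_iff_eq_base zero_le_one)
qed

lemma cabs_FF: "c \<in> FF ==> c ~= 0 ==> cabs c = 1" using cabs_fixed[of c 1] FF(2)[of c] by simp

lemma cabs_FF_le: "c \<in> FF ==> cabs c <= 1" using cabs_FF[of c] by (cases "c = 0") auto

lemma Kb_root:
 assumes "a \<in> Kb" shows "\<exists>b\<in>Kb. b ^ q ^ n = a"
proof (induction n)
 case 0 thus ?case using assms by auto
next
 case (Suc n)
 then obtain b where b: "b \<in> Kb" "b ^ q ^ n = a" by auto
 obtain c where c: "c ^ q = b" using root_ex b(1) by (auto simp: Kb_def)
 have s: "subfld (adjoin FF {th})" by (rule subfld_adjoin)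
 obtain p where p: "p \<in> polys (adjoin FF {th})" "p ~= 0" "poly p b = 0"
  using b(1) algebraic_over_iff[OF s] by (auto simp: Kb_def)
 have "pcompose p (monom 1 q) \<in> polys (adjoin FF {th})" by (intro polys_pcompose s p polys_monom subfld_1)
 moreover have "poly (pcompose p (monom 1 q)) c = 0" using p(3) c by (simp add: poly_pcompose poly_monom)
 moreover have "pcompose p (monom 1 q) ~= 0" using p(2) q_pos by (subst pcompose_eq_0_iff) (auto simp: degree_monom_eq)
 ultimately have "c \<in> Kb" using algebraic_over_iff[OF s] by (auto simp: Kb_def)
 thus ?case using b c by (intro bexI[of _ c]) (simp_all add: power_mult)
qed

lemma cabs_poly_theta:
 assumes "P \<in> polys FF" "P ~= 0"
 shows "cabs (poly P th) = real q ^ degree P"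
proof -
 let ?d = "degree P"
 have "poly P th = (\<Sum>i<?d. coeff P i * th ^ i) + coeff P ?d * th ^ ?d"
  unfolding poly_altdef by (simp add: lessThan_Suc_atMost[symmetric])
 moreover have c: "cabs (coeff P ?d * th ^ ?d) = real q ^ ?d"
  using assms by (simp add: cabs_mult cabs_power cabs_theta cabs_FF polysD)
 moreover have "cabs (\<Sum>i<?d. coeff P i * th ^ i) < real q ^ ?d"
 proof (rule cabs_sum_less)
  fix i assume "i \<in> {..<?d}"
  have "cabs (coeff P i * th ^ i) <= 1 * real q ^ i"
   unfolding cabs_mult cabs_power cabs_theta using cabs_FF_le[OF polysD[OF assms(1)]] q_pos
   by (intro mult_right_mono) auto
  also have "... < real q ^ ?d" using \<open>i \<in> {..<?d}\<close> q_gt1 by simp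
  finally show "cabs (coeff P i * th ^ i) < real q ^ ?d" .
 qed (use q_pos in simp)
 ultimately show ?thesis using cabs_add_eq by simp
qed

lemma poly_theta_eq_0: "P \<in> polys FF ==> poly P th = 0 \<longleftrightarrow> P = 0"
 using cabs_poly_theta[of P] q_pos by (metis cabs_eq_0 of_nat_0_eq_iff poly_0 power_eq_0_iff less_irrefl)

lemma cabs_poly_theta_le: "P \<in> polys FF ==> degree P <= H ==> cabs (poly P th) <= real q ^ H"
 using cabs_poly_theta[of P] q_gt1 by (cases "P = 0") (auto intro: power_increasing)

end

section \<open>Orders, Siegel's lemma and Liouville's inequality\<close>

lemma uniform_bound:
 assumes "finite A" "!!x. x \<in> A ==> \<exists>H::nat. P x H" "!!x H H'. P x H ==> H <= H' ==> P x H'"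
 shows "\<exists>H. \<forall>x\<in>A. P x H" using assms(1,2)
proof induction
 case (insert x A)
 then obtain H where "\<forall>x\<in>A. P x H" by auto
 moreover obtain H' where "P x H'" using insert.prems by blast
 ultimately show ?case using assms(3) by (intro exI[of _ "max H H'"]) auto
qed simp

lemma poly_sum_bound: "degree p <= n ==> poly p x = (\<Sum>i\<le>n. coeff p i * (x::'a::comm_ring_1) ^ i)"
 unfolding poly_altdef by (rule sum.mono_neutral_left) (auto simp: coeff_eq_0)

context carlitz_field begin

text \<open>The degree H of the coordinates serves as a height.\<close>

definition Ord :: "(nat => 'c) => nat => nat => 'c set" where
 "Ord w h H = {z. \<exists>P. (\<forall>b<h. P b \<in> polys FF & degree (P b) <= H) & z = (\<Sum>b<h. poly (P b) th * w b)}"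

lemma OrdI: "(!!b. b < h ==> P b \<in> polys FF) ==> (!!b. b < h ==> degree (P b) <= H) ==>
  z = (\<Sum>b<h. poly (P b) th * w b) ==> z \<in> Ord w h H" unfolding Ord_def by blast

lemma Ord_mono: "H <= H' ==> Ord w h H \<subseteq> Ord w h H'" unfolding Ord_def using le_trans by blast

lemma Ord_mono': "z \<in> Ord w h H ==> H <= H' ==> z \<in> Ord w h H'" using Ord_mono by blast

lemma Ord_0: "0 \<in> Ord w h H" by (rule OrdI[of _ "%_. 0"]) (auto simp: polys_0[OF FF(1)])

lemma Ord_add: "x \<in> Ord w h H ==> y \<in> Ord w h H ==> x + y \<in> Ord w h H"
proof -
 assume "x \<in> Ord w h H" "y \<in> Ord w h H"
 then obtain P Q where *: "\<forall>b<h. P b \<in> polys FF & degree (P b) <= H" "x = (\<Sum>b<h. poly (P b) th * w b)"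
  "\<forall>b<h. Q b \<in> polys FF & degree (Q b) <= H" "y = (\<Sum>b<h. poly (Q b) th * w b)"
  unfolding Ord_def by blast
 show ?thesis by (rule OrdI[of _ "%b. P b + Q b"])
   (use * in "auto simp: polys_add[OF FF(1)] degree_add_le sum.distrib algebra_simps")
qed

lemma Ord_sum: "(!!i. i \<in> A ==> f i \<in> Ord w h H) ==> sum f A \<in> Ord w h H"
 by (induction A rule: infinite_finite_induct) (auto simp: Ord_0 Ord_add)

lemma Ord_poly_mult:
 assumes "x \<in> Ord w h H" "Q \<in> polys FF" "degree Q <= d" shows "poly Q th * x \<in> Ord w h (H + d)"
proof -
 obtain P where *: "\<forall>b<h. P b \<in> polys FF & degree (P b) <= H" "x = (\<Sum>b<h. poly (P b) th * w b)"
  using assms(1) unfolding Ord_def by blast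
 show ?thesis
 proof (rule OrdI[of _ "%b. P b * Q"])
  fix b assume "b < h"
  thus "P b * Q \<in> polys FF" using * assms polys_mult[OF FF(1)] by auto
  have "degree (P b * Q) <= degree (P b) + degree Q" by (rule degree_mult_le)
  also have "... <= H + d" using * assms(3) \<open>b < h\<close> by (intro add_mono) auto
  finally show "degree (P b * Q) <= H + d" .
 qed (simp add: * sum_distrib_left mult_ac)
qed

lemma Ord_theta_mult: "x \<in> Ord w h H ==> th ^ d * x \<in> Ord w h (H + d)"
 using Ord_poly_mult[of x w h H "monom 1 d" d] polys_monom[OF FF(1) subfld_1[OF FF(1)], of d]
 by (simp add: poly_monom degree_monom_eq)

lemma Ord_gen: "b < h ==> w b \<in> Ord w h 0"
proof (rule OrdI[of _ "%i. if i = b then 1 else 0"])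
 assume "b < h"
 have "(\<Sum>i<h. poly (if i = b then 1 else 0) th * w i) = (\<Sum>i<h. if i = b then w i else 0)"
  by (rule sum.cong) auto
 thus "w b = (\<Sum>i<h. poly (if i = b then 1 else 0) th * w i)" using \<open>b < h\<close> by simp
qed (auto simp: polys_0[OF FF(1)] polys_1[OF FF(1)])

lemma Ord_exists_height:
 assumes "!!b. b < h ==> P b \<in> polys FF" shows "\<exists>H. (\<Sum>b<h. poly (P b) th * w b) \<in> Ord w h H"
proof
 show "(\<Sum>b<h. poly (P b) th * w b) \<in> Ord w h (\<Sum>b<h. degree (P b))"
  by (rule OrdI[of _ P]) (auto simp: assms intro: member_le_sum)
qed

text \<open>The \<open>F_q[\<theta>]\<close>-module with basis w is a ring. Its structure constants have
 degree at most c1, so heights are subadditive under multiplication up to the error c1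
 (\<open>Oh_mult\<close>).\<close>

definition good_order :: "nat => (nat => 'c) => nat => bool" where
 "good_order h w c1 \<longleftrightarrow> 0 < h & (\<forall>b<h. w b \<in> Kb) & 1 \<in> Ord w h 0 &
   (\<forall>P. (\<forall>b<h. P b \<in> polys FF) --> (\<Sum>b<h. poly (P b) th * w b) = 0 --> (\<forall>b<h. P b = 0)) &
   (\<forall>a<h. \<forall>b<h. w a * w b \<in> Ord w h c1)"

text \<open>All algebraic numbers that occur in one problem lie, up to a common denominator de in
 \<open>F_q[\<theta>]\<close>, in one such order.\<close>

lemma good_order_exists:
 assumes "finite Z" "Z \<subseteq> Kb"
 shows "\<exists>h w c1 de H. good_order h w c1 & de \<in> polys FF & de ~= 0 & (\<forall>z\<in>Z. poly de th * z \<in> Ord w h H)"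
proof -
 let ?k = "adjoin FF {th}"
 have k: "subfld ?k" by (rule subfld_adjoin)
 have "\<exists>h (w::nat => 'c) j. j < h & w j = 1 & (\<forall>b<h. algebraic_over ?k (w b)) &
   (\<forall>c. (\<forall>b<h. c b \<in> ?k) --> (\<Sum>b<h. c b * w b) = 0 --> (\<forall>b<h. c b = 0)) &
   (\<forall>a<h. \<forall>b<h. \<exists>c. (\<forall>i<h. c i \<in> ?k) & w a * w b = (\<Sum>i<h. c i * w i)) &
   (\<forall>z\<in>Z. \<exists>c. (\<forall>i<h. c i \<in> ?k) & z = (\<Sum>i<h. c i * w i))"
  by (rule finite_algebraic_basis[OF k assms(1)]) (use assms(2) in "auto simp: Kb_def")
 then obtain h j and v :: "nat => 'c" where j: "j < h" "v j = 1" and valg: "\<forall>b<h. algebraic_over ?k (v b)"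
  and ind: "!!c. (\<forall>b<h. c b \<in> ?k) ==> (\<Sum>b<h. c b * v b) = 0 ==> (\<forall>b<h. c b = 0)"
  and prod: "\<forall>a<h. \<forall>b<h. \<exists>c. (\<forall>i<h. c i \<in> ?k) & v a * v b = (\<Sum>i<h. c i * v i)"
  and Zv: "\<forall>z\<in>Z. \<exists>c. (\<forall>i<h. c i \<in> ?k) & z = (\<Sum>i<h. c i * v i)" by auto
 from prod obtain m where m: "!!a b i. a < h ==> b < h ==> i < h ==> m a b i \<in> ?k"
  "!!a b. a < h ==> b < h ==> v a * v b = (\<Sum>i<h. m a b i * v i)" by metis
 from Zv obtain z' where z': "!!z i. z \<in> Z ==> i < h ==> z' z i \<in> ?k" "!!z. z \<in> Z ==> z = (\<Sum>i<h. z' z i * v i)"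
  by metis
 obtain Q where Q: "Q \<in> polys FF" "poly Q th ~= 0"
  "\<forall>x\<in>{..<h}\<times>{..<h}\<times>{..<h}. \<exists>P\<in>polys FF. poly Q th * (case x of (a,b,i) => m a b i) = poly P th"
  using adjoin_single_common_denominator[OF FF(1), of "{..<h}\<times>{..<h}\<times>{..<h}" "%(a,b,i). m a b i" th] m(1) by auto
 then have "\<forall>a b i. \<exists>P. a < h --> b < h --> i < h --> P \<in> polys FF & poly Q th * m a b i = poly P th"
  by fastforce
 then obtain P where P: "!!a b i. a < h ==> b < h ==> i < h ==> P a b i \<in> polys FF & poly Q th * m a b i = poly (P a b i) th"
  by metis
 obtain D where D: "D \<in> polys FF" "poly D th ~= 0"
  "\<forall>x\<in>Z\<times>{..<h}. \<exists>P\<in>polys FF. poly D th * (case x of (z,i) => z' z i) = poly P th"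
  using adjoin_single_common_denominator[OF FF(1), of "Z\<times>{..<h}" "%(z,i). z' z i" th] z'(1) assms(1) by auto
 then have "\<forall>z i. \<exists>P. z \<in> Z --> i < h --> P \<in> polys FF & poly D th * z' z i = poly P th"
  by fastforce
 then obtain R where R: "!!z i. z \<in> Z ==> i < h ==> R z i \<in> polys FF & poly D th * z' z i = poly (R z i) th"
  by metis
 \<comment> \<open>scaling all basis vectors but 1 by \<open>Q\<close> makes the structure constants integral\<close>
 define s where "s = (%b. if b = j then 1 else Q)"
 define w where "w = (%b. poly (s b) th * v b)"
 have sF: "s b \<in> polys FF" for b using Q(1) polys_1[OF FF(1)] by (simp add: s_def)
 have s0: "s b ~= 0" for b using Q(2) by (auto simp: s_def)
 have wj: "w j = 1" using j by (simp add: w_def s_def)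
 have polyk: "poly p th \<in> ?k" if "p \<in> polys FF" for p
  by (rule poly_in_subfld[OF k]) (use that polys_mono[of FF ?k] in "auto intro: adjoin_base adjoin_gen")
 have wK: "w b \<in> Kb" if "b < h" for b using valg that algebraic_over_self[OF k polyk[OF sF]] unfolding w_def Kb_def
  by (intro subfld_mult[OF subfld_algebraics[OF k]]) auto
 have one: "1 \<in> Ord w h 0" using Ord_gen[OF j(1), of w] wj by simp
 have ind': "\<forall>b<h. p b = 0" if p: "\<forall>b<h. p b \<in> polys FF" "(\<Sum>b<h. poly (p b) th * w b) = 0" for p
 proof (intro allI impI)
  fix b assume b: "b < h"
  have "(\<Sum>b<h. poly (p b * s b) th * v b) = 0" using p(2) by (simp add: w_def mult_ac)
  hence "poly (p b * s b) th = 0"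
   using ind[of "%b. poly (p b * s b) th"] b p(1) polyk polys_mult[OF FF(1) _ sF] by blast
  hence "p b * s b = 0" using poly_theta_eq_0 p(1) b polys_mult[OF FF(1) _ sF] by blast
  thus "p b = 0" using s0 by simp
 qed
 have "\<exists>H. w a * w b \<in> Ord w h H" if ab: "a < h" "b < h" for a b
 proof -
  consider "a = j" | "b = j" | "a ~= j" "b ~= j" by auto
  thus ?thesis
  proof cases
   case 1 thus ?thesis using Ord_gen[OF ab(2), of w] wj by auto
  next
   case 2 thus ?thesis using Ord_gen[OF ab(1), of w] wj by auto
  next
   case 3
   define T where "T = (%i. if i = j then Q * P a b i else P a b i)"
   have "w a * w b = (\<Sum>i<h. poly Q th * (poly Q th * m a b i) * v i)"
   proof -
    have "w a * w b = poly Q th * poly Q th * (v a * v b)" using 3 by (simp add: w_def s_def mult_ac)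
    thus ?thesis unfolding m(2)[OF ab] by (simp add: sum_distrib_left mult_ac)
   qed
   also have "... = (\<Sum>i<h. poly (T i) th * w i)" by (rule sum.cong) (use P ab in "auto simp: T_def w_def s_def")
   finally show ?thesis using Ord_exists_height[of h T w] P ab polys_mult[OF FF(1) Q(1)] by (auto simp: T_def)
  qed
 qed
 hence "\<exists>c1. \<forall>x\<in>{..<h}\<times>{..<h}. w (fst x) * w (snd x) \<in> Ord w h c1"
  by (intro uniform_bound) (auto intro: Ord_mono')
 then obtain c1 where c1: "\<forall>a<h. \<forall>b<h. w a * w b \<in> Ord w h c1" by auto
 have "\<exists>H. poly (Q * D) th * z \<in> Ord w h H" if z: "z \<in> Z" for z
 proof -
  define T where "T = (%i. if i = j then Q * R z i else R z i)"
  have "poly (Q * D) th * z = (\<Sum>i<h. poly Q th * (poly D th * z' z i) * v i)"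
   by (subst z'(2)[OF z]) (simp add: sum_distrib_left mult_ac)
  also have "... = (\<Sum>i<h. poly (T i) th * w i)"
   by (rule sum.cong) (use R[OF z] j in "auto simp: T_def w_def s_def")
  finally show ?thesis using Ord_exists_height[of h T w] R z polys_mult[OF FF(1) Q(1)] by (auto simp: T_def)
 qed
 hence "\<exists>H. \<forall>z\<in>Z. poly (Q * D) th * z \<in> Ord w h H"
  by (intro uniform_bound assms) (auto intro: Ord_mono')
 then obtain H where H: "\<forall>z\<in>Z. poly (Q * D) th * z \<in> Ord w h H" by auto
 have "good_order h w c1" unfolding good_order_def using j(1) wK one ind' c1 by auto
 moreover have "Q * D \<in> polys FF" using Q D polys_mult[OF FF(1)] by auto
 moreover have "Q * D ~= 0" using Q D by auto
 ultimately show ?thesis using H by blast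
qed

context fixes h w c1 assumes good: "good_order h w c1" begin

abbreviation Oh where "Oh \<equiv> Ord w h"

lemma Oh_1: "1 \<in> Oh H" using good Ord_mono'[of 1 w h 0] by (auto simp: good_order_def)

lemma Oh_Kb: "x \<in> Oh H ==> x \<in> Kb"
proof -
 assume "x \<in> Oh H"
 then obtain P where *: "\<forall>b<h. P b \<in> polys FF & degree (P b) <= H" "x = (\<Sum>b<h. poly (P b) th * w b)"
  unfolding Ord_def by blast
 show ?thesis unfolding *(2) using * good polys_mono[OF FF_Kb]
  by (intro subfld_sum subfld_mult subfld_Kb poly_in_subfld theta_Kb) (auto simp: good_order_def)
qed

lemma Oh_mult: assumes "x \<in> Oh H" "y \<in> Oh H'" shows "x * y \<in> Oh (H + H' + c1)"
proof -
 obtain P where P: "\<forall>b<h. P b \<in> polys FF & degree (P b) <= H" "x = (\<Sum>b<h. poly (P b) th * w b)"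
  using assms(1) unfolding Ord_def by blast
 obtain Q where Q: "\<forall>b<h. Q b \<in> polys FF & degree (Q b) <= H'" "y = (\<Sum>b<h. poly (Q b) th * w b)"
  using assms(2) unfolding Ord_def by blast
 have "x * y = (\<Sum>a<h. \<Sum>b<h. poly (P a) th * (poly (Q b) th * (w a * w b)))"
  unfolding P(2) Q(2) sum_product by (intro sum.cong refl) (simp add: mult_ac)
 also have "... \<in> Oh (c1 + H' + H)" by (intro Ord_sum Ord_poly_mult) (use P Q good in "auto simp: good_order_def")
 finally show ?thesis by (simp add: add_ac)
qed

lemma Oh_power: assumes "x \<in> Oh H" shows "x ^ n \<in> Oh (n * (H + c1))"
proof (induction n)
 case (Suc n)
 have "x ^ Suc n \<in> Oh (H + n * (H + c1) + c1)" using Oh_mult[OF assms Suc] by simp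
 thus ?case by (simp add: algebra_simps)
qed (simp add: Oh_1)

lemma Oh_bound: "\<exists>C\<ge>1. \<forall>H. \<forall>x\<in>Oh H. cabs x <= C * real q ^ H"
proof -
 define C where "C = 1 + (\<Sum>b<h. cabs (w b))"
 have "cabs x <= C * real q ^ H" if x: "x \<in> Oh H" for x H
 proof -
  obtain P where P: "\<forall>b<h. P b \<in> polys FF & degree (P b) <= H" "x = (\<Sum>b<h. poly (P b) th * w b)"
   using x unfolding Ord_def by blast
  show ?thesis unfolding P(2)
  proof (rule cabs_sum_le)
   show "0 <= C * real q ^ H" unfolding C_def by (intro mult_nonneg_nonneg add_nonneg_nonneg sum_nonneg) auto
   fix b assume b: "b \<in> {..<h}"
   have "cabs (w b) <= (\<Sum>b<h. cabs (w b))" using b by (intro member_le_sum) auto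
   hence "cabs (w b) <= C" unfolding C_def by linarith
   moreover have "cabs (poly (P b) th) <= real q ^ H" using P b by (intro cabs_poly_theta_le) auto
   ultimately have "cabs (poly (P b) th) * cabs (w b) <= real q ^ H * C" by (intro mult_mono) auto
   thus "cabs (poly (P b) th * w b) <= C * real q ^ H" by (simp add: cabs_mult mult.commute)
  qed
 qed
 moreover have "C >= 1" unfolding C_def by (simp add: sum_nonneg)
 ultimately show ?thesis by blast
qed

lemma Oh_coordinates:
 "\<exists>co. \<forall>x\<in>Oh H. (\<forall>b<h. co x b \<in> polys FF & degree (co x b) <= H) &
   x = (\<Sum>b<h. poly (co x b) th * w b)" by (rule bchoice) (unfold Ord_def, blast)

text \<open>Siegel's lemma. Comparing coefficients of powers of \<theta> in all coordinates turns the system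
 into one over the finite field FF, with h * card U * (H + 1) unknowns; the hypothesis on
 cardinalities says that these outnumber the equations.\<close>

lemma siegel:
 fixes a :: "'e => 'u => 'c"
 assumes fin: "finite U" "finite E" and a: "!!e u. e \<in> E ==> u \<in> U ==> a e u \<in> Oh G"
  and card: "card E * (H + G + c1 + 1) < card U * (H + 1)"
 shows "\<exists>x. (\<forall>u\<in>U. x u \<in> Oh H) & (\<exists>u\<in>U. x u ~= 0) & (\<forall>e\<in>E. (\<Sum>u\<in>U. a e u * x u) = 0)"
proof -
 let ?G = "H + G + c1"
 have h0: "h > 0" and wb: "!!b. b < h ==> w b \<in> Oh 0" using good by (auto simp: good_order_def intro: Ord_gen)
 have "th ^ i * (a e u * w b) \<in> Oh ?G" if "e \<in> E" "u \<in> U" "i <= H" "b < h" for e u i b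
  using Ord_theta_mult[OF Oh_mult[OF a[OF that(1,2)] wb[OF that(4)]], of i] that(3) by (auto intro: Ord_mono')
 note in_G = this
 obtain co where co: "!!x. x \<in> Oh ?G ==> (\<forall>b<h. co x b \<in> polys FF & degree (co x b) <= ?G) &
   x = (\<Sum>b<h. poly (co x b) th * w b)" using Oh_coordinates by blast
 define P where "P = (%e u i b. co (th ^ i * (a e u * w b)))"
 have P: "(\<forall>b'<h. P e u i b b' \<in> polys FF & degree (P e u i b b') <= ?G) &
    th ^ i * (a e u * w b) = (\<Sum>b'<h. poly (P e u i b b') th * w b')"
  if "e \<in> E" "u \<in> U" "i <= H" "b < h" for e u i b unfolding P_def by (rule co[OF in_G[OF that]])
 let ?U = "U \<times> {..H} \<times> {..<h}" and ?E = "E \<times> {..?G} \<times> {..<h}"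
 define A where "A = (%(e, i', b') (u, i, b). coeff (P e u i b b') i')"
 have "card ?E < card ?U"
 proof -
  have "card E * (?G + 1) * h < card U * (H + 1) * h" using card h0 by (intro mult_strict_right_mono) auto
  moreover have "card ?E = card E * (?G + 1) * h" "card ?U = card U * (H + 1) * h"
   by (simp_all add: card_cartesian_product algebra_simps)
  ultimately show ?thesis by (simp only:)
 qed
 moreover have "A x y \<in> FF" if "x \<in> ?E" "y \<in> ?U" for x y
  using that P by (auto simp: A_def polys_def split: prod.splits)
 ultimately obtain c where c: "\<forall>y\<in>?U. c y \<in> FF" "\<exists>y\<in>?U. c y ~= 0" "\<forall>x\<in>?E. (\<Sum>y\<in>?U. A x y * c y) = 0"
  using underdetermined_system[of FF ?E ?U A] subfld_intros[OF FF(1)] fin by blast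
 define R where "R = (%u b. \<Sum>i\<le>H. monom (c (u, i, b)) i)"
 have RF: "R u b \<in> polys FF" if "u \<in> U" "b < h" for u b
  unfolding R_def by (intro polys_sum polys_monom FF(1)) (use c that in auto)
 have Rdeg: "degree (R u b) <= H" for u b
  unfolding R_def by (intro degree_sum_le) (auto intro: order_trans[OF degree_monom_le])
 define x where "x = (%u. \<Sum>b<h. poly (R u b) th * w b)"
 have "x u \<in> Oh H" if "u \<in> U" for u unfolding x_def by (rule OrdI[of _ "R u"]) (use RF Rdeg that in auto)
 moreover have "\<exists>u\<in>U. x u ~= 0"
 proof (rule ccontr)
  assume "\<not> (\<exists>u\<in>U. x u ~= 0)"
  hence "R u b = 0" if "u \<in> U" "b < h" for u b using good RF that unfolding good_order_def x_def by blast
  moreover obtain u i b where "u \<in> U" "i <= H" "b < h" "c (u, i, b) ~= 0" using c(2) by auto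
  moreover from this have "coeff (R u b) i = c (u, i, b)" by (simp add: R_def coeff_sum)
  ultimately show False by simp
 qed
 moreover have "(\<Sum>u\<in>U. a e u * x u) = 0" if e: "e \<in> E" for e
 proof -
  have "(\<Sum>u\<in>U. a e u * x u) = (\<Sum>u\<in>U. \<Sum>b<h. \<Sum>i\<le>H. c (u, i, b) * (th ^ i * (a e u * w b)))"
   unfolding x_def R_def poly_sum poly_monom by (simp add: sum_distrib_left sum_distrib_right mult_ac)
  also have "... = (\<Sum>u\<in>U. \<Sum>b<h. \<Sum>i\<le>H. c (u, i, b) * (\<Sum>b'<h. \<Sum>i'\<le>?G. coeff (P e u i b b') i' * th ^ i' * w b'))"
  proof (intro sum.cong refl)
   fix u b i assume *: "u \<in> U" "b \<in> {..<h}" "i \<in> {..H}"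
   have "poly p th = (\<Sum>i'\<le>?G. coeff p i' * th ^ i')" if "degree p <= ?G" for p
    by (rule poly_sum_bound[OF that])
   hence "(\<Sum>b'<h. poly (P e u i b b') th * w b') = (\<Sum>b'<h. \<Sum>i'\<le>?G. coeff (P e u i b b') i' * th ^ i' * w b')"
    using P[OF e *(1), of i b] * by (intro sum.cong refl) (simp add: sum_distrib_right)
   thus "c (u, i, b) * (th ^ i * (a e u * w b)) = c (u, i, b) * (\<Sum>b'<h. \<Sum>i'\<le>?G. coeff (P e u i b b') i' * th ^ i' * w b')"
    using P[OF e *(1), of i b] * by simp
  qed
  also have "... = (\<Sum>u\<in>U. \<Sum>i\<le>H. \<Sum>b<h. \<Sum>i'\<le>?G. \<Sum>b'<h. A (e, i', b') (u, i, b) * c (u, i, b) * (th ^ i' * w b'))"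
  proof (rule sum.cong[OF refl])
   fix u assume "u \<in> U"
   show "(\<Sum>b<h. \<Sum>i\<le>H. c (u, i, b) * (\<Sum>b'<h. \<Sum>i'\<le>?G. coeff (P e u i b b') i' * th ^ i' * w b')) =
    (\<Sum>i\<le>H. \<Sum>b<h. \<Sum>i'\<le>?G. \<Sum>b'<h. A (e, i', b') (u, i, b) * c (u, i, b) * (th ^ i' * w b'))"
    by (subst sum.swap, intro sum.cong refl, simp only: sum_distrib_left, subst sum.swap, intro sum.cong refl)
     (simp add: A_def mult_ac)
  qed
  also have "... = (\<Sum>y\<in>?U. \<Sum>z\<in>{..?G} \<times> {..<h}. A (e, z) y * c y * (th ^ fst z * w (snd z)))"
  proof -
   have "(\<Sum>u\<in>U. \<Sum>i\<le>H. \<Sum>b<h. g (u, i, b)) = (\<Sum>y\<in>?U. g y)" for g :: "'u \<times> nat \<times> nat => 'c"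
    by (simp add: sum.cartesian_product)
   from this[of "%y. \<Sum>i'\<le>?G. \<Sum>b'<h. A (e, i', b') y * c y * (th ^ i' * w b')"]
   have "(\<Sum>u\<in>U. \<Sum>i\<le>H. \<Sum>b<h. \<Sum>i'\<le>?G. \<Sum>b'<h. A (e, i', b') (u, i, b) * c (u, i, b) * (th ^ i' * w b'))
     = (\<Sum>y\<in>?U. \<Sum>i'\<le>?G. \<Sum>b'<h. A (e, i', b') y * c y * (th ^ i' * w b'))" .
   also have "... = (\<Sum>y\<in>?U. \<Sum>z\<in>{..?G} \<times> {..<h}. A (e, z) y * c y * (th ^ fst z * w (snd z)))"
    by (intro sum.cong refl) (simp add: sum.cartesian_product case_prod_beta)
   finally show ?thesis .
  qed
  also have "... = (\<Sum>z\<in>{..?G} \<times> {..<h}. (\<Sum>y\<in>?U. A (e, z) y * c y) * (th ^ fst z * w (snd z)))"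
   by (subst sum.swap) (simp add: sum_distrib_right)
  also have "... = 0" by (rule sum.neutral) (use c(3) e in auto)
  finally show ?thesis .
 qed
 ultimately show ?thesis by blast
qed

text \<open>Liouville's inequality. Counting as in Siegel's lemma, x satisfies a nontrivial equation of
 degree at most h over \<open>F_q[\<theta>]\<close> whose coefficients have degree at most Y. If
 \<bar>x\<bar> < 1, its lowest nonzero coefficient, which has absolute value at least 1, is at
 most \<open>q ^ Y * \<bar>x\<bar>\<close>.\<close>

lemma liouville: "\<exists>C. \<forall>H. \<forall>x\<in>Oh H. x ~= 0 --> cabs x >= 1 / real q ^ (C * (H + 1))"
proof -
 define C where "C = h * h * (c1 + 1)"
 have "cabs x >= 1 / real q ^ (C * (H + 1))" if x: "x \<in> Oh H" "x ~= 0" for x H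
 proof -
  \<comment> \<open>the choice that makes the (h + 1) * (Y + 1) unknown coefficients outnumber the h * (Y + h * (H
   + c1) + 1) conditions on coordinates\<close>
  define Y where "Y = h * h * (H + c1)"
  have YC: "Y <= C * (H + 1)" unfolding Y_def C_def mult.assoc by (intro mult_left_mono) (auto simp: algebra_simps)
  have "x ^ i * th ^ a \<in> Oh (Y + h * (H + c1))" if "i <= h" "a <= Y" for i a
  proof -
   have "th ^ a * x ^ i \<in> Oh (i * (H + c1) + a)" by (rule Ord_theta_mult[OF Oh_power[OF x(1)]])
   hence "x ^ i * th ^ a \<in> Oh (i * (H + c1) + a)" by (simp only: mult.commute)
   moreover have "i * (H + c1) + a <= Y + h * (H + c1)" using that mult_right_mono[of i h "H + c1"] by linarith
   ultimately show ?thesis by (rule Ord_mono')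
  qed
  note in_G = this
  obtain co where co: "!!x. x \<in> Oh (Y + h * (H + c1)) ==>
    (\<forall>b<h. co x b \<in> polys FF & degree (co x b) <= Y + h * (H + c1)) &
    x = (\<Sum>b<h. poly (co x b) th * w b)" using Oh_coordinates by blast
  define P where "P = (%i a. co (x ^ i * th ^ a))"
  have P: "(\<forall>b<h. P i a b \<in> polys FF & degree (P i a b) <= Y + h * (H + c1)) &
    x ^ i * th ^ a = (\<Sum>b<h. poly (P i a b) th * w b)" if "i <= h" "a <= Y" for i a
   unfolding P_def by (rule co[OF in_G[OF that]])
  let ?G = "Y + h * (H + c1)"
  let ?U = "{..h} \<times> {..Y}" and ?E = "{..?G} \<times> {..<h}"
  define A where "A = (%(g, b) (i, a). coeff (P i a b) g)"
  have "card ?E < card ?U" by (simp add: card_cartesian_product Y_def algebra_simps)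
  moreover have "A z y \<in> FF" if "z \<in> ?E" "y \<in> ?U" for z y
   using that P by (auto simp: A_def polys_def split: prod.splits)
  ultimately obtain c where c: "\<forall>y\<in>?U. c y \<in> FF" "\<exists>y\<in>?U. c y ~= 0" "\<forall>z\<in>?E. (\<Sum>y\<in>?U. A z y * c y) = 0"
   using underdetermined_system[of FF ?E ?U A] subfld_intros[OF FF(1)] by blast
  define y where "y = (%i. \<Sum>a\<le>Y. monom (c (i, a)) a)"
  have yF: "y i \<in> polys FF" if "i <= h" for i
   unfolding y_def by (intro polys_sum polys_monom FF(1)) (use c that in auto)
  have ydeg: "degree (y i) <= Y" for i
   unfolding y_def by (intro degree_sum_le) (auto intro: order_trans[OF degree_monom_le])
  have ysum: "(\<Sum>i\<le>h. poly (y i) th * x ^ i) = 0"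
  proof -
   have "(\<Sum>i\<le>h. poly (y i) th * x ^ i) = (\<Sum>i\<le>h. \<Sum>a\<le>Y. c (i, a) * (x ^ i * th ^ a))"
    unfolding y_def poly_sum poly_monom by (simp add: sum_distrib_right sum_distrib_left mult_ac)
   also have "... = (\<Sum>i\<le>h. \<Sum>a\<le>Y. c (i, a) * (\<Sum>g\<le>?G. \<Sum>b<h. coeff (P i a b) g * th ^ g * w b))"
   proof (intro sum.cong refl)
    fix i a assume *: "i \<in> {..h}" "a \<in> {..Y}"
    have "poly p th = (\<Sum>g\<le>?G. coeff p g * th ^ g)" if "degree p <= ?G" for p by (rule poly_sum_bound[OF that])
    hence "(\<Sum>b<h. poly (P i a b) th * w b) = (\<Sum>b<h. \<Sum>g\<le>?G. coeff (P i a b) g * th ^ g * w b)"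
     using P[of i a] * by (intro sum.cong refl) (simp add: sum_distrib_right)
    also have "... = (\<Sum>g\<le>?G. \<Sum>b<h. coeff (P i a b) g * th ^ g * w b)" by (rule sum.swap)
    finally show "c (i, a) * (x ^ i * th ^ a) = c (i, a) * (\<Sum>g\<le>?G. \<Sum>b<h. coeff (P i a b) g * th ^ g * w b)"
     using P[of i a] * by simp
   qed
   also have "... = (\<Sum>u\<in>?U. \<Sum>g\<le>?G. \<Sum>b<h. A (g, b) u * c u * (th ^ g * w b))"
    by (subst sum.cartesian_product, intro sum.cong refl)
     (auto simp: A_def sum_distrib_left mult_ac split: prod.splits)
   also have "... = (\<Sum>u\<in>?U. \<Sum>z\<in>?E. A z u * c u * (th ^ fst z * w (snd z)))"
    by (intro sum.cong refl) (simp add: sum.cartesian_product case_prod_beta)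
   also have "... = (\<Sum>z\<in>?E. (\<Sum>u\<in>?U. A z u * c u) * (th ^ fst z * w (snd z)))"
    by (subst sum.swap) (simp add: sum_distrib_right)
   also have "... = 0" by (rule sum.neutral) (use c(3) in auto)
   finally show ?thesis .
  qed
  have "\<exists>i\<le>h. y i ~= 0"
  proof -
   obtain i a where "i <= h" "a <= Y" "c (i, a) ~= 0" using c(2) by auto
   moreover from this have "coeff (y i) a = c (i, a)" by (simp add: y_def coeff_sum)
   ultimately show ?thesis by (intro exI[of _ i]) auto
  qed
  note ex = this
  define i where "i = (LEAST i. i <= h & y i ~= 0)"
  have i12: "i <= h & y i ~= 0" unfolding i_def by (rule LeastI_ex[OF ex])
  have i: "i <= h" "y i ~= 0" "!!i'. i' < i ==> y i' = 0"
   using i12 not_less_Least[of _ "%i. i <= h & y i ~= 0"] unfolding i_def[symmetric] by auto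
  have yi1: "1 <= cabs (poly (y i) th)" using cabs_poly_theta[OF yF[OF i(1)] i(2)] q_gt1 by simp
  show ?thesis
  proof (cases "cabs x >= 1")
   case True
   have "1 / real q ^ (C * (H + 1)) <= 1" using q_gt1 by simp
   thus ?thesis using True by linarith
  next
   case False
   have "(\<Sum>i'\<le>h. poly (y i') th * x ^ i') = (\<Sum>i'=i..h. poly (y i') th * x ^ i')"
    by (rule sum.mono_neutral_right) (use i in auto)
   also have "... = poly (y i) th * x ^ i + (\<Sum>i'=Suc i..h. poly (y i') th * x ^ i')"
    using i(1) by (rule sum.atLeast_Suc_atMost)
   finally have "poly (y i) th * x ^ i = - (\<Sum>i'=Suc i..h. poly (y i') th * x ^ i')"
    using ysum by (simp add: eq_neg_iff_add_eq_0)
   hence "cabs (poly (y i) th * x ^ i) = cabs (\<Sum>i'=Suc i..h. poly (y i') th * x ^ i')" by simp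
   also have "... <= real q ^ Y * cabs x ^ Suc i"
   proof (rule cabs_sum_le)
    fix i' assume i': "i' \<in> {Suc i..h}"
    have "cabs x ^ i' <= cabs x ^ Suc i" using False i' by (intro power_decreasing) auto
    moreover have "cabs (poly (y i') th) <= real q ^ Y" using i' yF ydeg by (intro cabs_poly_theta_le) auto
    ultimately show "cabs (poly (y i') th * x ^ i') <= real q ^ Y * cabs x ^ Suc i"
     unfolding cabs_mult cabs_power by (intro mult_mono) auto
   qed (simp add: zero_le_mult_iff)
   finally have "cabs (poly (y i) th) * cabs x ^ i <= (real q ^ Y * cabs x) * cabs x ^ i"
    by (simp add: cabs_mult cabs_power mult_ac)
   hence "cabs (poly (y i) th) <= real q ^ Y * cabs x" using x(2) by (simp add: mult_le_cancel_right)
   hence "1 <= real q ^ Y * cabs x" using yi1 by linarith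
   hence "1 / real q ^ Y <= cabs x" using q_pos by (simp add: field_simps)
   moreover have "1 / real q ^ (C * (H + 1)) <= 1 / real q ^ Y"
    using YC q_gt1 by (intro divide_left_mono power_increasing) auto
   ultimately show ?thesis by linarith
  qed
 qed
 thus ?thesis by blast
qed

end

end

section \<open>Entire power series and their twists\<close>

lemma null_seq_le:
 fixes f g :: "nat => real"
 assumes "g ----> 0" "!!n. 0 <= f n" "!!n. f n <= g n" shows "f ----> 0"
 by (rule real_tendsto_sandwich[OF _ _ tendsto_const assms(1)]) (use assms(2,3) in "auto intro: always_eventually")

context carlitz_field begin

text \<open>The type of \<open>C_\<infinity>\<close> is a field and a metric space; continuity of its
 operations is derived from the absolute value.\<close>

lemma C_LIMSEQ_iff: "(a_seq ----> (L::'c)) \<longleftrightarrow> (\<forall>e>0. \<exists>N. \<forall>n\<ge>N. cabs (a_seq n - L) < e)"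
 by (simp add: LIMSEQ_def dist_cabs)

lemma C_LIMSEQ_null_diff: "(a_seq ----> (L::'c)) \<longleftrightarrow> (%n. cabs (a_seq n - L)) ----> 0"
 unfolding C_LIMSEQ_iff by (simp add: LIMSEQ_iff)

lemma C_tendsto_add:
 assumes "a_seq ----> (a::'c)" "b_seq ----> b" shows "(%n. a_seq n + b_seq n) ----> a + b" unfolding C_LIMSEQ_iff
proof (intro allI impI)
 fix e :: real assume "e > 0"
 then obtain N M where N: "!!n. n >= N ==> cabs (a_seq n - a) < e" and M: "!!n. n >= M ==> cabs (b_seq n - b) < e"
  using assms unfolding C_LIMSEQ_iff by meson
 have "cabs (a_seq n + b_seq n - (a + b)) < e" if "n >= max N M" for n
  using cabs_add_less[of "a_seq n - a" e "b_seq n - b"] N[of n] M[of n] that by (simp add: algebra_simps)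
 thus "\<exists>N. \<forall>n\<ge>N. cabs (a_seq n + b_seq n - (a + b)) < e" by blast
qed

lemma C_tendsto_mult:
 assumes "a_seq ----> (a::'c)" "b_seq ----> b" shows "(%n. a_seq n * b_seq n) ----> a * b" unfolding C_LIMSEQ_iff
proof (intro allI impI)
 fix e :: real assume e: "e > 0"
 define A where "A = max 1 (max (cabs a) (cabs b))"
 define d where "d = min 1 (e / A)"
 have A: "A >= 1" "cabs a <= A" "cabs b <= A" by (auto simp: A_def)
 hence d: "d > 0" "d <= 1" "A * d <= e" using e by (auto simp: d_def min_def field_simps)
 then obtain N M where N: "!!n. n >= N ==> cabs (a_seq n - a) < d" and M: "!!n. n >= M ==> cabs (b_seq n - b) < d"
  using assms unfolding C_LIMSEQ_iff by meson
 have "cabs (a_seq n * b_seq n - a * b) < e" if n: "n >= max N M" for n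
 proof -
  have "cabs (a_seq n) <= A" using cabs_add_le[of "a_seq n - a" A a] N[of n] n d A by simp
  hence "cabs (a_seq n) * cabs (b_seq n - b) < A * d \<or> cabs (a_seq n) * cabs (b_seq n - b) = 0" using M[of n] n A d
   by (metis cabs_nonneg le_less max.bounded_iff mult_eq_0_iff mult_le_less_imp_less zero_less_one order.strict_trans2)
  hence 1: "cabs (a_seq n * (b_seq n - b)) < e" using d e A by (auto simp: cabs_mult)
  have "cabs (a_seq n - a) * cabs b <= cabs (a_seq n - a) * A" using A by (intro mult_left_mono) auto
  also have "... < d * A" using N[of n] n A by (intro mult_strict_right_mono) auto
  finally have 2: "cabs ((a_seq n - a) * b) < e" using d by (simp add: cabs_mult mult.commute)
  show ?thesis using cabs_add_less[OF 1 2] by (simp add: algebra_simps)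
 qed
 thus "\<exists>N. \<forall>n\<ge>N. cabs (a_seq n * b_seq n - a * b) < e" by blast
qed

lemma C_tendsto_cmult: "a_seq ----> (a::'c) ==> (%n. c * a_seq n) ----> c * a" by (rule C_tendsto_mult) auto

lemma C_tendsto_power: "a_seq ----> (a::'c) ==> (%n. a_seq n ^ k) ----> a ^ k"
 by (induction k) (auto intro: C_tendsto_mult)

lemma C_tendsto_diff: "a_seq ----> (a::'c) ==> b_seq ----> b ==> (%n. a_seq n - b_seq n) ----> a - b"
 using C_tendsto_add[of a_seq a "%n. -1 * b_seq n" "-1 * b"] C_tendsto_cmult[of b_seq b "-1"] by simp

lemma C_tendsto_sum:
 "finite A ==> (!!i. i \<in> A ==> a_seq i ----> (a i::'c)) ==> (%n. \<Sum>i\<in>A. a_seq i n) ----> (\<Sum>i\<in>A. a i)"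
 by (induction A rule: finite_induct) (auto intro: C_tendsto_add)

lemma C_tendsto_cabs_le:
 assumes "a_seq ----> (a::'c)" "!!n. n >= N ==> cabs (a_seq n) <= B" shows "cabs a <= B"
proof (rule field_le_epsilon)
 fix e :: real assume "e > 0"
 then obtain M where M: "!!n. n >= M ==> cabs (a_seq n - a) < e" using assms(1) unfolding C_LIMSEQ_iff by meson
 let ?n = "max N M"
 have "0 <= B" using assms(2)[of ?n] cabs_nonneg[of "a_seq ?n"] by (meson max.cobounded1 order_trans)
 hence "cabs (a_seq ?n) <= B + e" "cabs (a_seq ?n - a) <= B + e"
  using assms(2)[of ?n] M[of ?n] \<open>e > 0\<close> by auto
 from cabs_diff_le[OF this] show "cabs a <= B + e" by simp
qed

lemma C_convergent_null_diff:
 assumes "(%n. cabs (a_seq (Suc n) - (a_seq n::'c))) ----> 0"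
 shows "\<exists>L. a_seq ----> L"
proof -
 have "Cauchy a_seq" unfolding Cauchy_altdef2
 proof (intro allI impI)
  fix e :: real assume "e > 0"
  then obtain N where N: "!!n. n >= N ==> cabs (a_seq (Suc n) - a_seq n) < e"
   using assms unfolding LIMSEQ_iff by (metis abs_of_nonneg cabs_nonneg diff_zero real_norm_def)
  have "cabs (a_seq (N + k) - a_seq N) < e" for k
  proof (induction k)
   case (Suc k)
   have "cabs ((a_seq (Suc (N + k)) - a_seq (N + k)) + (a_seq (N + k) - a_seq N)) < e"
    by (rule cabs_add_less[OF N Suc]) simp
   thus ?case by simp
  qed (use \<open>e > 0\<close> in simp)
  hence "\<forall>n\<ge>N. dist (a_seq n) (a_seq N) < e" by (metis dist_cabs le_iff_add)
  thus "\<exists>N. \<forall>n\<ge>N. dist (a_seq n) (a_seq N) < e" by blast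
 qed
 thus ?thesis using complete_C unfolding complete_def by blast
qed

text \<open>Bounds for the Gauss norm of radius R. The Gauss norm is submultiplicative and ultrametric, and
 it takes the place of the maximum of \<open>\<bar>f\<bar>\<close> on a disc.\<close>

definition gauss_bd :: "'c fps => real => real => bool" where
 "gauss_bd f R B \<longleftrightarrow> (\<forall>i. cabs (cf f i) * R ^ i <= B)"

lemma gauss_bd_nonneg: "gauss_bd f R B ==> B >= 0"
 unfolding gauss_bd_def using cabs_nonneg[of "cf f 0"] by (metis mult.right_neutral order_trans power_0)

lemma gauss_bd_mono: "gauss_bd f R B ==> B <= B' ==> gauss_bd f R B'" unfolding gauss_bd_def by (meson order_trans)

lemma gauss_bd_radius: assumes "gauss_bd f R B" "0 <= R'" "R' <= R" shows "gauss_bd f R' B" unfolding gauss_bd_def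
proof
 fix i
 have "cabs (cf f i) * R' ^ i <= cabs (cf f i) * R ^ i" using assms by (intro mult_left_mono power_mono) auto
 thus "cabs (cf f i) * R' ^ i <= B" using assms(1) unfolding gauss_bd_def by (meson order_trans)
qed

lemma gauss_bd_add: "R >= 0 ==> gauss_bd f R B ==> gauss_bd g R B ==> gauss_bd (f + g) R B" unfolding gauss_bd_def
proof
 fix i assume *: "R >= 0" "\<forall>i. cabs (cf f i) * R ^ i <= B" "\<forall>i. cabs (cf g i) * R ^ i <= B"
 have "cabs (cf (f + g) i) * R ^ i <= max (cabs (cf f i)) (cabs (cf g i)) * R ^ i"
  using cabs_ultra[of "cf f i" "cf g i"] *(1) by (intro mult_right_mono) auto
 thus "cabs (cf (f + g) i) * R ^ i <= B" using * by (smt (verit) max_def)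
qed

lemma gauss_bd_0: "B >= 0 ==> gauss_bd 0 R B" by (simp add: gauss_bd_def)

lemma gauss_bd_sum: "R >= 0 ==> B >= 0 ==> (!!i. i \<in> A ==> gauss_bd (f i) R B) ==> gauss_bd (sum f A) R B"
 by (induction A rule: infinite_finite_induct) (auto intro: gauss_bd_add gauss_bd_0)

lemma gauss_bd_mult:
 assumes R: "R >= 0" and f: "gauss_bd f R A" and g: "gauss_bd g R B" shows "gauss_bd (f * g) R (A * B)"
 unfolding gauss_bd_def
proof
 fix n
 show "cabs (cf (f * g) n) * R ^ n <= A * B"
 proof (cases "R = 0")
  case True
  have "cabs (cf f 0) <= A" "cabs (cf g 0) <= B" using f g unfolding gauss_bd_def by (metis mult.right_neutral power_0)+
  hence "cabs (cf f 0) * cabs (cf g 0) <= A * B" using gauss_bd_nonneg[OF f] by (intro mult_mono) auto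
  moreover have "0 <= A * B" using gauss_bd_nonneg[OF f] gauss_bd_nonneg[OF g] by simp
  ultimately show ?thesis using True by (cases n) (auto simp: cabs_mult)
 next
  case False
  hence Rn: "R ^ n > 0" using R by simp
  have "cabs (\<Sum>i=0..n. cf f i * cf g (n - i)) <= A * B / R ^ n"
  proof (rule cabs_sum_le)
   show "0 <= A * B / R ^ n" using gauss_bd_nonneg[OF f] gauss_bd_nonneg[OF g] Rn by simp
   fix i assume i: "i \<in> {0..n}"
   have "(cabs (cf f i) * R ^ i) * (cabs (cf g (n - i)) * R ^ (n - i)) <= A * B"
    using f g R gauss_bd_nonneg[OF f] unfolding gauss_bd_def by (intro mult_mono) auto
   moreover have "R ^ i * R ^ (n - i) = R ^ n" using i by (simp add: power_add[symmetric])
   moreover have "(cabs (cf f i) * R ^ i) * (cabs (cf g (n - i)) * R ^ (n - i)) =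
     cabs (cf f i * cf g (n - i)) * (R ^ i * R ^ (n - i))" by (simp add: cabs_mult mult_ac)
   ultimately have "cabs (cf f i * cf g (n - i)) * R ^ n <= A * B" by simp
   thus "cabs (cf f i * cf g (n - i)) <= A * B / R ^ n" using Rn by (simp add: pos_le_divide_eq)
  qed
  thus ?thesis using Rn by (simp add: fps_mult_nth pos_le_divide_eq)
 qed
qed

lemma gauss_bd_const: "gauss_bd (fps_const c) R (cabs c)" by (simp add: gauss_bd_def)

lemma gauss_bd_prod:
 "R >= 0 ==> (!!i. i \<in> A ==> gauss_bd (f i) R (B i)) ==> gauss_bd (prod f A) R (prod B A)"
proof (induction A rule: infinite_finite_induct)
 case (infinite A) thus ?case using gauss_bd_const[of 1 R] by simp
next
 case empty thus ?case using gauss_bd_const[of 1 R] by simp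
qed (auto intro: gauss_bd_mult)

lemma gauss_bd_power: "R >= 0 ==> gauss_bd f R B ==> gauss_bd (f ^ n) R (B ^ n)"
 using gauss_bd_prod[of R "{..<n}" "%_. f" "%_. B"] by simp

lemma gauss_bd_X: "R >= 0 ==> gauss_bd fps_X R R" by (simp add: gauss_bd_def)

definition entire :: "'c fps => bool" where
 "entire f \<longleftrightarrow> (\<forall>R>0. \<exists>B. gauss_bd f R B)"

lemma entire_add: "entire f ==> entire g ==> entire (f + g)" unfolding entire_def
proof (intro allI impI)
 fix R :: real assume *: "\<forall>R>0. \<exists>B. gauss_bd f R B" "\<forall>R>0. \<exists>B. gauss_bd g R B" "R > 0"
 then obtain B B' where "gauss_bd f R B" "gauss_bd g R B'" by blast
 thus "\<exists>B. gauss_bd (f + g) R B" using \<open>R > 0\<close> by (intro exI[of _ "max B B'"] gauss_bd_add) (auto elim: gauss_bd_mono)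
qed

lemma entire_mult: "entire f ==> entire g ==> entire (f * g)" unfolding entire_def by (meson gauss_bd_mult less_imp_le)

lemma entire_0 [simp]: "entire 0" unfolding entire_def using gauss_bd_0[of 0] by auto
lemma entire_const [simp]: "entire (fps_const c)" unfolding entire_def using gauss_bd_const by auto
lemma entire_1 [simp]: "entire 1" using entire_const[of 1] by simp
lemma entire_X [simp]: "entire fps_X" unfolding entire_def using gauss_bd_X by (meson less_imp_le)
lemma entire_uminus: "entire f ==> entire (- f)" using entire_mult[OF entire_const[of "- 1"], of f]
 by (simp flip: fps_const_neg)
lemma entire_diff: "entire f ==> entire g ==> entire (f - g)" using entire_add[of f "- g"] entire_uminus[of g] by simp
lemma entire_sum: "(!!i. i \<in> A ==> entire (f i)) ==> entire (sum f A)"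
 by (induction A rule: infinite_finite_induct) (auto intro: entire_add)
lemma entire_prod: "(!!i. i \<in> A ==> entire (f i)) ==> entire (prod f A)"
 by (induction A rule: infinite_finite_induct) (auto intro: entire_mult)
lemma entire_power: "entire f ==> entire (f ^ n)" by (induction n) (auto intro: entire_mult)

lemma entire_fps_of_poly [simp]: "entire (pser p)"
proof (induction p)
 case (pCons a p)
 show ?case unfolding fps_of_poly_pCons by (intro entire_add entire_mult pCons entire_X entire_const)
qed simp

lemma entire_terms_null:
 assumes "entire f" shows "(%i. cabs (cf f i * x ^ i)) ----> 0"
proof -
 define R where "R = 2 * (cabs x + 1)"
 have R: "R > 0" "cabs x / R < 1" "cabs x / R >= 0" using cabs_nonneg[of x] unfolding R_def by (auto simp: field_simps simp del: cabs_nonneg)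
 obtain B where B: "gauss_bd f R B" using assms R unfolding entire_def by auto
 have "(%i. B * (cabs x / R) ^ i) ----> B * 0" by (intro tendsto_mult tendsto_const LIMSEQ_power_zero) (use R in auto)
 hence lim: "(%i. B * (cabs x / R) ^ i) ----> 0" by simp
 have le: "cabs (cf f i * x ^ i) <= B * (cabs x / R) ^ i" for i
 proof -
  have "cabs (cf f i) <= B / R ^ i" using B R by (simp add: gauss_bd_def pos_le_divide_eq)
  hence "cabs (cf f i) * cabs x ^ i <= B / R ^ i * cabs x ^ i" by (intro mult_right_mono) auto
  thus ?thesis by (simp add: cabs_mult cabs_power power_divide)
 qed
 show ?thesis by (rule null_seq_le[OF lim _ le]) simp
qed

lemma eval_at_sums:
 assumes "entire f" shows "(%n. \<Sum>i<n. cf f i * x ^ i) ----> eval_at x f"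
proof -
 have "\<exists>L. (%n. \<Sum>i<n. cf f i * x ^ i) ----> L"
  by (rule C_convergent_null_diff) (use entire_terms_null[OF assms] in simp)
 then obtain L where "(%i. cf f i * x ^ i) sums L" by (auto simp: sums_def)
 thus ?thesis unfolding eval_at_def using sums_unique[of _ L] by (auto simp: sums_def)
qed

lemma eval_at_unique:
 assumes "(%n. \<Sum>i<n. cf f i * x ^ i) ----> L" shows "eval_at x f = (L::'c)"
 unfolding eval_at_def using assms by (auto simp: sums_def intro: sums_unique[symmetric])

lemma eval_at_add: "entire f ==> entire g ==> eval_at x (f + g) = eval_at x f + eval_at x g"
 by (rule eval_at_unique) (use C_tendsto_add[OF eval_at_sums eval_at_sums, of f g x x] in "simp add: sum.distrib algebra_simps")

lemma eval_at_const [simp]: "eval_at x (fps_const c) = (c::'c)"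
proof (rule eval_at_unique)
 have "(\<Sum>i<n. cf (fps_const c) i * x ^ i) = c" if "n >= 1" for n
 proof -
  have "(\<Sum>i<n. cf (fps_const c) i * x ^ i) = (\<Sum>i\<in>{0::nat}. cf (fps_const c) i * x ^ i)"
   by (rule sum.mono_neutral_right) (use that in auto)
  thus ?thesis by simp
 qed
 thus "(%n. \<Sum>i<n. cf (fps_const c) i * x ^ i) ----> c"
  by (intro tendsto_eventually eventually_sequentiallyI[of 1]) auto
qed

lemma eval_at_0 [simp]: "eval_at x 0 = (0::'c)" using eval_at_const[of x 0] by simp
lemma eval_at_1 [simp]: "eval_at x 1 = (1::'c)" using eval_at_const[of x 1] by simp

text \<open>The product of partial sums minus the partial sum of the product consists of terms \<open>f_i g_j
 x^(i + j)\<close> with i + j >= n, which are uniformly small.\<close>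

lemma eval_at_mult:
 assumes f: "entire f" and g: "entire g" shows "eval_at x (f * g) = eval_at x f * eval_at x g"
proof (rule eval_at_unique)
 define S where "S = (%f n. \<Sum>i<n. cf f i * (x::'c) ^ i)"
 have prod: "(%n. S f n * S g n) ----> eval_at x f * eval_at x g"
  unfolding S_def by (intro C_tendsto_mult eval_at_sums f g)
 have diff: "(%n. S (f * g) n - S f n * S g n) ----> 0"
 proof -
  define R where "R = 2 * (cabs x + 1)"
  have R: "R > 0" "cabs x / R < 1" "cabs x / R >= 0" using cabs_nonneg[of x] unfolding R_def by (auto simp: field_simps simp del: cabs_nonneg)
  obtain A where A: "gauss_bd f R A" using f R unfolding entire_def by auto
  obtain B where B: "gauss_bd g R B" using g R unfolding entire_def by auto
  let ?r = "cabs x / R"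
  have fb: "cabs (cf f i * x ^ i) <= A * ?r ^ i" for i
  proof -
   have "cabs (cf f i) <= A / R ^ i" using A R by (simp add: gauss_bd_def pos_le_divide_eq)
   hence "cabs (cf f i) * cabs x ^ i <= A / R ^ i * cabs x ^ i" by (intro mult_right_mono) auto
   thus ?thesis by (simp add: cabs_mult cabs_power power_divide)
  qed
  have gb: "cabs (cf g i * x ^ i) <= B * ?r ^ i" for i
  proof -
   have "cabs (cf g i) <= B / R ^ i" using B R by (simp add: gauss_bd_def pos_le_divide_eq)
   hence "cabs (cf g i) * cabs x ^ i <= B / R ^ i * cabs x ^ i" by (intro mult_right_mono) auto
   thus ?thesis by (simp add: cabs_mult cabs_power power_divide)
  qed
  have AB: "A >= 0" "B >= 0" using gauss_bd_nonneg A B by auto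
  have le: "cabs (S (f * g) n - S f n * S g n) <= A * B * ?r ^ n" for n
  proof -
   let ?t = "%(i, j). (cf f i * x ^ i) * (cf g j * x ^ j)"
   have 1: "S f n * S g n = sum ?t ({..<n} \<times> {..<n})" by (simp add: S_def sum_product sum.cartesian_product)
   have "S (f * g) n = (\<Sum>k<n. \<Sum>i\<le>k. ?t (i, k - i))" unfolding S_def
   proof (intro sum.cong refl)
    fix k
    show "cf (f * g) k * x ^ k = (\<Sum>i\<le>k. ?t (i, k - i))" unfolding fps_mult_nth atLeast0AtMost sum_distrib_right
     by (intro sum.cong refl) (auto simp: power_add[symmetric] mult_ac le_add_diff_inverse)
   qed
   also have "... = sum ?t (\<Union>k\<in>{..<n}. (%i. (i, k - i)) ` {..k})"
    by (subst sum.UNION_disjoint) (auto simp: sum.reindex inj_on_def)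
   also have "(\<Union>k\<in>{..<n}. (%i. (i, k - i)) ` {..k}) = {p\<in>{..<n} \<times> {..<n}. fst p + snd p < n}"
   proof (intro equalityI subsetI)
    fix p assume "p \<in> {p\<in>{..<n} \<times> {..<n}. fst p + snd p < n}"
    thus "p \<in> (\<Union>k\<in>{..<n}. (%i. (i, k - i)) ` {..k})"
     by (intro UN_I[of "fst p + snd p"] image_eqI[of _ _ "fst p"]) (auto simp: prod_eq_iff)
   next
    fix p assume "p \<in> (\<Union>k\<in>{..<n}. (%i. (i, k - i)) ` {..k})"
    thus "p \<in> {p\<in>{..<n} \<times> {..<n}. fst p + snd p < n}" by auto
   qed
   finally have 2: "S (f * g) n = sum ?t {p\<in>{..<n} \<times> {..<n}. fst p + snd p < n}" .
   have "cabs (S (f * g) n - S f n * S g n) = cabs (S f n * S g n - S (f * g) n)" by (rule cabs_minus_commute)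
   also have "S f n * S g n - S (f * g) n = sum ?t (({..<n} \<times> {..<n}) - {p\<in>{..<n} \<times> {..<n}. fst p + snd p < n})"
    unfolding 1 2 by (rule sum_diff[symmetric]) auto
   also have "cabs ... <= A * B * ?r ^ n"
   proof (rule cabs_sum_le)
    show "0 <= A * B * ?r ^ n" using AB R by (intro mult_nonneg_nonneg zero_le_power) auto
    fix p assume p: "p \<in> ({..<n} \<times> {..<n}) - {p\<in>{..<n} \<times> {..<n}. fst p + snd p < n}"
    obtain i j where ij: "p = (i, j)" by (cases p)
    have "cabs (?t p) <= (A * ?r ^ i) * (B * ?r ^ j)" unfolding ij case_prod_conv cabs_mult[of "cf f i * x ^ i"]
     using AB R by (intro mult_mono fb gb) auto
    also have "... = A * B * ?r ^ (i + j)" by (simp add: power_add mult_ac)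
    also have "... <= A * B * ?r ^ n" using AB R p ij by (intro mult_left_mono power_decreasing) auto
    finally show "cabs (?t p) <= A * B * ?r ^ n" .
   qed
   finally show ?thesis .
  qed
  have "(%n. A * B * ?r ^ n) ----> A * B * 0" by (intro tendsto_mult tendsto_const LIMSEQ_power_zero) (use R in auto)
  hence lim: "(%n. A * B * ?r ^ n) ----> 0" by simp
  show ?thesis unfolding C_LIMSEQ_null_diff by (rule null_seq_le[OF lim]) (use le in simp_all)
 qed
 show "(%n. \<Sum>i<n. cf (f * g) i * x ^ i) ----> eval_at x f * eval_at x g"
  using C_tendsto_add[OF diff prod] by (simp add: S_def)
qed

lemma eval_at_X [simp]: "eval_at x fps_X = (x::'c)"
proof (rule eval_at_unique)
 have "(\<Sum>i<n. cf fps_X i * x ^ i) = x" if "n >= 2" for n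
 proof -
  have "(\<Sum>i<n. cf fps_X i * x ^ i) = (\<Sum>i\<in>{1::nat}. cf fps_X i * x ^ i)"
   by (rule sum.mono_neutral_right) (use that in auto)
  thus ?thesis by simp
 qed
 thus "(%n. \<Sum>i<n. cf fps_X i * x ^ i) ----> x" by (intro tendsto_eventually eventually_sequentiallyI[of 2]) auto
qed

lemma eval_at_sum: "(!!i. i \<in> A ==> entire (f i)) ==> eval_at x (sum f A) = (\<Sum>i\<in>A. eval_at x (f i))"
 by (induction A rule: infinite_finite_induct) (auto simp: eval_at_add entire_sum)

lemma eval_at_prod: "(!!i. i \<in> A ==> entire (f i)) ==> eval_at x (prod f A) = (\<Prod>i\<in>A. eval_at x (f i))"
 by (induction A rule: infinite_finite_induct) (auto simp: eval_at_mult entire_prod)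

lemma eval_at_power: "entire f ==> eval_at x (f ^ n) = eval_at x f ^ n"
 by (induction n) (auto simp: eval_at_mult entire_power)

lemma eval_at_fps_of_poly [simp]: "eval_at x (pser p) = poly p (x::'c)"
proof (induction p)
 case (pCons a p)
 show ?case unfolding fps_of_poly_pCons using pCons by (subst eval_at_add) (auto simp: entire_mult eval_at_mult)
qed simp

lemma eval_at_uminus: "entire f ==> eval_at x (- f) = - eval_at x (f::'c fps)"
 using eval_at_add[of f "- f" x] entire_uminus[of f] by (simp add: eq_neg_iff_add_eq_0 add.commute)

lemma eval_at_diff: "entire f ==> entire g ==> eval_at x (f - g) = eval_at x f - eval_at x (g::'c fps)"
 using eval_at_add[of f "- g" x] entire_uminus[of g] eval_at_uminus[of g x] by simp

text \<open>Division by t - x. The coefficients of the quotient are \<open>- 1 / x^(i + 1)\<close> times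
 partial sums of f(x); since f(x) = 0, they are also given by the remaining tails, and this yields
 the bound.\<close>

lemma remove_zero:
 assumes f: "entire f" and x: "x ~= 0" "eval_at x f = 0"
 shows "\<exists>g. entire g & f = (fps_X - fps_const x) * g &
  (\<forall>R B. R > 0 --> cabs x <= R --> gauss_bd f R B --> gauss_bd g R (B / R))"
proof -
 define S where "S = (%n. \<Sum>i<n. cf f i * x ^ i)"
 define g where "g = Abs_fps (%i. - S (Suc i) / x ^ Suc i)"
 have S0: "S ----> 0" using eval_at_sums[OF f, of x] x(2) by (simp add: S_def)
 have eq: "f = (fps_X - fps_const x) * g"
 proof (rule fps_ext)
  fix n show "cf f n = cf ((fps_X - fps_const x) * g) n"
   using x(1) by (cases n) (simp_all add: algebra_simps g_def S_def fps_mult_fps_X_commute[symmetric] divide_simps)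
 qed
 have bd: "gauss_bd g R (B / R)" if R: "R > 0" "cabs x <= R" "gauss_bd f R B" for R B unfolding gauss_bd_def
 proof
  fix i
  let ?r = "cabs x / R"
  have r: "?r >= 0" "?r <= 1" using R by auto
  have B0: "B >= 0" using gauss_bd_nonneg[OF R(3)] .
  have trm: "cabs (cf f j * x ^ j) <= B * ?r ^ j" for j
  proof -
   have "cabs (cf f j) <= B / R ^ j" using R by (simp add: gauss_bd_def pos_le_divide_eq)
   hence "cabs (cf f j) * cabs x ^ j <= B / R ^ j * cabs x ^ j" by (intro mult_right_mono) auto
   thus ?thesis by (simp add: cabs_mult cabs_power power_divide)
  qed
  have "cabs (0 - S (Suc i)) <= B * ?r ^ Suc i"
  proof (rule C_tendsto_cabs_le[OF C_tendsto_diff[OF S0 tendsto_const]])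
   fix n assume n: "n >= Suc i"
   have "S n - S (Suc i) = (\<Sum>j\<in>{..<n} - {..<Suc i}. cf f j * x ^ j)"
    unfolding S_def by (rule sum_diff[symmetric]) (use n in auto)
   also have "cabs ... <= B * ?r ^ Suc i"
   proof (rule cabs_sum_le)
    show "0 <= B * ?r ^ Suc i" using B0 r by (intro mult_nonneg_nonneg zero_le_power)
    fix j assume "j \<in> {..<n} - {..<Suc i}"
    hence "B * ?r ^ j <= B * ?r ^ Suc i" using B0 r by (intro mult_left_mono power_decreasing) auto
    thus "cabs (cf f j * x ^ j) <= B * ?r ^ Suc i" using trm[of j] by linarith
   qed
   finally show "cabs (S n - S (Suc i)) <= B * ?r ^ Suc i" .
  qed
  hence "cabs (S (Suc i)) / cabs x ^ Suc i * R ^ i <= B * ?r ^ Suc i / cabs x ^ Suc i * R ^ i"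
   using R by (intro mult_right_mono divide_right_mono) auto
  also have "... = B / R" using x(1) R by (simp add: power_divide field_simps)
  finally show "cabs (cf g i) * R ^ i <= B / R" by (simp add: g_def cabs_divide cabs_power[symmetric] cabs_mult)
 qed
 have "entire g" unfolding entire_def
 proof (intro allI impI)
  fix R :: real assume R: "R > 0"
  let ?R = "max R (cabs x)"
  obtain B where "gauss_bd f ?R B" using f R unfolding entire_def by (metis less_max_iff_disj)
  hence "gauss_bd g ?R (B / ?R)" using R by (intro bd) auto
  thus "\<exists>B. gauss_bd g R B" using R by (intro exI gauss_bd_radius[of g ?R _ R]) auto
 qed
 thus ?thesis using eq bd by blast
qed

lemma remove_zeros:
 assumes "finite Z" "!!x. x \<in> Z ==> x ~= 0" "entire f" "!!x. x \<in> Z ==> eval_at x f = 0"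
 shows "\<exists>g. entire g & f = (\<Prod>x\<in>Z. fps_X - fps_const x) * g &
  (\<forall>R B. R > 0 --> (\<forall>x\<in>Z. cabs x <= R) --> gauss_bd f R B --> gauss_bd g R (B / R ^ card Z))"
 using assms
proof (induction Z arbitrary: f rule: finite_induct)
 case empty thus ?case by (intro exI[of _ f]) auto
next
 case (insert z Z)
 obtain g where g: "entire g" "f = (\<Prod>x\<in>Z. fps_X - fps_const x) * g"
  "!!R B. R > 0 ==> (\<forall>x\<in>Z. cabs x <= R) ==> gauss_bd f R B ==> gauss_bd g R (B / R ^ card Z)"
  using insert.IH[of f] insert.prems by auto
 have "eval_at z f = (\<Prod>x\<in>Z. z - x) * eval_at z g"
  unfolding g(2) by (simp add: eval_at_mult entire_prod entire_diff g(1) eval_at_prod eval_at_diff)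
 hence "eval_at z g = 0" using insert by auto
 from remove_zero[OF g(1) _ this] insert.prems obtain k where k: "entire k" "g = (fps_X - fps_const z) * k"
  "!!R B. R > 0 ==> cabs z <= R ==> gauss_bd g R B ==> gauss_bd k R (B / R)" by auto
 have "f = (\<Prod>x\<in>insert z Z. fps_X - fps_const x) * k" using g(2) k(2) insert.hyps by (simp add: mult_ac)
 moreover have "gauss_bd k R (B / R ^ card (insert z Z))"
  if "R > 0" "\<forall>x\<in>insert z Z. cabs x <= R" "gauss_bd f R B" for R B
  using k(3)[OF that(1) _ g(3)[OF that(1) _ that(3)]] that insert.hyps by (simp add: mult.commute)
 ultimately show ?case using k(1) by blast
qed

text \<open>A Schwarz lemma: dividing f by the product of the t - x gains a factor R for each zero on the
 disc of radius R and loses at most a factor r on the unit disc.\<close>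

lemma many_zeros_bound:
 assumes Z: "finite Z" "!!x. x \<in> Z ==> x ~= 0" "!!x. x \<in> Z ==> cabs x <= r" and r: "1 <= r" "r <= R"
  and f: "entire f" "!!x. x \<in> Z ==> eval_at x f = 0" "gauss_bd f R B"
 shows "cabs (cf f m) <= r ^ card Z * B / R ^ card Z"
proof -
 obtain g where g: "f = (\<Prod>x\<in>Z. fps_X - fps_const x) * g"
  "!!R B. R > 0 ==> (\<forall>x\<in>Z. cabs x <= R) ==> gauss_bd f R B ==> gauss_bd g R (B / R ^ card Z)"
  using remove_zeros[OF Z(1,2) f(1,2)] by blast
 have "gauss_bd g R (B / R ^ card Z)" by (rule g(2)) (use r Z(3) f(3) in "auto intro: order_trans")
 hence 1: "gauss_bd g 1 (B / R ^ card Z)" by (rule gauss_bd_radius) (use r in auto)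
 have "gauss_bd (\<Prod>x\<in>Z. fps_X - fps_const x) 1 (\<Prod>x\<in>Z. r)"
 proof (rule gauss_bd_prod)
  fix x assume "x \<in> Z"
  hence "gauss_bd (fps_X + fps_const (- x)) 1 r"
   by (intro gauss_bd_add) (use gauss_bd_mono[OF gauss_bd_X[of 1] r(1)] gauss_bd_mono[OF gauss_bd_const[of "- x" 1], of r] Z(3)[of x] in auto)
  thus "gauss_bd (fps_X - fps_const x) 1 r" by (metis diff_conv_add_uminus fps_const_neg)
 qed simp
 from gauss_bd_mult[OF _ this 1] have "gauss_bd f 1 (r ^ card Z * (B / R ^ card Z))" unfolding g(1)[symmetric] by simp
 thus ?thesis unfolding gauss_bd_def by (metis mult.right_neutral power_one times_divide_eq_right)
qed

definition tw :: "nat => 'c fps => 'c fps" where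
 "tw n f = Abs_fps (%i. cf f i ^ q ^ n)"

lemma tw_nth [simp]: "cf (tw n f) i = cf f i ^ q ^ n" by (simp add: tw_def)

lemma twist_eq_tw: "twist q (int n) f = tw n f" by (simp add: twist_def tw_def frob_power_def)

lemma tw_0 [simp]: "tw 0 f = f" by (rule fps_ext) simp
lemma tw_zero [simp]: "tw n 0 = 0" by (rule fps_ext) simp
lemma tw_one [simp]: "tw n 1 = 1" by (rule fps_ext) simp
lemma tw_const [simp]: "tw n (fps_const c) = fps_const (c ^ q ^ n)" by (rule fps_ext) simp
lemma tw_X [simp]: "tw n fps_X = fps_X" by (rule fps_ext) simp
lemma tw_add: "tw n (f + g) = tw n f + tw n g" by (rule fps_ext) (simp add: frob_add_pow)
lemma tw_diff: "tw n (f - g) = tw n f - tw n g" by (rule fps_ext) (simp add: frob_diff)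
lemma tw_mult: "tw n (f * g) = tw n f * tw n g" by (rule fps_ext) (simp add: fps_mult_nth frob_sum power_mult_distrib)
lemma tw_sum: "tw n (sum f A) = (\<Sum>i\<in>A. tw n (f i))"
 by (induction A rule: infinite_finite_induct) (auto simp: tw_add)
lemma tw_prod: "tw n (prod f A) = (\<Prod>i\<in>A. tw n (f i))"
 by (induction A rule: infinite_finite_induct) (auto simp: tw_mult)
lemma tw_tw: "tw m (tw n f) = tw (m + n) f" by (rule fps_ext) (simp add: power_mult[symmetric] power_add mult.commute)
lemma tw_eq_0_iff [simp]: "tw n f = 0 \<longleftrightarrow> f = 0" using q_pos by (simp add: fps_eq_iff)
lemma gauss_bd_tw: assumes "gauss_bd f R B" "R >= 0" shows "gauss_bd (tw n f) (R ^ q ^ n) (B ^ q ^ n)"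
 unfolding gauss_bd_def
proof
 fix i
 have "(cabs (cf f i) * R ^ i) ^ q ^ n <= B ^ q ^ n" using assms unfolding gauss_bd_def by (intro power_mono) auto
 thus "cabs (cf (tw n f) i) * (R ^ q ^ n) ^ i <= B ^ q ^ n"
  by (simp add: cabs_power power_mult_distrib power_mult[symmetric] mult.commute)
qed

lemma entire_tw: assumes "entire f" shows "entire (tw n f)" unfolding entire_def
proof (intro allI impI)
 fix R :: real assume "R > 0"
 define R' where "R' = max 1 R"
 obtain B where "gauss_bd f R' B" using assms unfolding entire_def R'_def by (metis less_max_iff_disj zero_less_one)
 hence "gauss_bd (tw n f) (R' ^ q ^ n) (B ^ q ^ n)" by (rule gauss_bd_tw) (simp add: R'_def)
 moreover have "R <= R' ^ q ^ n"
 proof -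
  have "R <= R'" "1 <= R'" by (auto simp: R'_def)
  moreover have "R' ^ 1 <= R' ^ q ^ n" using q_pos \<open>1 <= R'\<close> by (intro power_increasing) auto
  ultimately show ?thesis by simp
 qed
 ultimately show "\<exists>B. gauss_bd (tw n f) R B" using \<open>R > 0\<close> gauss_bd_radius by (meson less_imp_le)
qed

lemma eval_at_tw: assumes "entire f" shows "eval_at (x ^ q ^ n) (tw n f) = eval_at x f ^ q ^ n"
proof (rule eval_at_unique)
 have "(%k. (\<Sum>i<k. cf f i * x ^ i) ^ q ^ n) ----> eval_at x f ^ q ^ n"
  by (intro C_tendsto_power eval_at_sums assms)
 thus "(%k. \<Sum>i<k. cf (tw n f) i * (x ^ q ^ n) ^ i) ----> eval_at x f ^ q ^ n"
  by (simp add: frob_sum power_mult_distrib power_mult[symmetric] mult.commute)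
qed

definition twp :: "nat => 'c poly => 'c poly" where "twp n p = map_poly (%c. c ^ q ^ n) p"

lemma coeff_twp [simp]: "coeff (twp n p) i = coeff p i ^ q ^ n" by (simp add: twp_def coeff_map_poly)

lemma fps_of_poly_twp: "pser (twp n p) = tw n (pser p)" by (rule fps_ext) simp

lemma degree_twp [simp]: "degree (twp n p) = degree p" unfolding twp_def by (rule degree_map_poly) (use q_pos in auto)

lemma twp_eq_0_iff [simp]: "twp n p = 0 \<longleftrightarrow> p = 0" using q_pos by (simp add: poly_eq_iff)

lemma twp_mult: "twp n (p * r) = twp n p * twp n r"
 by (rule poly_eqI) (simp add: coeff_mult frob_sum power_mult_distrib)

lemma twp_0 [simp]: "twp 0 p = p" by (rule poly_eqI) simp

lemma twp_Kb: "p \<in> polys Kb ==> twp n p \<in> polys Kb" by (auto simp: polys_def intro: subfld_power[OF subfld_Kb])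

lemma poly_twp: "poly (twp n p) (x ^ q ^ n) = poly p x ^ q ^ n"
 using eval_at_tw[of "pser p" x n] by (simp add: fps_of_poly_twp[symmetric])

end

section \<open>Relations between values and between functions\<close>

text \<open>All heights below are bounded by constant multiples of \<open>S = q ^ N * N\<close>; these rules
 compute the constants.\<close>

lemma scaled_bounds:
 fixes S :: nat assumes "S >= 1"
 shows "x <= S * A ==> y <= S * B ==> x + y <= S * (A + B)" "x <= S * A ==> c * x <= S * (c * A)" "c <= S * c"
 using assms by (auto simp: algebra_simps intro: add_mono)

context carlitz_field begin

context fixes h w c1 assumes good: "good_order h w c1" begin

definition PH :: "'c poly => nat => nat => bool" where
 "PH p H e \<longleftrightarrow> (\<forall>i. coeff p i \<in> Ord w h H) & degree p <= e"

lemma PH_mono: "PH p H e ==> H <= H' ==> e <= e' ==> PH p H' e'" unfolding PH_def using Ord_mono' by (meson le_trans)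

lemma PH_0: "PH 0 H e" by (simp add: PH_def Ord_0)
lemma PH_1: "PH 1 H e" using Oh_1[OF good] by (auto simp: PH_def Ord_0 coeff_1)

lemma PH_add: "PH p H e ==> PH r H e ==> PH (p + r) H e" unfolding PH_def by (auto intro: Ord_add degree_add_le)

lemma PH_sum: "(!!i. i \<in> A ==> PH (p i) H e) ==> PH (sum p A) H e"
 by (induction A rule: infinite_finite_induct) (auto intro: PH_0 PH_add)

lemma PH_mult: assumes "PH p H e" "PH r H' e'" shows "PH (p * r) (H + H' + c1) (e + e')" unfolding PH_def
proof (intro conjI allI)
 fix i show "coeff (p * r) i \<in> Ord w h (H + H' + c1)"
  unfolding coeff_mult by (intro Ord_sum Oh_mult[OF good]) (use assms in "auto simp: PH_def")
 have "degree (p * r) <= degree p + degree r" by (rule degree_mult_le)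
 also have "... <= e + e'" using assms by (auto simp: PH_def intro: add_mono)
 finally show "degree (p * r) <= e + e'" .
qed

lemma PH_twp: "PH p H e ==> PH (twp i p) (q ^ i * (H + c1)) e" unfolding PH_def by (auto intro: Oh_power[OF good])

lemma PH_poly_theta: assumes "PH p H e" shows "poly p (th ^ m) \<in> Ord w h (H + e * m)"
proof -
 have "poly p (th ^ m) = (\<Sum>i\<le>e. th ^ (i * m) * coeff p i)"
  using assms by (subst poly_sum_bound[of p e]) (auto simp: PH_def power_mult[symmetric] mult.commute)
 also have "... \<in> Ord w h (H + e * m)"
 proof (rule Ord_sum)
  fix i assume "i \<in> {..e}"
  have "th ^ (i * m) * coeff p i \<in> Ord w h (H + i * m)" using assms by (intro Ord_theta_mult) (auto simp: PH_def)
  thus "th ^ (i * m) * coeff p i \<in> Ord w h (H + e * m)"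
   by (rule Ord_mono') (use \<open>i \<in> {..e}\<close> in auto)
 qed
 finally show ?thesis .
qed

lemma PH_monom_sum: "(!!a. a <= D ==> x a \<in> Ord w h H) ==> PH (\<Sum>a\<le>D. monom (x a) a) H D"
 unfolding PH_def by (auto simp: coeff_sum intro!: degree_sum_le Ord_0 intro: order_trans[OF degree_monom_le])

lemma PH_Kb: "PH p H e ==> p \<in> polys Kb" unfolding PH_def polys_def using Oh_Kb[OF good] by blast

text \<open>At the sum of the lowest exponents only products of lowest coefficients occur, so the lowest
 coefficient of a solution of a linear twisted equation is a zero of a nonzero additive
 polynomial.\<close>

lemma twisted_equation_lowest:
 assumes F: "F ~= 0" and b: "\<exists>j\<le>l. b j ~= 0" and eq: "(\<Sum>j\<le>l. pser (b j) * tw j F) = 0"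
 defines "m \<equiv> subdegree F"
 shows "\<exists>k. (\<exists>j\<le>l. coeff (b j) k ~= 0) & (\<Sum>j\<le>l. coeff (b j) k * cf F m ^ q ^ j) = 0"
proof -
 define k where "k = (LEAST k. \<exists>j\<le>l. coeff (b j) k ~= 0)"
 have ex: "\<exists>k. \<exists>j\<le>l. coeff (b j) k ~= 0" using b by (metis leading_coeff_0_iff)
 have k: "\<exists>j\<le>l. coeff (b j) k ~= 0" unfolding k_def by (rule LeastI_ex[OF ex])
 have kmin: "coeff (b j) i = 0" if "i < k" "j <= l" for i j
  using not_less_Least[of i "%k. \<exists>j\<le>l. coeff (b j) k ~= 0"] that unfolding k_def by auto
 have "cf (pser (b j) * tw j F) (k + m) = coeff (b j) k * cf F m ^ q ^ j" if j: "j <= l" for j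
 proof -
  have "cf (pser (b j) * tw j F) (k + m) = (\<Sum>i=0..k+m. coeff (b j) i * cf F (k + m - i) ^ q ^ j)"
   by (simp add: fps_mult_nth)
  also have "... = (\<Sum>i\<in>{k}. coeff (b j) i * cf F (k + m - i) ^ q ^ j)"
  proof (rule sum.mono_neutral_right)
   show "\<forall>i\<in>{0..k + m} - {k}. coeff (b j) i * cf F (k + m - i) ^ q ^ j = 0"
   proof
    fix i assume i: "i \<in> {0..k + m} - {k}"
    show "coeff (b j) i * cf F (k + m - i) ^ q ^ j = 0"
    proof (cases "i < k")
     case False
     hence "k + m - i < subdegree F" using i by (auto simp: m_def)
     hence "cf F (k + m - i) = 0" by (rule nth_less_subdegree_zero)
     thus ?thesis by simp
    qed (use kmin j in simp)
   qed
  qed auto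
  finally show ?thesis by simp
 qed
 hence "(\<Sum>j\<le>l. coeff (b j) k * cf F m ^ q ^ j) = cf (\<Sum>j\<le>l. pser (b j) * tw j F) (k + m)"
  by (simp add: fps_sum_nth)
 thus ?thesis using k eq by auto
qed

text \<open>For small z the term with the smallest exponent would dominate all others.\<close>

lemma additive_root_lower_bound:
 fixes z :: 'c
 assumes c: "\<exists>j\<le>l. c j ~= 0" "!!j. j <= l ==> cabs (c j) <= A" "!!j. j <= l ==> c j ~= 0 ==> a <= cabs (c j)"
  and z: "z ~= 0" "(\<Sum>j\<le>l. c j * z ^ q ^ j) = 0" and aA: "0 < a" "a <= A"
 shows "a <= A * cabs z"
proof (cases "cabs z >= 1")
 case True
 have "a <= A * 1" using aA by simp
 also have "... <= A * cabs z" using True aA by (intro mult_left_mono) auto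
 finally show ?thesis .
next
 case False
 define j0 where "j0 = (LEAST j. j <= l & c j ~= 0)"
 have j0': "j0 <= l & c j0 ~= 0" unfolding j0_def by (rule LeastI_ex) (use c(1) in auto)
 hence j0: "j0 <= l" "c j0 ~= 0" by auto
 have jmin: "c j = 0" if "j < j0" for j
  using not_less_Least[of j "%j. j <= l & c j ~= 0"] that j0 unfolding j0_def[symmetric] by auto
 have "(\<Sum>j\<le>l. c j * z ^ q ^ j) = (\<Sum>j=j0..l. c j * z ^ q ^ j)"
  by (rule sum.mono_neutral_right) (use jmin in auto)
 also have "... = c j0 * z ^ q ^ j0 + (\<Sum>j=Suc j0..l. c j * z ^ q ^ j)" using j0(1) by (rule sum.atLeast_Suc_atMost)
 finally have "c j0 * z ^ q ^ j0 = - (\<Sum>j=Suc j0..l. c j * z ^ q ^ j)" using z(2) by (simp add: eq_neg_iff_add_eq_0)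
 hence "cabs (c j0 * z ^ q ^ j0) = cabs (\<Sum>j=Suc j0..l. c j * z ^ q ^ j)" by simp
 also have "... <= A * cabs z ^ Suc (q ^ j0)"
 proof (rule cabs_sum_le)
  fix j assume j: "j \<in> {Suc j0..l}"
  have "q ^ j0 < q ^ j" using j q_gt1 by (intro power_strict_increasing) auto
  hence "cabs z ^ q ^ j <= cabs z ^ Suc (q ^ j0)" using False by (intro power_decreasing) auto
  thus "cabs (c j * z ^ q ^ j) <= A * cabs z ^ Suc (q ^ j0)"
   unfolding cabs_mult cabs_power using c(2)[of j] j aA by (intro mult_mono) auto
 qed (use aA in "auto intro!: mult_nonneg_nonneg")
 finally have "cabs (c j0) * cabs z ^ q ^ j0 <= (A * cabs z) * cabs z ^ q ^ j0"
  by (simp add: cabs_mult cabs_power mult_ac)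
 hence "cabs (c j0) <= A * cabs z" using z(1) by (simp add: mult_le_cancel_right)
 thus ?thesis using c(3)[OF j0] by linarith
qed

text \<open>A system \<open>d \<psi>^(1) = B \<psi>\<close> of twisted equations, where ps is \<psi> and De
 its index set, with coefficients in the order of height at most h0 and of degree at most d0 in t.
 Condition dnz says that d has no zero at the \<open>q^i\<close>-th roots of \<theta>, so the
 values of all twists of \<psi> at \<theta> are determined by those of \<psi>.\<close>

context
 fixes De :: "'i set" and ps :: "'i => 'c fps" and B :: "'i => 'i => 'c poly" and d :: "'c poly"
  and h0 d0 :: nat
 assumes finD: "finite De" and ent: "!!al. al \<in> De ==> entire (ps al)"
  and B: "!!al be. al \<in> De ==> be \<in> De ==> PH (B al be) h0 d0" and d: "PH d h0 d0"
  and sys: "!!al. al \<in> De ==> pser d * tw 1 (ps al) = (\<Sum>be\<in>De. pser (B al be) * ps be)"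
  and dnz: "!!i. poly (twp i d) th ~= 0"
begin

abbreviation comb :: "'i set => ('i => 'c poly) => nat => 'c fps" where
 "comb T \<pi> N == (\<Sum>al\<in>T. pser (\<pi> al) * tw N (ps al))"

text \<open>The iterated system is \<open>dn i * \<psi>^(i) = Bn i * \<psi>\<close>
 (\<open>iterate_sys\<close>).\<close>

fun Bn :: "nat => 'i => 'i => 'c poly" where
 "Bn 0 al be = (if al = be then 1 else 0)"
| "Bn (Suc i) al be = (\<Sum>ga\<in>De. twp i (B al ga) * Bn i ga be)"

definition dn :: "nat => 'c poly" where "dn i = (\<Prod>j<i. twp j d)"

lemma iterate_sys: "al \<in> De ==> pser (dn i) * tw i (ps al) = (\<Sum>be\<in>De. pser (Bn i al be) * ps be)"
proof (induction i arbitrary: al)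
 case 0
 have "(\<Sum>be\<in>De. pser (Bn 0 al be) * ps be) = (\<Sum>be\<in>De. if be = al then ps be else 0)"
  by (rule sum.cong) auto
 thus ?case using 0 finD by (simp add: dn_def)
next
 case (Suc i)
 have "tw i (pser d * tw 1 (ps al)) = tw i (\<Sum>ga\<in>De. pser (B al ga) * ps ga)" using sys[OF Suc.prems] by simp
 hence step: "pser (twp i d) * tw (Suc i) (ps al) = (\<Sum>ga\<in>De. pser (twp i (B al ga)) * tw i (ps ga))"
  by (simp add: tw_mult tw_tw tw_sum fps_of_poly_twp)
 have "pser (dn (Suc i)) * tw (Suc i) (ps al) = pser (dn i) * (pser (twp i d) * tw (Suc i) (ps al))"
  by (simp add: dn_def fps_of_poly_mult mult_ac)
 also have "... = (\<Sum>ga\<in>De. pser (twp i (B al ga)) * (pser (dn i) * tw i (ps ga)))"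
  unfolding step by (simp add: sum_distrib_left mult_ac)
 also have "... = (\<Sum>ga\<in>De. \<Sum>be\<in>De. pser (twp i (B al ga)) * (pser (Bn i ga be) * ps be))"
  by (intro sum.cong refl) (simp add: Suc.IH sum_distrib_left)
 also have "... = (\<Sum>be\<in>De. pser (Bn (Suc i) al be) * ps be)"
  by (subst sum.swap) (simp add: fps_of_poly_sum fps_of_poly_mult sum_distrib_right sum_distrib_left mult_ac)
 finally show ?case .
qed

definition c3 :: nat where "c3 = h0 + 2 * c1"

lemma height_step: "q ^ i * (h0 + c1) + q ^ i * c3 + c1 <= q ^ Suc i * c3"
proof -
 have "1 <= q ^ i" using q_pos by simp
 hence "c1 <= q ^ i * c1" by simp
 hence "q ^ i * (h0 + c1) + q ^ i * c3 + c1 <= 2 * (q ^ i * c3)" by (simp add: c3_def algebra_simps)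
 also have "... <= q * (q ^ i * c3)" using q_ge_2 by (intro mult_right_mono) auto
 finally show ?thesis by simp
qed

lemma Bn_height: "al \<in> De ==> be \<in> De ==> PH (Bn i al be) (q ^ i * c3) (i * d0)"
proof (induction i arbitrary: al)
 case 0 thus ?case using PH_0 PH_1 by auto
next
 case (Suc i)
 have "PH (Bn (Suc i) al be) (q ^ i * (h0 + c1) + q ^ i * c3 + c1) (d0 + i * d0)"
  unfolding Bn.simps by (intro PH_sum PH_mult PH_twp B Suc)
 thus ?case by (rule PH_mono) (use height_step in auto)
qed

lemma dn_height: "PH (dn i) (q ^ i * c3) (i * d0)"
proof (induction i)
 case 0 thus ?case using PH_1 by (simp add: dn_def)
next
 case (Suc i)
 have "PH (twp i d * dn i) (q ^ i * (h0 + c1) + q ^ i * c3 + c1) (d0 + i * d0)" by (intro PH_mult PH_twp d Suc)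
 moreover have "dn (Suc i) = twp i d * dn i" by (simp add: dn_def mult.commute)
 ultimately show ?case using PH_mono height_step by simp
qed

lemma dn_theta: "poly (dn i) th ~= 0" and dn_nz: "dn i ~= 0"
proof -
 show "poly (dn i) th ~= 0" using dnz by (simp add: dn_def poly_prod)
 thus "dn i ~= 0" by auto
qed

text \<open>The bound on H has the shape of the heights that Siegel's lemma will produce.\<close>

definition low_bound :: "'i set => nat => nat => bool" where
 "low_bound T C5 C8 \<longleftrightarrow> (\<forall>N D H \<pi>. N >= 1 --> D <= N --> H <= q ^ N * N * C5 --> (\<forall>al\<in>T. PH (\<pi> al) H D) -->
  comb T \<pi> N ~= 0 --> (\<exists>m. 1 / real q ^ (q ^ N * N * C8) <= cabs (cf (comb T \<pi> N) m)))"

text \<open>With l = card De, the l + 1 twists of F = comb T \<pi> N by 0, ..., l are combinations of the l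
 functions \<open>\<psi>^(N)\<close>. So they satisfy a linear relation, and Siegel's lemma bounds
 the heights of its coefficients. The lowest coefficient of F is then a zero of an additive
 polynomial whose coefficients are bounded above by their height and below by Liouville's
 inequality.\<close>

lemma combination_lower_bound:
 assumes T: "T \<subseteq> De" "T ~= {}" and C: "!!H x. x \<in> Ord w h H ==> x ~= 0 ==> cabs x >= 1 / real q ^ (C * (H + 1))"
  and c0: "!!H x. x \<in> Ord w h H ==> cabs x <= real q ^ (c0 + H)"
 shows "\<exists>C8. low_bound T C5 C8"
proof -
 define l where "l = card De"
 have l1: "l >= 1" using T finD by (metis One_nat_def Suc_leI card_gt_0_iff l_def subset_empty)
 \<comment> \<open>C6, C7 and C8 bound G2, H3 and the final exponent, as multiples of \<open>q ^ N * N\<close>\<close>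
 define C6 where "C6 = q ^ l * (C5 + c1) + (q ^ l * c3 + c1) + c1"
 define C7 where "C7 = 3 * l * (C6 + c1 + 1) + (q ^ l * c3 + c1) + c1"
 define C8 where "C8 = C * (C7 + 1) + (c0 + C7)"
 show ?thesis unfolding low_bound_def
 proof (rule exI[of _ C8], intro allI impI)
  fix N D H \<pi>
  assume N: "N >= 1" and D: "D <= N" and H: "H <= q ^ N * N * C5" and \<pi>: "\<forall>al\<in>T. PH (\<pi> al) H D"
  define F where "F = comb T \<pi> N"
  assume "comb T \<pi> N ~= 0"
  hence F: "F ~= 0" by (simp add: F_def)
  let ?S = "q ^ N * N"
  have S1: "?S >= 1" using N q_pos by simp
  note sb = scaled_bounds[OF S1]
  have QS: "q ^ N * x <= ?S * x" for x using N by simp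
  \<comment> \<open>the twists of \<open>F\<close> in terms of those of \<open>\<psi>\<close>\<close>
  define row where "row = (%j be. \<Sum>al\<in>T. twp j (\<pi> al) * twp N (Bn j al be))"
  have rowF: "pser (twp N (dn j)) * tw j F = (\<Sum>be\<in>De. pser (row j be) * tw N (ps be))" for j
  proof -
   have it: "pser (twp N (dn j)) * tw (N + j) (ps al) = (\<Sum>be\<in>De. pser (twp N (Bn j al be)) * tw N (ps be))"
    if "al \<in> T" for al using arg_cong[OF iterate_sys[of al j], of "tw N"] that T
    by (auto simp: tw_mult tw_sum tw_tw fps_of_poly_twp)
   have "pser (twp N (dn j)) * tw j F =
     (\<Sum>al\<in>T. pser (twp j (\<pi> al)) * (pser (twp N (dn j)) * tw (N + j) (ps al)))"
    by (simp add: F_def tw_sum tw_mult tw_tw fps_of_poly_twp sum_distrib_left mult_ac add.commute)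
   also have "... = (\<Sum>al\<in>T. \<Sum>be\<in>De. pser (twp j (\<pi> al)) * (pser (twp N (Bn j al be)) * tw N (ps be)))"
    by (intro sum.cong refl) (simp add: it sum_distrib_left)
   also have "... = (\<Sum>be\<in>De. pser (row j be) * tw N (ps be))"
    by (subst sum.swap) (simp add: row_def fps_of_poly_sum fps_of_poly_mult sum_distrib_right sum_distrib_left mult_ac)
   finally show ?thesis .
  qed
  define G2 where "G2 = q ^ l * (H + c1) + q ^ N * (q ^ l * c3 + c1) + c1"
  define E2 where "E2 = D + l * d0"
  have qjl: "j <= l ==> q ^ j * x <= q ^ l * x" for j x using q_pos by (intro mult_right_mono power_increasing) auto
  have row_height: "PH (row j be) G2 E2" if "j <= l" "be \<in> De" for j be
  proof -
   have "PH (row j be) (q ^ j * (H + c1) + q ^ N * (q ^ j * c3 + c1) + c1) (D + j * d0)"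
    unfolding row_def by (intro PH_sum PH_mult PH_twp Bn_height) (use T \<pi> that in auto)
   thus ?thesis
   proof (rule PH_mono)
    show "q ^ j * (H + c1) + q ^ N * (q ^ j * c3 + c1) + c1 <= G2"
     unfolding G2_def using qjl[OF that(1)] by (intro add_mono mult_left_mono) auto
    show "D + j * d0 <= E2" unfolding E2_def using that by simp
   qed
  qed
  have dn_height': "PH (twp N (dn j)) (q ^ N * (q ^ l * c3 + c1)) (j * d0)" if "j <= l" for j
   by (rule PH_mono[OF PH_twp[OF dn_height]]) (use qjl[OF that] in auto)
  \<comment> \<open>a linear dependency between the \<open>l + 1\<close> rows, from Siegel's lemma\<close>
  define D2 where "D2 = 3 * l * (E2 + 1) - 1"
  define H2 where "H2 = 3 * l * (G2 + c1 + 1) - 1"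
  have D2: "D2 + 1 = 3 * l * (E2 + 1)" and H2: "H2 + 1 = 3 * l * (G2 + c1 + 1)"
   using l1 by (simp_all add: D2_def H2_def)
  let ?U = "{..l} \<times> {..D2}" and ?E = "De \<times> {..D2 + E2}"
  define A where "A = (%(be, k) (j, a). if a <= k then coeff (row j be) (k - a) else 0)"
  have "card ?E * (H2 + G2 + c1 + 1) < card ?U * (H2 + 1)"
  proof -
   define e g where "e = E2 + 1" and "g = G2 + c1 + 1"
   have pos: "e >= 1" "g >= 1" by (auto simp: e_def g_def)
   have "card ?E * (H2 + G2 + c1 + 1) = l * ((D2 + 1) + E2) * ((H2 + 1) + (G2 + c1))"
    using finD by (simp add: card_cartesian_product l_def algebra_simps)
   also have "... = l * (3 * l * e + E2) * (3 * l * g + (G2 + c1))" unfolding D2 H2 e_def g_def by (rule refl)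
   also have "... <= l * (3 * l * e + e) * (3 * l * g + g)" by (intro mult_mono add_mono) (auto simp: e_def g_def)
   also have "... = (e * g) * (l * (3 * l + 1) * (3 * l + 1))" by (simp add: algebra_simps)
   also have "... < (e * g) * ((l + 1) * (3 * l) * (3 * l))"
   proof (rule mult_strict_left_mono)
    have "l <= l * l" using l1 by simp
    moreover have "0 < l * l" using l1 by simp
    ultimately have "l < 3 * (l * l)" by linarith
    thus "l * (3 * l + 1) * (3 * l + 1) < (l + 1) * (3 * l) * (3 * l)" by (simp add: algebra_simps)
   qed (use pos in simp)
   also have "... = (l + 1) * (3 * l * e) * (3 * l * g)" by (simp add: algebra_simps)
   also have "... = (l + 1) * (D2 + 1) * (H2 + 1)" unfolding D2 H2 e_def g_def by (rule refl)
   also have "... = card ?U * (H2 + 1)" by (simp add: card_cartesian_product)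
   finally show ?thesis .
  qed
  moreover have "A x y \<in> Ord w h G2" if "x \<in> ?E" "y \<in> ?U" for x y
   using that row_height by (auto simp: A_def PH_def Ord_0 split: prod.splits)
  ultimately obtain y where y: "\<forall>u\<in>?U. y u \<in> Ord w h H2" "\<exists>u\<in>?U. y u ~= 0" "\<forall>x\<in>?E. (\<Sum>u\<in>?U. A x u * y u) = 0"
   using siegel[OF good, of ?U ?E A G2 H2] finD by blast
  define b where "b = (%j. \<Sum>a\<le>D2. monom (y (j, a)) a)"
  have coeff_b: "coeff (b j) a = (if a <= D2 then y (j, a) else 0)" for j a by (simp add: b_def coeff_sum)
  have b_height: "PH (b j) H2 D2" if "j <= l" for j unfolding b_def by (rule PH_monom_sum) (use y that in auto)
  have "(\<Sum>j\<le>l. b j * row j be) = 0" if be: "be \<in> De" for be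
  proof (rule poly_eqI)
   fix k
   have deg: "degree (b j * row j be) <= D2 + E2" if "j <= l" for j
    using PH_mult[OF b_height[OF that] row_height[OF that be]] by (simp add: PH_def)
   show "coeff (\<Sum>j\<le>l. b j * row j be) k = coeff 0 k"
   proof (cases "k <= D2 + E2")
    case True
    have "coeff (\<Sum>j\<le>l. b j * row j be) k = (\<Sum>j\<le>l. \<Sum>a\<le>k. coeff (b j) a * coeff (row j be) (k - a))"
     by (simp add: coeff_sum coeff_mult)
    also have "... = (\<Sum>j\<le>l. \<Sum>a\<le>D2. A (be, k) (j, a) * y (j, a))"
    proof (rule sum.cong[OF refl])
     fix j
     have "(\<Sum>a\<le>k. coeff (b j) a * coeff (row j be) (k - a)) = (\<Sum>a\<in>{..k} \<inter> {..D2}. coeff (b j) a * coeff (row j be) (k - a))"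
      by (rule sum.mono_neutral_right) (auto simp: coeff_b)
     also have "... = (\<Sum>a\<in>{..k} \<inter> {..D2}. A (be, k) (j, a) * y (j, a))"
      by (rule sum.cong) (auto simp: A_def coeff_b)
     also have "... = (\<Sum>a\<le>D2. A (be, k) (j, a) * y (j, a))" by (rule sum.mono_neutral_left) (auto simp: A_def)
     finally show "(\<Sum>a\<le>k. coeff (b j) a * coeff (row j be) (k - a)) = (\<Sum>a\<le>D2. A (be, k) (j, a) * y (j, a))" .
    qed
    also have "... = (\<Sum>u\<in>?U. A (be, k) u * y u)" by (simp add: sum.cartesian_product case_prod_beta)
    also have "... = 0" using y(3) be True by auto
    finally show ?thesis by simp
   next
    case False
    thus ?thesis unfolding coeff_sum using deg
     by (intro trans[OF sum.neutral coeff_0[symmetric]] ballI coeff_eq_0) fastforce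
   qed
  qed
  note dep = this
  define b' where "b' = (%j. b j * twp N (dn j))"
  have "(\<Sum>j\<le>l. pser (b' j) * tw j F) = (\<Sum>j\<le>l. \<Sum>be\<in>De. pser (b j) * (pser (row j be) * tw N (ps be)))"
   by (intro sum.cong refl) (simp add: b'_def fps_of_poly_mult mult.assoc rowF sum_distrib_left)
  also have "... = (\<Sum>be\<in>De. pser (\<Sum>j\<le>l. b j * row j be) * tw N (ps be))"
   by (subst sum.swap) (simp add: fps_of_poly_sum fps_of_poly_mult sum_distrib_right sum_distrib_left mult_ac)
  also have "... = 0" by (rule sum.neutral) (simp add: dep)
  finally have eq: "(\<Sum>j\<le>l. pser (b' j) * tw j F) = 0" .
  have "\<exists>j\<le>l. b' j ~= 0"
  proof -
   obtain j a where "j <= l" "a <= D2" "y (j, a) ~= 0" using y(2) by auto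
   hence "coeff (b j) a ~= 0" by (simp add: coeff_b)
   hence "b j ~= 0" by auto
   thus ?thesis using \<open>j <= l\<close> dn_nz by (auto simp: b'_def)
  qed
  then obtain k where k: "\<exists>j\<le>l. coeff (b' j) k ~= 0" "(\<Sum>j\<le>l. coeff (b' j) k * cf F (subdegree F) ^ q ^ j) = 0"
   using twisted_equation_lowest[OF F _ eq] by blast
  define H3 where "H3 = H2 + q ^ N * (q ^ l * c3 + c1) + c1"
  have b'_height: "coeff (b' j) k \<in> Ord w h H3" if "j <= l" for j
   using PH_mult[OF b_height[OF that] dn_height'[OF that]] by (simp add: PH_def b'_def H3_def)
  let ?z = "cf F (subdegree F)"
  have low: "1 / real q ^ (C * (H3 + 1)) <= real q ^ (c0 + H3) * cabs ?z"
  proof (rule additive_root_lower_bound[OF k(1) _ _ _ k(2)])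
   show "cabs (coeff (b' j) k) <= real q ^ (c0 + H3)" if "j <= l" for j using c0 b'_height[OF that] by blast
   show "1 / real q ^ (C * (H3 + 1)) <= cabs (coeff (b' j) k)" if "j <= l" "coeff (b' j) k ~= 0" for j
    using C b'_height that by blast
   show "?z ~= 0" using F by simp
   have "1 / real q ^ (C * (H3 + 1)) <= 1" using q_gt1 by simp
   also have "1 <= real q ^ (c0 + H3)" using q_gt1 by (simp add: one_le_power)
   finally show "1 / real q ^ (C * (H3 + 1)) <= real q ^ (c0 + H3)" .
  qed (use q_pos in simp)
  have "G2 <= ?S * C6" unfolding G2_def C6_def by (intro sb(1) sb(2)[of "H + c1"] sb(3) H QS)
  hence "H2 + 1 <= ?S * (3 * l * (C6 + c1 + 1))" unfolding H2 by (intro sb(2) sb(1) sb(3))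
  hence "H3 <= ?S * C7" unfolding H3_def C7_def by (intro sb(1) sb(3) QS) simp
  hence "C * (H3 + 1) + (c0 + H3) <= ?S * C8" unfolding C8_def
   using sb(1)[OF sb(2)[OF sb(1)[OF _ sb(3)]] sb(1)[OF sb(3)]] by blast
  hence "real q ^ (C * (H3 + 1)) * real q ^ (c0 + H3) <= real q ^ (?S * C8)"
   unfolding power_add[symmetric] using q_pos by (intro power_increasing) auto
  hence "1 / real q ^ (?S * C8) <= 1 / (real q ^ (C * (H3 + 1)) * real q ^ (c0 + H3))"
   using q_pos by (intro divide_left_mono) auto
  also have "... <= cabs ?z" using low q_pos by (simp add: divide_le_eq mult_ac)
  finally show "\<exists>m. 1 / real q ^ (?S * C8) <= cabs (cf (comb T \<pi> N) m)" unfolding F_def[symmetric] by blast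
 qed
qed

text \<open>Kb is perfect, so the twist is undone by taking roots of the coefficients.\<close>

lemma untwist_relation:
 assumes "!!al. al \<in> T ==> \<pi> al \<in> polys Kb" "al0 \<in> T" "\<pi> al0 ~= 0"
  and "comb T \<pi> N = 0"
 shows "\<exists>P. (\<forall>al\<in>T. P al \<in> polys Kb) & (\<exists>al\<in>T. P al ~= 0) & (\<Sum>al\<in>T. pser (P al) * ps al) = 0"
proof -
 have "\<exists>g. \<forall>a\<in>Kb. g a \<in> Kb & g a ^ q ^ N = a" by (rule bchoice) (use Kb_root[of _ N] in blast)
 then obtain g where g: "!!a. a \<in> Kb ==> g a \<in> Kb" "!!a. a \<in> Kb ==> g a ^ q ^ N = a" by blast
 have g0: "g 0 = 0" using g(2)[of 0] subfld_0[OF subfld_Kb] by (simp split: if_splits)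
 define P where "P = (%al. map_poly g (\<pi> al))"
 have tP: "twp N (P al) = \<pi> al" if "al \<in> T" for al
  by (rule poly_eqI) (use assms(1)[OF that] g in "auto simp: P_def coeff_map_poly g0 polys_def")
 have "P al \<in> polys Kb" if "al \<in> T" for al
  using assms(1)[OF that] g by (auto simp: P_def polys_def coeff_map_poly g0)
 moreover have "P al0 ~= 0" using tP[OF assms(2)] assms(3) by (metis twp_eq_0_iff)
 moreover have "tw N (\<Sum>al\<in>T. pser (P al) * ps al) = comb T \<pi> N"
  unfolding tw_sum tw_mult fps_of_poly_twp[symmetric] by (intro sum.cong refl) (simp add: tP)
 ultimately show ?thesis using assms(2,4) by (intro exI[of _ P]) auto
qed

text \<open>The iterated system expresses the value of \<open>\<psi>_\<alpha>^(N)\<close> at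
 \<open>\<theta>^(q^j)\<close>, up to a nonzero factor independent of \<alpha>, by the r numbers
 \<open>v^(q^j)\<close>. Hence N * r linear conditions make F = comb T \<pi> N vanish at these N
 points, and as card T > r Siegel's lemma solves them with \<pi> of degree less than N. If there
 were no relation, F would not be zero by \<open>untwist_relation\<close>, and
 \<open>combination_lower_bound\<close> would contradict \<open>many_zeros_bound\<close> on a disc
 of radius \<open>R ^ (q ^ N)\<close>.\<close>

lemma relation_from_values_integral:
 assumes T: "T \<subseteq> De" "r < card T"
  and c: "!!be ka. be \<in> De ==> ka < r ==> c be ka \<in> Ord w h h0"
  and v: "!!be. be \<in> De ==> eval_at th (ps be) = (\<Sum>ka<r. c be ka * v ka)"
 shows "\<exists>P. (\<forall>al\<in>T. P al \<in> polys Kb) & (\<exists>al\<in>T. P al ~= 0) & (\<Sum>al\<in>T. pser (P al) * ps al) = 0"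
proof (rule ccontr)
 assume no: "\<not> ?thesis"
 have finT: "finite T" using T finD finite_subset by auto
 have T0: "T ~= {}" using T(2) by auto
 obtain C where C: "!!H x. x \<in> Ord w h H ==> x ~= 0 ==> cabs x >= 1 / real q ^ (C * (H + 1))"
  using liouville[OF good] by blast
 obtain C0 where C0: "!!H x. x \<in> Ord w h H ==> cabs x <= C0 * real q ^ H" using Oh_bound[OF good] by blast
 obtain c0 where "C0 < real q ^ c0" using real_arch_pow[of "real q" C0] q_gt1 by auto
 hence c0: "cabs x <= real q ^ (c0 + H)" if "x \<in> Ord w h H" for H x
 proof -
  have "C0 * real q ^ H <= real q ^ c0 * real q ^ H" using \<open>C0 < real q ^ c0\<close> by (intro mult_right_mono) auto
  thus ?thesis using C0[OF that] by (simp add: power_add)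
 qed
 define rh where "rh = r + 1"
 define c4 where "c4 = c3 + d0 + h0 + c1"
 define C5 where "C5 = 2 * r * (1 + (c4 + c1) + c1)"
 from combination_lower_bound[OF T(1) T0 C c0, of C5] obtain C8 where C8: "low_bound T C5 C8" by (rule exE)
 define K where "K = c0 + C5 + C8 + 1"
 \<comment> \<open>With this radius \<open>R ^ M = 2 ^ M * q ^ (N * K)\<close>. The two bounds for F yield \<open>R
  ^ M <= q ^ (N * K) * \<Psi>\<close>, which is absurd for \<open>\<Psi> < 2 ^ M\<close>.\<close>
 define R where "R = 2 * real q ^ (2 * rh * K)"
 have R1: "real q <= R" "1 <= R"
 proof -
  have "real q ^ 1 <= real q ^ (2 * rh * K)" using q_gt1 by (intro power_increasing) (auto simp: rh_def K_def)
  moreover have "0 <= real q ^ (2 * rh * K)" by simp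
  ultimately show "real q <= R" unfolding R_def power_one_right by linarith
  thus "1 <= R" using q_ge_2 by simp
 qed
 obtain \<Psi> where \<Psi>: "\<Psi> >= 1" "!!al. al \<in> T ==> gauss_bd (ps al) R \<Psi>"
 proof -
  have "\<forall>al\<in>T. \<exists>B. gauss_bd (ps al) R B" using ent T(1) R1 unfolding entire_def by (meson less_le_trans subsetD zero_less_one)
  then obtain Bf where Bf: "!!al. al \<in> T ==> gauss_bd (ps al) R (Bf al)" by metis
  show thesis
  proof (rule that[of "1 + (\<Sum>al\<in>T. Bf al)"])
   have nn: "!!al. al \<in> T ==> 0 <= Bf al" using Bf gauss_bd_nonneg by blast
   thus "1 <= 1 + (\<Sum>al\<in>T. Bf al)" by (simp add: sum_nonneg)
   fix al assume a: "al \<in> T"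
   have "Bf al <= (\<Sum>al\<in>T. Bf al)" using nn a finT by (intro member_le_sum) auto
   thus "gauss_bd (ps al) R (1 + (\<Sum>al\<in>T. Bf al))" by (intro gauss_bd_mono[OF Bf[OF a]]) simp
  qed
 qed
 obtain M' where "\<Psi> < 2 ^ M'" using real_arch_pow[of 2 \<Psi>] by auto
 define M where "M = Suc M'"
 have M: "M >= 1" "\<Psi> < 2 ^ M" using \<open>\<Psi> < 2 ^ M'\<close> \<Psi>(1) unfolding M_def power_Suc by linarith+
 define N where "N = 2 * rh * M"
 \<comment> \<open>D + 1 = N - M coefficients for each function exceed the number of conditions, since \<open>(r +
  1) * (N - M) = N * r + (r + 1) * M\<close>, and N zeros still gain M + 1 factors \<open>R ^ (q ^
  N)\<close> over degree D\<close>
 define D where "D = N - M - 1"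
 have MN: "M + 1 <= N" using M(1) by (simp add: N_def rh_def algebra_simps)
 have N1: "N >= 1" and DN: "D <= N" and ND: "N = D + (M + 1)" using MN by (auto simp: D_def)
 define Q where "Q = q ^ N"
 have Q1: "Q >= 1" using q_pos by (simp add: Q_def)
 define G where "G = Q * (D + (c4 + c1))"
 define H where "H = 2 * r * (G + c1)"
 note sb = scaled_bounds[of "Q * N"]
 have S1: "Q * N >= 1" using Q1 N1 by simp
 have "D + (c4 + c1) <= N * 1 + N * (c4 + c1)" using DN N1 by (intro add_mono) auto
 hence "G <= Q * (N * 1 + N * (c4 + c1))" unfolding G_def by (rule mult_left_mono) simp
 hence "G <= (Q * N) * (1 + (c4 + c1))" by (simp add: algebra_simps)
 hence HC5: "H <= q ^ N * N * C5" unfolding H_def C5_def Q_def[symmetric]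
  by (intro sb(2)[OF S1] sb(1)[OF S1] sb(3)[OF S1])
 \<comment> \<open>vanishing at \<open>th\<close> to the power \<open>q ^ j\<close>, \<open>1 <= j <= N\<close>, as linear conditions\<close>
 define gam where "gam = (%j al ka. \<Sum>be\<in>De. poly (Bn (N - j) al be) th * c be ka)"
 have gam: "gam j al ka ^ q ^ j \<in> Ord w h (Q * (c4 + c1))" if "j <= N" "al \<in> T" "ka < r" for j al ka
 proof -
  let ?i = "N - j"
  have "poly (Bn ?i al be) (th ^ 1) * c be ka \<in> Ord w h ((q ^ ?i * c3 + ?i * d0 * 1) + h0 + c1)" if "be \<in> De" for be
   using that \<open>al \<in> T\<close> \<open>ka < r\<close> T(1) by (intro Oh_mult[OF good] PH_poly_theta Bn_height c) auto
  hence "gam j al ka \<in> Ord w h ((q ^ ?i * c3 + ?i * d0 * 1) + h0 + c1)" unfolding gam_def by (intro Ord_sum) simp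
  moreover have "(q ^ ?i * c3 + ?i * d0 * 1) + h0 + c1 <= q ^ ?i * c4"
  proof -
   have "?i * d0 <= q ^ ?i * d0" using power_gt_expt[of q ?i] q_gt1 by (intro mult_right_mono) auto
   moreover have "1 * h0 <= q ^ ?i * h0" "1 * c1 <= q ^ ?i * c1" using q_pos by (intro mult_right_mono; simp)+
   moreover have "q ^ ?i * c4 = q ^ ?i * c3 + q ^ ?i * d0 + q ^ ?i * h0 + q ^ ?i * c1"
    unfolding c4_def by (simp only: distrib_left)
   ultimately show ?thesis unfolding mult_1_right mult_1 by linarith
  qed
  ultimately have "gam j al ka \<in> Ord w h (q ^ ?i * c4)" by (rule Ord_mono')
  hence "gam j al ka ^ q ^ j \<in> Ord w h (q ^ j * (q ^ ?i * c4 + c1))" by (rule Oh_power[OF good])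
  moreover have "q ^ j * (q ^ ?i * c4 + c1) <= Q * (c4 + c1)"
  proof -
   have "q ^ j * q ^ ?i = Q" using that(1) by (simp add: Q_def power_add[symmetric])
   moreover have "q ^ j * c1 <= Q * c1" unfolding Q_def using that(1) q_pos by (intro mult_right_mono power_increasing) auto
   ultimately show ?thesis by (simp add: distrib_left mult.assoc[symmetric])
  qed
  ultimately show ?thesis by (rule Ord_mono')
 qed
 let ?U = "T \<times> {..D}" and ?E = "{1..N} \<times> {..<r}"
 define A where "A = (%(j, ka) (al, a). th ^ (a * q ^ j) * gam j al ka ^ q ^ j)"
 have A: "A e u \<in> Ord w h G" if "e \<in> ?E" "u \<in> ?U" for e u
 proof -
  obtain j ka al a where eu: "e = (j, ka)" "u = (al, a)" by (cases e; cases u)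
  have "A e u \<in> Ord w h (Q * (c4 + c1) + a * q ^ j)"
   unfolding A_def eu case_prod_conv by (intro Ord_theta_mult gam) (use that eu in auto)
  moreover have "a * q ^ j <= D * Q" unfolding Q_def using that eu q_pos by (intro mult_mono power_increasing) auto
  ultimately show ?thesis by (elim Ord_mono') (simp add: G_def algebra_simps)
 qed
 have "card ?E * (H + G + c1 + 1) < card ?U * (H + 1)"
 proof -
  have e1: "N * r * (G + c1) = rh * M * H" by (simp add: N_def H_def)
  have D1: "D + 1 = N - M" using ND by simp
  have e2: "rh * (D + 1) = N * r + rh * M"
  proof -
   have "rh * (D + 1) + rh * M = rh * N" unfolding D1 using MN by (simp add: distrib_left[symmetric])
   also have "... = N * r + rh * M + rh * M" by (simp add: N_def rh_def algebra_simps)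
   finally show ?thesis by simp
  qed
  have "rh * M >= 1" using M(1) by (simp add: rh_def)
  have "card ?E * (H + G + c1 + 1) = N * r * (H + 1) + N * r * (G + c1)"
   by (simp add: card_cartesian_product algebra_simps)
  also have "... = N * r * (H + 1) + rh * M * H" by (simp only: e1)
  also have "... < N * r * (H + 1) + rh * M * (H + 1)" using \<open>rh * M >= 1\<close> by simp
  also have "... = rh * (D + 1) * (H + 1)" by (simp only: e2 distrib_right)
  also have "... <= card T * (D + 1) * (H + 1)" using T(2) by (intro mult_right_mono) (auto simp: rh_def)
  also have "... = card ?U * (H + 1)" by (simp add: card_cartesian_product)
  finally show ?thesis .
 qed
 then obtain x where x: "\<forall>u\<in>?U. x u \<in> Ord w h H" "\<exists>u\<in>?U. x u ~= 0" "\<forall>e\<in>?E. (\<Sum>u\<in>?U. A e u * x u) = 0"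
  using siegel[OF good, of ?U ?E A G H] A finT by blast
 define \<pi> where "\<pi> = (%al. \<Sum>a\<le>D. monom (x (al, a)) a)"
 have \<pi>: "PH (\<pi> al) H D" if "al \<in> T" for al unfolding \<pi>_def by (rule PH_monom_sum) (use x that in auto)
 define F where "F = comb T \<pi> N"
 have F0: "F ~= 0"
 proof
  assume "F = 0"
  obtain al a where "al \<in> T" "a <= D" "x (al, a) ~= 0" using x(2) by auto
  moreover from this have "coeff (\<pi> al) a = x (al, a)" by (simp add: \<pi>_def coeff_sum)
  ultimately have "al \<in> T" "\<pi> al ~= 0" by auto
  moreover have "!!al. al \<in> T ==> \<pi> al \<in> polys Kb" using PH_Kb[OF \<pi>] .
  ultimately show False using untwist_relation[of T \<pi> al N] \<open>F = 0\<close> no unfolding F_def by blast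
 qed
 have entF: "entire F" unfolding F_def
  by (intro entire_sum entire_mult entire_fps_of_poly entire_tw ent) (use T(1) in auto)
 have zero: "eval_at (th ^ q ^ j) F = 0" if j: "j \<in> {1..N}" for j
 proof -
  let ?i = "N - j" and ?z = "th ^ q ^ j"
  let ?d = "poly (dn ?i) th ^ q ^ j"
  have val: "?d * eval_at ?z (tw N (ps al)) = (\<Sum>ka<r. gam j al ka ^ q ^ j * v ka ^ q ^ j)" if a: "al \<in> T" for al
  proof -
   have a': "al \<in> De" using a T by auto
   have "eval_at th (pser (dn ?i) * tw ?i (ps al)) = eval_at th (\<Sum>be\<in>De. pser (Bn ?i al be) * ps be)"
    by (simp only: iterate_sys[OF a'])
   hence "poly (dn ?i) th * eval_at th (tw ?i (ps al)) = (\<Sum>be\<in>De. poly (Bn ?i al be) th * (\<Sum>ka<r. c be ka * v ka))"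
    using ent a' v by (simp add: eval_at_mult entire_tw eval_at_sum entire_mult)
   also have "... = (\<Sum>ka<r. gam j al ka * v ka)"
    unfolding gam_def sum_distrib_left sum_distrib_right by (subst sum.swap) (simp add: mult_ac)
   finally have "(poly (dn ?i) th * eval_at th (tw ?i (ps al))) ^ q ^ j = (\<Sum>ka<r. gam j al ka ^ q ^ j * v ka ^ q ^ j)"
    by (simp add: frob_sum power_mult_distrib)
   moreover have "eval_at ?z (tw N (ps al)) = eval_at th (tw ?i (ps al)) ^ q ^ j"
    using eval_at_tw[OF entire_tw[OF ent[OF a'], of ?i], of th j] j by (simp add: tw_tw)
   ultimately show ?thesis by (simp add: power_mult_distrib)
  qed
  have "?d * eval_at ?z F = (\<Sum>al\<in>T. poly (\<pi> al) ?z * (?d * eval_at ?z (tw N (ps al))))"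
   unfolding F_def using ent T(1)
   by (subst eval_at_sum) (auto simp: entire_mult entire_tw eval_at_mult sum_distrib_left mult_ac subset_iff intro!: sum.cong)
  also have "... = (\<Sum>al\<in>T. (\<Sum>a\<le>D. x (al, a) * th ^ (a * q ^ j)) * (\<Sum>ka<r. gam j al ka ^ q ^ j * v ka ^ q ^ j))"
   by (rule sum.cong) (simp_all add: val \<pi>_def poly_sum poly_monom power_mult[symmetric] mult.commute[of "q ^ j"])
  also have "... = (\<Sum>al\<in>T. \<Sum>a\<le>D. \<Sum>ka<r. A (j, ka) (al, a) * x (al, a) * v ka ^ q ^ j)"
   by (rule sum.cong) (simp_all add: sum_product A_def mult_ac)
  also have "... = (\<Sum>u\<in>?U. \<Sum>ka<r. A (j, ka) u * x u * v ka ^ q ^ j)"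
   by (subst sum.cartesian_product, rule sum.cong) auto
  also have "... = (\<Sum>ka<r. (\<Sum>u\<in>?U. A (j, ka) u * x u) * v ka ^ q ^ j)"
   by (subst sum.swap) (simp add: sum_distrib_right)
  also have "... = 0" by (rule sum.neutral) (use x(3) j in auto)
  finally show ?thesis using dn_theta by simp
 qed
 \<comment> \<open>the bound at radius \<open>R ^ Q\<close>\<close>
 define Bd where "Bd = real q ^ (c0 + H) * (R ^ Q) ^ D * \<Psi> ^ Q"
 have RQ: "1 <= R ^ Q" "real q ^ Q <= R ^ Q" using R1 by (auto intro!: one_le_power power_mono)
 have bdF: "gauss_bd F (R ^ Q) Bd" unfolding F_def
 proof (rule gauss_bd_sum)
  show "0 <= Bd" using R1 \<Psi> q_pos by (simp add: Bd_def)
  fix al assume a: "al \<in> T"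
  have "gauss_bd (pser (\<pi> al)) (R ^ Q) (real q ^ (c0 + H) * (R ^ Q) ^ D)" unfolding gauss_bd_def
  proof
   fix i show "cabs (cf (pser (\<pi> al)) i) * (R ^ Q) ^ i <= real q ^ (c0 + H) * (R ^ Q) ^ D"
   proof (cases "i <= D")
    case True
    thus ?thesis using c0 \<pi>[OF a] RQ by (intro mult_mono power_increasing) (auto simp: PH_def)
   next
    case False
    hence "coeff (\<pi> al) i = 0" using \<pi>[OF a] by (intro coeff_eq_0) (auto simp: PH_def)
    thus ?thesis using RQ by simp
   qed
  qed
  moreover have "gauss_bd (tw N (ps al)) (R ^ Q) (\<Psi> ^ Q)"
   unfolding Q_def by (rule gauss_bd_tw[OF \<Psi>(2)[OF a]]) (use R1 in simp)
  ultimately show "gauss_bd (pser (\<pi> al) * tw N (ps al)) (R ^ Q) Bd"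
   unfolding Bd_def using RQ by (intro gauss_bd_mult) auto
 qed (use RQ in simp)
 let ?Z = "(%j. th ^ q ^ j) ` {1..N}"
 have cardZ: "card ?Z = N"
 proof -
  have "inj_on (%j. th ^ q ^ j) {1..N}"
  proof (rule inj_onI)
   fix i j assume "th ^ q ^ i = th ^ q ^ j"
   hence "cabs (th ^ q ^ i) = cabs (th ^ q ^ j)" by simp
   hence "real q ^ q ^ i = real q ^ q ^ j" by (simp only: cabs_power cabs_theta)
   thus "i = j" using q_gt1 by (simp add: power_inject_exp)
  qed
  thus ?thesis by (simp add: card_image)
 qed
 obtain m where m: "1 / real q ^ (q ^ N * N * C8) <= cabs (cf F m)"
  using C8 N1 DN HC5 \<pi> F0 unfolding F_def low_bound_def by blast
 have "cabs (cf F m) <= (real q ^ Q) ^ card ?Z * Bd / (R ^ Q) ^ card ?Z"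
 proof (rule many_zeros_bound)
  fix y assume "y \<in> ?Z"
  then obtain j where j: "j \<in> {1..N}" "y = th ^ q ^ j" by auto
  have cy: "cabs y = real q ^ q ^ j" by (simp only: j(2) cabs_power cabs_theta)
  thus "y ~= 0" using q_pos by auto
  show "cabs y <= real q ^ Q" unfolding cy Q_def using j q_pos by (intro power_increasing) auto
  show "eval_at y F = 0" using zero j by simp
 qed (use entF bdF RQ q_pos in "auto intro!: one_le_power")
 hence "1 / real q ^ (Q * N * C8) <= (real q ^ Q) ^ N * Bd / (R ^ Q) ^ N" using m unfolding cardZ Q_def by linarith
 also have "... = real q ^ (Q * N) * real q ^ (c0 + H) * \<Psi> ^ Q / (R ^ Q) ^ (M + 1)"
 proof -
  have "(R ^ Q) ^ N = (R ^ Q) ^ D * (R ^ Q) ^ (M + 1)" by (subst ND) (simp only: power_add)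
  moreover have "(real q ^ Q) ^ N = real q ^ (Q * N)" by (simp only: power_mult)
  ultimately show ?thesis using RQ by (simp add: Bd_def field_simps)
 qed
 finally have "(R ^ Q) ^ (M + 1) <= real q ^ (Q * N) * real q ^ (c0 + H) * \<Psi> ^ Q * real q ^ (Q * N * C8)"
  using RQ q_pos by (simp add: field_simps)
 also have "... = real q ^ (Q * N + (c0 + H) + Q * N * C8) * \<Psi> ^ Q" by (simp add: power_add)
 also have "... <= real q ^ (Q * N * K) * \<Psi> ^ Q"
 proof -
  have "Q * N + (c0 + H) + Q * N * C8 <= Q * N * (1 + (c0 + C5) + C8)"
   by (intro sb(1)[OF S1] sb(3)[OF S1]) (use HC5 in "auto simp: Q_def")
  hence "Q * N + (c0 + H) + Q * N * C8 <= Q * N * K" by (simp add: K_def add_ac)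
  thus ?thesis using q_pos \<Psi> by (intro mult_right_mono power_increasing) auto
 qed
 also have "... = (real q ^ (N * K) * \<Psi>) ^ Q" by (simp add: power_mult_distrib power_mult[symmetric] mult_ac)
 finally have "(R ^ (M + 1)) ^ Q <= (real q ^ (N * K) * \<Psi>) ^ Q" by (simp only: power_mult[symmetric] mult.commute)
 hence "R ^ (M + 1) <= real q ^ (N * K) * \<Psi>" using R1 \<Psi> Q1 by (subst (asm) power_mono_iff) auto
 moreover have "R ^ M <= R ^ (M + 1)" using R1 by (intro power_increasing) auto
 moreover have "R ^ M = 2 ^ M * real q ^ (N * K)"
  by (simp add: R_def N_def power_mult_distrib power_mult[symmetric] mult_ac)
 ultimately have "2 ^ M * real q ^ (N * K) <= real q ^ (N * K) * \<Psi>" by linarith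
 hence "2 ^ M <= \<Psi>" using q_pos by (simp add: mult_le_cancel_left mult.commute[of "2 ^ M"])
 thus False using M(2) by simp
qed

end

end

text \<open>Multiplying the system by a common denominator, and replacing c and v by \<open>?e * c\<close>
 and \<open>v / ?e\<close>, moves all coefficients into one order.\<close>

theorem relation_from_values:
 fixes De :: "'i set" and ps :: "'i => 'c fps"
 assumes fin: "finite De" and ent: "!!al. al \<in> De ==> entire (ps al)"
  and B: "!!al be. al \<in> De ==> be \<in> De ==> B al be \<in> polys Kb" and d: "d \<in> polys Kb"
  and sys: "!!al. al \<in> De ==> pser d * tw 1 (ps al) = (\<Sum>be\<in>De. pser (B al be) * ps be)"
  and dnz: "!!i. poly (twp i d) th ~= 0"
  and T: "T \<subseteq> De" "r < card T"
  and c: "!!be ka. be \<in> De ==> ka < r ==> c be ka \<in> Kb"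
  and v: "!!be. be \<in> De ==> eval_at th (ps be) = (\<Sum>ka<r. c be ka * v ka)"
 shows "\<exists>P. (\<forall>al\<in>T. P al \<in> polys Kb) & (\<exists>al\<in>T. P al ~= 0) & (\<Sum>al\<in>T. pser (P al) * ps al) = 0"
proof -
 define Z where "Z = (\<Union>al\<in>De. \<Union>be\<in>De. set (coeffs (B al be))) Un set (coeffs d) Un (\<Union>be\<in>De. c be ` {..<r})"
 have Z: "finite Z" unfolding Z_def using fin by auto
 have cK: "set (coeffs p) \<subseteq> Kb" if "p \<in> polys Kb" for p
  using that by (auto simp: coeffs_def polys_def split: if_splits)
 have ZK: "Z \<subseteq> Kb" unfolding Z_def using cK[OF B] cK[OF d] c by blast
 obtain h w c1 de H where good: "good_order h w c1" and de: "de \<in> polys FF" "de ~= 0"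
  and ZH: "!!z. z \<in> Z ==> poly de th * z \<in> Ord w h H" using good_order_exists[OF Z ZK] by blast
 let ?e = "poly de th"
 have e0: "?e ~= 0" using de poly_theta_eq_0 by blast
 define d0 where "d0 = degree d + (\<Sum>al\<in>De. \<Sum>be\<in>De. degree (B al be))"
 have PHI: "PH h w (Polynomial.smult ?e p) H d0" if "set (coeffs p) \<subseteq> Z" "degree p <= d0" for p
  unfolding PH_def[OF good]
 proof (intro conjI allI)
  fix i show "coeff (Polynomial.smult ?e p) i \<in> Ord w h H"
  proof (cases "coeff p i = 0")
   case False
   hence "coeff p i \<in> Z" using that(1) by (metis coeff_in_coeffs le_degree coeff_0 subsetD)
   thus ?thesis using ZH by simp
  qed (simp add: Ord_0)
 qed (use that(2) degree_smult_le[of ?e p] in linarith)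
 note rel = relation_from_values_integral[OF good fin ent _ _ _ _ T, where B = "%al be. Polynomial.smult ?e (B al be)"
   and d = "Polynomial.smult ?e d" and c = "%be ka. ?e * c be ka" and v = "%ka. v ka / ?e"]
 show ?thesis
 proof (rule rel)
  fix al be assume ab: "al \<in> De" "be \<in> De"
  have "degree (B al be) <= (\<Sum>be\<in>De. degree (B al be))" using ab fin by (intro member_le_sum) auto
  also have "... <= (\<Sum>al\<in>De. \<Sum>be\<in>De. degree (B al be))"
   using ab fin by (intro member_le_sum[of al De "%al. \<Sum>be\<in>De. degree (B al be)"]) auto
  finally show "PH h w (Polynomial.smult ?e (B al be)) H d0" using ab by (intro PHI) (auto simp: Z_def d0_def)
 next
  show "PH h w (Polynomial.smult ?e d) H d0" by (intro PHI) (auto simp: Z_def d0_def)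
 next
  fix al assume "al \<in> De"
  thus "pser (Polynomial.smult ?e d) * tw 1 (ps al) = (\<Sum>be\<in>De. pser (Polynomial.smult ?e (B al be)) * ps be)"
   using sys[of al] by (simp add: fps_of_poly_smult mult.assoc sum_distrib_left[symmetric])
 next
  fix i
  have "twp i (Polynomial.smult ?e d) = Polynomial.smult (?e ^ q ^ i) (twp i d)"
   by (rule poly_eqI) (simp add: power_mult_distrib)
  thus "poly (twp i (Polynomial.smult ?e d)) th ~= 0" using dnz e0 by simp
 next
  fix be ka assume "be \<in> De" "ka < r"
  thus "?e * c be ka \<in> Ord w h H" by (intro ZH) (auto simp: Z_def)
 next
  fix be assume "be \<in> De"
  thus "eval_at th (ps be) = (\<Sum>ka<r. ?e * c be ka * (v ka / ?e))" using v e0 by simp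
 qed
qed

end

section \<open>Growth of spans of products\<close>

definition subrng :: "'a::comm_ring_1 set => bool" where
 "subrng R \<longleftrightarrow> 0 \<in> R & 1 \<in> R & (\<forall>x\<in>R. \<forall>y\<in>R. x + y \<in> R & x * y \<in> R) & (\<forall>x\<in>R. - x \<in> R)"

lemma subfld_subrng: "subfld F ==> subrng F" by (auto simp: subfld_def subrng_def)

lemma subrngD:
 assumes "subrng R"
 shows "0 \<in> R" "1 \<in> R" "x \<in> R ==> y \<in> R ==> x + y \<in> R" "x \<in> R ==> y \<in> R ==> x * y \<in> R" "x \<in> R ==> - x \<in> R"
 using assms by (auto simp: subrng_def)

inductive_set lspan :: "'a::comm_ring_1 set => 'a set => 'a set" for R S where
 lspan_0: "0 \<in> lspan R S"
| lspan_step: "x \<in> lspan R S ==> c \<in> R ==> s \<in> S ==> x + c * s \<in> lspan R S"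

lemma lspan_mono: assumes "S \<subseteq> S'" shows "lspan R S \<subseteq> lspan R S'"
proof
 fix x assume "x \<in> lspan R S" thus "x \<in> lspan R S'" by induction (use assms in "auto intro: lspan.intros")
qed

lemma lspan_mono': assumes "R \<subseteq> R'" shows "lspan R S \<subseteq> lspan R' S"
proof
 fix x assume "x \<in> lspan R S" thus "x \<in> lspan R' S" by induction (use assms in "auto intro: lspan.intros")
qed

lemma lspan_add: assumes "x \<in> lspan R S" "y \<in> lspan R S" shows "x + y \<in> lspan R S"
 using assms(2,1) by induction (auto simp: add.assoc[symmetric] intro: lspan.intros)

lemma lspan_sum: "(!!i. i \<in> A ==> f i \<in> lspan R S) ==> sum f A \<in> lspan R S"
 by (induction A rule: infinite_finite_induct) (auto intro: lspan_0 lspan_add)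

lemma lspan_scale: "c \<in> R ==> s \<in> S ==> c * s \<in> lspan R S" using lspan_step[OF lspan_0] by simp

lemma lspan_base: "subrng R ==> s \<in> S ==> s \<in> lspan R S" using lspan_scale[of 1 R s S] by (simp add: subrngD)

lemma lspan_mult:
 assumes R: "subrng R" and "!!s s'. s \<in> S ==> s' \<in> S' ==> s * s' \<in> S''"
  and "x \<in> lspan R S" "y \<in> lspan R S'"
 shows "x * y \<in> lspan R S''" using assms(3)
proof induction
 case (lspan_step x c s)
 have "c * s * y \<in> lspan R S''" using assms(4)
 proof induction
  case (lspan_step y d s')
  have "c * d * (s * s') \<in> lspan R S''" using lspan_step assms(2)[OF \<open>s \<in> S\<close> \<open>s' \<in> S'\<close>] \<open>c \<in> R\<close>
   by (intro lspan_scale subrngD(4)[OF R])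
  from lspan_add[OF lspan_step.IH this] show ?case
   by (metis (no_types, opaque_lifting) distrib_left mult.assoc mult.left_commute)
 qed (simp add: lspan_0)
 from lspan_add[OF lspan_step.IH this] show ?case by (simp add: distrib_right)
qed (simp add: lspan_0)

lemma lspan_cmult: assumes R: "subrng R" and "c \<in> R" "x \<in> lspan R S" shows "c * x \<in> lspan R S"
 using assms(3)
proof induction
 case (lspan_step x d s)
 thus ?case using lspan_add[OF lspan_step.IH lspan_scale[of "c * d" R s S]] assms
  by (simp add: algebra_simps subrngD(4)[OF R])
qed (simp add: lspan_0)

lemma lspan_uminus: "subrng R ==> x \<in> lspan R S ==> - x \<in> lspan R S"
 using lspan_cmult[of R "-1" x S] by (simp add: subrngD)

lemma lspan_diff: "subrng R ==> x \<in> lspan R S ==> y \<in> lspan R S ==> x - y \<in> lspan R S"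
 using lspan_add[of x R S "- y"] lspan_uminus[of R y S] by simp

lemma lspan_trans: assumes "subrng R" "S \<subseteq> lspan R S'" shows "lspan R S \<subseteq> lspan R S'"
proof
 fix x assume "x \<in> lspan R S" thus "x \<in> lspan R S'"
  by induction (use assms in "auto intro!: lspan_0 lspan_add lspan_cmult")
qed

lemma lspan_finite_rep:
 assumes R: "subrng R" and "finite S" "x \<in> lspan R S"
 shows "\<exists>c. (\<forall>s\<in>S. c s \<in> R) & x = (\<Sum>s\<in>S. c s * s)" using assms(3)
proof induction
 case lspan_0 thus ?case by (intro exI[of _ "%_. 0"]) (simp add: subrngD[OF R])
next
 case (lspan_step x d s)
 then obtain c where c: "\<forall>s\<in>S. c s \<in> R" "x = (\<Sum>s\<in>S. c s * s)" by auto
 have "x + d * s = (\<Sum>s'\<in>S. (c(s := c s + d)) s' * s')"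
  using lspan_step assms(2) by (simp add: c(2) sum.remove[of S s] algebra_simps)
 thus ?case using c lspan_step by (intro exI[of _ "c(s := c s + d)"]) (auto simp: subrngD[OF R])
qed

lemma lspan_hom:
 assumes "x \<in> lspan R S" and f: "f 0 = 0" "!!x y. x \<in> lspan R S ==> y \<in> lspan R S ==> f (x + y) = f x + f y"
  "!!c s. c \<in> R ==> s \<in> S ==> f (c * s) \<in> lspan R' S'"
 shows "f x \<in> lspan R' S'" using assms(1)
proof induction
 case (lspan_step x c s)
 thus ?case by (subst f(2)) (auto intro: lspan_add f(3) lspan_scale)
qed (simp add: f(1) lspan_0)

definition wprods :: "'a::comm_ring_1 set => ('a => nat) => nat => 'a set" where
 "wprods G wt n = {prod_list gs | gs. set gs \<subseteq> G & sum_list (map wt gs) <= n}"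

lemma wprods_1: "1 \<in> wprods G wt n" unfolding wprods_def by (intro CollectI exI[of _ "[]"]) auto

lemma wprods_gen: "g \<in> G ==> wt g <= n ==> g \<in> wprods G wt n"
 unfolding wprods_def by (intro CollectI exI[of _ "[g]"]) auto

lemma wprods_mult: "x \<in> wprods G wt m ==> y \<in> wprods G wt n ==> x * y \<in> wprods G wt (m + n)"
proof -
 assume "x \<in> wprods G wt m" "y \<in> wprods G wt n"
 then obtain gs hs where "set gs \<subseteq> G" "sum_list (map wt gs) <= m" "x = prod_list gs"
  "set hs \<subseteq> G" "sum_list (map wt hs) <= n" "y = prod_list hs" unfolding wprods_def by blast
 thus ?thesis unfolding wprods_def by (intro CollectI exI[of _ "gs @ hs"]) auto
qed

lemma wprods_mono: "G \<subseteq> G' ==> m <= n ==> wprods G wt m \<subseteq> wprods G' wt n"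
 unfolding wprods_def using le_trans by fastforce

lemma wprods_power: "x \<in> wprods G wt m ==> x ^ k \<in> wprods G wt (k * m)"
proof (induction k)
 case (Suc k)
 thus ?case using wprods_mult[of x G wt m "x ^ k" "k * m"] by simp
qed (simp add: wprods_1)

lemma wprods_finite:
 assumes "finite G" "!!g. g \<in> G ==> wt g >= 1" shows "finite (wprods G wt n)"
proof -
 have len: "length gs <= sum_list (map wt gs)" if "set gs \<subseteq> G" for gs
  using that by (induction gs) (use assms(2) in "force")+
 have "wprods G wt n \<subseteq> prod_list ` {gs. set gs \<subseteq> G & length gs <= n}"
  unfolding wprods_def using len le_trans by blast
 thus ?thesis using finite_lists_length_le[OF assms(1)] finite_surj by blast
qed

definition wspan :: "'a::comm_ring_1 set => 'a set => ('a => nat) => nat => 'a set" where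
 "wspan R G wt n = lspan R (wprods G wt n)"

context fixes R :: "'a::comm_ring_1 set" assumes R: "subrng R" begin

lemma wspan_const: "c \<in> R ==> c \<in> wspan R G wt n"
 using lspan_scale[of c R 1 "wprods G wt n"] wprods_1[of G wt n] by (simp add: wspan_def)
lemma wspan_1: "1 \<in> wspan R G wt n" using wspan_const subrngD[OF R] by blast
lemma wspan_gen: "g \<in> G ==> wt g <= n ==> g \<in> wspan R G wt n"
 unfolding wspan_def by (intro lspan_base R wprods_gen)
lemma wspan_add: "x \<in> wspan R G wt n ==> y \<in> wspan R G wt n ==> x + y \<in> wspan R G wt n"
 unfolding wspan_def by (rule lspan_add)
lemma wspan_diff: "x \<in> wspan R G wt n ==> y \<in> wspan R G wt n ==> x - y \<in> wspan R G wt n"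
 unfolding wspan_def by (rule lspan_diff[OF R])
lemma wspan_uminus: "x \<in> wspan R G wt n ==> - x \<in> wspan R G wt n"
 unfolding wspan_def by (rule lspan_uminus[OF R])
lemma wspan_sum: "(!!i. i \<in> A ==> f i \<in> wspan R G wt n) ==> sum f A \<in> wspan R G wt n"
 unfolding wspan_def by (rule lspan_sum)
lemma wspan_mult: "x \<in> wspan R G wt m ==> y \<in> wspan R G wt n ==> x * y \<in> wspan R G wt (m + n)"
 unfolding wspan_def by (rule lspan_mult[OF R wprods_mult])
lemma wspan_cmult: "c \<in> R ==> x \<in> wspan R G wt n ==> c * x \<in> wspan R G wt n"
 unfolding wspan_def by (rule lspan_cmult[OF R])
lemma wspan_mono: "G \<subseteq> G' ==> m <= n ==> x \<in> wspan R G wt m ==> x \<in> wspan R G' wt n"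
 unfolding wspan_def using lspan_mono[OF wprods_mono] by blast
lemma wspan_power: "x \<in> wspan R G wt m ==> x ^ k \<in> wspan R G wt (k * m)"
proof (induction k)
 case (Suc k)
 thus ?case using wspan_mult[of x G wt m "x ^ k" "k * m"] by simp
qed (simp add: wspan_1)

end

lemma gen_ring_wspan:
 assumes K: "subfld K" and x: "x \<in> gen_ring K V" shows "\<exists>n. x \<in> wspan K V (%_. 1) n"
proof -
 have R: "subrng K" by (rule subfld_subrng[OF K])
 obtain M c where M: "finite M" "\<forall>m\<in>M. vars m \<subseteq> V & c m \<in> K" "x = (\<Sum>m\<in>M. c m * mono_val m)"
  using x by (auto simp: gen_ring_def)
 have "\<exists>n. (\<Prod>x\<in>A. x ^ f x) \<in> wspan K V (%_. 1) n" if "finite A" "A \<subseteq> V" for A and f :: "'a => nat"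
  using that
 proof induction
  case empty thus ?case using wspan_1[OF R] by auto
 next
  case (insert a A)
  then obtain n where "(\<Prod>x\<in>A. x ^ f x) \<in> wspan K V (%_. 1) n" by auto
  moreover have "a ^ f a \<in> wspan K V (%_. 1) (f a * 1)"
   using insert.prems by (intro wspan_power[OF R] wspan_gen[OF R]) auto
  ultimately have "a ^ f a * (\<Prod>x\<in>A. x ^ f x) \<in> wspan K V (%_. 1) (f a * 1 + n)" by (rule wspan_mult[OF R, rotated])
  thus ?case using insert.hyps by auto
 qed
 note pw = this
 have ex: "\<exists>n. c m * mono_val m \<in> wspan K V (%_. 1) n" if m: "m \<in> M" for m
 proof -
  obtain n where "mono_val m \<in> wspan K V (%_. 1) n"
   unfolding mono_val_def using pw[of "vars m" "lkp m"] M(2) m by auto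
  thus ?thesis using wspan_cmult[OF R] M(2) m by blast
 qed
 have "\<exists>n. \<forall>m\<in>M. c m * mono_val m \<in> wspan K V (%_. 1) n"
  by (rule uniform_bound[OF M(1) ex]) (auto intro: wspan_mono[OF R order_refl])
 then obtain n where n: "!!m. m \<in> M ==> c m * mono_val m \<in> wspan K V (%_. 1) n" by blast
 show ?thesis unfolding M(3) by (intro exI[of _ n] wspan_sum[OF R] n)
qed

lemma wprods_insert:
 assumes "x \<in> wprods (insert y V) (%_. 1) n"
 shows "\<exists>i\<le>n. \<exists>g\<in>wprods V (%_. 1) n. x = y ^ i * g"
proof -
 obtain gs where gs: "set gs \<subseteq> insert y V" "length gs <= n" "x = prod_list gs"
  using assms by (auto simp: wprods_def sum_list_triv)
 have "\<exists>i\<le>length gs. \<exists>hs. set hs \<subseteq> V & length hs <= length gs & prod_list gs = y ^ i * prod_list hs"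
  using gs(1)
 proof (induction gs)
  case (Cons g gs)
  then obtain i hs where ih: "i <= length gs" "set hs \<subseteq> V" "length hs <= length gs" "prod_list gs = y ^ i * prod_list hs"
   by auto
  show ?case
  proof (cases "g = y")
   case True thus ?thesis using ih by (intro exI[of _ "Suc i"] conjI exI[of _ hs]) auto
  next
   case False thus ?thesis using ih Cons.prems by (intro exI[of _ i] conjI exI[of _ "g # hs"]) auto
  qed
 qed auto
 then obtain i hs where "i <= length gs" "set hs \<subseteq> V" "length hs <= length gs" "prod_list gs = y ^ i * prod_list hs" by auto
 thus ?thesis using gs by (intro exI[of _ i] conjI bexI[of _ "prod_list hs"]) (auto simp: wprods_def sum_list_triv)
qed

text \<open>D is the leading coefficient of an equation of degree m for y with coefficients in
 \<open>K[V]\<close>. Each multiplication by D * y can be reduced modulo this equation and raises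
 the degree in V by a bounded amount.\<close>

lemma wspan_insert_algebraic:
 fixes K :: "'a::field set"
 assumes K: "subfld K" and y: "y \<in> acl K V"
 shows "\<exists>m de D. D ~= 0 & (\<forall>n. \<forall>x\<in>wprods (insert y V) (%_. 1) n.
   D ^ n * x \<in> lspan K ((%(u, e). u * y ^ e) ` (wprods V (%_. 1) (de * n) \<times> {..<m})))"
proof -
 have R: "subrng K" by (rule subfld_subrng[OF K])
 obtain p where p: "p \<in> polys (gen_ring K V)" "p ~= 0" "poly p y = 0"
  using y algebraic_over_adjoin_iff[OF K] by (auto simp: acl_def)
 define m where "m = degree p"
 let ?W = "%n. wspan K V (%_. 1) n"
 have "\<exists>n. \<forall>i\<in>{..m}. coeff p i \<in> ?W n"
  by (rule uniform_bound) (use gen_ring_wspan[OF K polysD[OF p(1)]] in "auto intro: wspan_mono[OF R order_refl]")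
 then obtain d where d: "!!i. i <= m ==> coeff p i \<in> ?W d" by auto
 define D where "D = coeff p m"
 have D: "D ~= 0" "D \<in> ?W d" using p d by (auto simp: D_def m_def)
 define L where "L = (%n. lspan K ((%(u, e). u * y ^ e) ` (wprods V (%_. 1) n \<times> {..<m})))"
 have Ladd: "x \<in> L n ==> z \<in> L n ==> x + z \<in> L n" for x z n unfolding L_def by (rule lspan_add)
 have Lsum: "(!!i. i \<in> A ==> f i \<in> L n) ==> sum f A \<in> L n" for A and f :: "nat => 'a" and n
  unfolding L_def by (rule lspan_sum)
 have L_mult: "x * z \<in> L (a + b)" if "x \<in> ?W a" "z \<in> L b" for x z a b
 proof -
  have "s * s' \<in> (%(u, e). u * y ^ e) ` (wprods V (%_. 1) (a + b) \<times> {..<m})"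
   if s: "s \<in> wprods V (%_. 1) a" "s' \<in> (%(u, e). u * y ^ e) ` (wprods V (%_. 1) b \<times> {..<m})" for s s'
  proof -
   obtain u e where ue: "u \<in> wprods V (%_. 1) b" "e < m" "s' = u * y ^ e" using s(2) by auto
   have "s * u \<in> wprods V (%_. 1) (a + b)" by (rule wprods_mult[OF s(1) ue(1)])
   thus ?thesis using ue by (intro image_eqI[of _ _ "(s * u, e)"]) (auto simp: mult.assoc)
  qed
  thus ?thesis using that unfolding L_def wspan_def by (intro lspan_mult[OF R])
 qed
 have L_in: "x * y ^ e \<in> L n" if "x \<in> ?W n" "e < m" for x e n
 proof -
  have "x * y ^ e \<in> lspan K ((%(u, e). u * y ^ e) ` (wprods V (%_. 1) n \<times> {..<m}))"
   by (rule lspan_mult[OF R, of "wprods V (%_. 1) n" "{y ^ e}"])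
    (use that lspan_base[OF R] in "auto simp: wspan_def")
  thus ?thesis by (simp add: L_def)
 qed
 have m0: "m > 0"
 proof (rule ccontr)
  assume "\<not> m > 0"
  hence "p = [:coeff p 0:]" by (metis degree_0_id m_def not_gr0)
  thus False using p(2,3) by (metis poly_pCons poly_0 mult_zero_right add.right_neutral pCons_0_0)
 qed
 have Dym: "D * y ^ m = - (\<Sum>e<m. coeff p e * y ^ e)"
 proof -
  have "(\<Sum>e<Suc m. coeff p e * y ^ e) = 0" using p(3) by (simp add: poly_altdef m_def lessThan_Suc_atMost)
  thus ?thesis by (simp add: D_def eq_neg_iff_add_eq_0 add.commute)
 qed
 have step: "D * (y * x) \<in> L (d + n)" if "x \<in> L n" for x n
 proof -
  from that have "x \<in> lspan K ((%(u, e). u * y ^ e) ` (wprods V (%_. 1) n \<times> {..<m}))" by (simp add: L_def)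
  thus ?thesis
 proof induction
  case (lspan_step x c s)
  then obtain u e where ue: "u \<in> wprods V (%_. 1) n" "e < m" "s = u * y ^ e" by auto
  have cu: "c * u \<in> ?W n" unfolding wspan_def by (intro lspan_scale lspan_step ue)
  have "D * (y * (c * s)) \<in> L (d + n)"
  proof (cases "Suc e < m")
   case True
   have "(D * (c * u)) * y ^ Suc e \<in> L (d + n)" by (rule L_in[OF wspan_mult[OF R D(2) cu] True])
   thus ?thesis by (simp add: ue(3) mult_ac)
  next
   case False
   hence "m = Suc e" using ue by simp
   have "D * (y * (c * s)) = (c * u) * (D * y ^ m)" by (simp add: ue(3) \<open>m = Suc e\<close> mult_ac)
   also have "... = (\<Sum>e<m. (- (c * u) * coeff p e) * y ^ e)" by (simp add: Dym sum_negf sum_distrib_left mult_ac)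
   also have "... \<in> L (d + n)"
   proof (rule Lsum)
    fix e' assume "e' \<in> {..<m}"
    hence "e' < m" "coeff p e' \<in> ?W d" using d by auto
    from wspan_mult[OF R wspan_uminus[OF R cu] this(2)] have "- (c * u) * coeff p e' \<in> ?W (d + n)"
     by (simp only: add.commute)
    thus "(- (c * u) * coeff p e') * y ^ e' \<in> L (d + n)" using \<open>e' < m\<close> by (rule L_in)
   qed
   finally show ?thesis .
  qed
  from Ladd[OF lspan_step.IH this] show ?case by (simp add: distrib_left)
 qed (simp add: L_def lspan_0)
 qed
 have ypow: "D ^ i * y ^ i \<in> L (d * i)" for i
 proof (induction i)
  case 0
  have "1 * y ^ 0 \<in> L 0" by (rule L_in) (use wspan_1[OF R] m0 in auto)
  thus ?case by simp
 next
  case (Suc i)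
  have "D * (y * (D ^ i * y ^ i)) \<in> L (d + d * i)" by (rule step[OF Suc])
  thus ?case by (simp add: mult_ac)
 qed
 have "D ^ n * x \<in> L ((d + 1) * n)" if xw: "x \<in> wprods (insert y V) (%_. 1) n" for x n
 proof -
  obtain i g where ig: "i <= n" "g \<in> wprods V (%_. 1) n" "x = y ^ i * g" using wprods_insert[OF xw] by auto
  have "g \<in> ?W n" using ig(2) unfolding wspan_def by (rule lspan_base[OF R])
  hence "(D ^ (n - i) * g) * (D ^ i * y ^ i) \<in> L (((n - i) * d + n) + d * i)"
   by (intro L_mult wspan_mult[OF R] wspan_power[OF R] D ypow)
  moreover have "(D ^ (n - i) * g) * (D ^ i * y ^ i) = D ^ n * x"
   using ig(1,3) by (simp add: mult_ac) (simp add: mult.assoc[symmetric] power_add[symmetric])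
  moreover have "((n - i) * d + n) + d * i = (d + 1) * n"
  proof -
   have "n = (n - i) + i" using ig(1) by simp
   hence "d * n = d * (n - i) + d * i" by (metis distrib_left)
   thus ?thesis by (simp add: algebra_simps)
  qed
  ultimately show ?thesis by simp
 qed
 thus ?thesis using D(1) unfolding L_def by blast
qed

text \<open>A transcendental y contributes its powers \<open>y ^ i\<close>, i <= n, hence another factor n +
 1. An algebraic y contributes only m powers and rescales n; the powers of D are absorbed in the
 generators.\<close>

lemma growth_bound:
 fixes K :: "'a::field set"
 assumes K: "subfld K" and V: "finite V"
 shows "\<exists>M E. \<forall>n. \<exists>U. finite U & card U <= M * (E * n + 1) ^ trdeg K (adjoin K V) & wprods V (%_. 1) n \<subseteq> lspan K U"
 using V
proof induction
 case empty
 have R: "subrng K" by (rule subfld_subrng[OF K])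
 have "wprods {} (%_. 1) n \<subseteq> lspan K {1}" for n :: nat
  using lspan_base[OF R, of 1 "{1}"] by (auto simp: wprods_def)
 moreover have "trdeg K (adjoin K {}) = 0" using trdeg_eq_card[OF K alg_independent_empty[OF K], of "{}"] by simp
 ultimately show ?case by (intro exI[of _ 1] exI[of _ 1] allI exI[of _ "{1}"]) auto
next
 case (insert y V)
 have R: "subrng K" by (rule subfld_subrng[OF K])
 let ?r = "trdeg K (adjoin K V)"
 obtain M E where ME: "!!n. \<exists>U. finite U & card U <= M * (E * n + 1) ^ ?r & wprods V (%_. 1) n \<subseteq> lspan K U"
  using insert.IH by blast
 show ?case
 proof (cases "y \<in> acl K V")
  case False
  hence r': "trdeg K (adjoin K (insert y V)) = Suc ?r" using trdeg_insert[OF K insert.hyps(1)] by simp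
  have "\<exists>U. finite U & card U <= M * ((E + 1) * n + 1) ^ Suc ?r & wprods (insert y V) (%_. 1) n \<subseteq> lspan K U" for n
  proof -
   obtain U where U: "finite U" "card U <= M * (E * n + 1) ^ ?r" "wprods V (%_. 1) n \<subseteq> lspan K U" using ME by blast
   let ?U = "(%(u, i). u * y ^ i) ` (U \<times> {..n})"
   have "card ?U <= card U * (n + 1)" using card_image_le[of "U \<times> {..n}"] U(1) by (simp add: card_cartesian_product)
   also have "... <= (M * (E * n + 1) ^ ?r) * (n + 1)" using U(2) by (rule mult_right_mono) simp
   also have "... <= (M * ((E + 1) * n + 1) ^ ?r) * ((E + 1) * n + 1)" by (intro mult_mono power_mono) auto
   finally have "card ?U <= M * ((E + 1) * n + 1) ^ Suc ?r" by (simp add: mult_ac)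
   moreover have "wprods (insert y V) (%_. 1) n \<subseteq> lspan K ?U"
   proof
    fix x assume "x \<in> wprods (insert y V) (%_. 1) n"
    then obtain i g where ig: "i <= n" "g \<in> wprods V (%_. 1) n" "x = y ^ i * g" using wprods_insert by blast
    have "y ^ i * g \<in> lspan K ?U" by (rule lspan_mult[OF R, of "{y ^ i}" U])
      (use ig U(3) lspan_base[OF R, of "y ^ i" "{y ^ i}"] in "force simp: mult.commute")+
    thus "x \<in> lspan K ?U" using ig by simp
   qed
   ultimately show ?thesis using U(1) by (intro exI[of _ ?U]) auto
  qed
  thus ?thesis unfolding r' by blast
 next
  case True
  hence r': "trdeg K (adjoin K (insert y V)) = ?r" using trdeg_insert[OF K insert.hyps(1)] by simp
  obtain m de D where D: "D ~= 0" "!!n x. x \<in> wprods (insert y V) (%_. 1) n ==>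
    D ^ n * x \<in> lspan K ((%(u, e). u * y ^ e) ` (wprods V (%_. 1) (de * n) \<times> {..<m}))"
   using wspan_insert_algebraic[OF K True] by blast
  have "\<exists>U. finite U & card U <= (M * m) * ((E * de) * n + 1) ^ ?r & wprods (insert y V) (%_. 1) n \<subseteq> lspan K U" for n
  proof -
   obtain U where U: "finite U" "card U <= M * (E * (de * n) + 1) ^ ?r" "wprods V (%_. 1) (de * n) \<subseteq> lspan K U" using ME by blast
   let ?U = "(%(u, e). u * y ^ e / D ^ n) ` (U \<times> {..<m})"
   have "card ?U <= card U * m" using card_image_le[of "U \<times> {..<m}"] U(1) by (simp add: card_cartesian_product)
   also have "... <= (M * (E * (de * n) + 1) ^ ?r) * m" using U(2) by (rule mult_right_mono) simp
   finally have "card ?U <= (M * m) * ((E * de) * n + 1) ^ ?r" by (simp add: mult_ac)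
   moreover have "wprods (insert y V) (%_. 1) n \<subseteq> lspan K ?U"
   proof
    fix x assume x: "x \<in> wprods (insert y V) (%_. 1) n"
    have sub: "(%(u, e). u * y ^ e) ` (wprods V (%_. 1) (de * n) \<times> {..<m}) \<subseteq> lspan K ((%(u, e). u * y ^ e) ` (U \<times> {..<m}))"
    proof
     fix z assume "z \<in> (%(u, e). u * y ^ e) ` (wprods V (%_. 1) (de * n) \<times> {..<m})"
     then obtain u e where ue: "u \<in> lspan K U" "e < m" "z = u * y ^ e" using U(3) by auto
     show "z \<in> lspan K ((%(u, e). u * y ^ e) ` (U \<times> {..<m}))" unfolding ue(3)
      by (rule lspan_mult[OF R, of U "{y ^ e}"]) (use ue lspan_base[OF R, of "y ^ e" "{y ^ e}"] in auto)
    qed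
    have "D ^ n * x \<in> lspan K ((%(u, e). u * y ^ e) ` (U \<times> {..<m}))"
     using D(2)[OF x] lspan_trans[OF R sub] by blast
    note DnX = this
    have inv: "inverse (D ^ n) \<in> lspan K {inverse (D ^ n)}" by (rule lspan_base[OF R]) simp
    have mul: "s * s' \<in> ?U" if s: "s \<in> {inverse (D ^ n)}" "s' \<in> (%(u, e). u * y ^ e) ` (U \<times> {..<m})" for s s'
    proof -
     obtain u e where ue: "u \<in> U" "e < m" "s' = u * y ^ e" using s(2) by auto
     thus ?thesis using s(1) by (intro image_eqI[of _ _ "(u, e)"]) (auto simp: divide_inverse mult_ac)
    qed
    have "inverse (D ^ n) * (D ^ n * x) \<in> lspan K ?U" by (rule lspan_mult[OF R mul inv DnX])
    thus "x \<in> lspan K ?U" using D(1) by (simp add: mult.assoc[symmetric])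
   qed
   ultimately show ?thesis using U(1) by (intro exI[of _ ?U]) auto
  qed
  thus ?thesis unfolding r' by blast
 qed
qed

section \<open>Transcendence degrees of values and of functions\<close>

lemma polys_linear_factor:
 assumes F: "subfld F" and c: "c \<in> F" and p: "[:- c, 1:] * r \<in> polys F" shows "r \<in> polys F"
proof -
 have "coeff r i \<in> F" if "n = Suc (degree r) - i" for n i using that
 proof (induction n arbitrary: i)
  case 0 thus ?case using subfld_0[OF F] by (simp add: coeff_eq_0)
 next
  case (Suc n)
  have "coeff r (Suc i) \<in> F" using Suc.IH[of "Suc i"] Suc.prems by simp
  moreover have "coeff r i = coeff ([:- c, 1:] * r) (Suc i) + c * coeff r (Suc i)" by simp
  ultimately show ?case using subfld_add[OF F polysD[OF p, of "Suc i"] subfld_mult[OF F c]] by metis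
 qed
 thus ?thesis by (auto simp: polys_def)
qed

text \<open>Relations with exponents indexed by A instead of by the elements f a. In this form the same
 exponents describe a relation between functions and one between their values.\<close>

lemma alg_independent_image_iff:
 fixes f :: "'b => 'a::field"
 assumes K: "subfld K" and A: "finite A" and inj: "inj_on f A"
 shows "alg_independent K (f ` A) \<longleftrightarrow>
  (\<forall>E c. finite E --> E \<subseteq> A \<rightarrow>\<^sub>E UNIV --> (\<forall>e\<in>E. c e \<in> K) -->
    (\<Sum>e\<in>E. c e * (\<Prod>a\<in>A. f a ^ e a)) = 0 --> (\<forall>e\<in>E. c e = 0))" (is "_ \<longleftrightarrow> ?R")
proof -
 define ph where "ph = (%e. Poly_Mapping.Abs_poly_mapping (%x. if x \<in> f ` A then e (inv_into A f x) else (0::nat)))"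
 have fin: "finite {x. (if x \<in> f ` A then e (inv_into A f x) else (0::nat)) ~= 0}" for e
  by (rule finite_subset[of _ "f ` A"]) (use A in auto)
 have look: "lkp (ph e) x = (if x \<in> f ` A then e (inv_into A f x) else 0)" for e x
  unfolding ph_def using fin[of e] by (subst Poly_Mapping.Abs_poly_mapping_inverse) auto
 have keys: "vars (ph e) \<subseteq> f ` A" for e by (auto simp: in_keys_iff look split: if_splits)
 have val: "mono_val (ph e) = (\<Prod>a\<in>A. f a ^ e a)" for e
  by (simp add: mono_val_superset[OF finite_imageI[OF A] keys] prod.reindex[OF inj] look inv_into_f_f[OF inj])
 have injph: "inj_on ph (A \<rightarrow>\<^sub>E UNIV)"
 proof (rule inj_onI)
  fix e e' assume e: "e \<in> A \<rightarrow>\<^sub>E UNIV" "e' \<in> A \<rightarrow>\<^sub>E UNIV" and "ph e = ph e'"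
  hence "e a = e' a" if "a \<in> A" for a
   using look[of e "f a"] look[of e' "f a"] that by (simp add: inv_into_f_f[OF inj])
  thus "e = e'" using e by (intro PiE_ext[of _ A "%_. UNIV"]) auto
 qed
 have ex: "\<exists>e\<in>A \<rightarrow>\<^sub>E UNIV. ph e = m" if mk: "vars m \<subseteq> f ` A" for m
 proof (intro bexI[of _ "restrict (lkp m \<circ> f) A"] poly_mapping_eqI)
  fix x show "lkp (ph (restrict (lkp m \<circ> f) A)) x = lkp m x"
  proof (cases "x \<in> f ` A")
   case True thus ?thesis by (auto simp: look inv_into_f_f[OF inj])
  next
   case False
   hence "x \<notin> vars m" using mk by blast
   hence "lkp m x = 0" by (simp add: in_keys_iff)
   thus ?thesis using False by (simp add: look)
  qed
 qed auto
 show ?thesis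
 proof
  assume ai: "alg_independent K (f ` A)"
  have ai': "\<forall>m\<in>M. c m = 0" if "finite M" "\<forall>m\<in>M. vars m \<subseteq> f ` A & c m \<in> K" "(\<Sum>m\<in>M. c m * mono_val m) = 0" for M c
   using iffD1[OF alg_independent_iff[OF subfld_0[OF K]] ai, THEN spec, of M, THEN spec, of c] that by simp
  show ?R
  proof (intro allI impI)
   fix E c assume E: "finite E" "E \<subseteq> A \<rightarrow>\<^sub>E UNIV" "\<forall>e\<in>E. c e \<in> K"
    and 0: "(\<Sum>e\<in>E. c e * (\<Prod>a\<in>A. f a ^ e a)) = 0"
   have injE: "inj_on ph E" using injph E(2) inj_on_subset by blast
   have "(\<Sum>m\<in>ph ` E. c (inv_into E ph m) * mono_val m) = 0"
    using 0 by (simp add: sum.reindex[OF injE] val inv_into_f_f[OF injE])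
   moreover have "\<forall>m\<in>ph ` E. vars m \<subseteq> f ` A & c (inv_into E ph m) \<in> K"
   proof
    fix m assume "m \<in> ph ` E"
    then obtain e where e: "e \<in> E" "m = ph e" by auto
    thus "vars m \<subseteq> f ` A & c (inv_into E ph m) \<in> K" using keys[of e] E(3) by (simp add: inv_into_f_f[OF injE])
   qed
   ultimately have "\<forall>m\<in>ph ` E. c (inv_into E ph m) = 0" using finite_imageI[OF E(1)] by (intro ai')
   thus "\<forall>e\<in>E. c e = 0" by (simp add: inv_into_f_f[OF injE])
  qed
 next
  assume R: ?R
  show "alg_independent K (f ` A)" unfolding alg_independent_iff[OF subfld_0[OF K]]
  proof (intro allI impI)
   fix M c assume M: "finite M" "\<forall>m\<in>M. vars m \<subseteq> f ` A & c m \<in> K" "(\<Sum>m\<in>M. c m * mono_val m) = 0"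
   define E where "E = {e\<in>A \<rightarrow>\<^sub>E UNIV. ph e \<in> M}"
   have im: "ph ` E = M" unfolding E_def using ex M(2) by (fastforce simp: image_iff)
   have injE: "inj_on ph E" using injph inj_on_subset[of ph _ E] unfolding E_def by blast
   have "finite E" using im injE M(1) finite_imageD by blast
   moreover have "(\<Sum>e\<in>E. c (ph e) * (\<Prod>a\<in>A. f a ^ e a)) = 0"
    using M(3) unfolding im[symmetric] by (simp add: sum.reindex[OF injE] val)
   ultimately have "\<forall>e\<in>E. c (ph e) = 0"
    using R[rule_format, of E "c \<circ> ph"] M(2) im unfolding E_def by auto
   thus "\<forall>m\<in>M. c m = 0" using im by blast
  qed
 qed
qed

context carlitz_field begin

text \<open>k0 below is the field of rational functions Kb(t), inside the Laurent series in t.\<close>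

definition em :: "'c poly => 'c fls" where "em p = fps_to_fls (pser p)"

lemma em_simps [simp]: "em 0 = 0" "em 1 = 1" "em (a + b) = em a + em b" "em (a * b) = em a * em b"
  "em (- a) = - em a" "em (a - b) = em a - em b" "em a = 0 \<longleftrightarrow> a = 0" "em a = em b \<longleftrightarrow> a = b"
 by (auto simp: em_def fps_of_poly_add fps_of_poly_mult fps_of_poly_uminus fps_of_poly_diff fls_times_fps_to_fls)

definition k0 :: "'c fls set" where "k0 = {em a / em b | a b. a \<in> polys Kb & b \<in> polys Kb & b ~= 0}"

lemma em_k0: "a \<in> polys Kb ==> em a \<in> k0"
 unfolding k0_def by (rule CollectI, rule exI[of _ a], rule exI[of _ 1]) (auto simp: polys_1[OF subfld_Kb])

lemma k0I: "a \<in> polys Kb ==> b \<in> polys Kb ==> b ~= 0 ==> em a / em b \<in> k0" unfolding k0_def by blast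

lemma k0E:
 assumes "x \<in> k0"
 obtains a b where "x = em a / em b" "a \<in> polys Kb" "b \<in> polys Kb" "b ~= 0"
 using assms unfolding k0_def by blast

lemma subfld_k0: "subfld k0"
proof -
 note P = polys_1[OF subfld_Kb] polys_add[OF subfld_Kb] polys_mult[OF subfld_Kb] polys_uminus[OF subfld_Kb]
 have 1: "x + y \<in> k0 & x * y \<in> k0" if xy: "x \<in> k0" "y \<in> k0" for x y
 proof -
  obtain a b where x: "x = em a / em b" "a \<in> polys Kb" "b \<in> polys Kb" "b ~= 0" using xy(1) by (rule k0E)
  obtain c d where y: "y = em c / em d" "c \<in> polys Kb" "d \<in> polys Kb" "d ~= 0" using xy(2) by (rule k0E)
  have "x + y = em (a * d + c * b) / em (b * d)" "x * y = em (a * c) / em (b * d)" using x y by (auto simp: field_simps)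
  moreover have "em (a * d + c * b) / em (b * d) \<in> k0" "em (a * c) / em (b * d) \<in> k0"
   using x y by (intro k0I P; simp)+
  ultimately show ?thesis by simp
 qed
 have 2: "- x \<in> k0 & (x ~= 0 --> inverse x \<in> k0)" if xk: "x \<in> k0" for x
 proof -
  obtain a b where x: "x = em a / em b" "a \<in> polys Kb" "b \<in> polys Kb" "b ~= 0" using xk by (rule k0E)
  have "- x = em (- a) / em b" "inverse x = em b / em a" using x by auto
  thus ?thesis using k0I[OF P(4)[OF x(2)] x(3,4)] k0I[OF x(3,2)] x by force
 qed
 have "1 \<in> k0" "0 \<in> k0" using em_k0[of 1] em_k0[of 0] P(1) polys_0[OF subfld_Kb] by auto
 thus ?thesis using 1 2 unfolding subfld_def by (metis inverse_zero)
qed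

lemma k0_common_denominator:
 assumes "finite E" "!!e. e \<in> E ==> c e \<in> k0"
 shows "\<exists>b a. b \<in> polys Kb & b ~= 0 & (\<forall>e\<in>E. a e \<in> polys Kb & em b * c e = em (a e))"
 using assms
proof induction
 case empty thus ?case using polys_1[OF subfld_Kb] by auto
next
 case (insert x E)
 then obtain b a where ba: "b \<in> polys Kb" "b ~= 0" "\<forall>e\<in>E. a e \<in> polys Kb & em b * c e = em (a e)" by auto
 obtain a' b' where x: "c x = em a' / em b'" "a' \<in> polys Kb" "b' \<in> polys Kb" "b' ~= 0"
  using insert.prems[of x, simplified] by (rule k0E)
 have "em b * em b' * c e = em b' * em (a e)" if "e \<in> E" for e using ba(3) that by (metis mult.assoc mult.commute)
 hence "\<forall>e\<in>E. em b * (em b' * c e) = em b' * em (a e)" by (simp add: mult.assoc)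
 thus ?case by (intro exI[of _ "b * b'"] exI[of _ "%e. if e = x then b * a' else b' * a e"])
    (use ba x insert.hyps in "auto simp: polys_mult[OF subfld_Kb]")
qed

lemma trdeg_basis:
 assumes K: "subfld K" and S: "finite S"
 obtains B where "B \<subseteq> S" "alg_independent K B" "S \<subseteq> acl K B" "trdeg K (adjoin K S) = card B" "finite B"
proof -
 obtain B where B: "B \<subseteq> S" "alg_independent K B" "S \<subseteq> acl K B" using exists_alg_basis[OF K S] by auto
 have fB: "finite B" using B(1) S finite_subset by auto
 show ?thesis by (rule that[OF B _ fB], rule trdeg_eq_card[OF K B(2) fB _ B(3)]) (use B(1) adjoin_gen in blast)
qed

lemma fls_relation:
 "(\<Sum>e\<in>E. em (a e) * (\<Prod>f\<in>Y. fps_to_fls f ^ e f)) = 0 \<longleftrightarrow> (\<Sum>e\<in>E. pser (a e) * (\<Prod>f\<in>Y. f ^ e f)) = 0"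
proof -
 have p: "fps_to_fls (\<Prod>f\<in>Y. f ^ e f) = (\<Prod>f\<in>Y. fps_to_fls f ^ e f)" for e :: "'c fps => nat"
  by (induction Y rule: infinite_finite_induct) (simp_all add: fls_times_fps_to_fls fps_to_fls_power)
 have "fps_to_fls (\<Sum>e\<in>E. pser (a e) * (\<Prod>f\<in>Y. f ^ e f)) = (\<Sum>e\<in>E. em (a e) * (\<Prod>f\<in>Y. fps_to_fls f ^ e f))"
  by (induction E rule: infinite_finite_induct) (simp_all add: em_def fls_times_fps_to_fls p)
 thus ?thesis by (simp only: fps_to_fls_eq_0_iff[symmetric])
qed

text \<open>A relation between the functions with coefficients in \<open>Kb[t]\<close> gives a relation
 between the values. If their independence forces all coefficients to vanish at \<theta>, the
 factor t - \<theta> is cancelled; degrees decrease, so in the end all coefficients are zero.\<close>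

lemma trdeg_values_le:
 assumes X: "finite X0" "!!f. f \<in> X0 ==> entire f"
 shows "trdeg Kb (adjoin Kb (eval_at th ` X0)) <= trdeg k0 (adjoin k0 (fps_to_fls ` X0))"
proof -
 obtain B where B: "B \<subseteq> eval_at th ` X0" "alg_independent Kb B" "trdeg Kb (adjoin Kb (eval_at th ` X0)) = card B" "finite B"
  using trdeg_basis[OF subfld_Kb finite_imageI[OF X(1)]] by metis
 obtain Y where Y: "Y \<subseteq> X0" "inj_on (eval_at th) Y" "B = eval_at th ` Y" using B(1) by (auto simp: subset_image_inj)
 have finY: "finite Y" using Y(1) X(1) finite_subset by auto
 have injf: "inj_on fps_to_fls Y" by (auto simp: inj_on_def)
 have "alg_independent k0 (fps_to_fls ` Y)" unfolding alg_independent_image_iff[OF subfld_k0 finY injf]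
 proof (intro allI impI)
  fix E and c :: "('c fps => nat) => 'c fls"
  assume E: "finite E" "E \<subseteq> Y \<rightarrow>\<^sub>E UNIV" and c: "\<forall>e\<in>E. c e \<in> k0" and 0: "(\<Sum>e\<in>E. c e * (\<Prod>f\<in>Y. fps_to_fls f ^ e f)) = 0"
  obtain b a where b: "b ~= 0" and a: "!!e. e \<in> E ==> a e \<in> polys Kb" "!!e. e \<in> E ==> em b * c e = em (a e)"
   using k0_common_denominator[OF E(1), of c] c by metis
  have "(\<Sum>e\<in>E. em (a e) * (\<Prod>f\<in>Y. fps_to_fls f ^ e f)) = em b * (\<Sum>e\<in>E. c e * (\<Prod>f\<in>Y. fps_to_fls f ^ e f))"
   unfolding sum_distrib_left by (rule sum.cong[OF refl]) (simp add: a(2)[symmetric] mult.assoc)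
  hence rel0: "(\<Sum>e\<in>E. pser (a e) * (\<Prod>f\<in>Y. f ^ e f)) = 0" using 0 by (simp add: fls_relation)
  have step: "\<forall>e\<in>E. a e = 0" if "(\<Sum>e\<in>E. pser (a e) * (\<Prod>f\<in>Y. f ^ e f)) = 0" "!!e. e \<in> E ==> a e \<in> polys Kb"
    "!!e. e \<in> E ==> a e = 0 \<or> degree (a e) < N" for N a using that
  proof (induction N arbitrary: a)
   case (Suc N)
   have ent: "entire (\<Prod>f\<in>Y. f ^ e f)" for e using Y(1) X(2) by (intro entire_prod entire_power) auto
   have ev: "eval_at th (\<Prod>f\<in>Y. f ^ e f) = (\<Prod>f\<in>Y. eval_at th f ^ e f)" for e :: "'c fps => nat"
   proof -
    have "eval_at th (\<Prod>f\<in>Y. f ^ e f) = (\<Prod>f\<in>Y. eval_at th (f ^ e f))"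
     using Y(1) X(2) by (intro eval_at_prod entire_power) auto
    also have "... = (\<Prod>f\<in>Y. eval_at th f ^ e f)" using Y(1) X(2) by (intro prod.cong[OF refl] eval_at_power) auto
    finally show ?thesis .
   qed
   have "eval_at th (\<Sum>e\<in>E. pser (a e) * (\<Prod>f\<in>Y. f ^ e f)) = (\<Sum>e\<in>E. poly (a e) th * (\<Prod>f\<in>Y. eval_at th f ^ e f))"
    by (simp add: eval_at_sum eval_at_mult entire_mult ent ev)
   hence "(\<Sum>e\<in>E. poly (a e) th * (\<Prod>f\<in>Y. eval_at th f ^ e f)) = 0" using Suc.prems(1) by simp
   hence z: "\<forall>e\<in>E. poly (a e) th = 0"
    using iffD1[OF alg_independent_image_iff[OF subfld_Kb finY Y(2)] B(2)[unfolded Y(3)], THEN spec, of E, THEN spec, of "%e. poly (a e) th"]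
     E Suc.prems(2) poly_in_subfld[OF subfld_Kb _ theta_Kb] by blast
   hence "\<forall>e\<in>E. \<exists>a'. a e = [:- th, 1:] * a'" by (auto simp: poly_eq_0_iff_dvd dvd_def)
   then obtain a' where a': "!!e. e \<in> E ==> a e = [:- th, 1:] * a' e" by metis
   have "pser [:- th, 1:] * (\<Sum>e\<in>E. pser (a' e) * (\<Prod>f\<in>Y. f ^ e f)) = (\<Sum>e\<in>E. pser (a e) * (\<Prod>f\<in>Y. f ^ e f))"
    unfolding sum_distrib_left by (rule sum.cong[OF refl]) (simp only: a' fps_of_poly_mult mult.assoc)
   hence s0: "(\<Sum>e\<in>E. pser (a' e) * (\<Prod>f\<in>Y. f ^ e f)) = 0" using Suc.prems(1) by simp
   have "\<forall>e\<in>E. a' e = 0"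
   proof (rule Suc.IH[OF s0])
    fix e assume e: "e \<in> E"
    show "a' e \<in> polys Kb" using polys_linear_factor[OF subfld_Kb theta_Kb, of "a' e"] Suc.prems(2)[OF e] a'[OF e] by simp
    show "a' e = 0 \<or> degree (a' e) < N"
    proof (cases "a' e = 0")
     case False
     hence "a e ~= 0" "degree (a e) = Suc (degree (a' e))"
      using degree_mult_eq[of "[:- th, 1:]" "a' e"] no_zero_divisors[of "[:- th, 1:]" "a' e"] a'[OF e] by auto
     thus ?thesis using Suc.prems(3)[OF e] by simp
    qed simp
   qed
   thus ?case using a' by simp
  qed auto
  have "\<forall>e\<in>E. a e = 0"
  proof -
   have "degree (a e) < Suc (\<Sum>e\<in>E. degree (a e))" if "e \<in> E" for e
    using member_le_sum[of e E "%e. degree (a e)"] E(1) that by simp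
   thus ?thesis using step[OF rel0 a(1), of "Suc (\<Sum>e\<in>E. degree (a e))"] by blast
  qed
  thus "\<forall>e\<in>E. c e = 0" using a(2) b by auto
 qed
 moreover obtain B2 where B2: "fps_to_fls ` X0 \<subseteq> acl k0 B2" "trdeg k0 (adjoin k0 (fps_to_fls ` X0)) = card B2" "finite B2"
  using trdeg_basis[OF subfld_k0 finite_imageI[OF X(1)], of fps_to_fls] by metis
 ultimately have "card (fps_to_fls ` Y) <= card B2" using alg_independent_card_le[OF subfld_k0] finY Y(1) by blast
 thus ?thesis using B2 B(3) Y(2,3) by (simp add: card_image[OF injf] card_image)
qed

lemma subrng_polys: "subrng (pser ` polys Kb)"
proof -
 note P = polys_1[OF subfld_Kb] polys_add[OF subfld_Kb] polys_mult[OF subfld_Kb]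
  polys_uminus[OF subfld_Kb] polys_0[OF subfld_Kb]
 show ?thesis unfolding subrng_def
  using P by (auto simp: fps_of_poly_add[symmetric] fps_of_poly_mult[symmetric] fps_of_poly_uminus[symmetric]
   intro!: imageI intro: image_eqI[of _ _ 0] image_eqI[of _ _ 1])
qed

lemma wprods_prod:
 "(!!a. a \<in> A ==> f a \<in> wprods G wt (n a)) ==> prod f A \<in> wprods G wt (sum n A)"
 by (induction A rule: infinite_finite_induct) (auto simp: wprods_1 intro: wprods_mult)

lemma twist_wprods:
 assumes wt: "!!f. f \<in> X0 ==> wt f >= 1" and d: "d \<in> polys Kb"
  and cl: "!!f. f \<in> X0 ==> pser d * tw 1 f \<in> wspan (pser ` polys Kb) X0 wt (wt f)"
  and x: "x \<in> wprods X0 wt n"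
 shows "pser (d ^ n) * tw 1 x \<in> wspan (pser ` polys Kb) X0 wt n"
proof -
 let ?W = "wspan (pser ` polys Kb) X0 wt"
 note R = subrng_polys
 obtain gs where gs: "set gs \<subseteq> X0" "sum_list (map wt gs) <= n" "x = prod_list gs" using x by (auto simp: wprods_def)
 have "length gs <= sum_list (map wt gs) & pser (d ^ length gs) * tw 1 (prod_list gs) \<in> ?W (sum_list (map wt gs))"
  using gs(1)
 proof (induction gs)
  case Nil thus ?case using wspan_1[OF R, of X0 wt 0] by simp
 next
  case (Cons g gs)
  have "(pser d * tw 1 g) * (pser (d ^ length gs) * tw 1 (prod_list gs)) \<in> ?W (wt g + sum_list (map wt gs))"
   using Cons by (intro wspan_mult[OF R] cl) auto
  thus ?case using Cons wt[of g] by (auto simp: tw_mult fps_of_poly_mult mult_ac)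
 qed
 hence len: "length gs <= n" and "pser (d ^ length gs) * tw 1 x \<in> ?W n"
  using gs(2,3) wspan_mono[OF R order_refl gs(2)] by auto
 from wspan_cmult[OF R _ this(2), of "pser (d ^ (n - length gs))"] polys_power[OF subfld_Kb d]
 have "pser (d ^ (n - length gs)) * (pser (d ^ length gs) * tw 1 x) \<in> ?W n" by blast
 moreover have "d ^ n = d ^ (n - length gs) * d ^ length gs" using len by (simp add: power_add[symmetric])
 ultimately show ?thesis by (simp add: fps_of_poly_mult mult.assoc)
qed

lemma eval_at_wprods:
 assumes "!!f. f \<in> X0 ==> entire f" "!!f. f \<in> X0 ==> wt f >= 1" "x \<in> wprods X0 wt n"
 shows "entire x & eval_at th x \<in> wprods (eval_at th ` X0) (%_. 1) n"
proof -
 obtain gs where gs: "set gs \<subseteq> X0" "sum_list (map wt gs) <= n" "x = prod_list gs" using assms(3) by (auto simp: wprods_def)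
 have "entire (prod_list gs) & eval_at th (prod_list gs) = prod_list (map (eval_at th) gs) & length gs <= sum_list (map wt gs)"
  using gs(1) by (induction gs) (use assms(1,2) in "force simp: eval_at_mult entire_mult")+
 moreover have "set (map (eval_at th) gs) \<subseteq> eval_at th ` X0" using gs(1) by auto
 ultimately show ?thesis using gs(2,3) unfolding wprods_def
  by (intro conjI CollectI exI[of _ "map (eval_at th) gs"]) (auto simp: sum_list_triv)
qed

text \<open>Let the functions of Y be independent, more than r in number, where r is the transcendence degree
 of the values. The \<open>(k + 1) ^ card Y\<close> monomials with exponents at most k belong to
 the system of all products of weight at most n, whose values span a space of smaller dimension;
 \<open>relation_from_values\<close> gives a relation between these monomials.\<close>

lemma trdeg_functions_le:
 assumes X: "finite X0" "!!f. f \<in> X0 ==> entire f" and wt: "!!f. f \<in> X0 ==> wt f >= 1"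
  and cl: "!!f. f \<in> X0 ==> pser ([:- (th ^ q), 1:] ^ m) * tw 1 f \<in> wspan (pser ` polys Kb) X0 wt (wt f)"
 shows "trdeg k0 (adjoin k0 (fps_to_fls ` X0)) <= trdeg Kb (adjoin Kb (eval_at th ` X0))"
proof (rule ccontr)
 let ?r = "trdeg Kb (adjoin Kb (eval_at th ` X0))"
 assume "\<not> trdeg k0 (adjoin k0 (fps_to_fls ` X0)) <= ?r"
 hence gt: "?r < trdeg k0 (adjoin k0 (fps_to_fls ` X0))" by simp
 obtain B where B: "B \<subseteq> fps_to_fls ` X0" "alg_independent k0 B" "trdeg k0 (adjoin k0 (fps_to_fls ` X0)) = card B" "finite B"
  using trdeg_basis[OF subfld_k0 finite_imageI[OF X(1)], of fps_to_fls] by metis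
 obtain Y where Y: "Y \<subseteq> X0" "inj_on fps_to_fls Y" "B = fps_to_fls ` Y" using B(1) by (auto simp: subset_image_inj)
 have finY: "finite Y" using Y(1) X(1) finite_subset by auto
 have rY: "?r < card Y" using gt B(3) Y by (simp add: card_image)
 have ind: "\<forall>e\<in>E. a e = 0" if "finite E" "E \<subseteq> Y \<rightarrow>\<^sub>E UNIV" "\<forall>e\<in>E. a e \<in> polys Kb"
  "(\<Sum>e\<in>E. pser (a e) * (\<Prod>f\<in>Y. f ^ e f)) = 0" for E a
  using iffD1[OF alg_independent_image_iff[OF subfld_k0 finY Y(2)] B(2)[unfolded Y(3)], THEN spec, of E, THEN spec, of "%e. em (a e)"]
   that em_k0 by (simp add: fls_relation)
 obtain M E where ME: "!!n. \<exists>U. finite U & card U <= M * (E * n + 1) ^ ?r & wprods (eval_at th ` X0) (%_. 1) n \<subseteq> lspan Kb U"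
  using growth_bound[OF subfld_Kb finite_imageI[OF X(1), of "eval_at th"]] by blast
 define S where "S = (\<Sum>f\<in>Y. wt f)"
 \<comment> \<open>so that \<open>M * (E * (k * S) + 1) ^ r <= k * (k + 1) ^ r < (k + 1) ^ (r + 1)\<close>\<close>
 define k where "k = M * (E * S + 1) ^ ?r"
 define n where "n = k * S"
 obtain U where U: "finite U" "card U <= M * (E * n + 1) ^ ?r" "wprods (eval_at th ` X0) (%_. 1) n \<subseteq> lspan Kb U" using ME by blast
 let ?mon = "%e. \<Prod>f\<in>Y. f ^ e f"
 define E0 where "E0 = (Y \<rightarrow>\<^sub>E {..k})"
 have finE: "finite E0" unfolding E0_def using finY by (intro finite_PiE) auto
 have E0: "E0 \<subseteq> Y \<rightarrow>\<^sub>E UNIV" unfolding E0_def by (rule PiE_mono) auto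
 have injm: "inj_on ?mon E0"
 proof (rule inj_onI, rule ccontr)
  fix e e' assume e: "e \<in> E0" "e' \<in> E0" "?mon e = ?mon e'" "e ~= e'"
  have "\<forall>x\<in>{e, e'}. (if x = e then 1 else - 1 :: 'c poly) = 0"
   by (rule ind) (use e E0 polys_1[OF subfld_Kb] polys_uminus[OF subfld_Kb] in "auto simp: fps_of_poly_uminus")
  thus False by auto
 qed
 define T where "T = ?mon ` E0"
 have "card T = (k + 1) ^ card Y" unfolding T_def card_image[OF injm] unfolding E0_def using finY by (simp add: card_PiE)
 moreover have "card U < (k + 1) ^ card Y"
 proof -
  have "E * n + 1 <= (E * S + 1) * (k + 1)" unfolding n_def by (simp add: algebra_simps)
  hence "(E * n + 1) ^ ?r <= (E * S + 1) ^ ?r * (k + 1) ^ ?r" by (metis power_mono power_mult_distrib zero_le)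
  hence "M * (E * n + 1) ^ ?r <= M * ((E * S + 1) ^ ?r * (k + 1) ^ ?r)" by (rule mult_le_mono2)
  hence "card U <= M * ((E * S + 1) ^ ?r * (k + 1) ^ ?r)" using U(2) by linarith
  also have "... = k * (k + 1) ^ ?r" by (simp add: k_def)
  also have "... < (k + 1) ^ Suc ?r" by simp
  also have "... <= (k + 1) ^ card Y" using rY by (intro power_increasing) auto
  finally show ?thesis .
 qed
 ultimately have cT: "card U < card T" by simp
 let ?d = "([:- (th ^ q), 1:] ^ m) ^ n"
 have d: "[:- (th ^ q), 1:] ^ m \<in> polys Kb"
  by (intro polys_power polys_pCons subfld_Kb polys_0 subfld_uminus[OF subfld_Kb] subfld_power[OF subfld_Kb] theta_Kb subfld_1)
 define De where "De = wprods X0 wt n"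
 have finDe: "finite De" unfolding De_def by (rule wprods_finite[OF X(1) wt])
 have TDe: "T \<subseteq> De"
 proof
  fix x assume "x \<in> T"
  then obtain e where e: "e \<in> E0" "x = ?mon e" by (auto simp: T_def)
  have "x \<in> wprods X0 wt (\<Sum>f\<in>Y. e f * wt f)" unfolding e(2) by (intro wprods_prod wprods_power wprods_gen) (use Y(1) in auto)
  moreover have "(\<Sum>f\<in>Y. e f * wt f) <= n"
   unfolding n_def S_def sum_distrib_left by (rule sum_mono) (use e(1) in "auto simp: E0_def")
  ultimately show "x \<in> De" unfolding De_def using wprods_mono[OF order_refl] by blast
 qed
 have "\<exists>B. (\<forall>be\<in>De. B be \<in> polys Kb) & pser ?d * tw 1 al = (\<Sum>be\<in>De. pser (B be) * be)" if "al \<in> De" for al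
 proof -
  have "pser ?d * tw 1 al \<in> lspan (pser ` polys Kb) De"
   using twist_wprods[OF wt d cl, of al n] that unfolding De_def wspan_def by simp
  from lspan_finite_rep[OF subrng_polys finDe this]
  obtain c where c: "\<forall>be\<in>De. c be \<in> pser ` polys Kb" "pser ?d * tw 1 al = (\<Sum>be\<in>De. c be * be)" by blast
  have "\<forall>be\<in>De. \<exists>b. b \<in> polys Kb & c be = pser b" using c(1) by blast
  then obtain B where "\<forall>be\<in>De. B be \<in> polys Kb & c be = pser (B be)" by (rule bchoice[THEN exE])
  note B = this
  have "(\<Sum>be\<in>De. c be * be) = (\<Sum>be\<in>De. pser (B be) * be)" by (rule sum.cong[OF refl]) (use B in simp)
  thus ?thesis unfolding c(2) using B by blast
 qed
 hence "\<forall>al. \<exists>B. al \<in> De --> (\<forall>be\<in>De. B be \<in> polys Kb) & pser ?d * tw 1 al = (\<Sum>be\<in>De. pser (B be) * be)" by blast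
 then obtain B where "\<forall>al. al \<in> De --> (\<forall>be\<in>De. B al be \<in> polys Kb) & pser ?d * tw 1 al = (\<Sum>be\<in>De. pser (B al be) * be)"
  by (rule choice[THEN exE])
 hence Bp: "!!al be. al \<in> De ==> be \<in> De ==> B al be \<in> polys Kb"
  "!!al. al \<in> De ==> pser ?d * tw 1 al = (\<Sum>be\<in>De. pser (B al be) * be)" by simp_all
 obtain h where h: "bij_betw h {..<card U} U" using ex_bij_betw_nat_finite[OF U(1)] by (auto simp: atLeast0LessThan)
 have "\<exists>c. (\<forall>s\<in>U. c s \<in> Kb) & eval_at th be = (\<Sum>s\<in>U. c s * s)" if "be \<in> De" for be
 proof -
  have "eval_at th be \<in> lspan Kb U" using eval_at_wprods[of X0 wt be n] X(2) wt that U(3) unfolding De_def by blast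
  from lspan_finite_rep[OF subfld_subrng[OF subfld_Kb] U(1) this] show ?thesis .
 qed
 hence "\<forall>be. \<exists>c. be \<in> De --> (\<forall>s\<in>U. c s \<in> Kb) & eval_at th be = (\<Sum>s\<in>U. c s * s)" by blast
 then obtain c where "\<forall>be. be \<in> De --> (\<forall>s\<in>U. c be s \<in> Kb) & eval_at th be = (\<Sum>s\<in>U. c be s * s)"
  by (rule choice[THEN exE])
 hence c: "!!be s. be \<in> De ==> s \<in> U ==> c be s \<in> Kb" "!!be. be \<in> De ==> eval_at th be = (\<Sum>s\<in>U. c be s * s)" by simp_all
 have dnz: "poly (twp i ?d) th ~= 0" for i
 proof -
  have "twp i (p ^ k) = twp i p ^ k" for p k by (induction k) (simp_all add: twp_mult, rule poly_eqI, simp)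
  moreover have "twp i [:- (th ^ q), 1:] = [:- (th ^ q ^ Suc i), 1:]"
   by (rule poly_eqI) (simp add: coeff_pCons frob_minus power_mult[symmetric] split: nat.split)
  moreover have "th ~= th ^ q ^ Suc i"
  proof
   assume "th = th ^ q ^ Suc i"
   hence "real q ^ 1 = real q ^ (q ^ Suc i)" using cabs_theta cabs_power[of th "q ^ Suc i"] by simp
   hence "1 = q ^ Suc i" using q_gt1 by (subst (asm) power_inject_exp) auto
   thus False using q_gt1 by simp
  qed
  ultimately show ?thesis by simp
 qed
 have ent: "entire x" if "x \<in> De" for x using eval_at_wprods[of X0 wt x n] X(2) wt that unfolding De_def by blast
 obtain P where P: "\<forall>al\<in>T. P al \<in> polys Kb" "\<exists>al\<in>T. P al ~= 0" "(\<Sum>al\<in>T. pser (P al) * al) = 0"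
 proof (atomize_elim, rule relation_from_values[OF finDe ent Bp(1) polys_power[OF subfld_Kb d] Bp(2) dnz TDe cT])
  show "c be (h ka) \<in> Kb" if "be \<in> De" "ka < card U" for be ka using c(1) that bij_betwE[OF h] by blast
  show "eval_at th be = (\<Sum>ka<card U. c be (h ka) * h ka)" if "be \<in> De" for be
   unfolding c(2)[OF that] by (rule sum.reindex_bij_betw[OF h, symmetric])
 qed
 have "\<forall>e\<in>E0. P (?mon e) = 0"
  by (rule ind[OF finE E0]) (use P(1,3) in "auto simp: T_def sum.reindex[OF injm]")
 thus False using P(2) by (auto simp: T_def)
qed

theorem trdeg_values_eq_functions:
 assumes "finite X0" "!!f. f \<in> X0 ==> entire f" and "!!f. f \<in> X0 ==> wt f >= 1"
  and "!!f. f \<in> X0 ==> pser ([:- (th ^ q), 1:] ^ m) * tw 1 f \<in> wspan (pser ` polys Kb) X0 wt (wt f)"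
 shows "trdeg Kb (adjoin Kb (eval_at th ` X0)) = trdeg k0 (adjoin k0 (fps_to_fls ` X0))"
 using trdeg_values_le[OF assms(1,2)] trdeg_functions_le[OF assms] by (rule order_antisym) auto

end

section \<open>Difference fields\<close>

text \<open>ta is an endomorphism \<tau>; for the application it is a twist of Laurent series.\<close>

locale difference_field =
 fixes ta :: "'a::field => 'a"
 assumes tau_add: "ta (x + y) = ta x + ta y" and tau_mult: "ta (x * y) = ta x * ta y" and tau_1 [simp]: "ta 1 = 1"
begin

lemma tau_0 [simp]: "ta 0 = 0" using tau_add[of 0 0] by (metis add_cancel_right_left add_0)
lemma tau_minus: "ta (- x) = - ta x" using tau_add[of x "- x"] by (simp add: eq_neg_iff_add_eq_0 add.commute)
lemma tau_diff: "ta (x - y) = ta x - ta y" using tau_add[of x "- y"] by (simp add: tau_minus)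
lemma tau_eq_0 [simp]: "ta x = 0 \<longleftrightarrow> x = 0"
proof
 assume "ta x = 0"
 thus "x = 0" using tau_mult[of x "inverse x"] by (cases "x = 0") auto
qed simp
lemma tau_inverse: "ta (inverse x) = inverse (ta x)"
 using tau_mult[of x "inverse x"] by (cases "x = 0") (auto intro: inverse_unique[symmetric])
lemma tau_divide: "ta (x / y) = ta x / ta y" by (simp add: divide_inverse tau_mult tau_inverse)
lemma tau_power: "ta (x ^ n) = ta x ^ n" by (induction n) (simp_all add: tau_mult)
lemma tau_powi: "ta (x powi n) = ta x powi n" by (simp add: power_int_def tau_power tau_inverse)
lemma tau_prod: "ta (prod f A) = (\<Prod>i\<in>A. ta (f i))" by (induction A rule: infinite_finite_induct) (simp_all add: tau_mult)

abbreviation "mp \<equiv> map_poly ta"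

lemma coeff_mp [simp]: "coeff (mp p) i = ta (coeff p i)" by (simp add: coeff_map_poly)
lemma mp_pCons: "mp (pCons a p) = pCons (ta a) (mp p)" by (simp add: map_poly_pCons)
lemma degree_mp [simp]: "degree (mp p) = degree p" by (simp add: degree_map_poly)
lemma poly_mp: "poly (mp p) (ta x) = ta (poly p x)" by (induction p) (simp_all add: mp_pCons tau_add tau_mult)
lemma mp_add: "mp (p + r) = mp p + mp r" by (rule poly_eqI) (simp add: tau_add)
lemma mp_diff: "mp (p - r) = mp p - mp r" by (rule poly_eqI) (simp add: tau_diff)
lemma mp_smult: "mp (Polynomial.smult c p) = Polynomial.smult (ta c) (mp p)" by (rule poly_eqI) (simp add: tau_mult)
lemma mp_mult: "mp (p * r) = mp p * mp r" by (induction p) (simp_all add: mp_pCons mp_add mp_smult)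
lemma mp_pcompose: "mp (pcompose p r) = pcompose (mp p) (mp r)"
 by (induction p) (simp_all add: pcompose_pCons mp_pCons mp_add mp_mult)

definition stable :: "'a set => bool" where "stable M \<longleftrightarrow> subfld M & ta ` M \<subseteq> M"

lemma stableD: "stable M ==> subfld M" "stable M ==> x \<in> M ==> ta x \<in> M" by (auto simp: stable_def)

lemma stable_adjoin:
 assumes K: "!!x. x \<in> K ==> ta x \<in> adjoin K S" and S: "!!y. y \<in> S ==> ta y \<in> adjoin K S"
 shows "stable (adjoin K S)"
proof -
 note I = subfld_intros[OF subfld_adjoin[of K S]]
 have "subfld {x. ta x \<in> adjoin K S}" by (rule subfldI) (auto simp: tau_add tau_mult tau_minus tau_inverse intro: I)
 from adjoin_least[OF this] show ?thesis using K S by (auto simp: stable_def subfld_adjoin)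
qed

lemma mp_over: "stable M ==> p \<in> polys M ==> mp p \<in> polys M" by (auto simp: polys_def stableD)

lemma minimal_polynomial:
 assumes M: "subfld M" and y: "algebraic_over M y"
 obtains p where "p \<in> polys M" "poly p y = 0" "lead_coeff p = 1" "degree p > 0"
  "!!r. r \<in> polys M ==> poly r y = 0 ==> degree r < degree p ==> r = 0"
proof -
 let ?P = "%n. \<exists>p\<in>polys M. p ~= 0 & poly p y = 0 & degree p = n"
 have "\<exists>n. ?P n" using y[unfolded algebraic_over_iff[OF M]] by blast
 from LeastI_ex[OF this] obtain p where p: "p \<in> polys M" "p ~= 0" "poly p y = 0" "degree p = (LEAST n. ?P n)" by blast
 let ?p = "Polynomial.smult (inverse (lead_coeff p)) p"
 show ?thesis
 proof (rule that[of ?p])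
  show "?p \<in> polys M" using p(1) by (intro polys_smult[OF M] subfld_inverse[OF M] polysD)
  show "poly ?p y = 0" "lead_coeff ?p = 1" using p(2,3) by auto
  show "degree ?p > 0"
  proof (rule ccontr)
   assume "\<not> degree ?p > 0"
   hence "degree p = 0" using p(2) by simp
   then obtain c where "p = [:c:]" by (rule degree_eq_zeroE)
   thus False using p by simp
  qed
  fix r assume r: "r \<in> polys M" "poly r y = 0" "degree r < degree ?p"
  show "r = 0"
  proof (rule ccontr)
   assume "r ~= 0"
   hence "(LEAST n. ?P n) <= degree r" using r by (intro Least_le) auto
   moreover have "degree ?p = degree p" using p(2) by simp
   ultimately show False using r(3) p(4) by linarith
  qed
 qed
qed

lemma minimal_polynomial_unique:
 assumes M: "subfld M" and p: "p \<in> polys M" "poly p y = 0" "lead_coeff p = 1" "degree p > 0"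
  and min: "!!r. r \<in> polys M ==> poly r y = 0 ==> degree r < degree p ==> r = 0"
  and r: "r \<in> polys M" "poly r y = 0" "lead_coeff r = 1" "degree r = degree p"
 shows "r = p"
proof -
 have "coeff (r - p) i = 0" if "i > degree p - 1" for i
  using that p(3,4) r(3,4) by (cases "i = degree p") (auto simp: coeff_eq_0)
 hence "degree (r - p) <= degree p - 1" by (intro degree_le) auto
 hence "r - p = 0" using p r by (intro min polys_diff[OF M]) auto
 thus ?thesis by simp
qed

text \<open>The polynomial that \<tau> makes of the minimal polynomial of b, rescaled by xsi, vanishes at b
 too and hence coincides with it. Its constant term is therefore an eigenvector with eigenvalue
 \<open>xsi ^ d\<close>.\<close>

lemma multiplicative_algebraic:
 assumes M: "stable M" and b: "algebraic_over M b" "b ~= 0" and xsi: "ta b = xsi * b" "xsi \<in> M"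
 shows "\<exists>d\<ge>1. \<exists>b'\<in>M. b' ~= 0 & ta b' = xsi ^ d * b'"
proof -
 note sM = stableD(1)[OF M]
 from xsi(1) b(2) have xsi0: "xsi ~= 0" using tau_eq_0[of b] by auto
 obtain p where p: "p \<in> polys M" "poly p b = 0" "lead_coeff p = 1" "degree p > 0"
  "!!r. r \<in> polys M ==> poly r b = 0 ==> degree r < degree p ==> r = 0"
  using minimal_polynomial[OF sM b(1)] by blast
 let ?d = "degree p"
 let ?r = "Polynomial.smult (inverse (xsi ^ ?d)) (pcompose (mp p) [:0, xsi:])"
 have c: "coeff ?r i = inverse (xsi ^ ?d) * xsi ^ i * ta (coeff p i)" for i
  using coeff_pcompose_monom_linear[of "mp p" xsi i] by (simp add: monom_altdef)
 have 1: "?r \<in> polys M" using xsi(2) p(1)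
  by (auto simp: polys_def c simp del: coeff_smult intro!: subfld_mult[OF sM] subfld_inverse[OF sM] subfld_power[OF sM] stableD(2)[OF M])
 have 2: "poly ?r b = 0" using poly_mp[of p b] p(2) xsi(1) by (simp add: poly_pcompose mult.commute)
 have 3: "degree ?r = ?d" using xsi0 by (simp add: degree_pcompose)
 have 4: "lead_coeff ?r = 1" unfolding 3 c using p(3) xsi0 by simp
 have "?r = p" by (rule minimal_polynomial_unique[OF sM p(1-4) p(5) 1 2 4 3])
 hence "ta (coeff p 0) = xsi ^ ?d * coeff p 0" using c[of 0] xsi0 by (simp add: field_simps)
 moreover have "coeff p 0 ~= 0"
 proof
  assume "coeff p 0 = 0"
  then obtain p' where p': "p = pCons 0 p'" by (cases p) auto
  hence "p' ~= 0" using p(4) by auto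
  moreover have "p' = 0"
   using p' p(1,2) b(2) \<open>p' ~= 0\<close> by (intro p(5)) (auto simp: polys_def coeff_pCons split: nat.splits)
  ultimately show False by simp
 qed
 ultimately show ?thesis using p(1,4) by (intro exI[of _ ?d] conjI bexI[of _ "coeff p 0"]) (auto intro: polysD)
qed

text \<open>If y is transcendental, write b as a quotient of polynomials in y. As \<tau> acts on y by a
 substitution of degree 1, the quotient of the leading coefficients is an eigenvector, up to a
 power of rh.\<close>

lemma multiplicative_step:
 assumes M: "stable M" and y: "ta y = rh * y + a" and rh: "rh \<in> M" "rh ~= 0" and a: "a \<in> M"
  and b: "b \<in> adjoin M {y}" "b ~= 0" and xsi: "ta b = xsi * b" "xsi \<in> M"
 shows "\<exists>d\<ge>1. \<exists>m. \<exists>b'\<in>M. b' ~= 0 & ta b' = xsi ^ d * (rh powi m) * b'"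
proof (cases "algebraic_over M y")
 case True
 note sM = stableD(1)[OF M]
 have "adjoin M {y} \<subseteq> {x. algebraic_over M x}"
  by (rule adjoin_least[OF subfld_algebraics[OF sM]]) (use True algebraic_over_self[OF sM] in auto)
 hence "algebraic_over M b" using b(1) by auto
 from multiplicative_algebraic[OF M this b(2) xsi] obtain d b' where "d >= 1" "b' \<in> M" "b' ~= 0" "ta b' = xsi ^ d * b'" by blast
 thus ?thesis by (intro exI[of _ d] conjI exI[of _ 0] bexI[of _ b']) auto
next
 case False
 note sM = stableD(1)[OF M]
 obtain P Q where PQ: "P \<in> polys M" "Q \<in> polys M" "poly Q y ~= 0" "b = poly P y / poly Q y"
  using b(1) adjoin_single_iff[OF sM] by blast
 have nz: "P ~= 0" "Q ~= 0" using PQ b(2) by auto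
 let ?l = "[:a, rh:]"
 let ?D = "pcompose (mp P) ?l * Q - Polynomial.smult xsi (P * pcompose (mp Q) ?l)"
 have ty: "poly ?l y = ta y" using y by (simp add: algebra_simps)
 have tb: "ta (poly P y) * poly Q y = xsi * (poly P y * ta (poly Q y))"
  using xsi(1) PQ(3) unfolding PQ(4) tau_divide by (simp add: field_simps)
 hence "poly ?D y = 0" by (simp only: poly_diff poly_smult poly_mult poly_pcompose ty poly_mp) simp
 moreover have "?l \<in> polys M" using rh a by (intro polys_pCons[OF sM] polys_0[OF sM])
 hence "?D \<in> polys M"
  by (intro polys_diff[OF sM] polys_smult[OF sM] polys_mult[OF sM] polys_pcompose[OF sM] mp_over[OF M] PQ xsi)
 ultimately have "?D = 0" using False algebraic_over_iff[OF sM] by blast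
 hence eq: "pcompose (mp P) ?l * Q = Polynomial.smult xsi (P * pcompose (mp Q) ?l)" by simp
 have lc: "lead_coeff (pcompose (mp R) ?l) = ta (lead_coeff R) * rh ^ degree R" for R
  using lead_coeff_comp[of ?l "mp R"] rh by simp
 have "ta (lead_coeff P) * rh ^ degree P * lead_coeff Q = xsi * (lead_coeff P * (ta (lead_coeff Q) * rh ^ degree Q))"
  using arg_cong[OF eq, of lead_coeff] by (simp only: lead_coeff_mult lead_coeff_smult lc)
 hence "ta (lead_coeff P / lead_coeff Q) = xsi ^ 1 * (rh powi (int (degree Q) - int (degree P))) * (lead_coeff P / lead_coeff Q)"
  using nz rh(2) by (simp add: tau_divide power_int_diff field_simps)
 thus ?thesis using nz PQ
  by (intro exI[of _ 1] conjI exI[of _ "int (degree Q) - int (degree P)"] bexI[of _ "lead_coeff P / lead_coeff Q"])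
    (auto intro!: subfld_divide[OF sM] polysD)
qed

text \<open>Successive adjunction of solutions of linear difference equations of order one.\<close>

inductive tower :: "'a set => 'a set => 'a set => bool" for M Ga where
 tower_empty: "tower M Ga {}"
| tower_insert: "tower M Ga S ==> rh \<in> Ga ==> ta y - rh * y \<in> adjoin M S ==> tower M Ga (insert y S)"

lemma tower_stable:
 assumes M: "stable M" and "tower M Ga S" "Ga \<subseteq> M" shows "stable (adjoin M S)" using assms(2)
proof induction
 case tower_empty
 show ?case using M adjoin_empty[OF stableD(1)[OF M]] by simp
next
 case (tower_insert S rh y)
 have sub: "adjoin M S \<subseteq> adjoin M (insert y S)" by (rule adjoin_mono) auto
 note I = subfld_intros[OF subfld_adjoin[of M "insert y S"]]
 show ?case
 proof (rule stable_adjoin)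
  fix x assume "x \<in> M" thus "ta x \<in> adjoin M (insert y S)" using stableD(2)[OF M] adjoin_base by blast
 next
  fix x assume x: "x \<in> insert y S"
  have "ta y - rh * y \<in> adjoin M (insert y S)" "rh * y \<in> adjoin M (insert y S)"
   using tower_insert.hyps sub assms(3) by (auto intro!: I(4) intro: adjoin_base adjoin_gen)
  from I(3)[OF this] have "ta y \<in> adjoin M (insert y S)" by simp
  moreover have "ta x \<in> adjoin M (insert y S)" if "x \<in> S"
   using stableD(2)[OF tower_insert.IH adjoin_gen[OF that]] sub by blast
  ultimately show "ta x \<in> adjoin M (insert y S)" using x by auto
 qed
qed

lemma tower_add_finite:
 assumes "finite A" "tower M Ga S" "!!y. y \<in> A ==> \<exists>rh\<in>Ga. ta y - rh * y \<in> adjoin M S"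
 shows "tower M Ga (S Un A)" using assms(1,3)
proof induction
 case empty thus ?case using assms(2) by simp
next
 case (insert y A)
 obtain rh where rh: "rh \<in> Ga" "ta y - rh * y \<in> adjoin M S" using insert.prems by auto
 have "ta y - rh * y \<in> adjoin M (S Un A)" using adjoin_mono[of M M S "S Un A"] rh(2) by auto
 from tower.tower_insert[OF _ rh(1) this] insert show ?case by simp
qed

text \<open>An eigenvalue that occurs in a tower occurs, up to a power and a factor in Ga, already in the
 base field.\<close>

lemma tower_character_descent:
 assumes M: "stable M" and "tower M Ga S"
  and Ga: "Ga \<subseteq> M - {0}" "1 \<in> Ga" "!!x y. x \<in> Ga ==> y \<in> Ga ==> x * y \<in> Ga" "!!x m. x \<in> Ga ==> x powi m \<in> Ga"
  and b: "b \<in> adjoin M S" "b ~= 0" "ta b = xsi * b" and xsi: "xsi \<in> M"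
 shows "\<exists>D\<ge>1. \<exists>ga\<in>Ga. \<exists>b'\<in>M. b' ~= 0 & ta b' = xsi ^ D * ga * b'"
 using assms(2) b xsi
proof (induction arbitrary: b xsi)
 case tower_empty
 have "\<exists>b'\<in>M. b' ~= 0 & ta b' = xsi ^ 1 * 1 * b'"
  by (rule bexI[of _ b]) (use tower_empty.prems adjoin_empty[OF stableD(1)[OF M]] in simp_all)
 thus ?case using Ga(2) le_refl[of "1::nat"] by blast
next
 case (tower_insert S rh y)
 note sM = stableD(1)[OF M]
 have st: "stable (adjoin M S)" using tower_stable[OF M tower_insert.hyps(1)] Ga(1) by blast
 have rh: "rh \<in> adjoin M S" "rh ~= 0" "rh \<in> M" using tower_insert.hyps(2) Ga(1) adjoin_base by auto
 have "\<exists>d\<ge>1. \<exists>m. \<exists>b'\<in>adjoin M S. b' ~= 0 & ta b' = xsi ^ d * (rh powi m) * b'"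
  by (rule multiplicative_step[OF st _ rh(1,2) tower_insert.hyps(3) _ tower_insert.prems(2,3)])
    (use tower_insert.prems(1,4) adjoin_insert[of M y S] adjoin_base[of xsi M S] in simp_all)
 then obtain d m b' where db: "d >= 1" "b' \<in> adjoin M S" "b' ~= 0" "ta b' = (xsi ^ d * (rh powi m)) * b'" by blast
 have "xsi ^ d * (rh powi m) \<in> M" using tower_insert.prems(4) rh(3) by (intro subfld_intros[OF sM])
 from tower_insert.IH[OF db(2,3,4) this] obtain D ga b'' where
  D: "D >= 1" "ga \<in> Ga" "b'' \<in> M" "b'' ~= 0" "ta b'' = (xsi ^ d * (rh powi m)) ^ D * ga * b''" by blast
 have "(xsi ^ d * (rh powi m)) ^ D * ga = xsi ^ (d * D) * ((rh powi m) powi int D * ga)"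
  by (simp add: power_mult_distrib power_mult)
 moreover have "(rh powi m) powi int D * ga \<in> Ga" using Ga(3,4) tower_insert.hyps(2) D(2) by blast
 moreover have "d * D >= 1" using db(1) D(1) by (simp add: Suc_le_eq)
 moreover have "\<exists>b'\<in>M. b' ~= 0 & ta b' = (xsi ^ d * (rh powi m)) ^ D * ga * b'" using D by blast
 ultimately show ?case by (metis (lifting))
qed

text \<open>For constants c the polynomial P(X + c) - P(X) is again invariant and has smaller degree, hence
 it is constant. As there are infinitely many constants, additivity follows for all arguments.\<close>

lemma invariant_polynomial_additive:
 assumes M: "subfld M" and C: "infinite {c \<in> M. ta c = c}" and a: "a \<in> M"
  and P: "P \<in> polys M" "pcompose (mp P) [:a, 1:] = P"
  and min: "!!R. R \<in> polys M ==> pcompose (mp R) [:a, 1:] = R ==> degree R < degree P ==> degree R = 0"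
 shows "poly P (x + z) = poly P x + poly P z - poly P 0"
proof -
 let ?C = "{c \<in> M. ta c = c}"
 have const: "poly P (x + c) = poly P x + poly P c - poly P 0" if c: "c \<in> ?C" for x c
 proof -
  let ?R = "pcompose P [:c, 1:] - P"
  have R: "?R \<in> polys M" using c P(1)
   by (intro polys_diff[OF M] polys_pcompose[OF M] polys_pCons[OF M] polys_0[OF M] subfld_1[OF M]) auto
  have "pcompose (mp (pcompose P [:c, 1:])) [:a, 1:] = pcompose (mp P) (pcompose [:c, 1:] [:a, 1:])"
   using c by (simp add: mp_pcompose mp_pCons pcompose_assoc)
  also have "pcompose [:c, 1:] [:a, 1:] = pcompose [:a, 1:] [:c, 1:]" by (simp add: pcompose_pCons algebra_simps)
  also have "pcompose (mp P) ... = pcompose P [:c, 1:]" using P(2) by (simp add: pcompose_assoc)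
  finally have inv: "pcompose (mp ?R) [:a, 1:] = ?R" using P(2) by (simp add: mp_diff pcompose_diff)
  have "degree ?R = 0"
  proof (cases "degree P = 0")
   case True
   then obtain d where "P = [:d:]" by (rule degree_eq_zeroE)
   thus ?thesis by simp
  next
   case False
   have l: "lead_coeff (pcompose P [:c, 1:]) = lead_coeff P" "degree (pcompose P [:c, 1:]) = degree P"
    by (subst lead_coeff_comp) (auto simp: degree_pcompose)
   have "degree ?R < degree P"
   proof -
    have "coeff ?R i = 0" if "i > degree P - 1" for i using that l by (cases "i = degree P") (auto simp: coeff_eq_0)
    hence "degree ?R <= degree P - 1" by (intro degree_le) auto
    thus ?thesis using False by simp
   qed
   thus ?thesis by (rule min[OF R inv])
  qed
  then obtain d where "?R = [:d:]" by (rule degree_eq_zeroE)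
  hence "poly ?R x = poly ?R 0" by simp
  thus ?thesis by (simp add: poly_pcompose algebra_simps)
 qed
 let ?S = "pcompose P [:x, 1:] - P + [:poly P 0 - poly P x:]"
 have "?C \<subseteq> {c. poly ?S c = 0}" using const by (auto simp: poly_pcompose)
 hence "?S = 0" using C finite_subset[of ?C] poly_roots_finite[of ?S] by blast
 hence "poly ?S z = 0" by simp
 thus ?thesis by (simp add: poly_pcompose algebra_simps)
qed

text \<open>An analogue of Artin-Schreier theory. The minimal polynomial of y is invariant under \<open>P
 \<mapsto> P^\<tau>(X + a)\<close>. An invariant polynomial P of least positive degree is additive
 up to its constant term; Q = P - P(0) has constant coefficients, and invariance of P at 0 reads
 Q(a) = \<tau> f - f with f = - P(0).\<close>

lemma additive_algebraic:
 assumes M: "stable M" and C: "infinite {c \<in> M. ta c = c}" and y: "algebraic_over M y" "ta y = y + a" and a: "a \<in> M"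
 shows "\<exists>Q f. Q \<in> polys {c \<in> M. ta c = c} & degree Q > 0 & (\<forall>x z. poly Q (x + z) = poly Q x + poly Q z) &
  f \<in> M & poly Q a = ta f - f"
proof -
 note sM = stableD(1)[OF M]
 let ?inv = "%P. P \<in> polys M & degree P > 0 & pcompose (mp P) [:a, 1:] = P"
 have "\<exists>P. ?inv P"
 proof -
  obtain p where p: "p \<in> polys M" "poly p y = 0" "lead_coeff p = 1" "degree p > 0"
   "!!r. r \<in> polys M ==> poly r y = 0 ==> degree r < degree p ==> r = 0"
   using minimal_polynomial[OF sM y(1)] by blast
  let ?r = "pcompose (mp p) [:a, 1:]"
  have 1: "?r \<in> polys M" using a p(1)
   by (intro polys_pcompose[OF sM] mp_over[OF M] polys_pCons[OF sM] polys_0[OF sM] subfld_1[OF sM])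
  have 2: "poly ?r y = 0" using poly_mp[of p y] p(2) y(2) by (simp add: poly_pcompose add.commute)
  have 3: "lead_coeff ?r = 1" using p(3) by (subst lead_coeff_comp) auto
  have 4: "degree ?r = degree p" by (simp add: degree_pcompose)
  have "?r = p" by (rule minimal_polynomial_unique[OF sM p(1-4) p(5) 1 2 3 4])
  thus ?thesis using p by blast
 qed
 then obtain P where P: "?inv P" and min: "!!R. ?inv R ==> degree P <= degree R"
  using exists_least_iff[of "%n. \<exists>P. ?inv P & degree P = n"] by (metis not_le)
 have P': "P \<in> polys M" "degree P > 0" "pcompose (mp P) [:a, 1:] = P" using P by auto
 have add: "poly P (x + z) = poly P x + poly P z - poly P 0" for x z
 proof (rule invariant_polynomial_additive[OF sM C a P'(1,3)])
  fix R assume "R \<in> polys M" "pcompose (mp R) [:a, 1:] = R" "degree R < degree P"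
  thus "degree R = 0" using min[of R] by auto
 qed
 let ?p0 = "poly P 0"
 define Q where "Q = P - [:?p0:]"
 have Qadd: "poly Q (x + z) = poly Q x + poly Q z" for x z by (simp add: Q_def add)
 have dQ: "degree Q > 0"
 proof -
  have "degree (P + [:- ?p0:]) = degree P" by (rule degree_add_eq_left) (use P'(2) in simp)
  moreover have "Q = P + [:- ?p0:]" by (simp add: Q_def)
  ultimately show ?thesis using P'(2) by simp
 qed
 have val: "poly (mp P) x = poly P x + poly Q (- a)" for x
 proof -
  have "poly (mp P) x = poly (pcompose (mp P) [:a, 1:]) (x - a)" by (simp add: poly_pcompose)
  thus ?thesis using add[of x "- a"] P'(3) by (simp add: Q_def)
 qed
 have "infinite (UNIV :: 'a set)" using C finite_subset[OF subset_UNIV] by blast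
 moreover have "{x. poly (mp P - P - [:poly Q (- a):]) x = 0} = UNIV" using val by auto
 ultimately have "mp P - P - [:poly Q (- a):] = 0" using poly_roots_finite by metis
 hence mpP: "mp P = P + [:poly Q (- a):]" by (simp add: algebra_simps)
 have "Q \<in> polys {c \<in> M. ta c = c}"
 proof (rule polysI)
  fix i
  have "coeff P i \<in> M" using P'(1) by (rule polysD)
  show "coeff Q i \<in> {c \<in> M. ta c = c}"
  proof (cases i)
   case 0 thus ?thesis using subfld_0[OF sM] by (simp add: Q_def poly_0_coeff_0)
  next
   case (Suc j) thus ?thesis using arg_cong[OF mpP, of "%p. coeff p i"] \<open>coeff P i \<in> M\<close> by (simp add: Q_def)
  qed
 qed
 moreover have "poly Q a = ta (- ?p0) - (- ?p0)"
 proof -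
  have "ta ?p0 = ?p0 + poly Q (- a)" using poly_mp[of P 0] val[of 0] by simp
  moreover have "poly Q (- a) = - poly Q a" using Qadd[of a "- a"] Qadd[of 0 0] by (simp add: eq_neg_iff_add_eq_0 add.commute)
  ultimately show ?thesis by (simp add: tau_minus)
 qed
 moreover have "- ?p0 \<in> M" by (intro subfld_uminus[OF sM] poly_in_subfld[OF sM] P' subfld_0[OF sM])
 ultimately show ?thesis using dQ Qadd by blast
qed

end

section \<open>Additive equations over a weighted extension\<close>

text \<open>Products of a power of Om and elements of Y. The exponent of Om, at least d, may be negative; the
 total weight, in which Om counts 1, is at most T. So a power of Om uses up weight available to Y.\<close>

definition wgens :: "'a::field => 'a set => ('a => nat) => int => int => 'a set" where
 "wgens Om Y wt d T = {Om powi d' * x | d' x. d <= d' & d' <= T & x \<in> wprods Y wt (nat (T - d'))}"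

locale weighted_span =
 fixes ka :: "'a::field set" and Om :: 'a and Y :: "'a set" and wt :: "'a => nat"
 assumes kap_subfld: "subfld ka" and Om_nonzero: "Om ~= 0"
begin

lemma kap_subrng: "subrng ka" by (rule subfld_subrng[OF kap_subfld])

abbreviation "gens \<equiv> wgens Om Y wt"
abbreviation "F d T \<equiv> lspan ka (gens d T)"

lemma gensI: "d <= d' ==> d' <= T ==> x \<in> wprods Y wt (nat (T - d')) ==> Om powi d' * x \<in> gens d T"
 by (auto simp: wgens_def)

lemma gens_mono: "d' <= d ==> T <= T' ==> gens d T \<subseteq> gens d' T'"
proof
 fix e assume le: "d' <= d" "T <= T'" "e \<in> gens d T"
 then obtain k x where "d <= k" "k <= T" "x \<in> wprods Y wt (nat (T - k))" "e = Om powi k * x" by (auto simp: wgens_def)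
 moreover have "nat (T - k) <= nat (T' - k)" using le by simp
 ultimately show "e \<in> gens d' T'" using wprods_mono[OF order_refl, of "nat (T - k)" "nat (T' - k)" Y wt] le by (auto intro!: gensI)
qed

lemma F_mono: "d' <= d ==> T <= T' ==> x \<in> F d T ==> x \<in> F d' T'" using lspan_mono[OF gens_mono] by blast

lemma gens_mult: "x \<in> gens d T ==> y \<in> gens d' T' ==> x * y \<in> gens (d + d') (T + T')"
proof -
 assume "x \<in> gens d T" "y \<in> gens d' T'"
 then obtain k z k' z' where k: "d <= k" "k <= T" "z \<in> wprods Y wt (nat (T - k))" "x = Om powi k * z"
  "d' <= k'" "k' <= T'" "z' \<in> wprods Y wt (nat (T' - k'))" "y = Om powi k' * z'" by (auto simp: wgens_def)
 have "x * y = Om powi (k + k') * (z * z')" using Om_nonzero k by (simp add: power_int_add mult_ac)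
 moreover have "nat (T + T' - (k + k')) = nat (T - k) + nat (T' - k')" using k by simp
 moreover have "Om powi (k + k') * (z * z') \<in> gens (d + d') (T + T')"
  by (rule gensI) (use k wprods_mult[OF k(3,7)] calculation(2) in simp_all)
 ultimately show ?thesis by simp
qed

lemma F_mult: "x \<in> F d T ==> y \<in> F d' T' ==> x * y \<in> F (d + d') (T + T')"
 by (rule lspan_mult[OF kap_subrng gens_mult])

lemmas F_intros = lspan_add lspan_diff[OF kap_subrng] lspan_cmult[OF kap_subrng] lspan_uminus[OF kap_subrng]

lemma F_base: "x \<in> gens d T ==> x \<in> F d T" by (rule lspan_base[OF kap_subrng])

lemma F_wprods: "x \<in> wprods Y wt n ==> x \<in> F 0 (int n)" using gensI[of 0 0 "int n" x] by (intro F_base) simp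

lemma Om_F: "Om powi d \<in> F d d" using gensI[of d d d 1] wprods_1[of Y wt 0] by (intro F_base) simp

end

text \<open>\<tau> multiplies Om by s and changes y \<in> Y by terms divisible by Om of no larger weight.
 Hence \<tau> preserves the filtration F, and modulo F (d + 1) it acts on the generators with
 exponent d as multiplication by s powi d (\<open>tau_gens\<close>).\<close>

locale weighted_base = difference_field ta + weighted_span ka Om Y wt
 for ta :: "'a::field => 'a" and ka :: "'a set" and Om :: 'a and Y :: "'a set" and wt :: "'a => nat" +
 fixes s :: 'a
 assumes kap: "stable ka" and s: "s \<in> ka" and Om: "ta Om = s * Om"
  and tau_Y: "!!y. y \<in> Y ==> ta y - y \<in> F 1 (int (wt y))"
begin

lemma tau_wprods: "x \<in> wprods Y wt n ==> ta x - x \<in> F 1 (int n)"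
proof -
 assume "x \<in> wprods Y wt n"
 then obtain gs where gs: "set gs \<subseteq> Y" "sum_list (map wt gs) <= n" "x = prod_list gs" by (auto simp: wprods_def)
 have "ta (prod_list gs) - prod_list gs \<in> F 1 (int (sum_list (map wt gs)))" using gs(1)
 proof (induction gs)
  case Nil thus ?case by (simp add: lspan_0)
 next
  case (Cons g gs)
  let ?p = "prod_list gs" and ?n = "sum_list (map wt gs)"
  have g: "ta g - g \<in> F 1 (int (wt g))" using tau_Y[of g] Cons.prems by simp
  have p: "?p \<in> F 0 (int ?n)" using Cons.prems by (intro F_wprods) (auto simp: wprods_def)
  have "g \<in> F 0 (int (wt g))" using Cons.prems by (intro F_wprods wprods_gen) auto
  hence "ta g \<in> F 0 (int (wt g))" using F_intros(1)[OF F_mono[OF _ order_refl g, of 0], of g] by simp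
  from F_mult[OF this Cons.IH] F_mult[OF g p] Cons.prems
  have "ta g * (ta ?p - ?p) + (ta g - g) * ?p \<in> F 1 (int (wt g) + int ?n)" by (intro lspan_add) auto
  thus ?case by (simp add: tau_mult algebra_simps)
 qed
 thus ?thesis using F_mono[of 1 1 "int (sum_list (map wt gs))" "int n"] gs by simp
qed

lemma tau_gens:
 assumes "x \<in> wprods Y wt (nat (T - d))" "d <= T"
 shows "ta (Om powi d * x) - s powi d * (Om powi d * x) \<in> F (d + 1) T"
proof -
 have "Om powi d * (ta x - x) \<in> F (d + 1) (d + int (nat (T - d)))" by (rule F_mult[OF Om_F tau_wprods[OF assms(1)]])
 hence "s powi d * (Om powi d * (ta x - x)) \<in> F (d + 1) T" using assms(2)
  by (intro lspan_cmult[OF kap_subrng subfld_powi[OF kap_subfld s]]) simp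
 thus ?thesis by (simp add: tau_mult tau_powi Om power_int_mult_distrib algebra_simps)
qed

lemma tau_F: assumes "x \<in> F d T" shows "ta x \<in> F d T"
proof (rule lspan_hom[OF assms])
 fix c e assume c: "c \<in> ka" "e \<in> gens d T"
 then obtain k x where k: "d <= k" "k <= T" "x \<in> wprods Y wt (nat (T - k))" "e = Om powi k * x" by (auto simp: wgens_def)
 have "ta e - s powi k * e \<in> F d T" using F_mono[OF _ order_refl tau_gens[OF k(3,2)], of d] k by simp
 moreover have "s powi k * e \<in> F d T" using c by (intro F_intros subfld_powi[OF kap_subfld] s F_base)
 ultimately have "(ta e - s powi k * e) + s powi k * e \<in> F d T" by (rule F_intros)
 thus "ta (c * e) \<in> F d T" using c stableD(2)[OF kap] by (simp add: tau_mult F_intros)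
qed (auto simp: tau_add)

end

text \<open>\<open>no_character\<close> separates the eigenvalues s powi d for different d over ka, and
 \<open>fixed\<close> says that the extension has no new constants.\<close>

locale weighted_extension = weighted_base +
 assumes Y: "finite Y" "!!y. y \<in> Y ==> wt y >= 1"
  and no_character: "!!a d. a \<in> ka ==> d ~= 0 ==> ta a = s powi d * a ==> a = 0"
  and fixed: "!!c. c \<in> adjoin ka (insert Om Y) ==> ta c = c ==> c \<in> ka"
begin

text \<open>Generators on which \<tau> is triangular, with eigenvalues s powi d; P e d records what else is
 known about the step at which e is added.\<close>

inductive flag :: "('a => int => bool) => 'a set => 'a set => bool" for P B where
 flag_base: "flag P B B"
| flag_insert: "flag P B S ==> P e d ==> ta e - s powi d * e \<in> lspan ka S ==> flag P B (insert e S)"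

lemma flag_sub: "flag P B S ==> B \<subseteq> S" by (induction rule: flag.induct) auto

lemma flag_add_finite:
 assumes "finite A" "flag P B S" "!!e. e \<in> A ==> P e d" "!!e. e \<in> A ==> ta e - s powi d * e \<in> lspan ka S"
 shows "flag P B (S Un A)" using assms(1,3,4)
proof induction
 case (insert e A)
 have "ta e - s powi d * e \<in> lspan ka (S Un A)" using insert.prems(2)[of e] lspan_mono[of S "S Un A" ka] by auto
 thus ?case using flag_insert[of P B "S Un A" e d] insert by simp
qed (use assms(2) in simp)

lemma lspan_insert:
 assumes "x \<in> lspan ka (insert e S)" obtains c v where "c \<in> ka" "v \<in> lspan ka S" "x = v + c * e"
proof -
 have "\<exists>c\<in>ka. \<exists>v\<in>lspan ka S. x = v + c * e" using assms
 proof induction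
  case lspan_0 thus ?case using subfld_0[OF kap_subfld] lspan.lspan_0 by (intro bexI[of _ 0]) auto
 next
  case (lspan_step x c' s')
  then obtain c v where cv: "c \<in> ka" "v \<in> lspan ka S" "x = v + c * e" by auto
  show ?case
  proof (cases "s' = e")
   case True
   thus ?thesis using cv lspan_step.hyps subfld_add[OF kap_subfld]
    by (intro bexI[of _ "c + c'"] bexI[of _ v]) (auto simp: algebra_simps)
  next
   case False
   hence "v + c' * s' \<in> lspan ka S" using cv lspan_step.hyps by (auto intro: lspan.lspan_step)
   thus ?thesis using cv by (intro bexI[of _ c] bexI[of _ "v + c' * s'"]) auto
  qed
 qed
 thus ?thesis using that by blast
qed

lemma gens_step: "d <= T ==> gens d T = gens (d + 1) T Un (%x. Om powi d * x) ` wprods Y wt (nat (T - d))"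
proof (intro equalityI subsetI)
 fix e assume "e \<in> gens d T"
 then obtain k x where "d <= k" "k <= T" "x \<in> wprods Y wt (nat (T - k))" "e = Om powi k * x" by (auto simp: wgens_def)
 thus "e \<in> gens (d + 1) T Un (%x. Om powi d * x) ` wprods Y wt (nat (T - d))"
  by (cases "k = d") (auto intro!: gensI)
qed (use gens_mono[of d "d + 1" T T] in "auto intro!: gensI")

lemma gens_empty: "d > T ==> gens d T = {}" by (auto simp: wgens_def)

lemma flag_gens:
 assumes "flag P B (gens d1 T)" "d1 <= T + 1" "d <= d1"
  "!!e k. d <= k ==> k < d1 ==> ta e - s powi k * e \<in> F (k + 1) T ==> P e k"
 shows "flag P B (gens d T)"
proof -
 have "flag P B (gens (d1 - int n) T)" if "int n <= d1 - d" for n using that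
 proof (induction n)
  case 0 thus ?case using assms(1) by simp
 next
  case (Suc n)
  let ?k = "d1 - int (Suc n)"
  have k: "?k + 1 = d1 - int n" "?k <= T" "?k < d1" "d <= ?k" using Suc.prems assms(2) by auto
  have e: "ta e - s powi ?k * e \<in> F (?k + 1) T" if "e \<in> (%x. Om powi ?k * x) ` wprods Y wt (nat (T - ?k))" for e
   using that tau_gens[OF _ k(2)] by blast
  have "flag P B (gens (?k + 1) T)" using Suc k(1) by simp
  moreover have "finite ((%x. Om powi ?k * x) ` wprods Y wt (nat (T - ?k)))" by (intro finite_imageI wprods_finite Y)
  ultimately show ?case unfolding gens_step[OF k(2)] by (intro flag_add_finite) (use assms(4)[OF k(4,3) e] e in blast)+
 qed
 from this[of "nat (d1 - d)"] show ?thesis using assms(3) by simp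
qed

lemma lspan_stable: "x \<in> lspan ka S ==> (!!e. e \<in> S ==> ta e \<in> lspan ka S) ==> ta x \<in> lspan ka S"
 by (erule lspan_hom) (auto simp: tau_add tau_mult intro!: lspan_cmult[OF kap_subrng] stableD(2)[OF kap])

lemma flag_stable:
 assumes "flag P B S" "!!x. x \<in> lspan ka B ==> ta x \<in> lspan ka B" "x \<in> lspan ka S" shows "ta x \<in> lspan ka S"
 using assms(1,3)
proof (induction arbitrary: x)
 case (flag_insert S e d)
 have sub: "lspan ka S \<subseteq> lspan ka (insert e S)" by (rule lspan_mono) auto
 show ?case
 proof (rule lspan_stable[OF flag_insert.prems])
  fix e' assume e': "e' \<in> insert e S"
  have "(ta e - s powi d * e) + s powi d * e \<in> lspan ka (insert e S)"
   using flag_insert.hyps(3) sub by (intro lspan_add lspan_scale subfld_powi[OF kap_subfld s]) auto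
  moreover have "ta e' \<in> lspan ka (insert e S)" if "e' \<in> S"
   using flag_insert.IH[OF lspan_base[OF kap_subrng that]] sub by blast
  ultimately show "ta e' \<in> lspan ka (insert e S)" using e' by auto
 qed
qed (use assms(2) in simp)

lemma lspan_empty: "x \<in> lspan ka {} ==> x = 0" by (induction rule: lspan.induct) auto

text \<open>Normalise b to have coefficient 1 at the last generator e. Then \<open>\<tau> b - s^d b\<close>
 lies in the span of the previous generators, so either it is zero or the induction hypothesis
 applies to it.\<close>

lemma eigenvector:
 assumes "flag P {} S" and "b \<in> J \<inter> lspan ka S" "b ~= 0"
  and J: "!!x. x \<in> J ==> ta x \<in> J" "!!x y. x \<in> J ==> y \<in> J ==> x - y \<in> J" "!!c x. c \<in> ka ==> x \<in> J ==> c * x \<in> J"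
 shows "\<exists>b'\<in>J. b' ~= 0 & (\<exists>d. ta b' = s powi d * b')" using assms(1-3)
proof (induction arbitrary: b)
 case flag_base
 thus ?case using lspan_empty[of b] by simp
next
 case (flag_insert S e d)
 obtain c v where cv: "c \<in> ka" "v \<in> lspan ka S" "b = v + c * e" using lspan_insert flag_insert.prems(1) by blast
 show ?case
 proof (cases "c = 0")
  case True thus ?thesis using flag_insert.IH[of b] flag_insert.prems cv by simp
 next
  case False
  let ?b = "inverse c * b" and ?v = "inverse c * v"
  have c': "inverse c \<in> ka" by (rule subfld_inverse[OF kap_subfld cv(1)])
  have b: "?b \<in> J" "?b ~= 0" using flag_insert.prems J(3)[OF c'] False by auto
  have b3: "?b = ?v + e" using False by (simp add: cv(3) distrib_left)
  have sd: "s powi d \<in> ka" by (rule subfld_powi[OF kap_subfld s])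
  let ?z = "ta ?b - s powi d * ?b"
  have "?z \<in> J" by (intro J sd b(1))
  have v: "?v \<in> lspan ka S" by (rule lspan_cmult[OF kap_subrng c' cv(2)])
  have "?z = (ta ?v - s powi d * ?v) + (ta e - s powi d * e)" unfolding b3 by (simp add: tau_add algebra_simps)
  moreover have "ta ?v \<in> lspan ka S" by (rule flag_stable[OF flag_insert.hyps(1) _ v]) (auto dest!: lspan_empty intro: lspan_0)
  ultimately have "?z \<in> lspan ka S" using flag_insert.hyps(3) v sd by (auto intro!: lspan_add lspan_diff[OF kap_subrng] lspan_cmult[OF kap_subrng])
  show ?thesis
  proof (cases "?z = 0")
   case True thus ?thesis using b by (intro bexI[of _ ?b]) auto
  next
   case False thus ?thesis using flag_insert.IH[of ?z] \<open>?z \<in> J\<close> \<open>?z \<in> lspan ka S\<close> by blast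
  qed
 qed
qed

text \<open>1 has eigenvalue 1, while on F 1 only eigenvalues s powi d with d >= 1 occur. If 1 involves the
 last generator e with coefficient c, either \<open>\<tau> c * s^d = c\<close>, which
 \<open>no_character\<close> forbids, or e can be eliminated.\<close>

lemma one_not_positive: "1 \<notin> F 1 T"
proof
 assume 1: "1 \<in> F 1 T"
 have "flag (%_ d. d >= 1) {} (gens 1 T)" if "T >= 1"
  by (rule flag_gens[of _ _ "T + 1"]) (use that in "auto simp: gens_empty flag_base")
 moreover have "T >= 1" using 1 lspan_empty[of 1] gens_empty[of T 1] by (metis not_le zero_neq_one)
 ultimately have "flag (%_ d. d >= 1) {} (gens 1 T)" by simp
 moreover have "1 \<notin> lspan ka S" if "flag (%_ d. d >= 1) {} S" for S using that
 proof induction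
  case flag_base thus ?case using lspan_empty[of 1] by auto
 next
  case (flag_insert S e d)
  show ?case
  proof
   assume "1 \<in> lspan ka (insert e S)"
   then obtain c v where cv: "c \<in> ka" "v \<in> lspan ka S" "1 = v + c * e" using lspan_insert by blast
   have v': "ta v \<in> lspan ka S" by (rule flag_stable[OF flag_insert.hyps(1) _ cv(2)]) (auto dest!: lspan_empty intro: lspan_0)
   let ?a = "ta c * s powi d - c"
   have sd: "s powi d \<in> ka" by (rule subfld_powi[OF kap_subfld s])
   have a: "?a \<in> ka" by (intro subfld_diff[OF kap_subfld] subfld_mult[OF kap_subfld] stableD(2)[OF kap] sd cv(1))
   have "1 = ta v + ta c * ta e" using arg_cong[OF cv(3), of ta] by (simp add: tau_add tau_mult)
   hence "?a * e = v - ta v - ta c * (ta e - s powi d * e)" using cv(3) by (simp add: algebra_simps)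
   also have "... \<in> lspan ka S"
    by (intro lspan_diff[OF kap_subrng] lspan_cmult[OF kap_subrng] cv v' flag_insert.hyps stableD(2)[OF kap])
   finally have ae: "?a * e \<in> lspan ka S" .
   show False
   proof (cases "?a = 0")
    case True
    show False
    proof (cases "c = 0")
     case True thus False using cv(2,3) flag_insert.IH by simp
    next
     case False
     hence "ta (inverse c) = s powi d * inverse c" using \<open>?a = 0\<close> unfolding tau_inverse by (simp add: field_simps)
     thus False using no_character[of "inverse c" d] subfld_inverse[OF kap_subfld cv(1)] flag_insert.hyps(2) False by simp
    qed
   next
    case False
    have "c * inverse ?a * (?a * e) \<in> lspan ka S"
     by (intro lspan_cmult[OF kap_subrng] ae subfld_mult[OF kap_subfld] subfld_inverse[OF kap_subfld] a cv(1))
    moreover have "c * inverse ?a * (?a * e) = c * e" using False by (simp add: mult.assoc[symmetric])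
    ultimately have "1 \<in> lspan ka S" using lspan_add[OF cv(2)] cv(3) by metis
    thus False using flag_insert.IH by simp
   qed
  qed
 qed
 ultimately show False using 1 by blast
qed

text \<open>The generators with exponent d < 0 are removed from g by \<open>no_character\<close>; those with
 d = 0 can only have constant coefficients, and subtracting them changes \<tau> g - g by an
 element of F 1. What remains is c plus an element of F 1, and \<open>one_not_positive\<close>
 compares the parts in ka.\<close>

lemma level_zero:
 assumes "flag (%e d. d < 0 \<or> d = 0 & ta e - e \<in> F 1 T) (gens 1 T) S"
  and "g \<in> lspan ka (insert 1 S)" "ta g - g - r \<in> F 1 T" and r: "r \<in> ka"
 shows "\<exists>c\<in>ka. ta c - c = r" using assms(1-3)
proof (induction arbitrary: g)
 case flag_base
 obtain c v where cv: "c \<in> ka" "v \<in> F 1 T" "g = v + c * 1" using lspan_insert flag_base.prems(1) by blast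
 let ?a = "ta c - c - r"
 have a: "?a \<in> ka" by (intro subfld_diff[OF kap_subfld] stableD(2)[OF kap] cv(1) r)
 have "?a = (ta g - g - r) - (ta v - v)" unfolding cv(3) by (simp add: tau_add)
 also have "... \<in> F 1 T" by (intro lspan_diff[OF kap_subrng] flag_base.prems tau_F cv)
 finally have "inverse ?a * ?a \<in> F 1 T" by (intro lspan_cmult[OF kap_subrng] subfld_inverse[OF kap_subfld] a)
 hence "?a = 0" using one_not_positive[of T] by (cases "?a = 0") auto
 thus ?case using cv(1) by (intro bexI[of _ c]) auto
next
 case (flag_insert S e d)
 let ?V = "lspan ka (insert 1 S)"
 have sub: "lspan ka S \<subseteq> ?V" by (rule lspan_mono) auto
 have "g \<in> lspan ka (insert e (insert 1 S))" using flag_insert.prems(1) by (simp add: insert_commute)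
 then obtain c v where cv: "c \<in> ka" "v \<in> ?V" "g = v + c * e" using lspan_insert by blast
 have FS: "F 1 T \<subseteq> ?V" using flag_sub[OF flag_insert.hyps(1)] lspan_mono[of "gens 1 T" "insert 1 S"] by blast
 have v': "ta v \<in> ?V"
 proof (rule lspan_stable[OF cv(2)])
  fix e' assume "e' \<in> insert 1 S"
  moreover have "ta e' \<in> ?V" if "e' \<in> S"
   using flag_stable[OF flag_insert.hyps(1) tau_F lspan_base[OF kap_subrng that]] sub by blast
  ultimately show "ta e' \<in> ?V" using lspan_base[OF kap_subrng, of 1 "insert 1 S"] by auto
 qed
 have "r * 1 \<in> ?V" using r by (intro lspan_scale) auto
 hence r': "r \<in> ?V" by simp
 have sd: "s powi d \<in> ka" by (rule subfld_powi[OF kap_subfld s])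
 let ?a = "ta c * s powi d - c"
 have a: "?a \<in> ka" by (intro subfld_diff[OF kap_subfld] subfld_mult[OF kap_subfld] stableD(2)[OF kap] sd cv(1))
 have "?a * e = (ta g - g - r) + r + v - ta v - ta c * (ta e - s powi d * e)"
  unfolding cv(3) by (simp add: tau_add tau_mult algebra_simps)
 also have "... \<in> ?V"
  by (intro lspan_diff[OF kap_subrng] lspan_add lspan_cmult[OF kap_subrng] cv v' r' subsetD[OF sub flag_insert.hyps(3)] stableD(2)[OF kap] subsetD[OF FS flag_insert.prems(2)])
 finally have ae: "?a * e \<in> ?V" .
 show ?case
 proof (cases "?a = 0")
  case False
  have "c * inverse ?a * (?a * e) \<in> ?V"
   by (intro lspan_cmult[OF kap_subrng] ae subfld_mult[OF kap_subfld] subfld_inverse[OF kap_subfld] a cv(1))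
  moreover have "c * inverse ?a * (?a * e) = c * e" using False by (simp add: mult.assoc[symmetric])
  ultimately have "g \<in> ?V" using lspan_add[OF cv(2)] cv(3) by metis
  thus ?thesis using flag_insert.IH flag_insert.prems(2) by blast
 next
  case True
  show ?thesis
  proof (cases "c = 0")
   case True thus ?thesis using flag_insert.IH[OF _ flag_insert.prems(2)] cv by simp
  next
   case False
   hence "ta (inverse c) = s powi d * inverse c" using True unfolding tau_inverse by (simp add: field_simps)
   hence d: "d = 0" using no_character[of "inverse c" d] subfld_inverse[OF kap_subfld cv(1)] False by auto
   hence fc: "ta c = c" using True by simp
   have "c * (ta e - e) \<in> F 1 T" using flag_insert.hyps(2) d cv(1) by (intro lspan_cmult[OF kap_subrng]) auto
   hence "(ta g - g - r) - c * (ta e - e) \<in> F 1 T" by (intro lspan_diff[OF kap_subrng] flag_insert.prems(2))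
   moreover have "(ta g - g - r) - c * (ta e - e) = ta v - v - r" unfolding cv(3) by (simp add: tau_add tau_mult fc algebra_simps)
   ultimately show ?thesis using flag_insert.IH[OF cv(2)] by simp
  qed
 qed
qed

text \<open>The ring generated over ka by Om, its inverse and Y.\<close>

definition S :: "'a set" where "S = (\<Union>d T. F d T)"

lemma subrng_S: "subrng S" and kap_S: "ka \<subseteq> S" and S_gens: "Om powi d \<in> S" "y \<in> Y ==> y \<in> S" and tau_S: "x \<in> S ==> ta x \<in> S"
proof -
 show "Om powi d \<in> S" "y \<in> Y ==> y \<in> S" "x \<in> S ==> ta x \<in> S"
  using Om_F[of d] F_wprods[OF wprods_gen[OF _ order_refl], of y] tau_F unfolding S_def by blast+
 show sub: "ka \<subseteq> S"
 proof
  fix c assume "c \<in> ka"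
  from lspan_cmult[OF kap_subrng this Om_F[of 0]] show "c \<in> S" by (auto simp: S_def)
 qed
 have "x + y \<in> S & x * y \<in> S & - x \<in> S" if xy: "x \<in> S" "y \<in> S" for x y
 proof -
  obtain d T d' T' where xF: "x \<in> F d T" and yF: "y \<in> F d' T'" using xy by (auto simp: S_def)
  have "x \<in> F (min d d') (max T T')" by (rule F_mono[OF _ _ xF]) auto
  moreover have "y \<in> F (min d d') (max T T')" by (rule F_mono[OF _ _ yF]) auto
  ultimately have "x + y \<in> F (min d d') (max T T')" by (rule lspan_add)
  moreover have "x * y \<in> F (d + d') (T + T')" by (rule F_mult[OF xF yF])
  moreover have "- x \<in> F d T" by (rule lspan_uminus[OF kap_subrng xF])
  ultimately show ?thesis unfolding S_def by blast
 qed
 thus "subrng S" using sub subfld_0[OF kap_subfld] subfld_1[OF kap_subfld] by (auto simp: subrng_def)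
qed

lemma S_adjoin: "S \<subseteq> adjoin ka (insert Om Y)"
proof
 note A = subfld_intros[OF subfld_adjoin[of ka "insert Om Y"]]
 fix z assume "z \<in> S"
 then obtain d T where "z \<in> F d T" by (auto simp: S_def)
 thus "z \<in> adjoin ka (insert Om Y)"
 proof induction
  case (lspan_step x c e)
  then obtain k gs where gs: "set gs \<subseteq> Y" "e = Om powi k * prod_list gs" by (auto simp: wgens_def wprods_def)
  have "prod_list gs \<in> adjoin ka (insert Om Y)" using gs(1) by (induction gs) (auto intro!: A intro: adjoin_gen)
  thus ?case using lspan_step unfolding gs(2) by (auto intro!: A(3,4,12) intro: adjoin_gen adjoin_base)
 qed (rule A)
qed

lemma stable_extension: "stable (adjoin ka (insert Om Y))"
proof (rule stable_adjoin)
 fix x assume "x \<in> ka" thus "ta x \<in> adjoin ka (insert Om Y)" using stableD(2)[OF kap] adjoin_base by blast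
next
 fix x assume "x \<in> insert Om Y"
 hence "x \<in> S" using S_gens(1)[of 1] S_gens(2) by auto
 thus "ta x \<in> adjoin ka (insert Om Y)" using tau_S S_adjoin by blast
qed

text \<open>The denominators b \<in> S with b * g \<in> S form a \<tau>-stable ideal, so there is one with
 \<open>\<tau> b = s^k b\<close>. Then \<open>b / Om^k\<close> is fixed by \<tau> and lies in ka.
 Hence b is a unit and g \<in> S, where \<open>level_zero\<close> applies.\<close>

theorem descent:
 assumes g: "g \<in> adjoin ka (insert Om Y)" and r: "r \<in> ka" "ta g - g = r"
 shows "\<exists>f\<in>ka. ta f - f = r"
proof -
 note R = subrngD[OF subrng_S]
 have gr: "gen_ring ka (insert Om Y) \<subseteq> S"
 proof
  fix x assume "x \<in> gen_ring ka (insert Om Y)"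
  then obtain n where "x \<in> lspan ka (wprods (insert Om Y) (%_. 1) n)" using gen_ring_wspan[OF kap_subfld] by (auto simp: wspan_def)
  thus "x \<in> S"
  proof induction
   case (lspan_step x c e)
   then obtain gs where gs: "set gs \<subseteq> insert Om Y" "e = prod_list gs" by (auto simp: wprods_def)
   have "prod_list gs \<in> S" using gs(1) by (induction gs) (use R S_gens(1)[of 1] S_gens(2) in auto)
   thus ?case using lspan_step R kap_S gs(2) by auto
  qed (rule R)
 qed
 obtain x y where xy: "x \<in> S" "y \<in> S" "y ~= 0" "g = x / y"
  using g gr adjoin_iff_gen_ring[OF kap_subfld] by blast
 let ?J = "{b \<in> S. b * g \<in> S}"
 obtain d T where y: "y \<in> F d T" using xy(2) by (auto simp: S_def)
 have "flag (%_ _. True) {} (gens (min d (T + 1)) T)" by (rule flag_gens[of _ _ "T + 1"]) (auto simp: gens_empty flag_base)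
 moreover have "y \<in> ?J \<inter> F (min d (T + 1)) T" using xy y F_mono[of "min d (T + 1)" d T T] by auto
 moreover have "ta b \<in> ?J" if "b \<in> ?J" for b
 proof -
  have eq: "ta b * g = ta (b * g) + - (r * ta b)" using r(2) by (auto simp: tau_mult algebra_simps)
  have "ta (b * g) \<in> S" "ta b \<in> S" using that tau_S by auto
  moreover have "r \<in> S" using r(1) kap_S by auto
  ultimately have "ta (b * g) + - (r * ta b) \<in> S" by (intro R(3-5))
  thus ?thesis using \<open>ta b \<in> S\<close> eq by simp
 qed
 moreover have "x - y \<in> ?J" if "x \<in> ?J" "y \<in> ?J" for x y
  using that R(3)[of x "- y"] R(3)[of "x * g" "- (y * g)"] R(5)[of y] R(5)[of "y * g"] by (simp add: left_diff_distrib)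
 moreover have "c * x \<in> ?J" if "c \<in> ka" "x \<in> ?J" for c x
  using that R(4)[of c x] R(4)[of c "x * g"] kap_S by (auto simp: mult.assoc)
 ultimately obtain b k where b: "b \<in> ?J" "b ~= 0" "ta b = s powi k * b"
  using eigenvector[of "%_ _. True" "gens (min d (T + 1)) T" y ?J] xy(3) by blast
 let ?c = "b / Om powi k"
 note A = subfld_intros[OF subfld_adjoin[of ka "insert Om Y"]]
 note SA = S_adjoin
 from SA have "?c \<in> adjoin ka (insert Om Y)" using b(1) by (intro A) (auto intro: adjoin_gen)
 moreover have "s ~= 0" using Om Om_nonzero tau_eq_0[of Om] by auto
 hence "ta ?c = ?c" using b(3) Om Om_nonzero by (simp add: tau_divide tau_powi power_int_mult_distrib)
 ultimately have c: "?c \<in> ka" by (rule fixed)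
 have "inverse ?c * (Om powi (- k) * (b * g)) \<in> S"
  by (rule R(4)[OF subsetD[OF kap_S subfld_inverse[OF kap_subfld c]] R(4)[OF S_gens(1)]]) (use b(1) in simp)
 moreover have "inverse ?c * (Om powi (- k) * (b * g)) = g" using b(2) Om_nonzero by (simp add: power_int_minus field_simps)
 ultimately have "g \<in> S" by simp
 then obtain d T where "g \<in> F d T" by (auto simp: S_def)
 hence g: "g \<in> F (min d 1) (max T 1)" by (rule F_mono[rotated 2]) auto
 have "flag (%e d. d < 0 \<or> d = 0 & ta e - e \<in> F 1 (max T 1)) (gens 1 (max T 1)) (gens (min d 1) (max T 1))"
 proof (rule flag_gens[of _ _ 1])
  fix e k assume "min d 1 <= k" "k < 1" "ta e - s powi k * e \<in> F (k + 1) (max T 1)"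
  thus "k < 0 \<or> k = 0 & ta e - e \<in> F 1 (max T 1)" by (cases "k = 0") auto
 qed (auto intro: flag_base)
 moreover have "g \<in> lspan ka (insert 1 (gens (min d 1) (max T 1)))" using g lspan_mono[OF subset_insertI] by blast
 moreover have "ta g - g - r \<in> F 1 (max T 1)" using r(2) by (simp add: lspan_0)
 ultimately show ?thesis using level_zero r(1) by blast
qed

end

section \<open>Twists of Laurent series and their constants\<close>

context carlitz_field begin

definition twl :: "nat => 'c fls => 'c fls" where "twl n f = Abs_fls (%i. (fls_nth f i) ^ q ^ n)"

lemma twl_nth [simp]: "fls_nth (twl n f) i = (fls_nth f i) ^ q ^ n"
proof -
 have "\<exists>N. \<forall>i<N. (fls_nth f i) ^ q ^ n = 0" by (rule exI[of _ "fls_subdegree f"]) simp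
 thus ?thesis unfolding twl_def by (rule nth_Abs_fls_ex_lower_bound)
qed

lemma twl_fps: "twl n (fps_to_fls f) = fps_to_fls (tw n f)" by (rule fls_eqI) simp

lemma twl_shift: "twl n (fls_shift k f) = fls_shift k (twl n f)" by (rule fls_eqI) simp

lemma twl_mult: "twl n (f * g) = twl n f * twl n g"
proof -
 have *: "twl n (fls_shift k (fps_to_fls a) * fls_shift m (fps_to_fls b)) = twl n (fls_shift k (fps_to_fls a)) * twl n (fls_shift m (fps_to_fls b))"
  for k m a b by (simp add: twl_shift twl_fps fls_shifted_times_simps tw_mult fls_times_fps_to_fls[symmetric])
 show ?thesis using *[of "- fls_subdegree f" "fls_base_factor_to_fps f" "- fls_subdegree g" "fls_base_factor_to_fps g"]
  by (simp only: fls_conv_base_factor_to_fps_shift_subdegree[symmetric])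
qed

lemma difference_field_twl: "difference_field (twl n)"
proof
 show "twl n 1 = 1" using twl_fps[of n 1] by simp
qed (simp_all add: twl_mult fls_eq_iff frob_add_pow)

lemma twl_twl: "twl m (twl n f) = twl (m + n) f"
 by (rule fls_eqI) (simp add: power_mult[symmetric] power_add[symmetric] mult.commute)

lemma twl_em: "twl n (em p) = em (twp n p)" by (simp add: em_def twl_fps fps_of_poly_twp)

lemma twl_k0: assumes "x \<in> k0" shows "twl n x \<in> k0"
proof -
 interpret difference_field "twl n" by (rule difference_field_twl)
 obtain a b where "x = em a / em b" "a \<in> polys Kb" "b \<in> polys Kb" "b ~= 0" using assms by (rule k0E)
 thus ?thesis using k0I[OF twp_Kb twp_Kb, of a b n n] by (simp add: tau_divide twl_em)
qed

lemma stable_k0: "difference_field.stable (twl n) k0"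
 using subfld_k0 twl_k0 by (auto simp: difference_field.stable_def[OF difference_field_twl])

lemma constants_infinite: "infinite {c \<in> k0. twl n c = c}"
proof -
 have "range (%k. em (monom 1 k)) \<subseteq> {c \<in> k0. twl n c = c}"
  by (auto intro!: em_k0 polys_monom[OF subfld_Kb] subfld_1[OF subfld_Kb] poly_eqI simp: twl_em coeff_monom when_def)
 moreover have "inj (%k. em (monom 1 k :: 'c poly))" by (auto simp: inj_def monom_eq_iff')
 ultimately show ?thesis using finite_subset range_inj_infinite by blast
qed

text \<open>Functions meromorphic on all of \<open>C_\<infinity>\<close>, through their expansions at 0.\<close>

definition merom :: "'c fls set" where
 "merom = {fps_to_fls f / fps_to_fls g | f g. entire f & entire g & g ~= 0}"

lemma meromI: "entire f ==> entire g ==> g ~= 0 ==> fps_to_fls f / fps_to_fls g \<in> merom" by (auto simp: merom_def)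

lemma merom_entire: "entire f ==> fps_to_fls f \<in> merom" using meromI[of f 1] by simp

lemma subfld_merom: "subfld merom"
proof (rule subfldI)
 fix x y assume "x \<in> merom" "y \<in> merom"
 then obtain f g f' g' where e: "x = fps_to_fls f / fps_to_fls g" "entire f" "entire g" "g ~= 0"
  "y = fps_to_fls f' / fps_to_fls g'" "entire f'" "entire g'" "g' ~= 0" unfolding merom_def by blast
 have "x + y = fps_to_fls (f * g' + f' * g) / fps_to_fls (g * g')" "x * y = fps_to_fls (f * f') / fps_to_fls (g * g')"
  using e by (simp_all add: fls_times_fps_to_fls add_frac_eq)
 moreover have "entire (f * g' + f' * g)" "entire (f * f')" "entire (g * g')" "g * g' ~= 0"
  using e by (auto intro: entire_add entire_mult)
 ultimately show "x + y \<in> merom" "x * y \<in> merom" by (metis meromI)+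
 show "- x \<in> merom" using meromI[OF entire_uminus[OF e(2)] e(3,4)] e(1) by simp
 show "inverse x \<in> merom" if "x ~= 0" using meromI[OF e(3,2)] e(1) that by auto
qed (use merom_entire[of 0] merom_entire[of 1] in auto)

lemma k0_merom: "k0 \<subseteq> merom" unfolding k0_def by (auto simp: em_def intro!: meromI)

text \<open>Two of the finitely many possible windows of length w coincide.\<close>

lemma recurrent_sequence_periodic:
 fixes y :: "nat => 'b"
 assumes F: "finite F" "!!i. y i \<in> F"
  and det: "!!m m'. m >= m0 ==> m' >= m0 ==> (!!i. i < w ==> y (m + i) = y (m' + i)) ==> y (m + w) = y (m' + w)"
 shows "\<exists>P>0. \<exists>N. \<forall>r\<ge>N. y (r + P) = y r"
proof -
 let ?W = "%m. map (%i. y (m + i)) [0..<w]"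
 have "?W ` {m0..} \<subseteq> {xs. set xs \<subseteq> F & length xs = w}" using F by auto
 hence "finite (?W ` {m0..})" using finite_lists_length_eq[OF F(1)] finite_subset by blast
 hence "\<not> inj_on ?W {m0..}" using finite_imageD infinite_Ici by blast
 then obtain a b where "a >= m0" "b >= m0" "a ~= b" "?W a = ?W b" unfolding inj_on_def by blast
 then obtain m m' where m: "m >= m0" "m' > m" "?W m = ?W m'" by (metis nat_neq_iff)
 have "\<forall>i<w. y (m + r + i) = y (m' + r + i)" for r
 proof (induction r)
  case 0
  show ?case
  proof (intro allI impI)
   fix i assume "i < w"
   thus "y (m + 0 + i) = y (m' + 0 + i)" using arg_cong[OF m(3), of "%xs. xs ! i"] by simp
  qed
 next
  case (Suc r)
  have "y (m + r + w) = y (m' + r + w)" using Suc m by (intro det) auto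
  show ?case
  proof (intro allI impI)
   fix i assume "i < w"
   show "y (m + Suc r + i) = y (m' + Suc r + i)"
   proof (cases "Suc i = w")
    case True thus ?thesis using \<open>y (m + r + w) = y (m' + r + w)\<close> by auto
   next
    case False thus ?thesis using Suc[rule_format, of "Suc i"] \<open>i < w\<close> by simp
   qed
  qed
 qed
 hence "y (m + r + w) = y (m' + r + w)" for r using m by (intro det) auto
 hence "y (r + (m' - m)) = y r" if "r >= m + w" for r
  using that m(2) spec[of "%r. y (m + r + w) = y (m' + r + w)" "r - m - w"] by (simp add: algebra_simps)
 thus ?thesis using m(2) by (intro exI[of _ "m' - m"] conjI exI[of _ "m + w"]) auto
qed

lemma finite_frob_fixed: assumes "n >= 1" shows "finite {c::'c. c ^ q ^ n = c}" "{c. c ^ q ^ n = c} \<subseteq> Kb"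
proof -
 let ?p = "%k. monom 1 (q ^ n) - monom 1 1 :: 'c poly"
 have "q ^ n ~= 1" using assms one_less_power[OF q_gt1, of n] by auto
 hence "coeff (?p 0) 1 ~= 0" by (simp add: coeff_monom)
 hence nz: "?p 0 ~= 0" by (metis coeff_0)
 have ev: "poly (?p 0) c = 0 \<longleftrightarrow> c ^ q ^ n = c" for c by (simp add: poly_monom)
 show "finite {c::'c. c ^ q ^ n = c}" using poly_roots_finite[OF nz] ev by simp
 note A = subfld_adjoin[of FF "{th}"]
 have "?p 0 \<in> polys (adjoin FF {th})" by (intro polys_diff[OF A] polys_monom[OF A] subfld_1[OF A])
 note pA = this
 show "{c. c ^ q ^ n = c} \<subseteq> Kb"
 proof
  fix c :: 'c assume "c \<in> {c. c ^ q ^ n = c}"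
  hence "\<exists>p\<in>polys (adjoin FF {th}). p ~= 0 & poly p c = 0" using nz ev[of c] by (intro bexI[OF _ pA]) auto
  thus "c \<in> Kb" unfolding Kb_def by (simp add: algebraic_over_iff[OF A])
 qed
qed

text \<open>The coefficients of y lie in a finite field, so their differences have absolute value 0 or 1,
 while the coefficients of g and y * g tend to 0. If i0 is the first index at which
 \<open>\<bar>g_i\<bar>\<close> is maximal, then in the coefficient of y * g at m + D0 the term
 with \<open>g_i0\<close> can only be balanced by terms with later \<open>g_i\<close>. So the w
 preceding coefficients of y determine the next one, y is ultimately periodic, and it is rational.\<close>

lemma constants_power_series:
 assumes n: "n >= 1" and y: "!!i. cf y i ^ q ^ n = cf y i" and g: "entire g" "g ~= 0" and h: "entire (y * g)"
 shows "fps_to_fls y \<in> k0"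
proof -
 let ?F = "{c::'c. c ^ q ^ n = c}"
 have null: "(%i. cabs (cf f i)) ----> 0" if "entire f" for f using entire_terms_null[OF that, of 1] by simp
 obtain j where j: "cf g j ~= 0" using g(2) by (metis fps_nonzero_nth)
 have "\<forall>\<^sub>F i in sequentially. cabs (cf g i) < cabs (cf g j)" using null[OF g(1)] j by (intro order_tendstoD) auto
 then obtain N0 where N0: "!!i. i >= N0 ==> cabs (cf g i) < cabs (cf g j)" by (auto simp: eventually_sequentially)
 define M where "M = Max ((%i. cabs (cf g i)) ` {..N0 + j})"
 have "M \<in> (%i. cabs (cf g i)) ` {..N0 + j}" unfolding M_def by (intro Max_in) auto
 then obtain j1 where j1: "cabs (cf g j1) = M" by auto
 have le: "cabs (cf g i) <= M" for i
 proof (cases "i <= N0 + j")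
  case True thus ?thesis unfolding M_def by (intro Max_ge) auto
 next
  case False
  hence "cabs (cf g i) < cabs (cf g j)" by (intro N0) simp
  also have "... <= M" unfolding M_def by (intro Max_ge) auto
  finally show ?thesis by simp
 qed
 have M0: "M > 0" using le[of j] j by (metis cabs_pos less_le_trans)
 define i0 where "i0 = (LEAST i. cabs (cf g i) = M)"
 have i0: "cabs (cf g i0) = M" unfolding i0_def using j1 by (rule LeastI)
 have below: "cabs (cf g i) < M" if "i < i0" for i
  using not_less_Least[of i "%i. cabs (cf g i) = M"] that le[of i] unfolding i0_def by force
 have "\<forall>\<^sub>F i in sequentially. cabs (cf g i) < M & cabs (cf (y * g) i) < M"
  using null[OF g(1)] null[OF h] M0 by (intro eventually_conj order_tendstoD) auto
 then obtain D0 where "!!i. i >= D0 ==> cabs (cf g i) < M & cabs (cf (y * g) i) < M" by (auto simp: eventually_sequentially)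
 note D0 = this
 have i0D: "i0 < D0" using i0 D0[of i0] by (metis less_irrefl not_le)
 define w where "w = D0 - i0"
 have y1: "cabs (cf y i - cf y k) <= 1" "cf y i ~= cf y k ==> cabs (cf y i - cf y k) = 1" for i k
  using cabs_fixed[of "cf y i - cf y k" n] n y[of i] y[of k] by (cases "cf y i = cf y k"; simp add: frob_diff)+
 have det: "cf y (m + w) = cf y (m' + w)" if mm: "m >= D0" "m' >= D0" "!!i. i < w ==> cf y (m + i) = cf y (m' + i)" for m m'
 proof (rule ccontr)
  assume ne: "cf y (m + w) ~= cf y (m' + w)"
  let ?d = "%i. cf g i * (cf y (m + D0 - i) - cf y (m' + D0 - i))"
  have split: "cabs (cf (y * g) (a + D0) - (\<Sum>i\<le>D0. cf g i * cf y (a + D0 - i))) < M" for a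
  proof -
   have "cf (y * g) (a + D0) = (\<Sum>i=0..a + D0. cf g i * cf y (a + D0 - i))"
    by (simp add: mult.commute[of y] fps_mult_nth)
   also have "{0..a + D0} = {..D0} Un {D0<..a + D0}" by auto
   also have "(\<Sum>i\<in>.... cf g i * cf y (a + D0 - i)) =
     (\<Sum>i\<le>D0. cf g i * cf y (a + D0 - i)) + (\<Sum>i\<in>{D0<..a + D0}. cf g i * cf y (a + D0 - i))"
    by (rule sum.union_disjoint) auto
   moreover have "cabs (\<Sum>i\<in>{D0<..a + D0}. cf g i * cf y (a + D0 - i)) < M"
   proof (rule cabs_sum_less[OF M0])
    fix i assume "i \<in> {D0<..a + D0}"
    hence "cabs (cf g i) < M" using D0[of i] by simp
    moreover have "cabs (cf y (a + D0 - i)) <= 1" using cabs_fixed[OF y] n by (cases "cf y (a + D0 - i) = 0") auto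
    ultimately show "cabs (cf g i * cf y (a + D0 - i)) < M" unfolding cabs_mult
     by (meson cabs_nonneg mult_left_le order_le_less_trans)
   qed
   ultimately show ?thesis by simp
  qed
  have small: "cabs (\<Sum>i\<le>D0. cf g i * cf y (a + D0 - i)) < M" if "a >= D0" for a
   using cabs_diff_less[OF _ split[of a], of "cf (y * g) (a + D0)"] D0[of "a + D0"] by simp
  have "cabs ((\<Sum>i\<le>D0. cf g i * cf y (m + D0 - i)) - (\<Sum>i\<le>D0. cf g i * cf y (m' + D0 - i))) < M"
   using small mm by (intro cabs_diff_less) auto
  hence tot: "cabs (\<Sum>i\<le>D0. ?d i) < M" by (simp add: sum_subtractf[symmetric] right_diff_distrib)
  have "(\<Sum>i\<le>D0. ?d i) = ?d i0 + (\<Sum>i\<in>{..D0} - {i0}. ?d i)" using i0D by (intro sum.remove) auto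
  moreover have "cabs (\<Sum>i\<in>{..D0} - {i0}. ?d i) < M"
  proof (rule cabs_sum_less[OF M0])
   fix i assume i: "i \<in> {..D0} - {i0}"
   show "cabs (?d i) < M"
   proof (cases "i < i0")
    case True
    thus ?thesis unfolding cabs_mult using below[OF True] y1(1) by (meson cabs_nonneg mult_left_le order_le_less_trans)
   next
    case False
    hence "D0 - i < w" using i i0D unfolding w_def by auto
    from mm(3)[OF this] have "?d i = 0" using i by simp
    thus ?thesis using M0 by (metis cabs_0)
   qed
  qed
  ultimately have "cabs (?d i0) < M" using cabs_diff_less[OF tot, of "\<Sum>i\<in>{..D0} - {i0}. ?d i"] by simp
  moreover have "m + D0 - i0 = m + w" "m' + D0 - i0 = m' + w" using i0D by (auto simp: w_def)
  ultimately show False using y1(2)[OF ne] i0 by (simp add: cabs_mult)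
 qed
 obtain P N where P: "P > 0" "!!r. r >= N ==> cf y (r + P) = cf y r"
  using recurrent_sequence_periodic[OF finite_frob_fixed(1)[OF n], of "cf y" D0 w] y det by blast
 define p where "p = Poly (map (%i. cf y i - (if i < P then 0 else cf y (i - P))) [0..<N + P])"
 have cp: "coeff p i = (if i < N + P then cf y i - (if i < P then 0 else cf y (i - P)) else 0)" for i
  by (auto simp: p_def nth_default_def)
 have pK: "p \<in> polys Kb"
 proof -
  have "cf y i \<in> Kb" for i using finite_frob_fixed(2)[OF n] y[of i] by blast
  thus ?thesis using subfld_diff[OF subfld_Kb] subfld_0[OF subfld_Kb] by (auto simp: polys_def cp)
 qed
 have rK: "1 - monom 1 P \<in> polys Kb"
  by (intro polys_diff[OF subfld_Kb] polys_monom[OF subfld_Kb] polys_1[OF subfld_Kb] subfld_1[OF subfld_Kb])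
 have r0: "1 - monom 1 P ~= (0 :: 'c poly)"
 proof
  assume "1 - monom 1 P = (0 :: 'c poly)"
  from arg_cong[OF this, of "%p. coeff p P"] show False using P(1) by simp
 qed
 have "pser (1 - monom 1 P) * y = pser p"
 proof (rule fps_ext)
  fix i
  have "cf (pser (1 - monom 1 P) * y) i = cf y i - (if i < P then 0 else cf y (i - P))"
   by (simp add: fps_of_poly_diff fps_of_poly_monom' left_diff_distrib fps_X_power_mult_nth)
  also have "... = coeff p i" using P(2)[of "i - P"] by (auto simp: cp)
  finally show "cf (pser (1 - monom 1 P) * y) i = cf (pser p) i" by simp
 qed
 hence "em (1 - monom 1 P) * fps_to_fls y = em p" by (simp only: em_def fls_times_fps_to_fls[symmetric])
 hence "fps_to_fls y = em p / em (1 - monom 1 P)" using r0 by (metis em_simps(7) nonzero_mult_div_cancel_left)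
 thus ?thesis using k0I[OF pK rK r0] by simp
qed

text \<open>Multiplication by a power of t, which is fixed by twists, makes x a power series.\<close>

theorem constants_rational:
 assumes n: "n >= 1" and x: "x \<in> merom" "twl n x = x" shows "x \<in> k0"
proof -
 obtain f g where fg: "x = fps_to_fls f / fps_to_fls g" "entire f" "entire g" "g ~= 0" using x(1) unfolding merom_def by blast
 define m where "m = nat (- fls_subdegree x)"
 define y where "y = fls_regpart (fls_X ^ m * x)"
 have sub: "fls_subdegree (fls_X ^ m * x) >= 0 \<or> x = 0" by (cases "x = 0") (simp_all add: m_def fls_subdegree_mult)
 have y: "fps_to_fls y = fls_X ^ m * x" unfolding y_def using sub by (auto simp: fls_subdegree_ge0I)
 have nth: "fls_nth (fls_X ^ m * x) i = fls_nth x (i - int m)" for i by (simp add: fls_X_power_conv_shift_1 fls_shifted_times_simps)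
 have xi: "fls_nth x i ^ q ^ n = fls_nth x i" for i using x(2) twl_nth[of n x i] by simp
 have "cf y i ^ q ^ n = cf y i" for i unfolding y_def by (simp add: nth xi)
 moreover have "fps_to_fls (y * g) = fps_to_fls (fps_X ^ m * f)"
  using y fg(1,4) by (simp add: fls_times_fps_to_fls fps_to_fls_power)
 hence "entire (y * g)" using entire_mult[OF entire_power[OF entire_X] fg(2)] by simp
 ultimately have "fps_to_fls y \<in> k0" by (rule constants_power_series[OF n _ fg(3,4)])
 moreover have "fls_X ^ m = em (monom 1 m)" by (simp add: em_def fps_of_poly_monom' fps_to_fls_power)
 moreover have "em (monom 1 m) \<in> k0" by (intro em_k0 polys_monom[OF subfld_Kb] subfld_1[OF subfld_Kb])
 ultimately have "fps_to_fls y / fls_X ^ m \<in> k0" using subfld_divide[OF subfld_k0] by metis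
 moreover have "(fls_X :: 'c fls) ^ m ~= 0" by simp
 hence "fps_to_fls y / fls_X ^ m = x" unfolding y by (rule nonzero_mult_div_cancel_left)
 ultimately show ?thesis by simp
qed

lemma order_twp:
 assumes "p ~= 0" shows "order (x ^ q ^ n) (twp n p) = order x p"
proof -
 obtain r where r: "p = [:- x, 1:] ^ order x p * r" "\<not> [:- x, 1:] dvd r" using order_decomp[OF assms] by blast
 have "twp n (p ^ k) = twp n p ^ k" for p k by (induction k) (simp_all add: twp_mult, rule poly_eqI, simp)
 moreover have "twp n [:- x, 1:] = [:- (x ^ q ^ n), 1:]"
  by (rule poly_eqI) (simp add: coeff_pCons frob_minus split: nat.split)
 ultimately have "twp n p = [:- (x ^ q ^ n), 1:] ^ order x p * twp n r" using r(1) twp_mult[of n "[:- x, 1:] ^ order x p" r] by simp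
 moreover have "\<not> [:- (x ^ q ^ n), 1:] dvd twp n r" using r(2) poly_twp[of n r x] by (auto simp: poly_eq_0_iff_dvd[symmetric])
 moreover have "[:- (x ^ q ^ n), 1:] ^ order x p ~= 0" by simp
 ultimately show ?thesis
  by (intro order_unique_lemma) (simp_all only: power_Suc2 dvd_triv_left dvd_times_left_cancel_iff simp_thms)
qed

text \<open>The points \<open>\<theta>^(q^k)\<close>, for all integers k; for negative k the root is unique
 because the Frobenius map is injective. A twist shifts orders of zeros along this chain
 (\<open>zc_step\<close>, \<open>order_twp\<close>).\<close>

definition zc :: "int => 'c" where
 "zc k = (if k >= 0 then th ^ q ^ nat k else (SOME b. b ^ q ^ nat (- k) = th))"

lemma zc_neg: "zc (- int m) ^ q ^ m = th"
proof (cases "m = 0")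
 case False
 have "\<exists>b. b ^ q ^ m = th" using Kb_root[OF theta_Kb] by blast
 from someI_ex[OF this] show ?thesis using False by (simp add: zc_def)
qed (simp add: zc_def)

lemma zc_step: "zc k ^ q ^ n = zc (k + int n)"
proof (cases "k >= 0")
 case True
 thus ?thesis by (simp add: zc_def nat_add_distrib power_add power_mult[symmetric])
next
 case False
 define m where "m = nat (- k)"
 have k: "k = - int m" using False by (simp add: m_def)
 show ?thesis
 proof (cases "n >= m")
  case True
  have "zc k ^ q ^ n = (zc k ^ q ^ m) ^ q ^ (n - m)" using True by (simp add: power_mult[symmetric] power_add[symmetric])
  thus ?thesis using True zc_neg[of m] by (simp add: k zc_def nat_diff_distrib)
 next
  case False
  have "(zc k ^ q ^ n) ^ q ^ (m - n) = th" using False zc_neg[of m] by (simp add: k power_mult[symmetric] power_add[symmetric])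
  moreover have "zc (k + int n) ^ q ^ (m - n) = th" using False zc_neg[of "m - n"] by (simp add: k of_nat_diff)
  ultimately show ?thesis using frob_inj by metis
 qed
qed

lemma zc_inj: "zc k = zc k' \<longleftrightarrow> k = k'"
proof -
 have *: "zc k ~= zc (k + int n)" if "n > 0" for k n
 proof
  assume "zc k = zc (k + int n)"
  hence fx: "zc k ^ q ^ n = zc k" using zc_step[of k n] by metis
  show False
  proof (cases "k >= 0")
   case True
   have "zc k ~= 0" using True cabs_theta q_gt1 by (auto simp: zc_def)
   hence "cabs (zc k) = 1" using cabs_fixed[OF fx that] by simp
   thus False using True cabs_theta q_gt1 one_less_power[of "real q" "q ^ nat k"] by (simp add: zc_def cabs_power)
  next
   case False
   hence t: "zc k ^ q ^ nat (- k) = th" using zc_neg[of "nat (- k)"] by simp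
   have "zc k ~= 0" using t cabs_theta q_gt1 by auto
   hence "cabs th = 1" using cabs_fixed[OF fx that] t cabs_power[of "zc k" "q ^ nat (- k)"] by simp
   thus False using cabs_theta q_gt1 by simp
  qed
 qed
 show ?thesis using *[of "nat (k' - k)" k] *[of "nat (k - k')" k'] by (cases k k' rule: linorder_cases) auto
qed

definition lin :: "int => 'c poly" where "lin k = [:- zc k, 1:]"

lemma order_lin_power: "order (zc k) (lin j ^ n) = (if k = j then n else 0)"
 using order_power_n_n[of "zc j" n] order_0I[of "lin j ^ n" "zc k"] zc_inj[of k j] by (auto simp: lin_def)

lemma order_prod_lin:
 "finite A ==> (\<Prod>j\<in>A. lin (f j) ^ n j) ~= 0 & order (zc k) (\<Prod>j\<in>A. lin (f j) ^ n j) = (\<Sum>j\<in>A. if k = f j then n j else 0)"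
proof (induction rule: finite_induct)
 case (insert a A)
 have "lin (f a) ^ n a * (\<Prod>j\<in>A. lin (f j) ^ n j) ~= 0" using insert by (simp add: lin_def)
 thus ?case using insert by (simp add: order_mult order_lin_power)
qed simp

lemma finite_zc_roots: "p ~= 0 ==> finite {k. order (zc k) p ~= 0}"
proof -
 assume "p ~= 0"
 hence "finite {x. poly p x = 0}" by (rule poly_roots_finite)
 moreover have "zc ` {k. order (zc k) p ~= 0} \<subseteq> {x. poly p x = 0}" using order_root by blast
 ultimately show ?thesis using finite_imageD[of zc] finite_subset zc_inj by (metis inj_onI)
qed

text \<open>Let f k be the order of b at the k-th point of the chain. The equation says that f is periodic
 modulo l, except for a jump by ch i between - i and l - i. As f vanishes almost everywhere, it
 vanishes on both sides of the jump.\<close>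

theorem k0_no_character:
 assumes b: "b \<in> k0" "b ~= 0" and tb: "twl l b = (\<Prod>i<l. em (lin (int (l - i))) powi ch i) * b" and i: "i < l"
 shows "ch i = 0"
proof -
 obtain P Q where PQ: "b = em P / em Q" "Q ~= 0" "P ~= 0" using b(1) by (rule k0E) (use b(2) in auto)
 interpret difference_field "twl l" by (rule difference_field_twl)
 let ?A = "\<Prod>i<l. lin (int (l - i)) ^ nat (ch i)" and ?B = "\<Prod>i<l. lin (int (l - i)) ^ nat (- ch i)"
 have emp: "em (prod f I) = (\<Prod>i\<in>I. em (f i))" for f :: "nat => _" and I by (induction I rule: infinite_finite_induct) auto
 have empow: "em (p ^ n) = em p ^ n" for p n by (induction n) auto
 have l0: "em (lin k) ~= 0" for k by (simp add: lin_def)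
 have pw: "em (lin k) powi m * em (lin k) ^ nat (- m) = em (lin k) ^ nat m" for k m
  using l0[of k] by (cases "m >= 0") (auto simp: power_int_def field_simps)
 have 1: "(\<Prod>i<l. em (lin (int (l - i))) powi ch i) * em ?B = em ?A"
  by (simp add: emp empow prod.distrib[symmetric] pw)
 have AB: "?A ~= 0" "?B ~= 0" by (simp_all add: lin_def)
 have 2: "em (twp l P) * em Q = (\<Prod>i<l. em (lin (int (l - i))) powi ch i) * (em P * em (twp l Q))"
  using tb PQ(2,3) unfolding PQ(1) tau_divide twl_em by (simp add: field_simps)
 have "v * b = a * z" if "p * b = a" "v = p * z" for v b a p z :: "'c fls" using that by (auto simp: mult_ac)
 from this[OF 1 2] have "em (twp l P) * em Q * em ?B = em ?A * (em P * em (twp l Q))" .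
 hence eq: "twp l P * Q * ?B = ?A * (P * twp l Q)" by (simp only: em_simps(4)[symmetric] em_simps(8))
 define f where "f = (%k. int (order (zc k) P) - int (order (zc k) Q))"
 have ft: "f (k - int l) = f k + (\<Sum>i<l. if k = int (l - i) then ch i else 0)" for k
 proof -
  have tw: "order (zc k) (twp l R) = order (zc (k - int l)) R" if "R ~= 0" for R
   using order_twp[OF that, of "zc (k - int l)" l] by (simp add: zc_step)
  have ne: "twp l P * Q * ?B ~= 0" "?A * (P * twp l Q) ~= 0" using PQ AB by (simp_all add: eq)
  have "order (zc k) (twp l P * Q * ?B) = order (zc k) (twp l P) + order (zc k) Q + order (zc k) ?B"
   using ne(1) by (subst order_mult, simp, subst order_mult, simp_all)
  moreover have "order (zc k) (?A * (P * twp l Q)) = order (zc k) ?A + (order (zc k) P + order (zc k) (twp l Q))"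
   using ne(2) by (subst order_mult, simp, subst order_mult, simp_all)
  ultimately have "order (zc (k - int l)) P + order (zc k) Q + (\<Sum>j<l. if k = int (l - j) then nat (- ch j) else 0)
    = (\<Sum>j<l. if k = int (l - j) then nat (ch j) else 0) + (order (zc k) P + order (zc (k - int l)) Q)"
   using eq PQ order_prod_lin[of "{..<l}"] by (simp add: tw)
  hence "f (k - int l) = f k + (\<Sum>j<l. int (if k = int (l - j) then nat (ch j) else 0) - int (if k = int (l - j) then nat (- ch j) else 0))"
   unfolding f_def sum_subtractf of_nat_sum[symmetric] by linarith
  also have "(\<Sum>j<l. int (if k = int (l - j) then nat (ch j) else 0) - int (if k = int (l - j) then nat (- ch j) else 0))
    = (\<Sum>i<l. if k = int (l - i) then ch i else 0)" by (rule sum.cong[OF refl]) auto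
  finally show ?thesis .
 qed
 have "finite {k. f k ~= 0}"
  by (rule finite_subset[OF _ finite_UnI[OF finite_zc_roots[OF PQ(3)] finite_zc_roots[OF PQ(2)]]]) (auto simp: f_def)
 have chain: "f k = 0" if "!!m::nat. f (k + d * int m) = f k" "d ~= 0" for k d
 proof (rule ccontr)
  assume "f k ~= 0"
  hence "range (%m::nat. k + d * int m) \<subseteq> {k. f k ~= 0}" using that(1) by auto
  moreover have "inj (%m::nat. k + d * int m)" using that(2) by (auto simp: inj_def)
  ultimately show False using \<open>finite {k. f k ~= 0}\<close> finite_subset range_inj_infinite by blast
 qed
 let ?K = "int (l - i)"
 have K: "1 <= ?K" "?K <= int l" using i by auto
 have l1: "int l >= 1" using i by simp
 have "f (?K + int l * int m) = f ?K" for m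
 proof (induction m)
  case (Suc m)
  have "(\<Sum>j<l. if ?K + int l * int (Suc m) = int (l - j) then ch j else 0) = 0"
  proof (rule sum.neutral, intro ballI)
   fix j assume "j \<in> {..<l}"
   have "int l * int (Suc m) >= int l" by (simp add: distrib_left)
   moreover have "int (l - j) <= int l" by simp
   ultimately have "?K + int l * int (Suc m) ~= int (l - j)" using K by linarith
   thus "(if ?K + int l * int (Suc m) = int (l - j) then ch j else 0) = 0" by (rule if_not_P)
  qed
  thus ?case using ft[of "?K + int l * int (Suc m)"] Suc by (simp add: algebra_simps)
 qed simp
 hence fK: "f ?K = 0" using chain[of ?K "int l"] l1 by auto
 have "f ((?K - int l) + (- int l) * int m) = f (?K - int l)" for m
 proof (induction m)
  case (Suc m)
  have "(\<Sum>j<l. if ?K - int l + - int l * int m = int (l - j) then ch j else 0) = 0"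
  proof (rule sum.neutral, intro ballI)
   fix j assume "j \<in> {..<l}"
   hence "int (l - j) > 0" by simp
   moreover have "- int l * int m <= 0" by simp
   ultimately have "?K - int l + - int l * int m ~= int (l - j)" using K by linarith
   thus "(if ?K - int l + - int l * int m = int (l - j) then ch j else 0) = 0" by (rule if_not_P)
  qed
  thus ?case using ft[of "?K - int l + - int l * int m"] Suc by (simp add: algebra_simps)
 qed simp
 hence fK': "f (?K - int l) = 0" using chain[of "?K - int l" "- int l"] l1 by auto
 have "(\<Sum>j<l. if ?K = int (l - j) then ch j else 0) = (\<Sum>j<l. if j = i then ch j else 0)"
  by (rule sum.cong[OF refl]) (use i in auto)
 also have "... = ch i" using i by simp
 finally show ?thesis using ft[of ?K] fK fK' by simp
qed

end

section \<open>Hyperderivatives\<close>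

lemma hyperderiv_nth [simp]: "cf (hyperderiv m f) j = of_nat ((j + m) choose m) * cf f (j + m)"
 by (simp add: hyperderiv_def)

lemma hyperderiv_0 [simp]: "hyperderiv 0 f = f" by (rule fps_ext) simp

lemma hyperderiv_add: "hyperderiv m (f + g) = hyperderiv m f + hyperderiv m g"
 by (rule fps_ext) (simp add: algebra_simps)

lemma hyperderiv_diff: "hyperderiv m (f - g) = hyperderiv m f - hyperderiv m g"
 by (rule fps_ext) (simp add: algebra_simps)

lemma hyperderiv_cmult: "hyperderiv m (fps_const c * f) = fps_const c * hyperderiv m f"
 by (rule fps_ext) (simp add: algebra_simps)

lemma hyperderiv_const: "hyperderiv m (fps_const c) = (if m = 0 then fps_const c else 0)" by (rule fps_ext) simp

lemma hyperderiv_X_mult: "hyperderiv (Suc m) (fps_X * f) = fps_X * hyperderiv (Suc m) f + hyperderiv m f"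
proof (rule fps_ext)
 fix j show "cf (hyperderiv (Suc m) (fps_X * f)) j = cf (fps_X * hyperderiv (Suc m) f + hyperderiv m f) j"
  by (cases j) (simp_all add: distrib_right)
qed

lemma hyperderiv_mult: "hyperderiv m (f * g) = (\<Sum>i\<le>m. hyperderiv i f * hyperderiv (m - i) g)"
proof (rule fps_ext)
 fix j
 show "cf (hyperderiv m (f * g)) j = cf (\<Sum>i\<le>m. hyperderiv i f * hyperderiv (m - i) g) j"
 proof (induction "j + m" arbitrary: j m f rule: less_induct)
  case less
  define f' where "f' = fps_shift 1 f"
  define c where "c = cf f 0"
  have f: "f = fps_const c + fps_X * f'" unfolding f'_def c_def by (rule fps_ext) (simp add: fps_X_mult_nth)
  have fg: "f * g = fps_const c * g + fps_X * (f' * g)" by (simp add: f algebra_simps)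
  show ?case
  proof (cases m)
   case 0 thus ?thesis by simp
  next
   case (Suc k)
   have Df: "hyperderiv i f = (case i of 0 => fps_const c + fps_X * f' | Suc i' => fps_X * hyperderiv i f' + hyperderiv i' f')" for i
    by (cases i) (simp_all add: f hyperderiv_add hyperderiv_const hyperderiv_X_mult)
   have "(\<Sum>i\<le>m. hyperderiv i f * hyperderiv (m - i) g)
     = hyperderiv 0 f * hyperderiv m g + (\<Sum>i\<le>k. hyperderiv (Suc i) f * hyperderiv (k - i) g)"
    by (simp add: Suc sum.atMost_Suc_shift del: sum.atMost_Suc)
   also have "(\<Sum>i\<le>k. hyperderiv (Suc i) f * hyperderiv (k - i) g)
     = fps_X * (\<Sum>i\<le>k. hyperderiv (Suc i) f' * hyperderiv (k - i) g) + (\<Sum>i\<le>k. hyperderiv i f' * hyperderiv (k - i) g)"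
    by (simp add: Df sum.distrib sum_distrib_left algebra_simps)
   also have "hyperderiv 0 f * hyperderiv m g + ...
     = fps_const c * hyperderiv m g + fps_X * (\<Sum>i\<le>m. hyperderiv i f' * hyperderiv (m - i) g) + (\<Sum>i\<le>k. hyperderiv i f' * hyperderiv (k - i) g)"
    by (simp add: f Suc sum.atMost_Suc_shift algebra_simps del: sum.atMost_Suc)
   finally have R: "(\<Sum>i\<le>m. hyperderiv i f * hyperderiv (m - i) g) = ..." .
   have L: "hyperderiv m (f * g) = fps_const c * hyperderiv m g + fps_X * hyperderiv m (f' * g) + hyperderiv k (f' * g)"
    by (simp add: fg hyperderiv_add hyperderiv_cmult Suc hyperderiv_X_mult)
   have "cf (hyperderiv k (f' * g)) j = cf (\<Sum>i\<le>k. hyperderiv i f' * hyperderiv (k - i) g) j"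
    by (rule less) (simp add: Suc)
   moreover have "cf (fps_X * hyperderiv m (f' * g)) j = cf (fps_X * (\<Sum>i\<le>m. hyperderiv i f' * hyperderiv (m - i) g)) j"
    using less[of "j - 1" m f'] by (simp add: fps_X_mult_nth del: hyperderiv_nth)
   ultimately show ?thesis unfolding L R by (simp del: hyperderiv_nth)
  qed
 qed
qed

lemma hyperderiv_fps_of_poly: "\<exists>r. hyperderiv m (pser p) = pser r & (subfld F --> p \<in> polys F --> r \<in> polys F)"
proof -
 define r where "r = Poly (map (%j. of_nat ((j + m) choose m) * coeff p (j + m)) [0..<Suc (degree p)])"
 have c: "coeff r j = of_nat ((j + m) choose m) * coeff p (j + m)" for j
  by (auto simp: r_def nth_default_def coeff_eq_0 simp del: upt_Suc)
 have "hyperderiv m (pser p) = pser r" by (rule fps_ext) (simp add: c)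
 moreover have "r \<in> polys F" if "subfld F" "p \<in> polys F"
  using that subfld_mult[OF that(1)] subfld_of_nat[OF that(1)] by (auto simp: polys_def c)
 ultimately show ?thesis by blast
qed

context carlitz_field begin

lemma frob_of_nat: "(of_nat k :: 'c) ^ q ^ n = of_nat k" by (induction k) (simp_all add: frob_add_pow)

lemma hyperderiv_tw: "hyperderiv m (tw n f) = tw n (hyperderiv m f)"
 by (rule fps_ext) (simp add: power_mult_distrib frob_of_nat)

lemma cabs_of_nat_le: "cabs (of_nat k :: 'c) <= 1" by (induction k) (auto intro: cabs_add_le)

lemma entire_hyperderiv: assumes "entire f" shows "entire (hyperderiv m f)" unfolding entire_def
proof (intro allI impI)
 fix R :: real assume R: "R > 0"
 obtain B where B: "gauss_bd f (max R 1) B" using assms R unfolding entire_def by (metis less_max_iff_disj)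
 have "cabs (cf (hyperderiv m f) j) * R ^ j <= B" for j
 proof -
  have "cabs (cf (hyperderiv m f) j) * R ^ j <= (1 * cabs (cf f (j + m))) * max R 1 ^ (j + m)"
  proof (rule mult_mono)
   show "cabs (cf (hyperderiv m f) j) <= 1 * cabs (cf f (j + m))"
    by (simp add: cabs_mult mult_left_le_one_le cabs_of_nat_le)
   have "R ^ j <= max R 1 ^ j" using R by (intro power_mono) auto
   also have "... <= max R 1 ^ (j + m)" by (intro power_increasing) auto
   finally show "R ^ j <= max R 1 ^ (j + m)" .
  qed (use R in auto)
  also have "... <= B" using B by (auto simp: gauss_bd_def)
  finally show ?thesis .
 qed
 thus "\<exists>B. gauss_bd (hyperderiv m f) R B" by (auto simp: gauss_bd_def)
qed

end

section \<open>Logarithmic hyperderivatives and the weighted family of the L-series\<close>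

context carlitz_field begin

definition D :: "nat => 'c fps => 'c fls" where "D j f = fps_to_fls (hyperderiv j f)"

lemma D_mult: "D j (f * g) = (\<Sum>i\<le>j. D i f * D (j - i) g)"
proof -
 have "fps_to_fls (sum F A) = (\<Sum>i\<in>A. fps_to_fls (F i))" for F :: "nat => 'c fps" and A
  by (induction A rule: infinite_finite_induct) simp_all
 thus ?thesis by (simp add: D_def hyperderiv_mult fls_times_fps_to_fls)
qed

lemma D_diff: "D j (f - g) = D j f - D j g" by (simp add: D_def hyperderiv_diff)
lemma D_tw: "D j (tw k f) = twl k (D j f)" by (simp add: D_def hyperderiv_tw twl_fps)
lemma D_poly: "p \<in> polys Kb ==> D j (pser p) \<in> k0"
 using hyperderiv_fps_of_poly[of j p Kb] subfld_Kb em_k0 by (auto simp: D_def em_def)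
lemma D_merom: "entire f ==> D j f \<in> merom" by (simp add: D_def merom_entire entire_hyperderiv)
lemma D_one: "D j 1 = (if j = 0 then 1 else 0)" using hyperderiv_const[of j "1::'c"] by (auto simp: D_def)

text \<open>Logarithmic hyperderivatives. They satisfy additive equations (\<open>hd_twist\<close>) if f
 satisfies a multiplicative one.\<close>

definition hd :: "'c fps => nat => 'c fls" where "hd f j = D j f / D 0 f"

lemma D_hd: "f ~= 0 ==> D j f = hd f j * D 0 f" by (simp add: hd_def D_def)
lemma hd_0: "f ~= 0 ==> hd f 0 = 1" by (simp add: hd_def D_def)

text \<open>Expand the j-th hyperderivative of f = P * tw k f by the Leibniz rule and divide by f: the term
 without derivative of P is twl k (hd f j), and all others involve lower orders.\<close>

lemma hd_twist:
 assumes M: "difference_field.stable (twl k) M" "k0 \<subseteq> M" and P: "P \<in> polys Kb" and f: "f ~= 0" "pser P * tw k f = f"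
  and h: "!!i. 1 <= i ==> i < j ==> hd f i \<in> M" and j: "j >= 1"
 shows "twl k (hd f j) - hd f j \<in> M"
proof -
 interpret difference_field "twl k" by (rule difference_field_twl)
 note sM = stableD(1)[OF M(1)]
 define t where "t = (%i. twl k (D i f))"
 have P0: "em P ~= 0" using f by auto
 have t0: "t 0 ~= 0" using f(1) by (simp add: t_def D_def)
 have e: "D j f = em P * t j + (\<Sum>i\<in>{1..j}. D i (pser P) * t (j - i))" if "j >= 0" for j
 proof -
  have "D j f = (\<Sum>i\<le>j. D i (pser P) * t (j - i))"
   using D_mult[of j "pser P" "tw k f"] f(2) by (simp add: t_def D_tw)
  also have "{..j} = insert 0 {1..j}" by auto
  finally show ?thesis by (simp add: em_def D_def)
 qed
 have e0: "D 0 f = em P * t 0" using e[of 0] by simp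
 have q: "t i / t 0 = twl k (hd f i)" for i by (simp add: t_def hd_def tau_divide)
 have "twl k (hd f j) - hd f j = (t j * em P - D j f) / (t 0 * em P)"
 proof -
  have "hd f j = D j f / (em P * t 0)" by (simp add: hd_def e0)
  thus ?thesis unfolding q[symmetric] using P0 t0 by (simp add: field_simps)
 qed
 also have "t j * em P - D j f = - (\<Sum>i\<in>{1..j}. D i (pser P) * t (j - i))" using e[of j] by simp
 also have "... / (t 0 * em P) = - (\<Sum>i\<in>{1..j}. D i (pser P) / em P * twl k (hd f (j - i)))"
  by (simp add: sum_divide_distrib q[symmetric] mult_ac)
 also have "... \<in> M"
 proof (intro subfld_uminus[OF sM] subfld_sum[OF sM] subfld_mult[OF sM])
  fix i assume i: "i \<in> {1..j}"
  show "D i (pser P) / em P \<in> M" using subfld_divide[OF subfld_k0 D_poly[OF P] em_k0[OF P]] M(2) by auto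
  have "hd f (j - i) \<in> M" using i h[of "j - i"] hd_0[OF f(1)] subfld_1[OF sM] by (cases "i = j") auto
  thus "twl k (hd f (j - i)) \<in> M" by (rule stableD(2)[OF M(1)])
 qed
 finally show ?thesis .
qed

lemma lin_Kb: "lin (int i) \<in> polys Kb" unfolding lin_def zc_def
 by (intro polys_pCons subfld_Kb polys_0 subfld_uminus[OF subfld_Kb] subfld_1) (simp add: subfld_power[OF subfld_Kb theta_Kb])

lemma lin_nonzero: "lin k ~= 0" by (simp add: lin_def)

lemma twp_lin: "twp n (lin k) = lin (k + int n)"
 by (rule poly_eqI) (simp add: lin_def coeff_pCons frob_minus zc_step split: nat.split)

lemma tw_lin: "tw n (pser (lin k)) = pser (lin (k + int n))" by (simp add: fps_of_poly_twp[symmetric] twp_lin)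

end

text \<open>The functions of the theorem and their functional equations: Om is \<Omega>, om i is the
 (-i)-fold twist of \<open>\<Omega>_l\<close>, and Ls s is \<open>L_s\<close>. Since the twist of
 \<open>L_s\<close> involves the index s without its last entry, I is closed under removing it.\<close>

locale carlitz_functions = carlitz_field q FF th for q :: nat and FF :: "'c::{field,metric_space} set" and th :: 'c +
 fixes n l :: nat and Om :: "'c fps" and om :: "nat => 'c fps" and I :: "nat list set" and Ls :: "nat list => 'c fps" and u :: "nat => 'c poly"
 assumes l: "l >= 1"
  and Om: "entire Om" "Om ~= 0" "pser (lin 1) * tw 1 Om = Om"
  and om: "!!i. i < l ==> entire (om i)" "!!i. i < l ==> om i ~= 0"
  and om_twist: "!!i. Suc i < l ==> tw 1 (om (Suc i)) = om i" "pser (lin 1) * tw 1 (om 0) = om (l - 1)"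
  and I: "finite I" "[] \<notin> I" "!!s a. s @ [a] \<in> I ==> a >= 1 & (s = [] \<or> s \<in> I) & u a \<in> polys Kb"
  and Ls: "!!s. s \<in> I ==> entire (Ls s)" "Ls [] = 1"
  and Ls_twist: "!!s a. s @ [a] \<in> I ==> tw 1 (Ls (s @ [a])) = Ls (s @ [a]) - Om ^ a * pser (u a) * tw 1 (Ls s)"
begin

lemma Om_twist: "pser (\<Prod>i\<in>{1..k}. lin (int i)) * tw k Om = Om"
proof (induction k)
 case (Suc k)
 have "tw k (pser (lin 1) * tw 1 Om) = pser (lin (int (Suc k))) * tw (Suc k) Om"
  by (simp add: tw_mult tw_lin tw_tw add.commute)
 hence "pser (lin (int (Suc k))) * tw (Suc k) Om = tw k Om" using Om(3) by simp
 hence "pser (\<Prod>i\<in>{1..k}. lin (int i)) * (pser (lin (int (Suc k))) * tw (Suc k) Om) = Om" using Suc by simp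
 thus ?case by (simp add: fps_of_poly_mult mult_ac)
qed simp

lemma prod_lin_Kb: "(\<Prod>i\<in>{1..k}. lin (int i)) \<in> polys Kb" by (intro polys_prod[OF subfld_Kb] lin_Kb)

lemma om_twist_up: "i + k < l ==> tw k (om (i + k)) = om i"
proof (induction k)
 case (Suc k)
 thus ?case using om_twist(1)[of "i + k"] tw_tw[of k 1 "om (Suc (i + k))"] by simp
qed simp

lemma om_twist_l: assumes "i < l" shows "pser (lin (int (l - i))) * tw l (om i) = om i"
proof -
 have "tw l (om i) = tw (l - 1 - i) (tw 1 (tw i (om i)))" using assms by (simp add: tw_tw)
 also have "tw i (om i) = om 0" using om_twist_up[of 0 i] assms by simp
 finally have 1: "tw l (om i) = tw (l - 1 - i) (tw 1 (om 0))" .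
 have "tw (l - 1 - i) (om (l - 1)) = om i" using om_twist_up[of i "l - 1 - i"] assms by simp
 moreover have "tw (l - 1 - i) (pser (lin 1)) = pser (lin (int (l - i)))" using assms by (simp add: tw_lin of_nat_diff)
 ultimately show ?thesis using arg_cong[OF om_twist(2), of "tw (l - 1 - i)"] 1 by (simp add: tw_mult)
qed

text \<open>kOm is the base field of the weighted extension: it is stable under twists, and every
 hyperderivative of a power of Om is an element of kOm times that power
 (\<open>D_Om_power\<close>).\<close>

definition HOm :: "'c fls set" where "HOm = hd Om ` {1..n}"
definition kOm :: "'c fls set" where "kOm = adjoin k0 HOm"

lemma subfld_kOm: "subfld kOm" and k0_kOm: "k0 \<subseteq> kOm" and hd_kOm: "j <= n ==> hd Om j \<in> kOm"
proof -
 show "subfld kOm" "k0 \<subseteq> kOm" unfolding kOm_def by (auto intro: subfld_adjoin adjoin_base)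
 show "j <= n ==> hd Om j \<in> kOm"
  using hd_0[OF Om(2)] subfld_1[OF \<open>subfld kOm\<close>] adjoin_gen[of "hd Om j" HOm k0] unfolding kOm_def HOm_def by (cases "j = 0") auto
qed

lemma tower_HOm: "difference_field.tower (twl k) k0 {1} HOm"
proof -
 interpret difference_field "twl k" by (rule difference_field_twl)
 have "tower k0 {1} (hd Om ` {1..m})" for m
 proof (induction m)
  case 0 thus ?case by (simp add: tower_empty)
 next
  case (Suc m)
  let ?M = "adjoin k0 (hd Om ` {1..m})"
  have "stable ?M" by (rule tower_stable[OF stable_k0 Suc]) (use subfld_1[OF subfld_k0] in auto)
  hence "twl k (hd Om (Suc m)) - hd Om (Suc m) \<in> ?M"
   by (rule hd_twist[OF _ _ prod_lin_Kb Om(2) Om_twist]) (auto intro: adjoin_base adjoin_gen)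
  hence "tower k0 {1} (insert (hd Om (Suc m)) (hd Om ` {1..m}))" by (intro tower_insert[OF Suc, of 1]) auto
  thus ?case by (simp add: atLeastAtMostSuc_conv)
 qed
 thus ?thesis by (simp add: HOm_def)
qed

lemma stable_kOm: "difference_field.stable (twl k) kOm"
 unfolding kOm_def using difference_field.tower_stable[OF difference_field_twl stable_k0 tower_HOm] subfld_1[OF subfld_k0] by simp

lemma D_Om: "j <= n ==> D j Om = hd Om j * D 0 Om" by (rule D_hd[OF Om(2)])

lemma D_Om_power: "j <= n ==> \<exists>c\<in>kOm. D j (Om ^ a) = c * D 0 Om ^ a"
proof (induction a arbitrary: j)
 case 0 thus ?case using D_one[of j] subfld_0[OF subfld_kOm] subfld_1[OF subfld_kOm] by (auto intro!: bexI[of _ "if j = 0 then 1 else 0"])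
next
 case (Suc a)
 have "\<exists>c. c \<in> kOm & D (j - i) (Om ^ a) = c * D 0 Om ^ a" for i
 proof -
  have "j - i <= n" using Suc.prems by simp
  from Suc.IH[OF this] show ?thesis by blast
 qed
 hence "\<forall>i. \<exists>c. c \<in> kOm & D (j - i) (Om ^ a) = c * D 0 Om ^ a" by blast
 then obtain c where "\<forall>i. c i \<in> kOm & D (j - i) (Om ^ a) = c i * D 0 Om ^ a" by (rule choice[THEN exE])
 hence c: "!!i. c i \<in> kOm" "!!i. D (j - i) (Om ^ a) = c i * D 0 Om ^ a" by auto
 have "D j (Om ^ Suc a) = (\<Sum>i\<le>j. (hd Om i * D 0 Om) * (c i * D 0 Om ^ a))" unfolding power_Suc D_mult
 proof (rule sum.cong[OF refl])
  fix i assume "i \<in> {..j}"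
  hence "i <= n" using Suc.prems by simp
  show "D i Om * D (j - i) (Om ^ a) = (hd Om i * D 0 Om) * (c i * D 0 Om ^ a)" unfolding D_Om[OF \<open>i <= n\<close>] c(2) ..
 qed
 also have "... = (\<Sum>i\<le>j. hd Om i * c i) * D 0 Om ^ Suc a" by (simp add: sum_distrib_left sum_distrib_right mult_ac)
 finally show ?case using c Suc.prems hd_kOm
  by (intro bexI[of _ "\<Sum>i\<le>j. hd Om i * c i"] subfld_sum[OF subfld_kOm] subfld_mult[OF subfld_kOm]) auto
qed

lemma D_g:
 assumes "s @ [a] \<in> I" "j <= n" shows "\<exists>c\<in>kOm. D j (Om ^ a * pser (u a)) = c * D 0 Om ^ a"
proof -
 have "\<exists>c. i <= j --> c \<in> kOm & D i (Om ^ a) = c * D 0 Om ^ a" for i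
 proof -
  have "i <= j ==> i <= n" using assms(2) by simp
  thus ?thesis using D_Om_power[of i a] by blast
 qed
 hence "\<forall>i. \<exists>c. i <= j --> c \<in> kOm & D i (Om ^ a) = c * D 0 Om ^ a" by blast
 then obtain c where "\<forall>i. i <= j --> c i \<in> kOm & D i (Om ^ a) = c i * D 0 Om ^ a" by (rule choice[THEN exE])
 hence c: "!!i. i <= j ==> c i \<in> kOm" "!!i. i <= j ==> D i (Om ^ a) = c i * D 0 Om ^ a" by auto
 have "D j (Om ^ a * pser (u a)) = (\<Sum>i\<le>j. c i * D 0 Om ^ a * D (j - i) (pser (u a)))"
  unfolding D_mult by (rule sum.cong[OF refl]) (use c in auto)
 also have "... = (\<Sum>i\<le>j. c i * D (j - i) (pser (u a))) * D 0 Om ^ a"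
  unfolding sum_distrib_right by (rule sum.cong[OF refl]) (simp add: mult_ac)
 finally show ?thesis using c D_poly I(3)[OF assms(1)] k0_kOm
  by (intro bexI[of _ "\<Sum>i\<le>j. c i * D (j - i) (pser (u a))"] subfld_sum[OF subfld_kOm] subfld_mult[OF subfld_kOm]) auto
qed

text \<open>Different pairs (j, s) may give the same function; wL takes the smallest weight.\<close>

definition SL :: "'c fls set" where "SL = {D j (Ls s) | j s. j <= n & s \<in> I}"
definition wL :: "'c fls => nat" where "wL y = (LEAST w. \<exists>j s. j <= n & s \<in> I & y = D j (Ls s) & w = sum_list s)"

lemma finite_SL: "finite SL"
proof -
 have "SL = (%(j, s). D j (Ls s)) ` ({..n} \<times> I)" by (auto simp: SL_def)
 thus ?thesis using I(1) by simp
qed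

lemma wL_rep: "y \<in> SL ==> \<exists>j s. j <= n & s \<in> I & y = D j (Ls s) & wL y = sum_list s"
 unfolding wL_def SL_def by (rule LeastI_ex) auto

lemma wL_le: "j <= n ==> s \<in> I ==> wL (D j (Ls s)) <= sum_list s" unfolding wL_def by (rule Least_le) auto

lemma sum_list_pos: "s \<in> I ==> sum_list s >= 1" using I(2,3) by (cases s rule: rev_cases) force+

lemma wL_pos: "y \<in> SL ==> wL y >= 1" using wL_rep sum_list_pos by metis

sublocale WS: weighted_span kOm "D 0 Om" SL wL by unfold_locales (use subfld_kOm Om(2) in "auto simp: D_def")

text \<open>The difference is a hyperderivative of \<open>\<Omega>^a u_a\<close> times the twist of the
 series of a shorter index. The Leibniz rule keeps the factor \<open>\<Omega>^a\<close>, and a >=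
 1.\<close>

lemma D_Ls_twist:
 assumes "s \<in> I \<or> s = []" "j <= n"
 shows "twl 1 (D j (Ls s)) - D j (Ls s) \<in> WS.F 1 (int (sum_list s))" using assms
proof (induction s arbitrary: j rule: rev_induct)
 case Nil
 interpret difference_field "twl 1" by (rule difference_field_twl)
 show ?case using tau_0 tau_1 by (simp add: Ls(2) D_one lspan_0)
next
 case (snoc a s)
 note saI = snoc.prems(1)[simplified]
 have F0: "twl 1 (D i (Ls s)) \<in> WS.F 0 (int (sum_list s))" if i: "i <= n" for i
 proof -
  have "D i (Ls s) \<in> WS.F 0 (int (sum_list s))"
  proof (cases "s = []")
   case True thus ?thesis using WS.F_wprods[OF wprods_1, of 0] by (simp add: Ls(2) D_one lspan_0)
  next
   case False
   thus ?thesis using I(3)[OF saI] i wL_le by (intro WS.F_wprods wprods_gen) (auto simp: SL_def)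
  qed
  from lspan_add[OF WS.F_mono[OF _ order_refl snoc.IH, of 0 i] this] I(3)[OF saI] i show ?thesis by auto
 qed
 have summand: "D i (Om ^ a * pser (u a)) * twl 1 (D (j - i) (Ls s)) \<in> WS.F 1 (int (sum_list (s @ [a])))" if i: "i <= j" for i
 proof -
  obtain c where c: "c \<in> kOm" "D i (Om ^ a * pser (u a)) = c * D 0 Om ^ a" using D_g[OF saI, of i] i snoc.prems(2) by auto
  have "D 0 Om ^ a \<in> WS.F (int a) (int a)" using WS.Om_F[of "int a"] by simp
  hence "D i (Om ^ a * pser (u a)) \<in> WS.F (int a) (int a)" unfolding c(2) by (intro lspan_cmult[OF WS.kap_subrng] c(1))
  from WS.F_mult[OF this F0[of "j - i"]] snoc.prems(2)
  have "D i (Om ^ a * pser (u a)) * twl 1 (D (j - i) (Ls s)) \<in> WS.F (int a + 0) (int a + int (sum_list s))" by simp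
  thus ?thesis using I(3)[OF saI] by (elim WS.F_mono[rotated 2]) auto
 qed
 have "twl 1 (D j (Ls (s @ [a]))) - D j (Ls (s @ [a])) = - D j (Om ^ a * pser (u a) * tw 1 (Ls s))"
  unfolding D_tw[symmetric] Ls_twist[OF saI] by (simp add: D_diff)
 also have "... = - (\<Sum>i\<le>j. D i (Om ^ a * pser (u a)) * twl 1 (D (j - i) (Ls s)))" by (simp add: D_mult D_tw)
 also have "... \<in> WS.F 1 (int (sum_list (s @ [a])))"
  by (intro lspan_uminus[OF WS.kap_subrng] lspan_sum) (use summand in auto)
 finally show ?case .
qed

lemma twl_em_Om: "twl k (D 0 Om) = inverse (em (\<Prod>i\<in>{1..k}. lin (int i))) * D 0 Om"
proof -
 have "em (\<Prod>i\<in>{1..k}. lin (int i)) * twl k (D 0 Om) = D 0 Om"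
  using arg_cong[OF Om_twist[of k], of fps_to_fls] by (simp add: D_def em_def twl_fps fls_times_fps_to_fls)
 moreover have "em (\<Prod>i\<in>{1..k}. lin (int i)) ~= 0" by (simp add: lin_nonzero)
 ultimately show ?thesis by (metis divide_inverse mult.commute nonzero_mult_div_cancel_left)
qed

lemma s_k0: "inverse (em (\<Prod>i\<in>{1..k}. lin (int i))) \<in> k0"
 by (intro subfld_inverse[OF subfld_k0] em_k0 prod_lin_Kb)

lemma weighted_base_one: "weighted_base (twl 1) kOm (D 0 Om) SL wL (inverse (em (\<Prod>i\<in>{1..1}. lin (int i))))"
proof -
 interpret difference_field "twl 1" by (rule difference_field_twl)
 show ?thesis
 proof unfold_locales
  show "stable kOm" by (rule stable_kOm)
  fix y assume "y \<in> SL"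
  then obtain j s where js: "j <= n" "s \<in> I" "y = D j (Ls s)" "wL y = sum_list s" using wL_rep by blast
  show "twl 1 y - y \<in> WS.F 1 (int (wL y))" unfolding js(4) unfolding js(3) by (rule D_Ls_twist) (use js in auto)
 qed (use s_k0[of 1] k0_kOm twl_em_Om[of 1] in auto)
qed

lemma tau_SL:
 assumes "y \<in> SL" shows "twl k y - y \<in> WS.F 1 (int (wL y))"
proof (induction k)
 case 0
 have "twl 0 y = y" by (rule fls_eqI) simp
 thus ?case by (simp add: lspan_0)
next
 case (Suc k)
 interpret B: weighted_base "twl 1" kOm "D 0 Om" SL wL "inverse (em (\<Prod>i\<in>{1..1}. lin (int i)))" by (rule weighted_base_one)
 have "twl 1 (twl k y - y) + (twl 1 y - y) \<in> WS.F 1 (int (wL y))" by (intro lspan_add B.tau_F Suc B.tau_Y assms)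
 thus ?case unfolding B.tau_diff twl_twl by simp
qed

end

section \<open>The identity for functions\<close>

context difference_field begin

lemma tower_mono: "tower M Ga S ==> Ga \<subseteq> Ga' ==> tower M Ga' S"
 by (induction rule: tower.induct) (auto intro: tower.intros)

end

context carlitz_field begin

text \<open>The group of characters generated by the multipliers \<open>t - \<theta>^(q^(l-i))\<close> of the
 \<open>\<omega>_i\<close>, written by exponents.\<close>

definition chr :: "nat => (nat => int) => 'c fls" where
 "chr l c = (\<Prod>i<l. em (lin (int (l - i))) powi c i)"

lemma em_lin_nonzero: "em (lin k) ~= 0" by (simp add: lin_nonzero)

lemma chr_mult: "chr l c * chr l c' = chr l (%i. c i + c' i)"
 unfolding chr_def prod.distrib[symmetric] by (rule prod.cong[OF refl]) (simp add: power_int_add lin_nonzero)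

lemma chr_powi: "chr l c powi m = chr l (%i. c i * m)"
proof -
 have "(\<Prod>i\<in>A. f i) powi m = (\<Prod>i\<in>A. f i powi m)" for f :: "nat => 'c fls" and A
  by (induction A rule: infinite_finite_induct) (simp_all add: power_int_mult_distrib)
 thus ?thesis by (simp add: chr_def power_int_mult)
qed

lemma chr_0: "chr l (%_. 0) = 1" by (simp add: chr_def)

lemma chr_k0: "chr l c \<in> k0" "chr l c ~= 0"
proof -
 show "chr l c \<in> k0" unfolding chr_def by (intro subfld_prod[OF subfld_k0] subfld_powi[OF subfld_k0] em_k0 lin_Kb)
 show "chr l c ~= 0" by (simp add: chr_def lin_nonzero)
qed

lemma chr_single: "i < l ==> chr l (%j. if j = i then - 1 else 0) = inverse (em (lin (int (l - i))))"
proof -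
 assume "i < l"
 have "chr l (%j. if j = i then - 1 else 0) = (\<Prod>j<l. if j = i then inverse (em (lin (int (l - j)))) else 1)"
  unfolding chr_def by (rule prod.cong[OF refl]) (simp add: power_int_minus)
 thus ?thesis using \<open>i < l\<close> by simp
qed

lemma chr_all: "chr l (%_. - 1) = inverse (em (\<Prod>i\<in>{1..l}. lin (int i)))"
proof -
 have emp: "em (prod f A) = (\<Prod>i\<in>A. em (f i))" for f :: "nat => _" and A by (induction A rule: infinite_finite_induct) auto
 have "(\<Prod>i\<in>{1..l}. em (lin (int i))) = (\<Prod>i<l. em (lin (int (l - i))))"
  by (rule prod.reindex_bij_witness[of _ "%i. l - i" "%i. l - i"]) auto
 thus ?thesis by (simp add: chr_def emp power_int_minus prod_inversef[symmetric] o_def)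
qed

lemma chr_trivial: "b \<in> k0 ==> b ~= 0 ==> twl l b = chr l c * b ==> i < l ==> c i = 0"
 unfolding chr_def by (rule k0_no_character)

end

context carlitz_functions begin

interpretation T: difference_field "twl l" by (rule difference_field_twl)

abbreviation "s0 \<equiv> inverse (em (\<Prod>i\<in>{1..l}. lin (int i)))"

definition SOm :: "'c fls set" where "SOm = (%j. D j Om) ` {..n}"

lemma finite_SOm: "finite SOm" by (simp add: SOm_def)

lemma HOm_SOm: "HOm \<subseteq> adjoin k0 SOm"
 unfolding HOm_def hd_def using subfld_divide[OF subfld_adjoin[of k0 SOm]] adjoin_gen[of _ SOm k0] by (auto simp: SOm_def)

lemma hd_merom: "entire f ==> hd f j \<in> merom" unfolding hd_def by (intro subfld_divide[OF subfld_merom] D_merom)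

lemma HOm_merom: "HOm \<subseteq> merom" unfolding HOm_def using hd_merom[OF Om(1)] by auto
lemma SL_merom: "SL \<subseteq> merom" unfolding SL_def using D_merom Ls(1) by auto

context
 fixes T assumes tower: "T.tower k0 {1} (HOm Un T)" and merom: "T \<subseteq> merom"
begin

abbreviation "K \<equiv> adjoin k0 (HOm Un T)"

lemma stable_K: "T.stable K" by (rule T.tower_stable[OF stable_k0 tower]) (use subfld_1[OF subfld_k0] in auto)

lemma K_merom: "adjoin K (insert (D 0 Om) SL) \<subseteq> merom"
 using HOm_merom SL_merom merom k0_merom D_merom[OF Om(1)] by (intro adjoin_least[OF subfld_merom]) auto

text \<open>There are no new constants by \<open>constants_rational\<close>. A character s0 powi d realised
 in K would descend along the tower to k0, against \<open>chr_trivial\<close>.\<close>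

lemma weighted_extension_K: "weighted_extension (twl l) K (D 0 Om) SL wL s0"
proof
 show "subfld K" by (rule subfld_adjoin)
 show "D 0 Om ~= 0" using Om(2) by (simp add: D_def)
 show "T.stable K" by (rule stable_K)
 show "s0 \<in> K" using s_k0 by (rule adjoin_base)
 show "twl l (D 0 Om) = s0 * D 0 Om" by (rule twl_em_Om)
 show "finite SL" by (rule finite_SL)
 show "wL y >= 1" if "y \<in> SL" for y using wL_pos[OF that] .
 have "kOm \<subseteq> K" unfolding kOm_def by (rule adjoin_mono) auto
 thus "twl l y - y \<in> lspan K (wgens (D 0 Om) SL wL 1 (int (wL y)))" if "y \<in> SL" for y
  using tau_SL[OF that, of l] lspan_mono' by blast
 show "c \<in> K" if "c \<in> adjoin K (insert (D 0 Om) SL)" "twl l c = c" for c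
  using constants_rational[OF l] that K_merom adjoin_base by blast
 fix a d assume a: "a \<in> K" "d ~= 0" "twl l a = s0 powi d * a"
 show "a = 0"
 proof (rule ccontr)
  assume "a ~= 0"
  have "\<exists>E\<ge>1. \<exists>ga\<in>{1}. \<exists>b'\<in>k0. b' ~= 0 & twl l b' = (s0 powi d) ^ E * ga * b'"
   by (rule T.tower_character_descent[OF stable_k0 tower _ _ _ _ a(1) \<open>a ~= 0\<close> a(3)])
    (use subfld_1[OF subfld_k0] subfld_powi[OF subfld_k0 s_k0] in auto)
  then obtain E b' where b: "E >= 1" "b' \<in> k0" "b' ~= 0" "twl l b' = (s0 powi d) ^ E * b'" by auto
  have "(s0 powi d) ^ E = chr l (%_. - 1 * (d * int E))"
   unfolding chr_powi[symmetric] chr_all by (simp add: power_int_mult)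
  with b have "twl l b' = chr l (%_. - 1 * (d * int E)) * b'" by simp
  from chr_trivial[OF b(2,3) this, of 0] l a(2) b(1) show False by auto
 qed
qed

text \<open>The equation Q(\<tau> y - y) = \<tau> f - f of \<open>additive_algebraic\<close> can be solved
 with f in K by \<open>descent\<close>. Then Q(y) - f is fixed by \<tau>, hence rational, and y is
 algebraic over K.\<close>

lemma additive_step:
 assumes y: "y \<in> merom" "twl l y - y \<in> K" "y \<in> acl k0 (T Un (SOm Un SL))"
 shows "y \<in> acl k0 (T Un SOm)"
proof -
 interpret W: weighted_extension "twl l" K "D 0 Om" SL wL s0 by (rule weighted_extension_K)
 let ?N = "adjoin K (insert (D 0 Om) SL)"
 let ?a = "twl l y - y"
 note N = subfld_intros[OF subfld_adjoin[of K "insert (D 0 Om) SL"]]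
 have hdN: "hd Om j \<in> ?N" if "j <= n" for j
  using hd_kOm[OF that] adjoin_mono[of k0 k0 HOm "HOm Un T"] adjoin_base unfolding kOm_def by blast
 have "SOm \<subseteq> ?N" unfolding SOm_def
 proof
  fix x assume "x \<in> (%j. D j Om) ` {..n}"
  then obtain j where "j <= n" "x = D j Om" by auto
  thus "x \<in> ?N" using D_Om[of j] N(4)[OF hdN[of j] adjoin_gen[of "D 0 Om" "insert (D 0 Om) SL" K]] by (metis insertI1)
 qed
 moreover have "k0 \<subseteq> K" "T \<subseteq> K" by (auto intro: adjoin_base adjoin_gen)
 ultimately have "adjoin k0 (T Un (SOm Un SL)) \<subseteq> ?N"
  by (intro adjoin_least[OF subfld_adjoin]) (auto intro: adjoin_base adjoin_gen)
 hence alg: "algebraic_over ?N y" using y(3) algebraic_over_mono[OF subfld_adjoin subfld_adjoin] by (auto simp: acl_def)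
 have "k0 \<subseteq> ?N" using \<open>k0 \<subseteq> K\<close> adjoin_base by blast
 hence "{c \<in> k0. twl l c = c} \<subseteq> {c \<in> ?N. twl l c = c}" by auto
 hence inf: "infinite {c \<in> ?N. twl l c = c}" using constants_infinite finite_subset by blast
 have "?a \<in> ?N" using y(2) adjoin_base by blast
 from T.additive_algebraic[OF W.stable_extension inf alg _ this] obtain Q f where
  Q: "Q \<in> polys {c \<in> ?N. twl l c = c}" "degree Q > 0" "!!x z. poly Q (x + z) = poly Q x + poly Q z"
   "f \<in> ?N" "poly Q ?a = twl l f - f" by auto
 have const: "{c \<in> ?N. twl l c = c} \<subseteq> k0" using constants_rational[OF l] K_merom by blast
 have QK: "Q \<in> polys k0" using polys_mono[OF const] Q(1) by blast
 have QK': "Q \<in> polys K" using polys_mono[OF \<open>k0 \<subseteq> K\<close>] QK by blast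
 have "poly Q ?a \<in> K" by (rule poly_in_subfld[OF subfld_adjoin QK' y(2)])
 from W.descent[OF Q(4) this Q(5)[symmetric]] obtain f' where f': "f' \<in> K" "twl l f' - f' = poly Q ?a" by blast
 let ?z = "poly Q y - f'"
 have "map_poly (twl l) Q = Q" using Q(1) by (intro poly_eqI) (auto simp: polys_def)
 hence "twl l (poly Q y) = poly Q (y + ?a)" using T.poly_mp[of Q y] by simp
 also have "... = poly Q y + poly Q ?a" by (rule Q(3))
 finally have "twl l ?z = ?z" using f'(2) by (simp add: T.tau_diff algebra_simps)
 moreover have "f' \<in> merom" using f'(1) K_merom adjoin_base by blast
 hence "?z \<in> merom" using poly_in_subfld[OF subfld_merom _ y(1)] polys_mono[OF k0_merom] QK
  by (intro subfld_diff[OF subfld_merom]) auto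
 ultimately have "?z \<in> k0" using constants_rational[OF l] by blast
 hence "poly Q y \<in> K" using subfld_add[OF subfld_adjoin f'(1), of ?z] adjoin_base by auto
 hence "Q - [:poly Q y:] \<in> polys K" using QK' by (intro polys_diff[OF subfld_adjoin] polys_const[OF subfld_adjoin])
 moreover have "Q - [:poly Q y:] ~= 0"
 proof
  assume "Q - [:poly Q y:] = 0"
  hence "Q = [:poly Q y:]" by simp
  thus False using Q(2) by (metis degree_pCons_0 less_irrefl)
 qed
 ultimately have "algebraic_over K y" unfolding algebraic_over_iff[OF subfld_adjoin] by (intro bexI[of _ "Q - [:poly Q y:]"]) auto
 hence "y \<in> acl k0 (HOm Un T)" by (simp add: acl_def)
 moreover have "HOm Un T \<subseteq> acl k0 (T Un SOm)"
  using HOm_SOm adjoin_mono[of k0 k0 SOm "T Un SOm"] adjoin_subset_acl[of k0 "T Un SOm"] acl_gen by blast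
 ultimately show ?thesis using acl_idem by blast
qed

end

text \<open>Adjoining T raises the transcendence degree by the same amount with and without the L-series.
 Sums avoid subtraction of natural numbers.\<close>

definition inc :: "'c fls set => bool" where
 "inc T \<longleftrightarrow> trdeg k0 (adjoin k0 (T Un (SOm Un SL))) + trdeg k0 (adjoin k0 SOm)
   = trdeg k0 (adjoin k0 (T Un SOm)) + trdeg k0 (adjoin k0 (SOm Un SL))"

lemma inc_insert:
 assumes "finite T" "inc T" "y \<in> acl k0 (T Un (SOm Un SL)) ==> y \<in> acl k0 (T Un SOm)"
 shows "inc (insert y T)"
proof -
 have "y \<in> acl k0 (T Un SOm) ==> y \<in> acl k0 (T Un (SOm Un SL))" using acl_mono[of "T Un SOm" "T Un (SOm Un SL)"] by blast
 hence "y \<in> acl k0 (T Un SOm) \<longleftrightarrow> y \<in> acl k0 (T Un (SOm Un SL))" using assms(3) by blast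
 thus ?thesis using assms(1,2) finite_SOm finite_SL trdeg_insert[OF subfld_k0, of "T Un (SOm Un SL)" y] trdeg_insert[OF subfld_k0, of "T Un SOm" y]
  by (simp add: inc_def)
qed

text \<open>The invariant under which logarithmic hyperderivatives are adjoined one at a time.\<close>

definition good :: "'c fls set => bool" where
 "good T \<longleftrightarrow> finite T & T \<subseteq> merom & T.tower k0 {1} (HOm Un T) & inc T"

lemma good_add:
 assumes "finite A" "good T" "!!y. y \<in> A ==> y \<in> merom & twl l y - y \<in> adjoin k0 (HOm Un T)"
 shows "good (T Un A)" using assms(1,3)
proof induction
 case (insert y A)
 hence g: "good (T Un A)" by simp
 have "twl l y - y \<in> adjoin k0 (HOm Un (T Un A))" using insert.prems[of y] adjoin_mono[of k0 k0 "HOm Un T" "HOm Un (T Un A)"] by auto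
 hence "inc (insert y (T Un A))" "T.tower k0 {1} (insert y (HOm Un (T Un A)))"
  using g insert.prems[of y] additive_step[of "T Un A" y] T.tower_insert[of k0 "{1}" "HOm Un (T Un A)" 1 y]
  by (auto simp: good_def intro!: inc_insert)
 thus ?case using g insert.prems[of y] by (auto simp: good_def)
qed (use assms(2) in simp)

definition hset :: "nat => 'c fls set" where "hset m = (%(i, j). hd (om i) j) ` ({..<l} \<times> {1..m})"

lemma good_hset: "good (hset m)"
proof (induction m)
 case 0
 show ?case using tower_HOm by (simp add: hset_def good_def inc_def)
next
 case (Suc m)
 let ?A = "(%i. hd (om i) (Suc m)) ` {..<l}"
 have st: "T.stable (adjoin k0 (HOm Un hset m))" using Suc stable_K by (simp add: good_def)
 have "good (hset m Un ?A)"
 proof (rule good_add[OF _ Suc])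
  fix y assume "y \<in> ?A"
  then obtain i where i: "i < l" "y = hd (om i) (Suc m)" by auto
  have "twl l y - y \<in> adjoin k0 (HOm Un hset m)" unfolding i(2)
  proof (rule hd_twist[OF st _ lin_Kb om(2)[OF i(1)] om_twist_l[OF i(1)]])
   fix j assume "1 <= j" "j < Suc m"
   thus "hd (om i) j \<in> adjoin k0 (HOm Un hset m)" using i(1) by (intro adjoin_gen) (auto simp: hset_def)
  qed (auto intro: adjoin_base)
  thus "y \<in> merom & twl l y - y \<in> adjoin k0 (HOm Un hset m)" using hd_merom[OF om(1)] i by auto
 qed simp
 moreover have "hset (Suc m) = hset m Un ?A" by (force simp: hset_def le_Suc_eq)
 ultimately show ?case by simp
qed

definition Wset :: "nat => 'c fls set" where "Wset m = (%i. D 0 (om i)) ` {1..m}"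

lemma twl_om: "i < l ==> twl l (D 0 (om i)) = inverse (em (lin (int (l - i)))) * D 0 (om i)"
proof -
 assume i: "i < l"
 have "em (lin (int (l - i))) * twl l (D 0 (om i)) = D 0 (om i)"
  using arg_cong[OF om_twist_l[OF i], of fps_to_fls] by (simp add: D_def em_def twl_fps fls_times_fps_to_fls)
 thus ?thesis using em_lin_nonzero by (metis divide_inverse mult.commute nonzero_mult_div_cancel_left)
qed

text \<open>The multipliers of \<Omega> and of \<open>\<omega>_1, ..., \<omega>_m\<close> lie in the group Ga
 of characters whose exponents at 0 and at all indices greater than m agree; the additive steps
 have multiplier 1. If \<open>\<omega>_(m+1)\<close> were algebraic, a positive power of its
 multiplier times an element of Ga would be trivial. But the exponents at 0 and m + 1 of such a
 product differ.\<close>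

lemma om_transcendental:
 assumes m: "Suc m < l"
 shows "D 0 (om (Suc m)) \<notin> acl k0 (Wset m Un hset n Un (SOm Un SL))"
proof
 assume acl: "D 0 (om (Suc m)) \<in> acl k0 (Wset m Un hset n Un (SOm Un SL))"
 define Ga where "Ga = {chr l c | c. \<forall>i. m < i --> c i = c 0}"
 have Ga1: "Ga \<subseteq> k0 - {0}" using chr_k0 by (auto simp: Ga_def)
 have Ga2: "1 \<in> Ga" unfolding Ga_def by (rule CollectI, rule exI[of _ "%_. 0"]) (simp add: chr_0)
 have Ga3: "x * y \<in> Ga" if "x \<in> Ga" "y \<in> Ga" for x y
 proof -
  obtain c c' where "x = chr l c" "\<forall>i. m < i --> c i = c 0" "y = chr l c'" "\<forall>i. m < i --> c' i = c' 0" using \<open>x \<in> Ga\<close> \<open>y \<in> Ga\<close> unfolding Ga_def by blast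
  thus ?thesis unfolding Ga_def by (intro CollectI exI[of _ "%i. c i + c' i"]) (simp add: chr_mult)
 qed
 have Ga4: "x powi k \<in> Ga" if "x \<in> Ga" for x k
 proof -
  obtain c where "x = chr l c" "\<forall>i. m < i --> c i = c 0" using \<open>x \<in> Ga\<close> unfolding Ga_def by blast
  thus ?thesis unfolding Ga_def by (intro CollectI exI[of _ "%i. c i * k"]) (simp add: chr_powi)
 qed
 let ?G = "insert (D 0 Om) (HOm Un hset n)"
 have t1: "T.tower k0 Ga (HOm Un hset n)"
  using good_hset[of n] T.tower_mono[of k0 "{1}" "HOm Un hset n" Ga] Ga2 by (simp add: good_def)
 have "s0 \<in> Ga" unfolding Ga_def by (rule CollectI, rule exI[of _ "%_. - 1"]) (simp add: chr_all)
 hence t2: "T.tower k0 Ga ?G"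
  by (rule T.tower_insert[OF t1]) (simp only: twl_em_Om diff_self subfld_0[OF subfld_adjoin])
 have "T.tower k0 Ga (?G Un {y \<in> SL. wL y <= w})" for w
 proof (induction w)
  case 0
  have "{y \<in> SL. wL y <= 0} = {}" using wL_pos by fastforce
  thus ?case using t2 by (simp only: Un_empty_right)
 next
  case (Suc w)
  let ?B = "?G Un {y \<in> SL. wL y <= w}"
  have "T.tower k0 Ga (?B Un {y \<in> SL. wL y = Suc w})"
  proof (rule T.tower_add_finite[OF _ Suc])
   show "finite {y \<in> SL. wL y = Suc w}" using finite_SL by simp
   fix y assume "y \<in> {y \<in> SL. wL y = Suc w}"
   hence "twl l y - y \<in> WS.F 1 (int (Suc w))" using tau_SL[of y l] by simp
   hence "twl l y - y \<in> adjoin k0 ?B"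
   proof induction
    case lspan_0 show ?case by (rule subfld_0[OF subfld_adjoin])
   next
    case (lspan_step x c e)
    then obtain d gs where d: "1 <= d" "d <= int (Suc w)" "set gs \<subseteq> SL" "sum_list (map wL gs) <= nat (int (Suc w) - d)"
     "e = D 0 Om powi d * prod_list gs" by (auto simp: wgens_def wprods_def)
    have "wL g <= w" if "g \<in> set gs" for g using d(1,4) member_le_sum_list[of "wL g" "map wL gs"] that by force
    hence "set gs \<subseteq> ?B" using d(3) by auto
    hence "prod_list gs \<in> adjoin k0 ?B"
     by (induction gs) (auto intro!: subfld_1[OF subfld_adjoin] subfld_mult[OF subfld_adjoin] intro: adjoin_gen)
    moreover have "c \<in> adjoin k0 ?B" using lspan_step.hyps(2) adjoin_mono[of k0 k0 HOm ?B] unfolding kOm_def by blast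
    moreover have "D 0 Om \<in> adjoin k0 ?B" by (intro adjoin_gen) simp
    ultimately show ?case unfolding d(5)
     by (intro subfld_add[OF subfld_adjoin] subfld_mult[OF subfld_adjoin] subfld_powi[OF subfld_adjoin] lspan_step.IH)
   qed
   thus "\<exists>rh\<in>Ga. twl l y - rh * y \<in> adjoin k0 ?B" using Ga2 by (intro bexI[of _ 1]) auto
  qed
  moreover have "{y \<in> SL. wL y <= Suc w} = {y \<in> SL. wL y <= w} Un {y \<in> SL. wL y = Suc w}" by auto
  ultimately show ?case by (simp only: Un_assoc)
 qed
 moreover have "{y \<in> SL. wL y <= Max (insert 0 (wL ` SL))} = SL" using finite_SL by auto
 ultimately have t3: "T.tower k0 Ga (?G Un SL)" by metis
 let ?B = "?G Un SL Un Wset m"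
 have step: "\<exists>rh\<in>Ga. twl l y - rh * y \<in> adjoin k0 (?G Un SL)" if yW: "y \<in> Wset m" for y
 proof -
  from yW
  obtain i where i: "1 <= i" "i <= m" "y = D 0 (om i)" by (auto simp: Wset_def)
  have "inverse (em (lin (int (l - i)))) \<in> Ga"
   unfolding Ga_def by (rule CollectI, rule exI[of _ "%j. if j = i then - 1 else 0"]) (use i m chr_single in auto)
  moreover have "twl l y - inverse (em (lin (int (l - i)))) * y = 0" unfolding i(3) using twl_om[of i] i m by simp
  ultimately show ?thesis using subfld_0[OF subfld_adjoin] by metis
 qed
 have tB: "T.tower k0 Ga ?B" by (rule T.tower_add_finite[OF _ t3 step]) (simp_all add: Wset_def)
 let ?N = "adjoin k0 ?B"
 have "Ga \<subseteq> k0" using Ga1 by auto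
 hence "T.stable ?N" by (rule T.tower_stable[OF stable_k0 tB])
 have "SOm \<subseteq> ?N"
 proof
  fix x assume "x \<in> SOm"
  then obtain j where "j <= n" "x = D j Om" by (auto simp: SOm_def)
  hence "x = hd Om j * D 0 Om" using D_Om[OF \<open>j <= n\<close>] by metis
  moreover have "hd Om j \<in> ?N" using hd_kOm[OF \<open>j <= n\<close>] adjoin_mono[of k0 k0 HOm ?B] unfolding kOm_def by blast
  moreover have "D 0 Om \<in> ?N" by (intro adjoin_gen) simp
  ultimately show "x \<in> ?N" using subfld_mult[OF subfld_adjoin] by blast
 qed
 hence "adjoin k0 (Wset m Un hset n Un (SOm Un SL)) \<subseteq> ?N"
  by (intro adjoin_least[OF subfld_adjoin]) (auto intro: adjoin_base adjoin_gen)
 hence alg: "algebraic_over ?N (D 0 (om (Suc m)))"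
  using acl algebraic_over_mono[OF subfld_adjoin subfld_adjoin] by (auto simp: acl_def)
 let ?xsi = "chr l (%j. if j = Suc m then - 1 else 0)"
 have nz: "D 0 (om (Suc m)) ~= 0" using om(2)[OF m] by (simp add: D_def)
 have tw: "twl l (D 0 (om (Suc m))) = ?xsi * D 0 (om (Suc m))" unfolding chr_single[OF m] by (rule twl_om[OF m])
 obtain d b where b: "d >= 1" "b \<in> ?N" "b ~= 0" "twl l b = ?xsi ^ d * b"
  using T.multiplicative_algebraic[OF \<open>T.stable ?N\<close> alg nz tw adjoin_base[OF chr_k0(1)]] by blast
 have "?xsi ^ d \<in> k0" by (intro subfld_power[OF subfld_k0] chr_k0)
 from T.tower_character_descent[OF stable_k0 tB Ga1 Ga2 Ga3 Ga4 b(2-4) this]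
 obtain E ga b' where E: "E >= 1" "ga \<in> Ga" "b' \<in> k0" "b' ~= 0" "twl l b' = (?xsi ^ d) ^ E * ga * b'" by blast
 obtain c where c: "ga = chr l c" "!!i. m < i ==> c i = c 0" using E(2) unfolding Ga_def by blast
 let ?c = "%j. (if j = Suc m then - 1 else 0) * int (d * E) + c j"
 have "(?xsi ^ d) ^ E = ?xsi powi int (d * E)" by (simp only: power_int_of_nat power_mult)
 hence "(?xsi ^ d) ^ E * ga = chr l ?c" by (simp only: c(1) chr_powi chr_mult)
 hence "twl l b' = chr l ?c * b'" using E(5) by simp
 note z = chr_trivial[OF E(3,4) this]
 have "?c 0 = 0" "?c (Suc m) = 0" using z[of 0] z[of "Suc m"] m by simp_all
 thus False using c(2)[of "Suc m"] b(1) E(1) by simp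
qed

lemma inc_all: "m < l ==> inc (Wset m Un hset n)"
proof (induction m)
 case 0 thus ?case using good_hset[of n] by (simp add: Wset_def good_def)
next
 case (Suc m)
 have fin: "finite (Wset m Un hset n)" using good_hset[of n] by (simp add: Wset_def good_def)
 have "inc (insert (D 0 (om (Suc m))) (Wset m Un hset n))"
  by (rule inc_insert[OF fin]) (use Suc om_transcendental[OF Suc.prems] in auto)
 moreover have "Wset (Suc m) = insert (D 0 (om (Suc m))) (Wset m)" by (simp add: Wset_def atLeastAtMostSuc_conv)
 ultimately show ?case by simp
qed

definition Sw :: "'c fls set" where "Sw = (%(i, j). D j (om i)) ` ({..<l} \<times> {..n})"

text \<open>A single twist permutes the \<open>\<omega>_i\<close> cyclically up to the factor \<open>t -
 \<theta>^q\<close>, so the product satisfies the same equation as \<Omega> and the quotient is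
 fixed.\<close>

lemma om_product: "\<exists>x\<in>k0. x ~= 0 & D 0 Om = x * (\<Prod>i<l. D 0 (om i))"
proof -
 interpret O: difference_field "twl 1" by (rule difference_field_twl)
 let ?x = "D 0 Om / (\<Prod>i<l. D 0 (om i))"
 obtain l' where l': "l = Suc l'" using l by (cases l) auto
 have z: "em (lin 1) * twl 1 (D 0 (om 0)) = D 0 (om l')"
  using arg_cong[OF om_twist(2), of fps_to_fls] by (simp add: D_def em_def twl_fps fls_times_fps_to_fls l')
 have zO: "em (lin 1) * twl 1 (D 0 Om) = D 0 Om"
  using arg_cong[OF Om(3), of fps_to_fls] by (simp add: D_def em_def twl_fps fls_times_fps_to_fls)
 have st: "twl 1 (D 0 (om (Suc i))) = D 0 (om i)" if "i < l'" for i using om_twist(1)[of i] that l' by (simp add: D_tw[symmetric])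
 have nz: "(\<Prod>i<l. D 0 (om i)) ~= 0" using om(2) by (simp add: D_def)
 have "em (lin 1) * twl 1 (\<Prod>i<l. D 0 (om i)) = em (lin 1) * twl 1 (D 0 (om 0)) * (\<Prod>i<l'. twl 1 (D 0 (om (Suc i))))"
  unfolding l' prod.lessThan_Suc_shift O.tau_mult O.tau_prod by (simp only: mult.assoc)
 also have "... = D 0 (om l') * (\<Prod>i<l'. D 0 (om i))" unfolding z using st by simp
 also have "... = (\<Prod>i<l. D 0 (om i))" by (simp add: l')
 finally have zP: "em (lin 1) * twl 1 (\<Prod>i<l. D 0 (om i)) = (\<Prod>i<l. D 0 (om i))" .
 have "twl 1 ?x = (em (lin 1) * twl 1 (D 0 Om)) / (em (lin 1) * twl 1 (\<Prod>i<l. D 0 (om i)))"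
  unfolding O.tau_divide by (simp add: lin_nonzero)
 also have "... = ?x" unfolding zP zO ..
 finally have "twl 1 ?x = ?x" .
 moreover have "?x \<in> merom" using Om(1) om(1) by (intro subfld_divide[OF subfld_merom] subfld_prod[OF subfld_merom] D_merom) auto
 ultimately have "?x \<in> k0" by (intro constants_rational[of 1]) auto
 moreover have "?x ~= 0" using nz Om(2) by (simp add: D_def)
 ultimately show ?thesis using nz by (intro bexI[of _ ?x]) auto
qed

lemma Sw_generated: "Sw \<subseteq> adjoin k0 (Wset (l - 1) Un hset n Un SOm)" "Wset (l - 1) Un hset n \<subseteq> adjoin k0 (Sw Un SOm)"
proof -
 let ?A = "adjoin k0 (Wset (l - 1) Un hset n Un SOm)" and ?B = "adjoin k0 (Sw Un SOm)"
 note A = subfld_adjoin[of k0 "Wset (l - 1) Un hset n Un SOm"] and B = subfld_adjoin[of k0 "Sw Un SOm"]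
 obtain l' where l': "l = Suc l'" using l by (cases l) auto
 have w: "D 0 (om (Suc i)) \<in> ?A" if "i < l'" for i using that l' by (intro adjoin_gen) (auto simp: Wset_def)
 obtain x where x: "x \<in> k0" "x ~= 0" "D 0 Om = x * (\<Prod>i<l. D 0 (om i))" using om_product by blast
 have "(\<Prod>i<l'. D 0 (om (Suc i))) ~= 0" using om(2) by (simp add: D_def l')
 hence "D 0 (om 0) = D 0 Om / (x * (\<Prod>i<l'. D 0 (om (Suc i))))"
  unfolding x(3) using x(2) by (simp only: l' prod.lessThan_Suc_shift) simp
 also have "... \<in> ?A" using w x(1)
  by (intro subfld_divide[OF A] subfld_mult[OF A] subfld_prod[OF A]) (auto simp: SOm_def intro: adjoin_gen adjoin_base)
 finally have w0: "D 0 (om 0) \<in> ?A" .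
 have w': "D 0 (om i) \<in> ?A" if "i < l" for i using w0 w that l' by (cases i) auto
 show "Sw \<subseteq> ?A"
 proof
  fix y assume "y \<in> Sw"
  then obtain i j where ij: "i < l" "j <= n" "y = D j (om i)" by (auto simp: Sw_def)
  show "y \<in> ?A"
  proof (cases "j = 0")
   case True thus ?thesis using w' ij by simp
  next
   case False
   hence "hd (om i) j \<in> ?A" using ij by (intro adjoin_gen) (force simp: hset_def)
   moreover have "y = hd (om i) j * D 0 (om i)" unfolding ij(3) by (rule D_hd[OF om(2)[OF ij(1)]])
   ultimately show ?thesis using w'[OF ij(1)] subfld_mult[OF A] by blast
  qed
 qed
 have *: "D j (om i) \<in> ?B" if "i < l" "j <= n" for i j using that by (intro adjoin_gen) (auto simp: Sw_def)
 have "Wset (l - 1) \<subseteq> ?B" using * l' by (auto simp: Wset_def)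
 moreover have "hset n \<subseteq> ?B" using * by (auto simp: hset_def hd_def intro!: subfld_divide[OF B])
 ultimately show "Wset (l - 1) Un hset n \<subseteq> ?B" by simp
qed

theorem functional_identity:
 "trdeg k0 (adjoin k0 (SOm Un Sw Un SL)) + trdeg k0 (adjoin k0 SOm)
   = trdeg k0 (adjoin k0 (SOm Un Sw)) + trdeg k0 (adjoin k0 (SOm Un SL))"
proof -
 let ?T = "Wset (l - 1) Un hset n"
 have fin: "finite ?T" "finite Sw" using good_hset[of n] by (auto simp: Wset_def good_def Sw_def)
 have eq: "trdeg k0 (adjoin k0 (?T Un (SOm Un R))) = trdeg k0 (adjoin k0 (SOm Un Sw Un R))" if "finite R" for R
 proof (rule trdeg_cong_acl[OF subfld_k0])
  have "Sw \<subseteq> acl k0 (?T Un (SOm Un R))"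
   by (rule order_trans[OF Sw_generated(1) order_trans[OF adjoin_mono adjoin_subset_acl]]) auto
  moreover have "SOm Un R \<subseteq> acl k0 (?T Un (SOm Un R))" by (rule subsetI, rule acl_gen) simp
  ultimately show "SOm Un Sw Un R \<subseteq> acl k0 (?T Un (SOm Un R))" by simp
  have "?T \<subseteq> acl k0 (SOm Un Sw Un R)"
   by (rule order_trans[OF Sw_generated(2) order_trans[OF adjoin_mono adjoin_subset_acl]]) auto
  moreover have "SOm Un R \<subseteq> acl k0 (SOm Un Sw Un R)" by (rule subsetI, rule acl_gen) auto
  ultimately show "?T Un (SOm Un R) \<subseteq> acl k0 (SOm Un Sw Un R)" by simp
 qed (use fin finite_SOm that in auto)
 show ?thesis using inc_all[of "l - 1"] l eq[OF finite_SL] eq[of "{}"] by (simp add: inc_def)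
qed

end

section \<open>The identity for values\<close>

context carlitz_functions begin

definition FOm :: "'c fps set" where "FOm = {hyperderiv j Om | j. j <= n}"
definition Fw :: "'c fps set" where "Fw = {hyperderiv j (om i) | i j. i < l & j <= n}"
definition FL :: "'c fps set" where "FL = {hyperderiv j (Ls s) | s j. s \<in> I & j <= n}"

abbreviation "P \<equiv> pser ` polys Kb"

lemma P_hyperderiv: "p \<in> polys Kb ==> hyperderiv j (pser p) \<in> P"
 using hyperderiv_fps_of_poly[of j p Kb] subfld_Kb by auto

lemma lin_power_P: "pser (lin 1 ^ k) \<in> P" using lin_Kb[of 1] polys_power[OF subfld_Kb] by auto

context
 fixes F :: "'c fps set" and wt :: "'c fps => nat"
 assumes F: "FOm \<subseteq> F" "!!j. j <= n ==> wt (hyperderiv j Om) <= 1"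
begin

abbreviation "W \<equiv> wspan P F wt"

lemmas W_intros = wspan_add[OF subrng_polys] wspan_mult[OF subrng_polys] wspan_cmult[OF subrng_polys]
 wspan_sum[OF subrng_polys] wspan_diff[OF subrng_polys]

lemma W_hyperderiv_mult:
 assumes "!!i. i <= j ==> hyperderiv i f \<in> W a" "!!i. i <= j ==> hyperderiv i g \<in> W b"
 shows "hyperderiv j (f * g) \<in> W (a + b)" unfolding hyperderiv_mult by (intro W_intros assms) auto

lemma W_poly: "p \<in> polys Kb ==> hyperderiv i (pser p) \<in> W 0"
 by (intro wspan_const[OF subrng_polys] P_hyperderiv)

text \<open>The Leibniz rule for \<open>(t - \<theta>^q) f^(1) = g\<close>, solved for the highest
 hyperderivative of \<open>f^(1)\<close>, costs one more factor \<open>t - \<theta>^q\<close> for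
 each order.\<close>

lemma W_twist:
 assumes f: "pser (lin 1) * tw 1 f = g" and g: "!!j. j <= n ==> hyperderiv j g \<in> W w"
 shows "j <= n ==> pser (lin 1 ^ Suc j) * tw 1 (hyperderiv j f) \<in> W w"
proof (induction j rule: less_induct)
 case (less j)
 let ?t = "%i. tw 1 (hyperderiv i f)"
 have "hyperderiv j g = (\<Sum>i\<le>j. hyperderiv i (pser (lin 1)) * ?t (j - i))"
  unfolding f[symmetric] hyperderiv_mult hyperderiv_tw ..
 also have "{..j} = insert 0 {1..j}" by auto
 finally have "pser (lin 1) * ?t j = hyperderiv j g - (\<Sum>i\<in>{1..j}. hyperderiv i (pser (lin 1)) * ?t (j - i))" by simp
 hence "pser (lin 1 ^ Suc j) * ?t j = pser (lin 1 ^ j) * hyperderiv j g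
   - (\<Sum>i\<in>{1..j}. hyperderiv i (pser (lin 1)) * (pser (lin 1 ^ j) * ?t (j - i)))"
  by (simp add: fps_of_poly_mult power_Suc2 mult.assoc right_diff_distrib sum_distrib_left mult.left_commute del: power_Suc)
 also have "... \<in> W w"
 proof (rule W_intros(5)[OF W_intros(3)[OF lin_power_P g[OF less.prems]] W_intros(4)[OF W_intros(3)]])
  fix i assume i: "i \<in> {1..j}"
  show "hyperderiv i (pser (lin 1)) \<in> P" using P_hyperderiv[OF lin_Kb[of 1]] by simp
  have "pser (lin 1 ^ (i - 1)) * (pser (lin 1 ^ Suc (j - i)) * ?t (j - i)) \<in> W w"
   by (rule W_intros(3)[OF lin_power_P less.IH]) (use i less.prems in auto)
  moreover have "lin 1 ^ j = lin 1 ^ (i - 1) * lin 1 ^ Suc (j - i)" using i by (simp add: power_add[symmetric] del: power_Suc)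
  ultimately show "pser (lin 1 ^ j) * ?t (j - i) \<in> W w" by (simp only: fps_of_poly_mult mult.assoc)
 qed
 finally show ?case .
qed

lemma W_raise: "j <= n ==> pser (lin 1 ^ Suc j) * x \<in> W w ==> pser (lin 1 ^ Suc n) * x \<in> W w"
proof -
 assume "j <= n" "pser (lin 1 ^ Suc j) * x \<in> W w"
 hence "pser (lin 1 ^ (n - j)) * (pser (lin 1 ^ Suc j) * x) \<in> W w" by (simp only: W_intros(3)[OF lin_power_P])
 moreover have "lin 1 ^ Suc n = lin 1 ^ (n - j) * lin 1 ^ Suc j" using \<open>j <= n\<close> by (simp add: power_add[symmetric] del: power_Suc)
 ultimately show ?thesis by (simp only: fps_of_poly_mult mult.assoc)
qed

lemma W_Om: "j <= n ==> hyperderiv j Om \<in> W 1" using F by (intro wspan_gen[OF subrng_polys]) (auto simp: FOm_def)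

lemma closed_Om: "j <= n ==> pser (lin 1 ^ Suc n) * tw 1 (hyperderiv j Om) \<in> W 1"
 using W_raise W_twist[OF Om(3) W_Om] by blast

lemma closed_om:
 assumes Fw: "Fw \<subseteq> F" "!!i j. i < l ==> j <= n ==> wt (hyperderiv j (om i)) <= 1" and ij: "i < l" "j <= n"
 shows "pser (lin 1 ^ Suc n) * tw 1 (hyperderiv j (om i)) \<in> W 1"
proof -
 have W: "hyperderiv j (om i) \<in> W 1" if "i < l" "j <= n" for i j
  using Fw that by (intro wspan_gen[OF subrng_polys]) (auto simp: Fw_def)
 show ?thesis
 proof (cases i)
  case 0
  show ?thesis unfolding 0 using W_raise[OF ij(2)] W_twist[OF om_twist(2) W ij(2)] l by simp
 next
  case (Suc k)
  have "tw 1 (hyperderiv j (om i)) = hyperderiv j (om k)" using om_twist(1)[of k] ij(1) Suc by (simp add: hyperderiv_tw[symmetric])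
  moreover have "hyperderiv j (om k) \<in> W 1" using W[of k j] ij Suc by simp
  ultimately show ?thesis by (simp only: W_intros(3)[OF lin_power_P])
 qed
qed

lemma W_Om_power: "j <= n ==> hyperderiv j (Om ^ a) \<in> W a"
proof (induction a arbitrary: j)
 case 0 thus ?case using W_poly[of 1 j] polys_1[OF subfld_Kb] by simp
next
 case (Suc a)
 have "hyperderiv j (Om * Om ^ a) \<in> W (1 + a)" using Suc by (intro W_hyperderiv_mult W_Om Suc.IH) auto
 thus ?case by simp
qed

lemma closed_L:
 assumes FL: "FL \<subseteq> F" "!!s j. s \<in> I ==> j <= n ==> wt (hyperderiv j (Ls s)) <= sum_list s"
 shows "s \<in> I \<or> s = [] ==> j <= n ==> hyperderiv j (tw 1 (Ls s)) \<in> W (sum_list s)"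
proof (induction s arbitrary: j rule: rev_induct)
 case Nil thus ?case using W_poly[of 1 j] polys_1[OF subfld_Kb] by (simp add: Ls(2))
next
 case (snoc a s)
 hence sI: "s @ [a] \<in> I" by simp
 have "hyperderiv j (Om ^ a * pser (u a) * tw 1 (Ls s)) \<in> W ((a + 0) + sum_list s)"
  using snoc.prems(2) I(3)[OF sI] by (intro W_hyperderiv_mult W_Om_power W_poly snoc.IH) auto
 moreover have "hyperderiv j (Ls (s @ [a])) \<in> W (sum_list (s @ [a]))"
  using FL(1) sI snoc.prems(2) by (intro wspan_gen[OF subrng_polys] FL(2)) (auto simp: FL_def)
 ultimately show ?case unfolding Ls_twist[OF sI] hyperderiv_diff by (intro W_intros(5)) (simp_all add: add.commute)
qed

end

text \<open>Functions with different names and weights may coincide. The relation R lists all weights, and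
 each function gets the smallest one.\<close>

lemma trdeg_values_family:
 assumes R: "finite R" "!!f w. (f, w) \<in> R ==> entire f & w >= 1"
  and cl: "!!wt f w. (!!f w. (f, w) \<in> R ==> wt f <= w) ==> (f, w) \<in> R ==>
   pser (lin 1 ^ Suc n) * tw 1 f \<in> wspan P (fst ` R) wt w"
 shows "trdeg Kb (adjoin Kb (eval_at th ` fst ` R)) = trdeg k0 (adjoin k0 (fps_to_fls ` fst ` R))"
proof (rule trdeg_values_eq_functions)
 let ?wt = "%f. LEAST w. (f, w) \<in> R"
 have le: "?wt f <= w" if "(f, w) \<in> R" for f w using that by (rule Least_le)
 show "finite (fst ` R)" using R(1) by simp
 fix f assume "f \<in> fst ` R"
 then obtain w where "(f, w) \<in> R" by auto
 hence min: "(f, ?wt f) \<in> R" by (rule LeastI)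
 show "entire f" "?wt f >= 1" using R(2)[OF min] by simp_all
 have "pser (lin 1 ^ Suc n) * tw 1 f \<in> wspan P (fst ` R) ?wt (?wt f)" by (rule cl[OF le min])
 moreover have "lin 1 = [:- (th ^ q), 1:]" by (simp add: lin_def zc_def)
 ultimately show "pser ([:- (th ^ q), 1:] ^ Suc n) * tw 1 f \<in> wspan P (fst ` R) ?wt (?wt f)" by (simp only:)
qed

theorem values_eq:
 assumes "G = {} \<or> G = Fw" "H = {} \<or> H = FL"
 shows "trdeg Kb (adjoin Kb (eval_at th ` (FOm Un G Un H))) = trdeg k0 (adjoin k0 (fps_to_fls ` (FOm Un G Un H)))"
proof -
 define RO where "RO = (%j. (hyperderiv j Om, 1::nat)) ` {..n}"
 define RG where "RG = (if G = {} then {} else (%(i, j). (hyperderiv j (om i), 1::nat)) ` ({..<l} \<times> {..n}))"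
 define RH where "RH = (if H = {} then {} else (%(s, j). (hyperderiv j (Ls s), sum_list s)) ` (I \<times> {..n}))"
 define R where "R = RO Un RG Un RH"
 have "Fw = (%(i, j). hyperderiv j (om i)) ` ({..<l} \<times> {..n})" "FL = (%(s, j). hyperderiv j (Ls s)) ` (I \<times> {..n})"
  "FOm = (%j. hyperderiv j Om) ` {..n}" by (auto simp: Fw_def FL_def FOm_def)
 hence "fst ` RO = FOm" "fst ` RG = G" "fst ` RH = H"
  using assms by (auto simp add: RO_def RG_def RH_def image_image case_prod_unfold)
 hence fR: "fst ` R = FOm Un G Un H" by (simp add: R_def image_Un)
 have fin: "finite R" using I(1) by (simp add: R_def RO_def RG_def RH_def)
 have RG: "\<exists>i j. i < l & j <= n & f = hyperderiv j (om i) & w = 1 & G = Fw" if "(f, w) \<in> RG" for f w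
  using that assms by (auto simp: RG_def split: if_splits)
 have RH: "\<exists>s j. s \<in> I & j <= n & f = hyperderiv j (Ls s) & w = sum_list s & H = FL" if "(f, w) \<in> RH" for f w
  using that assms by (auto simp: RH_def split: if_splits)
 have "trdeg Kb (adjoin Kb (eval_at th ` fst ` R)) = trdeg k0 (adjoin k0 (fps_to_fls ` fst ` R))"
 proof (rule trdeg_values_family)
  show "finite R" by (rule fin)
  show "entire f & w >= 1" if fw: "(f, w) \<in> R" for f w
  proof -
   consider "(f, w) \<in> RO" | "(f, w) \<in> RG" | "(f, w) \<in> RH" using fw by (auto simp: R_def)
   thus ?thesis
   proof cases
    case 1 thus ?thesis using entire_hyperderiv[OF Om(1)] by (auto simp: RO_def)
   next
    case 2 from RG[OF this] show ?thesis using entire_hyperderiv[OF om(1)] by auto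
   next
    case 3 from RH[OF this] show ?thesis using entire_hyperderiv[OF Ls(1)] sum_list_pos by auto
   qed
  qed
  fix wt f w assume wt: "!!f w. (f, w) \<in> R ==> wt f <= w" and fw: "(f, w) \<in> R"
  have F: "FOm \<subseteq> fst ` R" "!!j. j <= n ==> wt (hyperderiv j Om) <= 1" unfolding fR using wt[of _ 1] by (auto simp: R_def RO_def)
  consider "(f, w) \<in> RO" | "(f, w) \<in> RG" | "(f, w) \<in> RH" using fw by (auto simp: R_def)
  thus "pser (lin 1 ^ Suc n) * tw 1 f \<in> wspan P (fst ` R) wt w"
  proof cases
   case 1 thus ?thesis using closed_Om[where F = "fst ` R" and wt = wt, OF F] by (auto simp: RO_def)
  next
   case 2
   then obtain i j where ij: "i < l" "j <= n" "f = hyperderiv j (om i)" "w = 1" "G = Fw" using RG by blast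
   have "G ~= {}" using ij by (auto simp: Fw_def)
   hence "wt (hyperderiv j (om i)) <= 1" if "i < l" "j <= n" for i j using that by (intro wt) (auto simp: R_def RG_def)
   thus ?thesis unfolding ij(3,4) using closed_om[where F = "fst ` R" and wt = wt, OF F _ _ ij(1,2)] ij(5) fR by blast
  next
   case 3
   then obtain s j where sj: "s \<in> I" "j <= n" "f = hyperderiv j (Ls s)" "w = sum_list s" "H = FL" using RH by blast
   have "H ~= {}" using sj by (auto simp: FL_def)
   hence wL: "wt (hyperderiv j (Ls s)) <= sum_list s" if "s \<in> I" "j <= n" for s j using that by (intro wt) (auto simp: R_def RH_def)
   have "hyperderiv j (tw 1 (Ls s)) \<in> wspan P (fst ` R) wt (sum_list s)"
    by (rule closed_L[where F = "fst ` R" and wt = wt, OF F _ wL]) (use sj fR in auto)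
   thus ?thesis unfolding sj(3,4) hyperderiv_tw[symmetric] by (intro wspan_cmult[OF subrng_polys] lin_power_P)
  qed
 qed
 thus ?thesis by (simp only: fR)
qed

theorem value_identity:
 "trdeg Kb (adjoin Kb (eval_at th ` (FOm Un Fw Un FL))) + trdeg Kb (adjoin Kb (eval_at th ` FOm))
   = trdeg Kb (adjoin Kb (eval_at th ` (FOm Un Fw))) + trdeg Kb (adjoin Kb (eval_at th ` (FOm Un FL)))"
proof -
 have "fps_to_fls ` FOm = SOm" "fps_to_fls ` Fw = Sw" "fps_to_fls ` FL = SL"
  by (auto simp: FOm_def Fw_def FL_def SOm_def Sw_def SL_def D_def)
 thus ?thesis using functional_identity values_eq[of "{}" "{}"] values_eq[of Fw "{}"] values_eq[of "{}" FL] values_eq[of Fw FL]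
  by (simp add: image_Un[of fps_to_fls])
qed

end

section \<open>The functions Omega\<close>

context carlitz_field begin

lemma theta_nonzero: "th ~= 0" using cabs_theta q_gt1 by auto

lemma gauss_bd_limit:
 assumes "!!j. (%N. cf (f N) j) ----> cf g j" "!!N. gauss_bd (f N) R B" "R > 0"
 shows "gauss_bd g R B" unfolding gauss_bd_def
proof
 fix j
 have "cabs (cf g j) <= B / R ^ j"
  by (rule C_tendsto_cabs_le[OF assms(1), of 0]) (use assms(2,3) in "simp add: gauss_bd_def field_simps")
 thus "cabs (cf g j) * R ^ j <= B" using assms(3) by (simp add: field_simps)
qed

context
 fixes r :: 'c and l :: nat
 assumes l: "l >= 1" and r: "r ^ (q ^ l - 1) = - th"
begin

text \<open>omg e is the (-e)-fold twist of \<open>\<Omega>_l\<close> (\<open>twist_Omega\<close>): the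
 exponents \<open>q^(i l)\<close> and \<open>q^l\<close> become \<open>q^(i l - e)\<close> and
 \<open>q^(l - e)\<close>, so no roots have to be chosen.\<close>

definition Qp :: "nat => nat => 'c fps" where
 "Qp e N = (\<Prod>i=1..N. 1 - fps_const (inverse (th ^ (q ^ (i * l - e)))) * fps_X)"

definition wp :: "nat => 'c fps" where "wp e = Abs_fps (%j. lim (%N. cf (Qp e N) j))"
definition omg :: "nat => 'c fps" where "omg e = fps_const (inverse (r ^ (q ^ (l - e)))) * wp e"

lemma r_nonzero: "r ~= 0"
proof
 assume "r = 0"
 have "q ^ l > 1" using one_less_power[OF q_gt1] l by simp
 hence "q ^ l - 1 > 0" by simp
 hence "r ^ (q ^ l - 1) = 0" unfolding \<open>r = 0\<close> by (rule zero_power)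
 thus False using r theta_nonzero by (metis neg_equal_0_iff_equal)
qed

lemma factor_gauss: "R >= 0 ==> gauss_bd (1 - fps_const c * fps_X) R (max 1 (cabs c * R))"
proof -
 assume "R >= 0"
 have "cabs (cf (1 - fps_const c * fps_X) i) * R ^ i <= max 1 (cabs c * R)" for i
  by (cases i; cases "i - 1") (auto simp: fps_X_nth)
 thus ?thesis by (simp add: gauss_bd_def)
qed

lemma cabs_theta_power: "cabs (inverse (th ^ (q ^ k))) = 1 / real q ^ (q ^ k)"
 by (simp add: cabs_inverse cabs_power cabs_theta divide_inverse)

lemma small_inverse: assumes "R > 0" "e < l" shows "\<exists>i0. \<forall>i\<ge>i0. cabs (inverse (th ^ (q ^ (i * l - e)))) * R <= 1"
proof -
 obtain k where k: "R < real q ^ k" using real_arch_pow[of "real q" R] q_gt1 by auto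
 have "cabs (inverse (th ^ (q ^ (i * l - e)))) * R <= 1" if i: "i >= k + 1" for i
 proof -
  have "k * 1 <= (i - 1) * l" using i l by (intro mult_mono) auto
  moreover have "(i - 1) * l + l = i * l" using i by (cases i) auto
  ultimately have "k <= i * l - e" using assms(2) by linarith
  also have "... < q ^ (i * l - e)" using q_gt1 less_exp[of "i * l - e"] power_mono[of 2 q "i * l - e"] by linarith
  finally have "real q ^ k <= real q ^ (q ^ (i * l - e))" using q_gt1 by (intro power_increasing) auto
  hence "R <= real q ^ (q ^ (i * l - e))" using k by simp
  thus ?thesis unfolding cabs_theta_power using q_pos by (simp add: field_simps)
 qed
 thus ?thesis by blast
qed

lemma Qp_gauss: assumes "R > 0" "e < l" shows "\<exists>B. \<forall>N. gauss_bd (Qp e N) R B"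
proof -
 let ?m = "%i. max 1 (cabs (inverse (th ^ (q ^ (i * l - e)))) * R)"
 obtain i0 where i0: "!!i. i >= i0 ==> cabs (inverse (th ^ (q ^ (i * l - e)))) * R <= 1" using small_inverse[OF assms] by blast
 have g: "gauss_bd (Qp e N) R (\<Prod>i=1..N. ?m i)" for N
  unfolding Qp_def by (rule gauss_bd_prod) (use assms(1) factor_gauss in auto)
 have "(\<Prod>i=1..N. ?m i) <= (\<Prod>i=1..i0. ?m i)" for N
 proof -
  have "(\<Prod>i=1..N. ?m i) <= (\<Prod>i=1..max N i0. ?m i)" by (rule prod_mono2) auto
  also have "(\<Prod>i=1..max N i0. ?m i) = (\<Prod>i=1..i0. ?m i)"
   by (rule prod.mono_neutral_right) (use i0 in "auto intro!: max_absorb1")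
  finally show ?thesis .
 qed
 thus ?thesis using g gauss_bd_mono by blast
qed

lemma Qp_limit: assumes "e < l" shows "(%N. cf (Qp e N) j) ----> cf (wp e) j"
proof -
 obtain B where B: "!!N. gauss_bd (Qp e N) 1 B" using Qp_gauss[OF _ assms, of 1] by auto
 let ?c = "%N. inverse (th ^ (q ^ (N * l - e)))"
 have step: "Qp e (Suc N) = Qp e N - fps_const (?c (Suc N)) * (fps_X * Qp e N)" for N
  by (simp add: Qp_def algebra_simps)
 have "(%N. cabs (cf (Qp e (Suc N)) j - cf (Qp e N) j)) ----> 0"
 proof (rule null_seq_le)
  have "(%N. (1 / real q) ^ N) ----> 0" using q_gt1 by (intro LIMSEQ_realpow_zero) auto
  thus "(%N. (1 / real q) ^ N * B) ----> 0" using tendsto_mult_left_zero by blast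
  fix N
  have c: "cabs (?c (Suc N)) <= (1 / real q) ^ N"
  proof -
   have "N * 1 <= N * l" using l by (intro mult_left_mono) auto
   moreover have "Suc N * l = N * l + l" by simp
   ultimately have "N <= Suc N * l - e" using assms by linarith
   also have "... < q ^ (Suc N * l - e)" using q_gt1 less_exp[of "Suc N * l - e"] power_mono[of 2 q "Suc N * l - e"] by linarith
   finally have "real q ^ N <= real q ^ (q ^ (Suc N * l - e))" using q_gt1 by (intro power_increasing) auto
   thus ?thesis unfolding cabs_theta_power using q_pos by (simp add: power_one_over field_simps)
  qed
  have B0: "B >= 0" using gauss_bd_nonneg[OF B] .
  have b: "cabs (cf (fps_X * Qp e N) j) <= B" using B[of N] B0 by (cases j) (auto simp: gauss_bd_def)
  have "cf (Qp e (Suc N)) j - cf (Qp e N) j = - (?c (Suc N) * cf (fps_X * Qp e N) j)" unfolding step by simp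
  hence "cabs (cf (Qp e (Suc N)) j - cf (Qp e N) j) = cabs (?c (Suc N)) * cabs (cf (fps_X * Qp e N) j)"
   by (simp only: cabs_minus cabs_mult)
  also have "... <= (1 / real q) ^ N * B" by (intro mult_mono c b) auto
  finally show "cabs (cf (Qp e (Suc N)) j - cf (Qp e N) j) <= (1 / real q) ^ N * B" .
 qed simp
 from C_convergent_null_diff[OF this] obtain L where "(%N. cf (Qp e N) j) ----> L" by blast
 thus ?thesis by (simp add: wp_def limI)
qed

lemma entire_wp: assumes "e < l" shows "entire (wp e)"
 unfolding entire_def using Qp_gauss[OF _ assms] gauss_bd_limit[OF Qp_limit[OF assms]] by meson

lemma entire_omg: "e < l ==> entire (omg e)" unfolding omg_def by (intro entire_mult entire_const entire_wp)

lemma wp_gauss_one: "gauss_bd (wp 0) 1 1"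
proof (rule gauss_bd_limit[OF Qp_limit])
 fix N
 have "gauss_bd (Qp 0 N) 1 (\<Prod>i=1..N. 1)" unfolding Qp_def
 proof (rule gauss_bd_prod)
  fix i
  have "cabs (inverse (th ^ (q ^ (i * l - 0)))) * 1 <= 1" using one_le_power[of "real q" "q ^ (i * l)"] q_gt1 by (simp add: cabs_theta_power)
  thus "gauss_bd (1 - fps_const (inverse (th ^ (q ^ (i * l - 0)))) * fps_X) 1 1"
   using factor_gauss[of 1 "inverse (th ^ (q ^ (i * l - 0)))"] by (simp only: max_absorb1)
 qed simp_all
 thus "gauss_bd (Qp 0 N) 1 1" by simp
qed (use l in auto)

lemma omg_nonzero: assumes "e < l" shows "omg e ~= 0"
proof -
 have "cf (Qp e N) 0 = 1" for N by (induction N) (simp_all add: Qp_def)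
 hence "cf (wp e) 0 = 1" using Qp_limit[OF assms, of 0] LIMSEQ_unique[OF _ tendsto_const[of "1::'c"]] by simp
 hence "cf (omg e) 0 ~= 0" using r_nonzero by (simp add: omg_def)
 thus ?thesis by auto
qed

lemma Omega_eq: "Omega q th r l = omg 0" by (simp add: Omega_def omg_def wp_def Qp_def)

lemma tw_wp:
 assumes "!!N. tw 1 (Qp e N) = f N" "!!j. (%N. cf (f N) j) ----> cf g j" "e < l"
 shows "tw 1 (wp e) = g"
proof (rule fps_ext)
 fix j
 have "(%N. cf (tw 1 (Qp e N)) j) ----> cf (tw 1 (wp e)) j"
  unfolding tw_nth by (rule C_tendsto_power[OF Qp_limit[OF assms(3)]])
 thus "cf (tw 1 (wp e)) j = cf g j" unfolding assms(1) using assms(2) by (rule LIMSEQ_unique)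
qed

lemma omg_twist: assumes "Suc e < l" shows "tw 1 (omg (Suc e)) = omg e"
proof -
 have "tw 1 (Qp (Suc e) N) = Qp e N" for N unfolding Qp_def tw_prod
 proof (rule prod.cong[OF refl])
  fix i assume i: "i \<in> {1..N}"
  have "l <= i * l" using i by simp
  hence "Suc (i * l - Suc e) = i * l - e" using assms by linarith
  hence "q ^ (i * l - Suc e) * q ^ 1 = q ^ (i * l - e)" by (metis power_Suc2 power_one_right)
  thus "tw 1 (1 - fps_const (inverse (th ^ q ^ (i * l - Suc e))) * fps_X) = 1 - fps_const (inverse (th ^ q ^ (i * l - e))) * fps_X"
   by (simp only: tw_diff tw_mult tw_one tw_const tw_X power_inverse[symmetric] power_mult[symmetric])
 qed
 from tw_wp[OF this Qp_limit] have "tw 1 (wp (Suc e)) = wp e" using assms by simp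
 moreover have "q ^ (l - Suc e) * q ^ 1 = q ^ (l - e)" using assms by (metis Suc_diff_Suc Suc_lessD power_Suc2 power_one_right)
 ultimately show ?thesis by (simp only: omg_def tw_mult tw_const power_inverse[symmetric] power_mult[symmetric])
qed

text \<open>The twist of the product for e = 0 lacks the first factor \<open>1 - t / \<theta>^q\<close> of
 the product for e = l - 1; the power of r turns it into \<open>t - \<theta>^q\<close>.\<close>

lemma omg_twist_0: "pser (lin 1) * tw 1 (omg 0) = omg (l - 1)"
proof -
 let ?c = "inverse (th ^ q)"
 have "Qp (l - 1) (Suc N) = (1 - fps_const ?c * fps_X) * tw 1 (Qp 0 N)" for N
 proof -
  have "Qp (l - 1) (Suc N) = (1 - fps_const (inverse (th ^ (q ^ (1 * l - (l - 1))))) * fps_X)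
    * (\<Prod>i=1..N. 1 - fps_const (inverse (th ^ (q ^ (Suc i * l - (l - 1))))) * fps_X)"
  proof -
   have "{1..Suc N} = insert 1 (Suc ` {1..N})" by (auto simp: image_Suc_atLeastAtMost)
   moreover have "1 \<notin> Suc ` {1..N}" by auto
   ultimately show ?thesis unfolding Qp_def by (simp only: prod.insert[OF finite_imageI[OF finite_atLeastAtMost]] prod.reindex[OF inj_Suc] o_def simp_thms)
  qed
  also have "1 * l - (l - 1) = 1" using l by simp
  also have "(\<Prod>i=1..N. 1 - fps_const (inverse (th ^ (q ^ (Suc i * l - (l - 1))))) * fps_X) = tw 1 (Qp 0 N)"
   unfolding Qp_def tw_prod
  proof (rule prod.cong[OF refl])
   fix i assume "i \<in> {1..N}"
   have "Suc i * l - (l - 1) = Suc (i * l)" using l by simp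
   hence "q ^ (i * l - 0) * q ^ 1 = q ^ (Suc i * l - (l - 1))" by simp
   thus "1 - fps_const (inverse (th ^ q ^ (Suc i * l - (l - 1)))) * fps_X = tw 1 (1 - fps_const (inverse (th ^ q ^ (i * l - 0))) * fps_X)"
    by (simp only: tw_diff tw_mult tw_one tw_const tw_X power_inverse[symmetric] power_mult[symmetric])
  qed
  finally show ?thesis by simp
 qed
 note split = this
 have wl: "wp (l - 1) = (1 - fps_const ?c * fps_X) * tw 1 (wp 0)"
 proof (rule fps_ext)
  fix j
  have t: "(%N. cf (tw 1 (Qp 0 N)) j) ----> cf (tw 1 (wp 0)) j" for j
   using C_tendsto_power[OF Qp_limit[of 0 j]] l by simp
  have nth: "cf ((1 - fps_const ?c * fps_X) * f) j = cf f j - ?c * (if j = 0 then 0 else cf f (j - 1))" for f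
   by (simp add: left_diff_distrib mult.assoc fps_X_mult_nth)
  have "(%N. cf (Qp (l - 1) (Suc N)) j) ----> cf ((1 - fps_const ?c * fps_X) * tw 1 (wp 0)) j" unfolding split nth
  proof (intro C_tendsto_diff C_tendsto_cmult t)
   show "(%N. if j = 0 then 0 else cf (tw 1 (Qp 0 N)) (j - 1)) ----> (if j = 0 then 0 else cf (tw 1 (wp 0)) (j - 1))"
    using t[of "j - 1"] by (cases "j = 0") simp_all
  qed
  moreover have "(%N. cf (Qp (l - 1) (Suc N)) j) ----> cf (wp (l - 1)) j" using l by (intro LIMSEQ_Suc Qp_limit) simp
  ultimately show "cf (wp (l - 1)) j = cf ((1 - fps_const ?c * fps_X) * tw 1 (wp 0)) j" by (rule LIMSEQ_unique[rotated])
 qed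
 have lin1: "pser (lin 1) = fps_const (- (th ^ q)) * (1 - fps_const ?c * fps_X)"
 proof (rule fps_ext)
  fix j show "cf (pser (lin 1)) j = cf (fps_const (- (th ^ q)) * (1 - fps_const ?c * fps_X)) j"
   using theta_nonzero by (cases j; cases "j - 1") (auto simp: lin_def zc_def)
 qed
 have "r ^ (q ^ l) = r ^ (q ^ l - 1) * r" using q_pos power_Suc2[of r "q ^ l - 1"] by simp
 hence "(r ^ (q ^ l)) ^ q = (- th) ^ q * r ^ q" by (simp only: r power_mult_distrib)
 moreover have "(- th) ^ q = - (th ^ q)" using frob_minus[of th 1] by simp
 ultimately have rr: "- (th ^ q) * inverse ((r ^ (q ^ l)) ^ q) = inverse (r ^ q)" using theta_nonzero r_nonzero by (simp add: field_simps)
 have "q ^ (l - (l - 1)) = q" using l by simp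
 hence o1: "omg (l - 1) = fps_const (inverse (r ^ q)) * wp (l - 1)" by (simp add: omg_def)
 have o2: "tw 1 (omg 0) = fps_const (inverse ((r ^ (q ^ l)) ^ q)) * tw 1 (wp 0)" by (simp add: omg_def tw_mult power_inverse)
 have "pser (lin 1) * tw 1 (omg 0)
   = (fps_const (- (th ^ q)) * fps_const (inverse ((r ^ (q ^ l)) ^ q))) * ((1 - fps_const ?c * fps_X) * tw 1 (wp 0))"
  unfolding lin1 o2 by (simp only: mult_ac)
 also have "... = omg (l - 1)" unfolding fps_const_mult rr o1 wl ..
 finally show ?thesis .
qed

lemma twist_Omega: assumes "e < l" shows "twist q (- int e) (Omega q th r l) = omg e"
proof -
 have "tw k (omg k) = omg 0" if "k < l" for k using that
 proof (induction k)
  case (Suc k)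
  have "tw (Suc k) (omg (Suc k)) = tw k (tw 1 (omg (Suc k)))" by (simp add: tw_tw)
  thus ?case using Suc omg_twist[of k] by simp
 qed simp
 from this[OF assms] have "cf (omg 0) j = cf (omg e) j ^ q ^ e" for j by (metis tw_nth)
 hence "(THE b. b ^ (q ^ e) = cf (omg 0) j) = cf (omg e) j" for j using frob_inj by (intro the_equality) auto
 moreover have "frob_power q (- int e) a = (THE b. b ^ (q ^ e) = a)" for a :: 'c
  by (cases "e = 0") (simp_all add: frob_power_def)
 ultimately show ?thesis unfolding Omega_eq by (intro fps_ext) (simp add: twist_def)
qed

lemma omg_gauss_one: "gauss_bd (omg 0) 1 (1 / cabs r ^ (q ^ l))"
 using gauss_bd_mult[OF _ gauss_bd_const wp_gauss_one, of "inverse (r ^ (q ^ l))"]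
 by (simp add: omg_def cabs_inverse cabs_power divide_inverse)

end

end

section \<open>The L-series\<close>

context carlitz_field begin

text \<open>Beyond some index J the coefficients are small even for radius 2, and for the finitely many
 others the radius can be increased a little because rh < 1.\<close>

lemma gauss_radius_above_one:
 assumes g: "entire g" "gauss_bd g 1 rh" and rh: "rh < 1"
 shows "\<exists>r>1. gauss_bd g r 1"
proof -
 obtain B where B: "gauss_bd g 4 B" using g(1) unfolding entire_def by (metis zero_less_numeral)
 obtain J where J: "B < 2 ^ J" using real_arch_pow[of 2 B] by auto
 have "(%n. rh * (1 + inverse (real (Suc n))) ^ J) ----> rh * (1 + 0) ^ J" by (intro tendsto_intros LIMSEQ_inverse_real_of_nat)
 hence "\<forall>\<^sub>F n in sequentially. rh * (1 + inverse (real (Suc n))) ^ J < 1" using rh by (intro order_tendstoD(2)[where y = "rh * (1 + 0) ^ J"]) auto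
 then obtain n where n: "rh * (1 + inverse (real (Suc n))) ^ J < 1" by (auto simp: eventually_sequentially)
 define r where "r = 1 + inverse (real (Suc n))"
 have r: "r > 1" "r <= 2" by (auto simp: r_def inverse_eq_divide)
 have rh0: "rh >= 0" using gauss_bd_nonneg[OF g(2)] .
 have "cabs (cf g j) * r ^ j <= 1" for j
 proof (cases "j < J")
  case True
  have "cabs (cf g j) <= rh" using g(2) by (simp add: gauss_bd_def)
  moreover have "r ^ j <= r ^ J" using r(1) True by (intro power_increasing) auto
  ultimately have "cabs (cf g j) * r ^ j <= rh * r ^ J" using rh0 r by (intro mult_mono) auto
  thus ?thesis using n by (simp add: r_def)
 next
  case False
  have le: "cabs (cf g j) * r ^ j <= cabs (cf g j) * 2 ^ j" using r by (intro mult_left_mono power_mono) auto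
  have "(4::real) ^ j = 2 ^ j * 2 ^ j" by (simp add: power_mult_distrib[symmetric])
  moreover have "cabs (cf g j) * 4 ^ j <= B" using B unfolding gauss_bd_def by blast
  ultimately have "cabs (cf g j) * 2 ^ j * 2 ^ j <= B" by (simp only: mult.assoc)
  hence "cabs (cf g j) * 2 ^ j * 2 ^ j <= 1 * 2 ^ j" using J False power_increasing[of J j "2::real"] by linarith
  hence "cabs (cf g j) * 2 ^ j <= 1" by (rule mult_right_le_imp_le) simp
  with le show ?thesis by linarith
 qed
 thus ?thesis using r(1) by (intro exI[of _ r]) (auto simp: gauss_bd_def)
qed

text \<open>The i-fold twist of g has Gauss norm at most 1 on the radius \<open>r ^ q ^ i\<close> with r > 1,
 so only finitely many twists exceed 1 at a given radius.\<close>

lemma tw_gauss_uniform: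
 assumes g: "entire g" "gauss_bd g 1 rh" "rh < 1" and R: "R > 0"
 shows "\<exists>B. \<forall>i. gauss_bd (tw i g) R B"
proof -
 obtain r where r: "r > 1" "gauss_bd g r 1" using gauss_radius_above_one[OF g] by blast
 obtain i0 where i0: "R < r ^ i0" using real_arch_pow[OF r(1)] by blast
 have "\<exists>B. gauss_bd (tw i g) R B" for i using entire_tw[OF g(1)] R unfolding entire_def by blast
 then obtain B where B: "!!i. gauss_bd (tw i g) R (B i)" by metis
 have "gauss_bd (tw i g) R (1 + (\<Sum>i<i0. B i))" for i
 proof (cases "i < i0")
  case True
  have "B i <= (\<Sum>i<i0. B i)" using True gauss_bd_nonneg[OF B] by (intro member_le_sum) auto
  thus ?thesis using gauss_bd_mono[OF B] by simp
 next
  case False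
  have "i0 <= q ^ i" using False q_gt1 less_exp[of i] power_mono[of 2 q i] by linarith
  hence "r ^ i0 <= r ^ q ^ i" using r(1) by (intro power_increasing) auto
  moreover have "gauss_bd (tw i g) (r ^ q ^ i) (1 ^ q ^ i)" using r by (intro gauss_bd_tw) auto
  ultimately have g1: "gauss_bd (tw i g) R 1" using R i0 by (intro gauss_bd_radius[of "tw i g" "r ^ q ^ i" 1 R]) auto
  have "(\<Sum>i<i0. B i) >= 0" by (rule sum_nonneg, rule gauss_bd_nonneg[OF B])
  thus ?thesis by (intro gauss_bd_mono[OF g1]) simp
 qed
 thus ?thesis by blast
qed

definition dl :: "nat => nat list set" where "dl d = {k. length k = d & sorted_wrt (>) k}"
definition An :: "nat => nat => nat list set" where "An d N = {k \<in> dl d. set k \<subseteq> {..<N}}"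

lemma finite_An: "finite (An d N)"
 by (rule finite_subset[OF _ finite_lists_length_eq[of "{..<N}" d]]) (auto simp: An_def dl_def)

lemma An_0: "An 0 N = {[]}" by (auto simp: An_def dl_def)

lemma An_Suc: "An (Suc d) (Suc N) = (%k. map Suc k @ [0]) ` An d N Un map Suc ` An (Suc d) N"
proof (intro equalityI subsetI)
 have sw: "sorted_wrt (>) (map Suc k) \<longleftrightarrow> sorted_wrt (>) k" for k by (simp add: sorted_wrt_map)
 have pos: "\<exists>k'. k = map Suc k'" if "\<forall>x\<in>set k. x > 0" for k
  by (rule exI[of _ "map (%x. x - 1) k"]) (use that in "auto intro!: map_idI[symmetric]")
 fix k assume k: "k \<in> An (Suc d) (Suc N)"
 hence "k ~= []" by (auto simp: An_def dl_def)
 then obtain k1 x where kx: "k = k1 @ [x]" by (metis append_butlast_last_id)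
 hence k1: "k = k1 @ [x]" "length k1 = d" "sorted_wrt (>) k1" "\<forall>y\<in>set k1. y > x" "set k \<subseteq> {..<Suc N}"
  using k by (auto simp: An_def dl_def sorted_wrt_append)
 show "k \<in> (%k. map Suc k @ [0]) ` An d N Un map Suc ` An (Suc d) N"
 proof (cases "x = 0")
  case True
  then obtain k' where k': "k1 = map Suc k'" using pos[of k1] k1(4) by auto
  have "k' \<in> An d N" using k1 sw[of k'] unfolding k' An_def dl_def by auto
  thus ?thesis using k1(1) True k' by blast
 next
  case False
  hence "\<forall>y\<in>set k. y > 0" using k1(1,4) by auto
  from pos[OF this] obtain k' where k': "k = map Suc k'" by blast
  have "k' \<in> An (Suc d) N" using k sw[of k'] unfolding k' An_def dl_def by auto
  thus ?thesis using k' by blast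
 qed
next
 fix k assume "k \<in> (%k. map Suc k @ [0]) ` An d N Un map Suc ` An (Suc d) N"
 thus "k \<in> An (Suc d) (Suc N)" by (auto simp: An_def dl_def sorted_wrt_map sorted_wrt_append)
qed

text \<open>For the L-series \<open>g a = \<Omega>^a u_a\<close>. That its Gauss norm is less than 1 is the
 hypothesis on \<open>u_a\<close> in the theorem, and it makes the series converge.\<close>

context
 fixes g :: "nat => 'c fps" and A :: "nat set" and rh :: real
 assumes g: "!!a. a \<in> A ==> entire (g a)" "!!a. a \<in> A ==> gauss_bd (g a) 1 rh" and rh: "0 <= rh" "rh < 1"
begin

definition Tp :: "nat list => nat list => 'c fps" where "Tp s k = (\<Prod>r<length s. tw (k ! r) (g (s ! r)))"
definition Lp :: "nat list => nat => 'c fps" where "Lp s N = (\<Sum>k\<in>An (length s) N. Tp s k)"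
definition Lf :: "nat list => 'c fps" where "Lf s = Abs_fps (%j. lim (%N. cf (Lp s N) j))"

lemma rho_power: "x >= N ==> rh ^ q ^ x <= rh ^ N"
 using rh q_gt1 less_exp[of x] power_mono[of 2 q x] by (intro power_decreasing) linarith+

lemma Tp_small:
 assumes s: "set s \<subseteq> A" and k: "k \<in> dl (length s)" "x \<in> set k" "x >= N"
 shows "cabs (cf (Tp s k) j) <= rh ^ N"
proof -
 obtain r0 where r0: "r0 < length s" "k ! r0 = x" using k(1,2) by (auto simp: dl_def in_set_conv_nth)
 have f: "gauss_bd (tw i (g (s ! r))) 1 (rh ^ q ^ i)" if "r < length s" for i r
  using gauss_bd_tw[OF g(2)[OF subsetD[OF s nth_mem[OF that]]], of i] by simp
 have "gauss_bd (Tp s k) 1 (\<Prod>r<length s. if r = r0 then rh ^ q ^ x else 1)" unfolding Tp_def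
 proof (rule gauss_bd_prod)
  fix r assume "r \<in> {..<length s}"
  moreover have "rh ^ q ^ (k ! r) <= 1" using rh by (intro power_le_one) auto
  ultimately show "gauss_bd (tw (k ! r) (g (s ! r))) 1 (if r = r0 then rh ^ q ^ x else 1)"
   using f[of r "k ! r"] r0(2) gauss_bd_mono by auto
 qed simp
 hence "gauss_bd (Tp s k) 1 (rh ^ q ^ x)" using r0(1) by simp
 thus ?thesis using rho_power[OF k(3)] unfolding gauss_bd_def by (metis mult.right_neutral order_trans power_one)
qed

lemma Tp_gauss: assumes "set s \<subseteq> A" "R > 0" shows "\<exists>B. \<forall>k. gauss_bd (Tp s k) R B"
proof -
 have "\<exists>B. \<forall>i. gauss_bd (tw i (g a)) R B" if "a \<in> A" for a by (rule tw_gauss_uniform[OF g(1,2) rh(2) assms(2)]) (use that in auto)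
 then obtain B where B: "!!a i. a \<in> A ==> gauss_bd (tw i (g a)) R (B a)" by metis
 have "gauss_bd (Tp s k) R (\<Prod>r<length s. B (s ! r))" for k
  unfolding Tp_def by (rule gauss_bd_prod) (use assms(2) B[OF subsetD[OF assms(1) nth_mem]] in auto)
 thus ?thesis by blast
qed

lemma An_mono: "N <= M ==> An d N \<subseteq> An d M" by (auto simp: An_def)

lemma Lp_limit: assumes s: "set s \<subseteq> A" shows "(%N. cf (Lp s N) j) ----> cf (Lf s) j"
proof -
 have "(%N. cabs (cf (Lp s (Suc N)) j - cf (Lp s N) j)) ----> 0"
 proof (rule null_seq_le)
  show "(%N. rh ^ N) ----> 0" using rh by (intro LIMSEQ_realpow_zero) auto
  fix N
  have "Lp s (Suc N) = Lp s N + (\<Sum>k\<in>An (length s) (Suc N) - An (length s) N. Tp s k)"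
   unfolding Lp_def using sum.subset_diff[OF An_mono[of N "Suc N" "length s"] finite_An, of "Tp s"] by (simp add: add.commute)
  hence "cf (Lp s (Suc N)) j - cf (Lp s N) j = (\<Sum>k\<in>An (length s) (Suc N) - An (length s) N. cf (Tp s k) j)"
   by (simp add: fps_sum_nth)
  also have "cabs ... <= rh ^ N"
  proof (rule cabs_sum_le)
   fix k assume k: "k \<in> An (length s) (Suc N) - An (length s) N"
   hence "\<not> set k \<subseteq> {..<N}" by (auto simp: An_def)
   then obtain x where "x \<in> set k" "x >= N" by (metis lessThan_iff not_less subsetI)
   thus "cabs (cf (Tp s k) j) <= rh ^ N" using k by (intro Tp_small[OF s]) (auto simp: An_def)
  qed (use rh in simp)
  finally show "cabs (cf (Lp s (Suc N)) j - cf (Lp s N) j) <= rh ^ N" .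
 qed simp
 from C_convergent_null_diff[OF this] obtain L where "(%N. cf (Lp s N) j) ----> L" by blast
 thus ?thesis by (simp add: Lf_def limI)
qed

lemma entire_Lf: assumes "set s \<subseteq> A" shows "entire (Lf s)" unfolding entire_def
proof (intro allI impI)
 fix R :: real assume R: "R > 0"
 obtain B where B: "!!k. gauss_bd (Tp s k) R B" using Tp_gauss[OF assms R] by blast
 have "gauss_bd (Lp s N) R B" for N unfolding Lp_def using R gauss_bd_nonneg[OF B] B by (intro gauss_bd_sum) auto
 thus "\<exists>B. gauss_bd (Lf s) R B" using gauss_bd_limit[OF Lp_limit[OF assms] _ R] by blast
qed

lemma Lf_has_sum:
 assumes s: "set s \<subseteq> A" shows "((%k. cf (Tp s k) j) has_sum cf (Lf s) j) (dl (length s))"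
 unfolding has_sum_def tendsto_iff eventually_finite_subsets_at_top
proof (intro allI impI)
 fix \<epsilon> :: real assume \<epsilon>: "\<epsilon> > 0"
 have "(%N. rh ^ N) ----> 0" using rh by (intro LIMSEQ_realpow_zero) auto
 hence "\<forall>\<^sub>F N in sequentially. rh ^ N < \<epsilon>" using \<epsilon> by (intro order_tendstoD) auto
 moreover have "\<forall>\<^sub>F N in sequentially. cabs (cf (Lp s N) j - cf (Lf s) j) < \<epsilon>"
  using Lp_limit[OF s, of j] \<epsilon> unfolding C_LIMSEQ_iff eventually_sequentially by blast
 ultimately have "\<forall>\<^sub>F N in sequentially. rh ^ N < \<epsilon> & cabs (cf (Lp s N) j - cf (Lf s) j) < \<epsilon>" by eventually_elim simp
 then obtain N where N: "rh ^ N < \<epsilon>" "cabs (cf (Lp s N) j - cf (Lf s) j) < \<epsilon>" by (auto simp: eventually_sequentially)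
 let ?A = "An (length s) N"
 have "dist (\<Sum>k\<in>Y. cf (Tp s k) j) (cf (Lf s) j) < \<epsilon>" if Y: "finite Y" "?A \<subseteq> Y" "Y \<subseteq> dl (length s)" for Y
 proof -
  have "(\<Sum>k\<in>Y. cf (Tp s k) j) = (\<Sum>k\<in>Y - ?A. cf (Tp s k) j) + cf (Lp s N) j"
   unfolding Lp_def fps_sum_nth by (rule sum.subset_diff[OF Y(2,1)])
  hence "(\<Sum>k\<in>Y. cf (Tp s k) j) - cf (Lf s) j = (\<Sum>k\<in>Y - ?A. cf (Tp s k) j) + (cf (Lp s N) j - cf (Lf s) j)" by simp
  also have "cabs ... < \<epsilon>"
  proof (intro cabs_add_less N(2) cabs_sum_less[OF \<epsilon>])
   fix k assume k: "k \<in> Y - ?A"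
   hence "k \<in> dl (length s)" using Y(3) by auto
   moreover have "\<not> set k \<subseteq> {..<N}" using k Y(3) by (auto simp: An_def)
   then obtain x where "x \<in> set k" "x >= N" by (metis lessThan_iff not_less subsetI)
   ultimately have "cabs (cf (Tp s k) j) <= rh ^ N" by (intro Tp_small[OF s])
   thus "cabs (cf (Tp s k) j) < \<epsilon>" using N(1) by simp
  qed
  finally show ?thesis by (simp add: dist_cabs)
 qed
 moreover have "finite ?A" "?A \<subseteq> dl (length s)" by (auto simp: finite_An) (auto simp: An_def)
 ultimately show "\<exists>F. finite F & F \<subseteq> dl (length s) & (\<forall>Y. finite Y & F \<subseteq> Y & Y \<subseteq> dl (length s) -->
   dist (\<Sum>k\<in>Y. cf (Tp s k) j) (cf (Lf s) j) < \<epsilon>)" by blast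
qed

lemma Lf_Nil: "Lf [] = 1"
proof -
 have "Lp [] N = 1" for N by (simp add: Lp_def An_0 Tp_def)
 thus ?thesis by (intro fps_ext) (simp add: Lf_def limI)
qed

lemma Tp_Suc:
 "k \<in> dl (Suc d) ==> length s = d ==> Tp (s @ [a]) (map Suc k) = tw 1 (Tp (s @ [a]) k)"
 "k \<in> dl d ==> length s = d ==> Tp (s @ [a]) (map Suc k @ [0]) = g a * tw 1 (Tp s k)"
 by (auto simp: Tp_def dl_def tw_prod tw_tw nth_append tw_mult intro!: prod.cong)

text \<open>The summands of \<open>L_(s,a)\<close> with last index 0 contain the factor g a; lowering all
 other indices by 1 undoes a twist.\<close>

lemma Lf_twist:
 assumes s: "set (s @ [a]) \<subseteq> A" shows "Lf (s @ [a]) = tw 1 (Lf (s @ [a])) + g a * tw 1 (Lf s)"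
proof (rule fps_ext)
 fix j
 let ?d = "length s"
 have rec: "Lp (s @ [a]) (Suc N) = tw 1 (Lp (s @ [a]) N) + g a * tw 1 (Lp s N)" for N
 proof -
  have disj: "(%k. map Suc k @ [0]) ` An ?d N \<inter> map Suc ` An (Suc ?d) N = {}"
  proof -
   have "0 \<in> set (map Suc k @ [0])" "0 \<notin> set (map Suc k')" for k k' :: "nat list" by auto
   thus ?thesis by (metis (no_types, lifting) disjoint_iff imageE)
  qed
  have inj: "inj_on (%k. map Suc k @ [0]) (An ?d N)" "inj_on (map Suc) (An (Suc ?d) N)" by (auto simp: inj_on_def)
  have "Lp (s @ [a]) (Suc N) = (\<Sum>k\<in>An ?d N. Tp (s @ [a]) (map Suc k @ [0])) + (\<Sum>k\<in>An (Suc ?d) N. Tp (s @ [a]) (map Suc k))"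
   unfolding Lp_def by (simp add: An_Suc sum.union_disjoint[OF _ _ disj] finite_An sum.reindex[OF inj(1)] sum.reindex[OF inj(2)])
  also have "(\<Sum>k\<in>An ?d N. Tp (s @ [a]) (map Suc k @ [0])) = g a * tw 1 (Lp s N)"
   unfolding Lp_def tw_sum sum_distrib_left by (rule sum.cong[OF refl], rule Tp_Suc(2)) (auto simp: An_def)
  also have "(\<Sum>k\<in>An (Suc ?d) N. Tp (s @ [a]) (map Suc k)) = tw 1 (Lp (s @ [a]) N)"
  proof -
   have "length (s @ [a]) = Suc ?d" by simp
   thus ?thesis unfolding Lp_def tw_sum by (intro sum.cong[OF _ Tp_Suc(1)]) (auto simp: An_def)
  qed
  finally show ?thesis by (simp add: add.commute)
 qed
 have t: "(%N. cf (tw 1 (Lp s N)) j) ----> cf (tw 1 (Lf s)) j" if "set s \<subseteq> A" for s j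
  unfolding tw_nth by (rule C_tendsto_power[OF Lp_limit[OF that]])
 have "(%N. cf (tw 1 (Lp (s @ [a]) N) + g a * tw 1 (Lp s N)) j)
   ----> cf (tw 1 (Lf (s @ [a])) + g a * tw 1 (Lf s)) j"
  unfolding fps_add_nth fps_mult_nth by (intro C_tendsto_add t s C_tendsto_sum C_tendsto_cmult) (use s in auto)
 moreover have "(%N. cf (Lp (s @ [a]) (Suc N)) j) ----> cf (Lf (s @ [a])) j" by (intro LIMSEQ_Suc Lp_limit s)
 ultimately show "cf (Lf (s @ [a])) j = cf (tw 1 (Lf (s @ [a])) + g a * tw 1 (Lf s)) j"
  unfolding rec by (rule LIMSEQ_unique[rotated])
qed

end

lemma Lseries_eq:
 assumes "!!a. a \<in> A ==> entire (W ^ a * pser (u a))" "!!a. a \<in> A ==> gauss_bd (W ^ a * pser (u a)) 1 rh"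
  "0 <= rh" "rh < 1" "set s \<subseteq> A"
 shows "Lseries q W u s = Lf (%a. W ^ a * pser (u a)) s"
proof (rule fps_ext)
 fix j
 note h = Lf_has_sum[where g = "%a. W ^ a * pser (u a)" and A = A and rh = rh and s = s, OF assms, of j]
 note T = Tp_def[where g = "%a. W ^ a * pser (u a)" and A = A and rh = rh and s = s, OF assms(1-4)]
 show "cf (Lseries q W u s) j = cf (Lf (%a. W ^ a * pser (u a)) s) j"
  using infsumI[OF h] by (simp add: Lseries_def twist_eq_tw T dl_def)
qed

end

section \<open>The completion of an algebraic closure of the Laurent series\<close>

lemma finite_field_power_card:
 fixes x :: "'f::{finite,field}" shows "x ^ CARD('f) = x" "of_nat CARD('f) = (0::'f)"
proof -
 show "of_nat CARD('f) = (0::'f)"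
 proof -
  have "(\<Sum>y\<in>UNIV. y + 1) = (\<Sum>y\<in>(UNIV::'f set). y)"
   by (rule sum.reindex_bij_witness[of _ "%y. y - 1" "%y. y + 1"]) auto
  thus ?thesis by (simp add: sum.distrib)
 qed
 show "x ^ CARD('f) = x"
 proof (cases "x = 0")
  case False
  let ?U = "UNIV - {0 :: 'f}"
  have "(\<Prod>y\<in>?U. x * y) = (\<Prod>y\<in>?U. y)"
   by (rule prod.reindex_bij_witness[of _ "%y. y / x" "%y. x * y"]) (use False in auto)
  hence "x ^ card ?U * \<Prod>?U = \<Prod>?U" by (simp add: prod.distrib)
  moreover have "\<Prod>?U ~= 0" by simp
  ultimately have U: "x ^ card ?U = 1" by simp
  have "CARD('f) = Suc (card ?U)" by (rule card.remove) auto
  thus ?thesis by (simp only: power_Suc U mult_1_right)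
 qed simp
qed

lemma algebraic_closure_closed:
 fixes A :: "'a::field set"
 assumes ac: "algebraic_closure (rta\<lparr>carrier := A\<rparr>) R"
 shows "subfld A" "R \<subseteq> A" "!!P. P \<in> polys A ==> degree P > 0 ==> \<exists>x\<in>A. poly P x = 0"
proof -
 let ?L = "rta\<lparr>carrier := A\<rparr>"
 interpret B: field "rta :: 'a ring" by (rule field_from_type_algebra)
 interpret L: algebraic_closure ?L R by (rule ac)
 have sf: "subfield A rta" by (rule B.subfield_iff(1)) (use L.field_axioms in auto)
 thus A: "subfld A" by (simp add: subfield_iff_subfld)
 show "R \<subseteq> A" using L.subset by simp
 fix P :: "'a poly" assume P: "P \<in> polys A" "degree P > 0"
 let ?p = "rev (coeffs P)"
 have P0: "P ~= 0" using P(2) by auto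
 have "set ?p \<subseteq> A" using P(1) by (auto simp: polys_def coeffs_def split: if_splits)
 moreover have "Polynomials.lead_coeff ?p ~= 0" using P0 by (simp add: hd_rev last_coeffs_eq_coeff_degree)
 ultimately have pc: "?p \<in> carrier (univ_poly ?L (carrier ?L))" by (simp add: univ_poly_def polynomial_def)
 have "L.splitted ?p" by (rule L.roots_over_carrier[OF pc])
 hence "size (L.roots ?p) = Polynomials.degree ?p" by (simp add: L.splitted_def)
 moreover have "Polynomials.degree ?p > 0" using P(2) P0 by (simp add: length_coeffs)
 ultimately have "L.roots ?p ~= {#}" by auto
 then obtain x where "x \<in># L.roots ?p" by blast
 hence "L.is_root ?p x" using L.roots_mem_iff_is_root[OF pc] by simp
 hence x: "x \<in> A" "L.eval ?p x = 0" by (auto simp: L.is_root_def)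
 have "L.eval = B.eval" by (rule B.eval_consistent) (rule subfieldE(1)[OF sf])
 moreover have "B.eval p x = poly (Poly (rev p)) x" for p
  by (induction p) (auto simp: Poly_append poly_monom B.eval.simps algebra_simps)
 ultimately show "\<exists>x\<in>A. poly P x = 0" using x by auto
qed

lemma algebraic_closure_root:
 fixes A :: "'a::field set"
 assumes ac: "algebraic_closure (rta\<lparr>carrier := A\<rparr>) R" and F: "subfld F" "F \<subseteq> R" and a: "algebraic_over F a" and m: "m > 0"
 shows "\<exists>b. b ^ m = a"
proof -
 note A = algebraic_closure_closed[OF ac]
 have "\<forall>a. poly P a = 0 --> a \<in> A" if "P \<in> polys A" "P ~= 0" for P using that
 proof (induction "degree P" arbitrary: P rule: less_induct)
  case less
  show ?case
  proof (cases "degree P = 0")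
   case True
   then obtain c where "P = [:c:]" by (rule degree_eq_zeroE)
   thus ?thesis using less.prems by auto
  next
   case False
   then obtain x where x: "x \<in> A" "poly P x = 0" using A(3)[OF less.prems(1)] by blast
   hence "[:- x, 1:] dvd P" by (simp only: poly_eq_0_iff_dvd)
   then obtain Q where Q: "P = [:- x, 1:] * Q" by (rule dvdE)
   have "[:- x, 1:] * Q \<in> polys A" using less.prems(1) by (simp only: Q)
   hence "Q \<in> polys A" by (rule polys_linear_factor[OF A(1) x(1)])
   moreover have "Q ~= 0" using less.prems(2) Q by (metis mult_zero_right)
   ultimately have Q': "Q \<in> polys A" "Q ~= 0" by auto
   have "degree P = Suc (degree Q)" using Q'(2) degree_mult_eq[of "[:- x, 1:]" Q] unfolding Q by simp
   hence IH: "\<forall>a. poly Q a = 0 --> a \<in> A" by (intro less.hyps Q') simp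
   show ?thesis
   proof (intro allI impI)
    fix a assume "poly P a = 0"
    hence "a = x \<or> poly Q a = 0" by (simp only: Q poly_mult) simp
    thus "a \<in> A" using IH x(1) by blast
   qed
  qed
 qed
 moreover have "polys F \<subseteq> polys A" using F(2) A(2) by (intro polys_mono) auto
 ultimately have "a \<in> A" using a unfolding algebraic_over_iff[OF F(1)] by blast
 let ?P = "monom 1 m - [:a:]"
 have "coeff ?P m = 1" using m by (simp add: coeff_pCons split: nat.split)
 hence "m <= degree ?P" by (intro le_degree) simp
 hence "degree ?P > 0" using m by simp
 moreover have "?P \<in> polys A"
  using \<open>a \<in> A\<close> by (intro polys_diff[OF A(1)] polys_monom[OF A(1)] polys_const[OF A(1)] subfld_1[OF A(1)])
 ultimately obtain b where "poly ?P b = 0" using A(3) by blast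
 thus ?thesis by (auto simp: poly_monom)
qed

lemma subfld_range:
 fixes h :: "'x::field => 'y::field"
 assumes add: "!!x y. h (x + y) = h x + h y" and mult: "!!x y. h (x * y) = h x * h y" and one: "h 1 = 1"
 shows "subfld (range h)"
proof (rule subfldI)
 have zero: "h 0 = 0" using add[of 0 0] by (metis add_cancel_right_left add_0)
 show "0 \<in> range h" using zero by (metis rangeI)
 show "1 \<in> range h" using one by (metis rangeI)
 fix x y assume "x \<in> range h" "y \<in> range h"
 then obtain a b where ab: "x = h a" "y = h b" by auto
 show "x + y \<in> range h" "x * y \<in> range h" unfolding ab add[symmetric] mult[symmetric] by blast+
 have "x + h (- a) = 0" unfolding ab add[symmetric] using zero by simp
 hence "- x = h (- a)" by (simp add: add_eq_0_iff)
 thus "- x \<in> range h" by (rule image_eqI) simp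
 assume "x ~= 0"
 hence "a ~= 0" using ab(1) zero by auto
 hence "x * h (inverse a) = 1" unfolding ab mult[symmetric] using one by simp
 hence "inverse x = h (inverse a)" by (rule inverse_unique)
 thus "inverse x \<in> range h" by (rule image_eqI) simp
qed

lemma C_infinity_carlitz_field:
 fixes \<iota> :: "'f::{finite,field} fls => 'c::{field,metric_space}"
 assumes p: "Factorial_Ring.prime p" and e: "e >= 1" and q: "q = p ^ e" "CARD('f) = q" and C: "is_C_infinity \<iota>"
 shows "carlitz_field q (range (%c. \<iota> (fls_const c))) (theta \<iota>)"
proof -
 have h: "\<iota> \<in> ring_hom rta rta" using C by (simp add: is_C_infinity_def)
 have add: "\<iota> (x + y) = \<iota> x + \<iota> y" and mult: "\<iota> (x * y) = \<iota> x * \<iota> y" and one: "\<iota> 1 = 1" for x y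
  using ring_hom_add[OF h, of x y] ring_hom_mult[OF h, of x y] ring_hom_one[OF h] by simp_all
 let ?j = "%c. \<iota> (fls_const c)"
 let ?FF = "range ?j"
 have zero: "\<iota> 0 = 0" using add[of 0 0] by (metis add_cancel_right_left add_0)
 have jadd: "?j (x + y) = ?j x + ?j y" and jmult: "?j (x * y) = ?j x * ?j y" for x y
  by (simp_all add: add[symmetric] mult[symmetric] fls_plus_const fls_const_mult_const)
 have jpow: "?j (x ^ n) = ?j x ^ n" for x n by (induction n) (simp_all add: one jmult del: fls_const_power)
 have q2: "q >= 2" using p e q(1) prime_ge_2_nat[OF p] self_le_power[of p e] by linarith
 have FF: "subfld ?FF" by (rule subfld_range[OF jadd jmult]) (simp add: one)
 have "of_nat k = ?j (of_nat k)" for k :: nat by (induction k) (simp_all add: zero one jadd)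
 hence "(of_nat q :: 'c) = 0" using finite_field_power_card(2)[where ?'f = 'f] q(2) zero by simp
 hence "CHAR('c) dvd p ^ e" using of_nat_eq_0_iff_char_dvd q(1) by blast
 then obtain i where i: "CHAR('c) = p ^ i" using divides_primepow_nat[OF p] by blast
 have "(of_nat p :: 'c) ^ e = 0" using \<open>(of_nat q :: 'c) = 0\<close> q(1) by simp
 hence "(of_nat p :: 'c) = 0" by simp
 hence "CHAR('c) dvd p" using of_nat_eq_0_iff_char_dvd by blast
 moreover have "CHAR('c) ~= 1" using of_nat_CHAR[where ?'a = 'c] by (metis of_nat_1 zero_neq_one)
 ultimately have char: "CHAR('c) = p" using p prime_nat_iff by blast
 have "theta \<iota> ~= 0 & cabs (theta \<iota>) = real q"
 proof -
  have "cabs (\<iota> fls_X_inv) = real CARD('f) powi (- fls_subdegree (fls_X_inv :: 'f fls))"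
   using C by (simp add: is_C_infinity_def)
  hence "cabs (theta \<iota>) = real q" by (simp add: theta_def q(2))
  thus ?thesis using q2 by (auto simp: cabs_def)
 qed
 obtain A where A: "algebraic_closure (rta\<lparr>carrier := A\<rparr>) (range \<iota>)" using C by (auto simp: is_C_infinity_def)
 have rng: "subfld (range \<iota>)" by (rule subfld_range[OF add mult one])
 have "adjoin ?FF {theta \<iota>} \<subseteq> range \<iota>" by (rule adjoin_least[OF rng]) (auto simp: theta_def)
 hence roots: "\<exists>b. b ^ q = a" if "algebraic_over (adjoin ?FF {theta \<iota>}) a" for a
  using algebraic_closure_root[OF A subfld_adjoin _ that, of q] q2 by simp
 have fr: "(x + y) ^ q = x ^ q + (y :: 'c) ^ q" for x y by (rule freshmans_dream'[of q e]) (simp_all add: char p q(1))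
 show ?thesis
 proof
  show "c ^ q = c" if "c \<in> ?FF" for c using that finite_field_power_card(1)[where ?'f = 'f] q(2) by (auto simp: jpow[symmetric])
 qed (use C FF q2 fr roots \<open>theta \<iota> ~= 0 & cabs (theta \<iota>) = real q\<close> in "auto simp: is_C_infinity_def")
qed

section \<open>The identity of transcendence degrees\<close>

theorem theorem6p4:
  fixes \<iota> :: "'f::{finite,field} fls \<Rightarrow> 'c::{field,metric_space}"
    and p e q n l :: nat
    and \<theta> :: 'c
    and \<rho> :: "nat \<Rightarrow> 'c"
    and u :: "nat \<Rightarrow> 'c poly"
    and I :: "nat list set"
  assumes "Factorial_Ring.prime p" and "e \<ge> 1" and "q = p ^ e" and "CARD('f) = q"
    and "is_C_infinity \<iota>"
    and "\<theta> = theta \<iota>"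
    and "\<And>m. m \<ge> 1 \<Longrightarrow> \<rho> m ^ (q ^ m - 1) = - \<theta>"
    and "\<And>i j. i \<ge> 1 \<Longrightarrow> Polynomial.coeff (u i) j \<in> kbar \<iota>"
    and "\<And>i. i \<ge> 1 \<Longrightarrow> poly_norm (u i) < cabs \<theta> powr (real i * real q / (real q - 1))"
    and "l \<ge> 1"
    and "finite I" and "\<And>s. s \<in> I \<Longrightarrow> is_index s"
    and "I = (\<Union>s\<in>I. Sub s)"
  shows
    "let K = kbar \<iota>;
         W = Omega q \<theta> (\<rho> 1) 1;
         \<Omega> = hyperderiv_values n \<theta> {W};
         \<Omega>l = hyperderiv_values n \<theta> {twist q (- int l') (Omega q \<theta> (\<rho> l) l) | l'. l' < l};
         \<L> = hyperderiv_values n \<theta> {Lseries q W u s | s. s \<in> I}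
     in int (trdeg K (adjoin K (\<Omega> \<union> \<Omega>l \<union> \<L>))) =
          int (trdeg K (adjoin K (\<Omega> \<union> \<Omega>l))) + int (trdeg K (adjoin K (\<Omega> \<union> \<L>)))
          - int (trdeg K (adjoin K \<Omega>))"
proof -
 interpret carlitz_field q "range (%c. \<iota> (fls_const c))" \<theta>
  unfolding assms(6) by (rule C_infinity_carlitz_field[OF assms(1-5)])
 have K: "kbar \<iota> = Kb" unfolding kbar_def kfield_def Kb_def assms(6)[symmetric] ..
 have r1: "\<rho> 1 ^ (q ^ 1 - 1) = - \<theta>" and rl: "\<rho> l ^ (q ^ l - 1) = - \<theta>" using assms(7)[of 1] assms(7)[OF assms(10)] by simp_all
 note O1 = le_refl r1 and Ol = assms(10) rl
 define W where "W = Omega q \<theta> (\<rho> 1) 1"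
 define om where "om = (%l'. twist q (- int l') (Omega q \<theta> (\<rho> l) l))"
 define g where "g = (%a. W ^ a * pser (u a))"
 define A where "A = (\<Union>s\<in>I. set s)"
 have finA: "finite A" unfolding A_def using assms(11) by simp
 have Apos: "a >= 1" if "a \<in> A" for a using that assms(12) by (force simp: A_def is_index_def)
 have W0: "W = omg (\<rho> 1) 1 0" unfolding W_def by (rule Omega_eq[OF O1])
 have entW: "entire W" unfolding W0 by (rule entire_omg[OF O1]) simp
 have entg: "entire (g a)" for a unfolding g_def by (intro entire_mult entire_power entW entire_fps_of_poly)
 \<comment> \<open>Since \<open>\<bar>\<rho> 1\<bar> ^ (q - 1) = \<bar>\<theta>\<bar>\<close>, the hypothesis on u
  a bounds it by \<open>w ^ (- a)\<close>, and \<open>w ^ a\<close> bounds the Gauss norm of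
  \<open>W ^ a\<close>. Hence the Gauss norm of g a is less than 1.\<close>
 define w where "w = 1 / cabs (\<rho> 1) ^ q"
 have gW: "gauss_bd W 1 w" using omg_gauss_one[OF O1] by (simp add: W0 w_def)
 have r0: "cabs (\<rho> 1) > 0" using r_nonzero[OF O1] by simp
 have norm: "gauss_bd (pser (u a)) 1 (poly_norm (u a))" for a
 proof -
  have "range (%i. cabs (Polynomial.coeff (u a) i)) \<subseteq> insert 0 ((%i. cabs (Polynomial.coeff (u a) i)) ` {..Polynomial.degree (u a)})"
   by (auto simp: coeff_eq_0 not_le image_iff) (metis atMost_iff coeff_eq_0 not_le)
  hence "finite (range (%i. cabs (Polynomial.coeff (u a) i)))" by (rule finite_subset) simp
  thus ?thesis by (auto simp: gauss_bd_def poly_norm_def intro!: Max_ge)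
 qed
 have gg: "gauss_bd (g a) 1 (w ^ a * poly_norm (u a))" for a
  unfolding g_def by (intro gauss_bd_mult gauss_bd_power gW norm) simp_all
 have small: "w ^ a * poly_norm (u a) < 1" if "a \<in> A" for a
 proof -
  have "cabs \<theta> powr (real a * real q / (real q - 1)) = cabs (\<rho> 1) ^ (q * a)"
  proof -
   have "cabs \<theta> = cabs (\<rho> 1) ^ (q - 1)" using arg_cong[OF r1, of cabs] by (simp add: cabs_power)
   also have "... = cabs (\<rho> 1) powr (real q - 1)" using q_pos r0 by (simp add: powr_realpow[symmetric] of_nat_diff)
   finally have "cabs \<theta> powr (real a * real q / (real q - 1)) = cabs (\<rho> 1) powr ((real q - 1) * (real a * real q / (real q - 1)))"
    by (simp add: powr_powr)
   also have "(real q - 1) * (real a * real q / (real q - 1)) = real (q * a)" using q_gt1 by (simp add: field_simps)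
   finally show ?thesis unfolding powr_realpow[OF r0] .
  qed
  hence "poly_norm (u a) < cabs (\<rho> 1) ^ (q * a)" using assms(9)[OF Apos[OF that]] by simp
  hence "w ^ a * poly_norm (u a) < w ^ a * cabs (\<rho> 1) ^ (q * a)" using r0 by (intro mult_strict_left_mono) (auto simp: w_def)
  also have "... = 1" using r0 by (simp add: w_def power_one_over power_mult)
  finally show ?thesis .
 qed
 define \<sigma> where "\<sigma> = Max (insert 0 ((%a. w ^ a * poly_norm (u a)) ` A))"
 have \<sigma>: "0 <= \<sigma>" "\<sigma> < 1" using finA small by (auto simp: \<sigma>_def)
 have g\<sigma>: "gauss_bd (g a) 1 \<sigma>" if "a \<in> A" for a
  using finA that by (intro gauss_bd_mono[OF gg]) (auto simp: \<sigma>_def)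
 have entg': "entire (g a)" if "a \<in> A" for a by (rule entg)
 note G = entg' g\<sigma> \<sigma>
 have series: "Lseries q W u s = Lf g s" if "set s \<subseteq> A" for s
  using Lseries_eq[of A W u \<sigma> s] G that unfolding g_def by simp
 have sA: "set s \<subseteq> A" if "s \<in> I" for s using that by (auto simp: A_def)
 have om: "om e = omg (\<rho> l) l e" if "e < l" for e unfolding om_def by (rule twist_Omega[OF Ol that])
 interpret carlitz_functions q "range (%c. \<iota> (fls_const c))" \<theta> n l W om I "Lf g" u
 proof
  show "l >= 1" by (rule assms(10))
  show "entire W" by (rule entW)
  show "W ~= 0" unfolding W0 by (rule omg_nonzero[OF O1]) simp
  show "pser (lin 1) * tw 1 W = W" unfolding W0 using omg_twist_0[OF O1] by simp
  show "entire (om i)" "om i ~= 0" if "i < l" for i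
   unfolding om[OF that] by (rule entire_omg[OF Ol that], rule omg_nonzero[OF Ol that])
  show "tw 1 (om (Suc i)) = om i" if "Suc i < l" for i using om[OF that] om[of i] that omg_twist[OF Ol that] by simp
  show "pser (lin 1) * tw 1 (om 0) = om (l - 1)" using om[of 0] om[of "l - 1"] assms(10) omg_twist_0[OF Ol] by simp
  show "finite I" by (rule assms(11))
  show "[] \<notin> I" using assms(12) by (auto simp: is_index_def)
  show "entire (Lf g s)" if "s \<in> I" for s by (rule entire_Lf[where g = g and A = A and rh = \<sigma>, OF G sA[OF that]])
  show "Lf g [] = 1" by (rule Lf_Nil[where g = g and A = A and rh = \<sigma>, OF G])
  fix s a assume sa: "s @ [a] \<in> I"
  show "tw 1 (Lf g (s @ [a])) = Lf g (s @ [a]) - W ^ a * pser (u a) * tw 1 (Lf g s)"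
   using arg_cong[OF Lf_twist[where g = g and A = A and rh = \<sigma>, OF G sA[OF sa]], of "%x. x - g a * tw 1 (Lf g s)"]
   by (simp add: g_def[THEN fun_cong])
  have a: "a >= 1" using Apos sA[OF sa] by auto
  moreover have "u a \<in> polys Kb" using assms(8)[OF a] K by (auto simp: polys_def)
  moreover have "s \<in> I" if "s ~= []"
  proof -
   have "s = map (%r. (s @ [a]) ! r) [0..<Suc (length s - 1)]" using that by (intro nth_equalityI) (auto simp: nth_append)
   hence "s \<in> Sub (s @ [a])" unfolding Sub_def using that by (intro CollectI exI[of _ 0] exI[of _ "length s - 1"]) auto
   thus ?thesis using assms(13) sa by blast
  qed
  ultimately show "a >= 1 & (s = [] \<or> s \<in> I) & u a \<in> polys Kb" by blast
 qed
 have 1: "hyperderiv_values n \<theta> {W} = eval_at \<theta> ` FOm" by (auto simp: hyperderiv_values_def FOm_def)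
 have 2: "hyperderiv_values n \<theta> {om l' | l'. l' < l} = eval_at \<theta> ` Fw" by (auto simp: hyperderiv_values_def Fw_def)
 have "{Lseries q W u s | s. s \<in> I} = {Lf g s | s. s \<in> I}" using series sA by (intro Collect_cong) metis
 hence 3: "hyperderiv_values n \<theta> {Lseries q W u s | s. s \<in> I} = eval_at \<theta> ` FL" by (auto simp: hyperderiv_values_def FL_def)
 show ?thesis unfolding Let_def W_def[symmetric] om_def[symmetric] K 1 2[unfolded om_def] 3 image_Un[symmetric]
  using value_identity 2 by (simp add: om_def)
qed

end
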